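(* Let $G$ be the Engel group ($n=4$, $Q=7$). For every admissible quadruple $(p,k,r,l)$, the integration pairing $$E_{r,l}^{p,k-p}(G)\times\mathscr D_{l,r}^{Q-p,\,n-k-(Q-p)}(G)\longrightarrow\mathbb R,\qquad ([\alpha],[\eta])\longmapsto\int_G\alpha\wedge\eta,$$ is well defined and non-degenerate. Moreover, the map $$\psi_{r,l}^{p,k-p}\colon E_{r,l}^{p,k-p}(G)\longrightarrow\mathscr C_{r,l}^{p,k-p}(G),\qquad \psi_{r,l}^{p,k-p}([\alpha])([\eta]):=\int_G\alpha\wedge\eta,$$ is a well-defined injective linear map. These maps intertwine the spectral differentials with the transposed boundary operators, i.e. for any two consecutive terms $E_{l,m}^{p-l,\,k-1-(p-l)}(G)\xrightarrow{\Delta_l}E_{r,l}^{p,k-p}(G)$ of one of the two spectral complexes of $G$, $$\psi_{r,l}^{p,k-p}\circ\Delta_l=\partial_l\circ\psi_{l,m}^{p-l,\,k-1-(p-l)},$$ and therefore they define embeddings of the two spectral complexes of the Engel group into the corresponding complexes of spectral currents.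
   Context: **Engel group.** $G$ is the connected, simply connected Lie group whose Lie algebra $\mathfrak g$ has a basis $X_1,X_2,X_3,X_4$ with only non-zero brackets $[X_1,X_2]=X_3$, $[X_1,X_3]=X_4$. The $X_i$ are regarded as left-invariant vector fields, $\theta_1,\dots,\theta_4$ is the dual basis of left-invariant 1-forms ($d\theta_1=d\theta_2=0$, $d\theta_3=-\theta_1\wedge\theta_2$, $d\theta_4=-\theta_1\wedge\theta_3$), and $G$ is oriented by $\operatorname{vol}=\theta_1\wedge\theta_2\wedge\theta_3\wedge\theta_4$. Topological dimension $n=4$, homogeneous dimension $Q=7$. **Weights.** $\theta_1,\theta_2,\theta_3,\theta_4$ have weights $1,1,2,3$; weights add under wedge products; functions have weight $0$. $\Omega^{p,q}(G)$ is the space of smooth $(p+q)$-forms that are $\mathcal C^\infty(G)$-combinations of left-invariant forms $\theta_{i_1}\wedge\dots\wedge\theta_{i_{p+q}}$ of weight $p$ (it is $0$ if there are none); $\Omega_c^{p,q}(G)$ is its compactly supported analogue. The exterior differential splits as $d=d_0+d_1+d_2+d_3$ with $d_i\colon\Omega^{p,k-p}(G)\to\Omega^{p+i,k+1-p-i}(G)$; for $f$ smooth and $\xi$ left-invariant: $d_0(f\xi)=f\,d\xi$, $d_1(f\xi)=X_1f\,\theta_1\wedge\xi+X_2f\,\theta_2\wedge\xi$, $d_2(f\xi)=X_3f\,\theta_3\wedge\xi$, $d_3(f\xi)=X_4f\,\theta_4\wedge\xi$. Set $d_i=0$ for $i>3$. **Cycles and boundaries.** For $r\ge1$, $\alpha\in\Omega^{p,k-p}(G)$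 lies in $Z_r^{p,k-p}(G)$ iff $d_0\alpha=0$ and there are $z_{p+j}\in\Omega^{p+j,k-p-j}(G)$, $1\le j\le r-1$, with $d_m\alpha=\sum_{i=0}^{m-1}d_iz_{p+m-i}$ for $1\le m\le r-1$. It lies in $B_r^{p,k-p}(G)$ iff there are $c_{p-j}\in\Omega^{p-j,k-1-p+j}(G)$, $0\le j\le r-1$, with $\alpha=\sum_{j=0}^{r-1}d_jc_{p-j}$ and $0=\sum_{j=i}^{r-1}d_{j-i}c_{p-j}$ for $1\le i\le r-1$. One has $B_l^{p,q}\subseteq Z_r^{p,q}$ for all $r,l\ge1$; set $E_{r,l}^{p,q}(G):=Z_r^{p,q}(G)/B_l^{p,q}(G)$. The notations $Z_r^{p,k-p}(G)\cap\Omega_c^k(G)$ and $B_r^{p,k-p}(G)\cap\Omega_c^k(G)$ mean the spaces defined by the same conditions but with $\alpha$ and all auxiliary forms $z_{p+j}$, $c_{p-j}$ required to be compactly supported. **Spectral differentials.** $\Delta_r[\alpha]=\big[d_r\alpha-\sum_{i=1}^{r-1}d_iz_{p+r-i}\big]$, where $\alpha\in Z_r^{p,k-p}$ and the $z_{p+j}$ are auxiliary forms as in the definition of $Z_r$. This gives well-defined maps $\Delta_r\colon E_{r,m_1}^{p,k-p}\to E_{m_2,r}^{p+r,k+1-p-r}$ between successive terms of the following two complexes, the *spectral complexes* of $G$: $$E_{1,1}^{0,0}\xrightarrow{\Delta_1}E_{2,1}^{1,0}\xrightarrow{\Delta_2}E_{3,2}^{3,-1}\xrightarrow{\Delta_3}E_{1,3}^{6,-3}\xrightarrow{\Delta_1}E_{1,1}^{7,-3},$$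 $$E_{1,1}^{0,0}\xrightarrow{\Delta_1}E_{3,1}^{1,0}\xrightarrow{\Delta_3}E_{2,3}^{4,-2}\xrightarrow{\Delta_2}E_{1,2}^{6,-3}\xrightarrow{\Delta_1}E_{1,1}^{7,-3}.$$ Here $E_{1,1}^{0,0}=Z_1^{0,0}=\mathcal C^\infty(G)$ and $E_{1,1}^{7,-3}=\Omega^{7,-3}(G)$. A quadruple $(p,k,r,l)$ is *admissible* if $E_{r,l}^{p,k-p}$ is one of the terms above, i.e. $(p,k,r,l)\in\{(0,0,1,1),(1,1,2,1),(3,2,3,2),(6,3,1,3),(7,4,1,1),(1,1,3,1),(4,2,2,3),(6,3,1,2)\}$. **Test forms and topology.** $\mathscr D_{r,l}^{p,k-p}(G):=\big(Z_r^{p,k-p}(G)\cap\Omega_c^k(G)\big)\big/\big(B_l^{p,k-p}(G)\cap\Omega_c^k(G)\big)$. The numerator carries the subspace topology from $\Omega_c^{p,k-p}(G)$ with its usual LF topology, and $\mathscr D_{r,l}^{p,k-p}(G)$ the quotient topology (locally convex, possibly non-Hausdorff). The same formula (with compactly supported auxiliary forms) defines continuous spectral differentials $\Delta_r$ on test forms, giving the compactly supported versions of the two complexes above. **Spectral currents.** $\mathscr C_{r,l}^{p,k-p}(G):=\big(\mathscr D_{l,r}^{Q-p,\,n-k-(Q-p)}(G)\big)'$ (continuous dual). For $T\in\mathscr C_{r,l}^{p,k-p}(G)$ and the test differential $\Delta_r\colon\mathscr D_{r,m}^{Q-p-r,\,(n-k-1)-(Q-p-r)}(G)\to\mathscr D_{l,r}^{Q-p,\,n-k-(Q-p)}(G)$,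 the boundary operator is $$\langle\partial_rT,[\eta]\rangle:=(-1)^{k+1}\langle T,\Delta_r[\eta]\rangle,\qquad \partial_r\colon\mathscr C_{r,l}^{p,k-p}(G)\to\mathscr C_{m,r}^{p+r,\,k+1-(p+r)}(G).$$ This yields two complexes of spectral currents, obtained from the two spectral complexes above by replacing each $E_{r,l}^{p,k-p}$ by $\mathscr C_{r,l}^{p,k-p}(G)$ and each $\Delta_r$ by $\partial_r$. *)

theory Defs
  imports "HOL-Analysis.Analysis" "HOL-Library.Function_Algebras"
begin

section \<open>Real vector spaces of functions, quotients, duals, complexes\<close>

instantiation "fun" :: (type, real_vector) real_vector
begin

definition scaleR_fun :: "real \<Rightarrow> ('a \<Rightarrow> 'b) \<Rightarrow> 'a \<Rightarrow> 'b"
  where "scaleR_fun c f = (\<lambda>x. c *\<^sub>R f x)"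

instance
  by standard (simp_all add: scaleR_fun_def fun_eq_iff scaleR_add_right scaleR_add_left)

end

lemma scaleR_fun_apply [simp]: "(c *\<^sub>R f) x = c *\<^sub>R f x"
  for f :: "'a \<Rightarrow> 'b::real_vector"
  by (simp add: scaleR_fun_def)

text \<open>Quotients and spaces of functionals are not types, so a real vector space is given here by
  its carrier together with its operations.\<close>

record 'v rspace =
  vcar :: "'v set"
  vzero :: 'v
  vadd :: "'v \<Rightarrow> 'v \<Rightarrow> 'v"
  vscale :: "real \<Rightarrow> 'v \<Rightarrow> 'v"

definition real_rspace :: "real rspace" where
  "real_rspace = \<lparr>vcar = UNIV, vzero = 0, vadd = (+), vscale = (*)\<rparr>"

definition lin_map :: "'v rspace \<Rightarrow> 'w rspace \<Rightarrow> ('v \<Rightarrow> 'w) \<Rightarrow> bool" where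
  "lin_map V W f \<longleftrightarrow>
     (\<forall>x\<in>vcar V. f x \<in> vcar W) \<and>
     (\<forall>x\<in>vcar V. \<forall>y\<in>vcar V. f (vadd V x y) = vadd W (f x) (f y)) \<and>
     (\<forall>c. \<forall>x\<in>vcar V. f (vscale V c x) = vscale W c (f x))"

text \<open>The quotient \<open>Z / B\<close> consists of the cosets \<open>\<alpha> +o B\<close>. The sum of two cosets is their
  elementwise sum; adding \<open>B\<close> in the scalar multiplication matters only for the scalar \<open>0\<close>.\<close>

definition quotient_rspace :: "'a::real_vector set \<Rightarrow> 'a set \<Rightarrow> 'a set rspace" where
  "quotient_rspace Z B =
     \<lparr>vcar = (\<lambda>\<alpha>. \<alpha> +o B) ` Z, vzero = B, vadd = (+), vscale = (\<lambda>c A. (*\<^sub>R) c ` A + B)\<rparr>"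

definition quotient_top :: "'a topology \<Rightarrow> ('a \<Rightarrow> 'b) \<Rightarrow> 'b topology" where
  "quotient_top X \<pi> =
     topology (\<lambda>V. V \<subseteq> \<pi> ` topspace X \<and> openin X {x \<in> topspace X. \<pi> x \<in> V})"

lemma openin_quotient_top:
  "openin (quotient_top X \<pi>) V \<longleftrightarrow>
     V \<subseteq> \<pi> ` topspace X \<and> openin X {x \<in> topspace X. \<pi> x \<in> V}"
proof -
  have "istopology (\<lambda>V. V \<subseteq> \<pi> ` topspace X \<and> openin X {x \<in> topspace X. \<pi> x \<in> V})"
    unfolding istopology_def
  proof (intro conjI allI impI)
    fix S T
    assume S: "S \<subseteq> \<pi> ` topspace X \<and> openin X {x \<in> topspace X. \<pi> x \<in> S}"
      and T: "T \<subseteq> \<pi> ` topspace X \<and> openin X {x \<in> topspace X. \<pi> x \<in> T}"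
    have "{x \<in> topspace X. \<pi> x \<in> S \<inter> T} =
        {x \<in> topspace X. \<pi> x \<in> S} \<inter> {x \<in> topspace X. \<pi> x \<in> T}" by auto
    with S T show "openin X {x \<in> topspace X. \<pi> x \<in> S \<inter> T}" by auto
    from S show "S \<inter> T \<subseteq> \<pi> ` topspace X" by auto
  next
    fix \<K>
    assume K: "\<forall>V\<in>\<K>. V \<subseteq> \<pi> ` topspace X \<and> openin X {x \<in> topspace X. \<pi> x \<in> V}"
    have "{x \<in> topspace X. \<pi> x \<in> \<Union> \<K>} = (\<Union>V\<in>\<K>. {x \<in> topspace X. \<pi> x \<in> V})" by auto
    with K show "openin X {x \<in> topspace X. \<pi> x \<in> \<Union> \<K>}" by auto
    from K show "\<Union> \<K> \<subseteq> \<pi> ` topspace X" by auto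
  qed
  then show ?thesis
    by (simp add: quotient_top_def)
qed

text \<open>Functionals are made extensional (\<open>undefined\<close> off the carrier), so that equality of
  functionals is equality of their values on the carrier.\<close>

definition dual_rspace :: "'v rspace \<Rightarrow> 'v topology \<Rightarrow> ('v \<Rightarrow> real) rspace" where
  "dual_rspace V X =
     \<lparr>vcar = {T \<in> extensional (vcar V). lin_map V real_rspace T \<and> continuous_map X euclideanreal T},
      vzero = (\<lambda>x\<in>vcar V. 0),
      vadd = (\<lambda>S T. \<lambda>x\<in>vcar V. S x + T x),
      vscale = (\<lambda>c T. \<lambda>x\<in>vcar V. c * T x)\<rparr>"

text \<open>Complexes \<open>V 0 \<rightarrow> V 1 \<rightarrow> \<dots> \<rightarrow> V N\<close> with \<open>\<delta> i\<close> mapping \<open>V i\<close> to \<open>V (i + 1)\<close>.\<close>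

definition is_complex :: "nat \<Rightarrow> (nat \<Rightarrow> 'v rspace) \<Rightarrow> (nat \<Rightarrow> 'v \<Rightarrow> 'v) \<Rightarrow> bool" where
  "is_complex N V \<delta> \<longleftrightarrow>
     (\<forall>i<N. lin_map (V i) (V (Suc i)) (\<delta> i)) \<and>
     (\<forall>i. Suc i < N \<longrightarrow> (\<forall>x\<in>vcar (V i). \<delta> (Suc i) (\<delta> i x) = vzero (V (Suc (Suc i)))))"

definition complex_embedding ::
  "nat \<Rightarrow> (nat \<Rightarrow> 'v rspace) \<Rightarrow> (nat \<Rightarrow> 'v \<Rightarrow> 'v) \<Rightarrow>
     (nat \<Rightarrow> 'w rspace) \<Rightarrow> (nat \<Rightarrow> 'w \<Rightarrow> 'w) \<Rightarrow> (nat \<Rightarrow> 'v \<Rightarrow> 'w) \<Rightarrow> bool" where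
  "complex_embedding N V \<delta> W \<epsilon> \<phi> \<longleftrightarrow>
     is_complex N V \<delta> \<and> is_complex N W \<epsilon> \<and>
     (\<forall>i\<le>N. lin_map (V i) (W i) (\<phi> i) \<and> inj_on (\<phi> i) (vcar (V i))) \<and>
     (\<forall>i<N. \<forall>x\<in>vcar (V i). \<phi> (Suc i) (\<delta> i x) = \<epsilon> i (\<phi> i x))"


section \<open>The Engel group\<close>

text \<open>A connected, simply connected Lie group is determined up to isomorphism by its Lie algebra;
  the Engel group is realised on \<open>real^4\<close>, with neutral element \<open>0\<close>, by the following product.
  The index \<open>4 :: 4\<close> is the same element as \<open>0 :: 4\<close>; only the names \<open>1, 2, 3, 4\<close> are used.\<close>

type_synonym engel = "real^4"

definition engel_mult :: "engel \<Rightarrow> engel \<Rightarrow> engel"  (infixl \<open>\<cdot>\<close> 70) where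
  "x \<cdot> y = (\<chi> i.
     if i = 3 then x$3 + y$3 + x$1 * y$2
     else if i = 4 then x$4 + y$4 + x$1 * y$3 + (x$1)\<^sup>2 / 2 * y$2
     else x$i + y$i)"

definition left_inv_field :: "4 \<Rightarrow> engel \<Rightarrow> engel" where
  "left_inv_field i x = frechet_derivative (\<lambda>y. x \<cdot> y) (at 0) (axis i 1)"

definition lie_bracket :: "(engel \<Rightarrow> engel) \<Rightarrow> (engel \<Rightarrow> engel) \<Rightarrow> engel \<Rightarrow> engel" where
  "lie_bracket V W x =
     frechet_derivative W (at x) (V x) - frechet_derivative V (at x) (W x)"

lemma vec4_eq_iff: "x = y \<longleftrightarrow> x$1 = y$1 \<and> x$2 = y$2 \<and> x$3 = y$3 \<and> x$4 = y$4"
  for x y :: "'a^4"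
  by (simp add: vec_eq_iff forall_4)

lemma idx4_distinct [simp]:
  "(1::4) \<noteq> 2" "(1::4) \<noteq> 3" "(1::4) \<noteq> 4" "(2::4) \<noteq> 1" "(2::4) \<noteq> 3" "(2::4) \<noteq> 4"
  "(3::4) \<noteq> 1" "(3::4) \<noteq> 2" "(3::4) \<noteq> 4" "(4::4) \<noteq> 1" "(4::4) \<noteq> 2" "(4::4) \<noteq> 3"
  by simp_all

lemma engel_mult_assoc: "(x \<cdot> y) \<cdot> z = x \<cdot> (y \<cdot> z)"
  by (simp add: engel_mult_def vec4_eq_iff algebra_simps power2_eq_square add_divide_distrib)

lemma engel_mult_0: "0 \<cdot> x = x" "x \<cdot> 0 = x"
  by (simp_all add: engel_mult_def vec4_eq_iff)

lemma engel_mult_inverse: "\<exists>y. x \<cdot> y = 0 \<and> y \<cdot> x = 0"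
proof -
  define y :: engel where "y = (\<chi> i. if i = 3 then - x$3 + x$1 * x$2
     else if i = 4 then - x$4 + x$1 * x$3 - (x$1)\<^sup>2 / 2 * x$2 else - x$i)"
  have "x \<cdot> y = 0 \<and> y \<cdot> x = 0"
    by (simp add: y_def engel_mult_def vec4_eq_iff algebra_simps power2_eq_square)
  then show ?thesis by blast
qed

lemma left_inv_field_eq:
  "left_inv_field 1 = (\<lambda>x. axis 1 1)"
  "left_inv_field 2 = (\<lambda>x. axis 2 1 + x$1 *\<^sub>R axis 3 1 + ((x$1)\<^sup>2 / 2) *\<^sub>R axis 4 1)"
  "left_inv_field 3 = (\<lambda>x. axis 3 1 + x$1 *\<^sub>R axis 4 1)"
  "left_inv_field 4 = (\<lambda>x. axis 4 1)"
proof -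
  have *: "left_inv_field i x = x \<cdot> axis i 1 - x" for i x
  proof -
    let ?L = "\<lambda>y. x \<cdot> y - x"
    have "linear ?L"
      by (rule linearI) (simp_all add: engel_mult_def vec4_eq_iff algebra_simps)
    then have "(?L has_derivative ?L) (at 0)"
      by (rule linear_imp_has_derivative)
    then have "((\<lambda>y. ?L y + x) has_derivative ?L) (at 0)"
      by (rule has_derivative_add_const)
    then have "((\<lambda>y. x \<cdot> y) has_derivative ?L) (at 0)"
      by simp
    then show ?thesis
      unfolding left_inv_field_def by (metis frechet_derivative_at)
  qed
  show "left_inv_field 1 = (\<lambda>x. axis 1 1)"
    "left_inv_field 2 = (\<lambda>x. axis 2 1 + x$1 *\<^sub>R axis 3 1 + ((x$1)\<^sup>2 / 2) *\<^sub>R axis 4 1)"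
    "left_inv_field 3 = (\<lambda>x. axis 3 1 + x$1 *\<^sub>R axis 4 1)"
    "left_inv_field 4 = (\<lambda>x. axis 4 1)"
    by (simp_all add: fun_eq_iff * engel_mult_def vec4_eq_iff axis_def)
qed

lemma frechet_derivative_left_inv_field:
  "frechet_derivative (left_inv_field 1) (at x) v = 0"
  "frechet_derivative (left_inv_field 2) (at x) v = v$1 *\<^sub>R axis 3 1 + (x$1 * v$1) *\<^sub>R axis 4 1"
  "frechet_derivative (left_inv_field 3) (at x) v = v$1 *\<^sub>R axis 4 1"
  "frechet_derivative (left_inv_field 4) (at x) v = 0"
proof -
  have nth: "((\<lambda>x::engel. x$1) has_derivative (\<lambda>v. v$1)) (at x)"
    by (rule bounded_linear_imp_has_derivative[OF bounded_linear_vec_nth])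
  have sq: "((\<lambda>x::engel. (x$1)\<^sup>2 / 2) has_derivative (\<lambda>v. x$1 * v$1)) (at x)"
    using has_derivative_mult_right[OF has_derivative_power[OF nth, of 2], of "1/2"]
    by (simp add: mult.commute)
  have 2: "(left_inv_field 2 has_derivative (\<lambda>v. v$1 *\<^sub>R axis 3 1 + (x$1 * v$1) *\<^sub>R axis 4 1)) (at x)"
    unfolding left_inv_field_eq
    using has_derivative_add[OF has_derivative_add[OF has_derivative_const
        has_derivative_scaleR_left[OF nth]] has_derivative_scaleR_left[OF sq]] by simp
  have 3: "(left_inv_field 3 has_derivative (\<lambda>v. v$1 *\<^sub>R axis 4 1)) (at x)"
    unfolding left_inv_field_eq
    using has_derivative_add[OF has_derivative_const has_derivative_scaleR_left[OF nth]] by simp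
  show
    "frechet_derivative (left_inv_field 2) (at x) v = v$1 *\<^sub>R axis 3 1 + (x$1 * v$1) *\<^sub>R axis 4 1"
    "frechet_derivative (left_inv_field 3) (at x) v = v$1 *\<^sub>R axis 4 1"
    by (simp_all add: frechet_derivative_at[OF 2, symmetric] frechet_derivative_at[OF 3, symmetric])
  show "frechet_derivative (left_inv_field 1) (at x) v = 0"
    "frechet_derivative (left_inv_field 4) (at x) v = 0"
    unfolding left_inv_field_eq by simp_all
qed

lemma left_inv_field_bracket:
  "lie_bracket (left_inv_field 1) (left_inv_field 2) = left_inv_field 3"
  "lie_bracket (left_inv_field 1) (left_inv_field 3) = left_inv_field 4"
  "lie_bracket (left_inv_field 1) (left_inv_field 4) = (\<lambda>x. 0)"
  "lie_bracket (left_inv_field 2) (left_inv_field 3) = (\<lambda>x. 0)"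
  "lie_bracket (left_inv_field 2) (left_inv_field 4) = (\<lambda>x. 0)"
  "lie_bracket (left_inv_field 3) (left_inv_field 4) = (\<lambda>x. 0)"
  unfolding fun_eq_iff lie_bracket_def frechet_derivative_left_inv_field
  by (simp_all add: left_inv_field_eq axis_def vec4_eq_iff)


section \<open>Left-invariant forms\<close>

text \<open>A left-invariant form is given by its coefficients in the basis
  \<open>\<theta>\<^sub>I = \<theta>\<^sub>i \<and> \<theta>\<^sub>j \<and> \<dots>\<close>, where \<open>I = {i < j < \<dots>}\<close> is a subset of \<open>{1, 2, 3, 4}\<close>.\<close>

type_synonym covector = "real^(4 set)"

text \<open>The position of an index in the order \<open>1 < 2 < 3 < 4\<close>; the order of the type \<open>4\<close> itself
  starts with \<open>4 = 0\<close>.\<close>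

definition pos :: "4 \<Rightarrow> nat" where
  "pos i = (if i = 1 then 1 else if i = 2 then 2 else if i = 3 then 3 else 4)"

definition theta :: "4 \<Rightarrow> covector" where
  "theta i = axis {i} 1"

text \<open>\<open>\<theta>\<^sub>I \<and> \<theta>\<^sub>J\<close> is \<open>0\<close> if \<open>I\<close> and \<open>J\<close> meet, and otherwise the sign of the permutation sorting
  \<open>I\<close> followed by \<open>J\<close>, times \<open>\<theta>\<close> with index \<open>I \<union> J\<close>.\<close>

definition wedge :: "covector \<Rightarrow> covector \<Rightarrow> covector"  (infixr \<open>\<and>\<and>\<close> 75) where
  "a \<and>\<and> b = (\<chi> K. \<Sum>I\<in>Pow K.
     (-1) ^ card {(i, j). i \<in> I \<and> j \<in> K - I \<and> pos j < pos i} * (a $ I) * (b $ (K - I)))"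

definition d_theta :: "4 \<Rightarrow> covector" where
  "d_theta i =
     (if i = 3 then - (theta 1 \<and>\<and> theta 2) else if i = 4 then - (theta 1 \<and>\<and> theta 3) else 0)"

fun theta_list :: "4 list \<Rightarrow> covector" where
  "theta_list [] = axis {} 1"
| "theta_list (i # is) = theta i \<and>\<and> theta_list is"

fun d_theta_list :: "4 list \<Rightarrow> covector" where
  "d_theta_list [] = 0"
| "d_theta_list (i # is) = d_theta i \<and>\<and> theta_list is - theta i \<and>\<and> d_theta_list is"

definition d_left_inv :: "covector \<Rightarrow> covector" where
  "d_left_inv \<xi> = (\<Sum>I\<in>UNIV. (\<xi> $ I) *\<^sub>R d_theta_list (filter (\<lambda>i. i \<in> I) [1, 2, 3, 4]))"

lemma theta_wedge_axis:
  assumes "\<And>j. j \<in> I \<Longrightarrow> pos i < pos j"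
  shows "theta i \<and>\<and> axis I 1 = axis (insert i I) 1"
proof -
  have "i \<notin> I" using assms by auto
  have "(theta i \<and>\<and> axis I 1) $ K = axis (insert i I) 1 $ K" for K
  proof -
    have "(theta i \<and>\<and> axis I 1) $ K = (\<Sum>J\<in>Pow K. if J = {i} then
       (-1) ^ card {(a, j). a \<in> {i} \<and> j \<in> K - {i} \<and> pos j < pos a} * axis I 1 $ (K - {i}) else 0)"
      unfolding wedge_def theta_def vec_lambda_beta
      by (rule sum.cong) (simp_all add: axis_def)
    also have "\<dots> = (if i \<in> K then
       (-1) ^ card {(a, j). a \<in> {i} \<and> j \<in> K - {i} \<and> pos j < pos a} * axis I 1 $ (K - {i}) else 0)"
      by (subst sum.delta) auto
    also have "\<dots> = axis (insert i I) 1 $ K"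
    proof (cases "K = insert i I")
      case True
      then have *: "{(a, j). a \<in> {i} \<and> j \<in> K - {i} \<and> pos j < pos a} = {}"
        using assms by fastforce
      show ?thesis unfolding * using True \<open>i \<notin> I\<close> by (simp add: axis_def)
    next
      case False
      then show ?thesis by (auto simp: axis_def)
    qed
    finally show ?thesis .
  qed
  then show ?thesis by (simp add: vec_eq_iff)
qed

lemma theta_list_basis: "theta_list (filter (\<lambda>i. i \<in> I) [1, 2, 3, 4]) = axis I 1"
proof -
  have "theta_list xs = axis (set xs) 1" if "sorted_wrt (\<lambda>i j. pos i < pos j) xs" for xs
    using that by (induction xs) (auto simp: theta_wedge_axis)
  moreover have "sorted_wrt (\<lambda>i j. pos i < pos j) [1, 2, 3, 4]"
    by (simp add: pos_def)
  then have "sorted_wrt (\<lambda>i j. pos i < pos j) (filter (\<lambda>i. i \<in> I) [1, 2, 3, 4])"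
    by (rule sorted_wrt_filter)
  moreover have "set (filter (\<lambda>i. i \<in> I) [1, 2, 3, 4]) = I"
    by (simp add: set_eq_iff forall_4)
  ultimately show ?thesis by metis
qed

definition weight :: "4 \<Rightarrow> nat" where
  "weight i = (if i = 3 then 2 else if i = 4 then 3 else 1)"


section \<open>Differential forms\<close>

type_synonym form = "engel \<Rightarrow> covector"

definition partial_deriv :: "4 \<Rightarrow> (engel \<Rightarrow> 'b::real_normed_vector) \<Rightarrow> engel \<Rightarrow> 'b" where
  "partial_deriv i f x = frechet_derivative f (at x) (axis i 1)"

definition smooth :: "(engel \<Rightarrow> 'b::real_normed_vector) \<Rightarrow> bool" where
  "smooth f \<longleftrightarrow> (\<forall>is x. foldr partial_deriv is f differentiable (at x))"

text \<open>Spaces with upper index \<open>p, k - p\<close> are indexed here by the weight \<open>p\<close> and the degree \<open>k\<close>.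
  Both are integers, because the definition of boundaries involves negative ones.\<close>

definition Omega :: "int \<Rightarrow> int \<Rightarrow> form set" where
  "Omega p k = {\<omega>. smooth \<omega> \<and>
     (\<forall>x I. \<omega> x $ I \<noteq> 0 \<longrightarrow> int (\<Sum>i\<in>I. weight i) = p \<and> int (card I) = k)}"

definition Omega_c :: "int \<Rightarrow> int \<Rightarrow> form set" where
  "Omega_c p k = {\<omega> \<in> Omega p k. compact (closure {x. \<omega> x \<noteq> 0})}"

text \<open>The component \<open>d\<^sub>m\<close> of the exterior differential; the sum is empty for \<open>m > 3\<close>.\<close>

definition dd :: "nat \<Rightarrow> form \<Rightarrow> form" where
  "dd m \<omega> = (\<lambda>x. if m = 0 then d_left_inv (\<omega> x)
     else \<Sum>i | weight i = m. theta i \<and>\<and> frechet_derivative \<omega> (at x) (left_inv_field i x))"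

text \<open>The volume form \<open>\<theta>\<^sub>1 \<and> \<theta>\<^sub>2 \<and> \<theta>\<^sub>3 \<and> \<theta>\<^sub>4\<close> is \<open>dx\<^sub>1 \<and> dx\<^sub>2 \<and> dx\<^sub>3 \<and> dx\<^sub>4\<close>, since the matrix of
  the fields \<open>left_inv_field i\<close> is unitriangular.\<close>

definition form_integrable :: "form \<Rightarrow> bool" where
  "form_integrable \<omega> \<longleftrightarrow> integrable lborel (\<lambda>x. \<omega> x $ UNIV)"

definition form_integral :: "form \<Rightarrow> real" where
  "form_integral \<omega> = (LINT x|lborel. \<omega> x $ UNIV)"


section \<open>Cycles, boundaries and spectral differentials\<close>

text \<open>The parameter \<open>\<O>\<close> is \<open>Omega\<close> or \<open>Omega_c\<close>. The auxiliary forms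
  \<open>z\<^sub>p\<^sub>+\<^sub>j\<close> and \<open>c\<^sub>p\<^sub>-\<^sub>j\<close> are \<open>z j\<close> and \<open>c j\<close>.\<close>

definition cycle_aux ::
  "(int \<Rightarrow> int \<Rightarrow> form set) \<Rightarrow> nat \<Rightarrow> int \<Rightarrow> int \<Rightarrow> form \<Rightarrow> (nat \<Rightarrow> form) \<Rightarrow> bool" where
  "cycle_aux \<O> r p k \<alpha> z \<longleftrightarrow>
     (\<forall>j\<in>{1..<r}. z j \<in> \<O> (p + int j) k) \<and>
     (\<forall>m\<in>{1..<r}. dd m \<alpha> = (\<Sum>i<m. dd i (z (m - i))))"

definition cycles :: "(int \<Rightarrow> int \<Rightarrow> form set) \<Rightarrow> nat \<Rightarrow> int \<Rightarrow> int \<Rightarrow> form set" where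
  "cycles \<O> r p k = {\<alpha> \<in> \<O> p k. dd 0 \<alpha> = 0 \<and> (\<exists>z. cycle_aux \<O> r p k \<alpha> z)}"

definition boundaries :: "(int \<Rightarrow> int \<Rightarrow> form set) \<Rightarrow> nat \<Rightarrow> int \<Rightarrow> int \<Rightarrow> form set" where
  "boundaries \<O> r p k = {\<alpha> \<in> \<O> p k. \<exists>c.
     (\<forall>j<r. c j \<in> \<O> (p - int j) (k - 1)) \<and>
     \<alpha> = (\<Sum>j<r. dd j (c j)) \<and>
     (\<forall>i\<in>{1..<r}. 0 = (\<Sum>j\<in>{i..<r}. dd (j - i) (c j)))}"

text \<open>The value of \<open>\<Delta>\<^sub>r\<close> on a class \<open>A\<close>: all representatives obtained from all elements of \<open>A\<close>
  and all choices of auxiliary forms. That \<open>\<Delta>\<^sub>r\<close> is well defined means that they form one coset.\<close>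

definition spectral_diff ::
  "(int \<Rightarrow> int \<Rightarrow> form set) \<Rightarrow> nat \<Rightarrow> int \<Rightarrow> int \<Rightarrow> form set \<Rightarrow> form set" where
  "spectral_diff \<O> r p k A =
     (\<Union>{(dd r \<alpha> - (\<Sum>i\<in>{1..<r}. dd i (z (r - i)))) +o boundaries \<O> r (p + int r) (k + 1) | \<alpha> z.
        \<alpha> \<in> A \<and> cycle_aux \<O> r p k \<alpha> z})"

definition E_space :: "nat \<Rightarrow> nat \<Rightarrow> int \<Rightarrow> int \<Rightarrow> form set rspace" where
  "E_space r l p k = quotient_rspace (cycles Omega r p k) (boundaries Omega l p k)"


section \<open>Test forms and currents\<close>

definition D_space :: "nat \<Rightarrow> nat \<Rightarrow> int \<Rightarrow> int \<Rightarrow> form set rspace" where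
  "D_space r l p k = quotient_rspace (cycles Omega_c r p k) (boundaries Omega_c l p k)"

text \<open>The usual topology on compactly supported forms, that is, the locally convex inductive limit
  of the spaces of forms supported in a compact set \<open>K\<close>, each with the topology of uniform convergence
  of all derivatives: a base at \<open>0\<close> is given by the absolutely convex sets that meet each of these
  spaces in a neighbourhood of \<open>0\<close>.\<close>

definition LF_nhd0 :: "int \<Rightarrow> int \<Rightarrow> form set \<Rightarrow> bool" where
  "LF_nhd0 p k N \<longleftrightarrow>
     N \<subseteq> Omega_c p k \<and> convex N \<and> (\<forall>c. \<bar>c\<bar> \<le> 1 \<longrightarrow> (\<forall>\<omega>\<in>N. c *\<^sub>R \<omega> \<in> N)) \<and>
     (\<forall>K. compact K \<longrightarrow> (\<exists>m. \<exists>\<epsilon>>0. \<forall>\<omega>\<in>Omega_c p k.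
        {x. \<omega> x \<noteq> 0} \<subseteq> K \<and>
        (\<forall>is x. length is \<le> m \<longrightarrow> norm (foldr partial_deriv is \<omega> x) < \<epsilon>) \<longrightarrow> \<omega> \<in> N))"

definition LF_top :: "int \<Rightarrow> int \<Rightarrow> form topology" where
  "LF_top p k = topology (\<lambda>U. U \<subseteq> Omega_c p k \<and> (\<forall>\<omega>\<in>U. \<exists>N. LF_nhd0 p k N \<and> \<omega> +o N \<subseteq> U))"

lemma LF_nhd0_Int:
  assumes "LF_nhd0 p k N" "LF_nhd0 p k N'"
  shows "LF_nhd0 p k (N \<inter> N')"
  unfolding LF_nhd0_def
proof (intro conjI allI impI)
  show "N \<inter> N' \<subseteq> Omega_c p k" "convex (N \<inter> N')"
    using assms by (auto simp: LF_nhd0_def intro: convex_Int)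
  show "\<forall>\<omega>\<in>N \<inter> N'. c *\<^sub>R \<omega> \<in> N \<inter> N'" if "\<bar>c\<bar> \<le> 1" for c
    using assms that by (auto simp: LF_nhd0_def)
  fix K :: "engel set"
  assume K: "compact K"
  obtain m \<epsilon> where 1: "\<epsilon> > 0" "\<And>\<omega>. \<omega> \<in> Omega_c p k \<Longrightarrow> {x. \<omega> x \<noteq> 0} \<subseteq> K \<Longrightarrow>
      \<forall>is x. length is \<le> m \<longrightarrow> norm (foldr partial_deriv is \<omega> x) < \<epsilon> \<Longrightarrow> \<omega> \<in> N"
    using assms(1) K unfolding LF_nhd0_def by meson
  obtain m' \<epsilon>' where 2: "\<epsilon>' > 0" "\<And>\<omega>. \<omega> \<in> Omega_c p k \<Longrightarrow> {x. \<omega> x \<noteq> 0} \<subseteq> K \<Longrightarrow>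
      \<forall>is x. length is \<le> m' \<longrightarrow> norm (foldr partial_deriv is \<omega> x) < \<epsilon>' \<Longrightarrow> \<omega> \<in> N'"
    using assms(2) K unfolding LF_nhd0_def by meson
  show "\<exists>m. \<exists>\<epsilon>>0. \<forall>\<omega>\<in>Omega_c p k.
        {x. \<omega> x \<noteq> 0} \<subseteq> K \<and>
        (\<forall>is x. length is \<le> m \<longrightarrow> norm (foldr partial_deriv is \<omega> x) < \<epsilon>) \<longrightarrow> \<omega> \<in> N \<inter> N'"
    by (rule exI[of _ "max m m'"], rule exI[of _ "min \<epsilon> \<epsilon>'"]) (use 1 2 in auto)
qed

lemma openin_LF_top:
  "openin (LF_top p k) U \<longleftrightarrow>
     U \<subseteq> Omega_c p k \<and> (\<forall>\<omega>\<in>U. \<exists>N. LF_nhd0 p k N \<and> \<omega> +o N \<subseteq> U)"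
proof -
  have "istopology (\<lambda>U. U \<subseteq> Omega_c p k \<and> (\<forall>\<omega>\<in>U. \<exists>N. LF_nhd0 p k N \<and> \<omega> +o N \<subseteq> U))"
    unfolding istopology_def
  proof (intro conjI allI impI ballI)
    fix S T \<omega>
    assume S: "S \<subseteq> Omega_c p k \<and> (\<forall>\<omega>\<in>S. \<exists>N. LF_nhd0 p k N \<and> \<omega> +o N \<subseteq> S)"
      and T: "T \<subseteq> Omega_c p k \<and> (\<forall>\<omega>\<in>T. \<exists>N. LF_nhd0 p k N \<and> \<omega> +o N \<subseteq> T)"
    show "S \<inter> T \<subseteq> Omega_c p k" using S by auto
    assume "\<omega> \<in> S \<inter> T"
    then obtain N N' where "LF_nhd0 p k N" "\<omega> +o N \<subseteq> S" "LF_nhd0 p k N'" "\<omega> +o N' \<subseteq> T"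
      using S T by (meson IntD1 IntD2)
    then have "LF_nhd0 p k (N \<inter> N') \<and> \<omega> +o (N \<inter> N') \<subseteq> S \<inter> T"
      using LF_nhd0_Int by (auto simp: elt_set_plus_def)
    then show "\<exists>N. LF_nhd0 p k N \<and> \<omega> +o N \<subseteq> S \<inter> T" by blast
  next
    fix \<K> :: "form set set"
    assume K: "\<forall>U\<in>\<K>. U \<subseteq> Omega_c p k \<and> (\<forall>\<omega>\<in>U. \<exists>N. LF_nhd0 p k N \<and> \<omega> +o N \<subseteq> U)"
    then show "\<Union> \<K> \<subseteq> Omega_c p k" by auto
    fix \<omega> assume "\<omega> \<in> \<Union> \<K>"
    then show "\<exists>N. LF_nhd0 p k N \<and> \<omega> +o N \<subseteq> \<Union> \<K>" using K by (meson Union_iff subset_iff)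
  qed
  then show ?thesis
    by (simp add: LF_top_def)
qed

definition D_top :: "nat \<Rightarrow> nat \<Rightarrow> int \<Rightarrow> int \<Rightarrow> form set topology" where
  "D_top r l p k =
     quotient_top (subtopology (LF_top p k) (cycles Omega_c r p k))
       (\<lambda>\<eta>. \<eta> +o boundaries Omega_c l p k)"

text \<open>Topological dimension \<open>4\<close>, homogeneous dimension \<open>7\<close>.\<close>

definition C_space :: "nat \<Rightarrow> nat \<Rightarrow> int \<Rightarrow> int \<Rightarrow> (form set \<Rightarrow> real) rspace" where
  "C_space r l p k = dual_rspace (D_space l r (7 - p) (4 - k)) (D_top l r (7 - p) (4 - k))"

text \<open>\<open>\<partial>\<^sub>r\<close> from \<open>C_space r l p k\<close> to \<open>C_space m r (p + r) (k + 1)\<close>; the formula does not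
  involve \<open>l\<close>.\<close>

definition current_boundary ::
  "nat \<Rightarrow> nat \<Rightarrow> int \<Rightarrow> int \<Rightarrow> (form set \<Rightarrow> real) \<Rightarrow> form set \<Rightarrow> real" where
  "current_boundary m r p k T = (\<lambda>H\<in>vcar (D_space r m (7 - p - int r) (4 - k - 1)).
     (-1) powi (k + 1) * T (spectral_diff Omega_c r (7 - p - int r) (4 - k - 1) H))"


section \<open>Pairing and the two spectral complexes\<close>

definition pairing :: "form set \<Rightarrow> form set \<Rightarrow> real" where
  "pairing A H = (THE c. \<exists>\<alpha>\<in>A. \<exists>\<eta>\<in>H. c = form_integral (\<lambda>x. \<alpha> x \<and>\<and> \<eta> x))"

definition psi :: "nat \<Rightarrow> nat \<Rightarrow> int \<Rightarrow> int \<Rightarrow> form set \<Rightarrow> form set \<Rightarrow> real" where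
  "psi r l p k A = (\<lambda>H\<in>vcar (D_space l r (7 - p) (4 - k)). pairing A H)"

definition pairing_well_defined :: "nat \<Rightarrow> nat \<Rightarrow> int \<Rightarrow> int \<Rightarrow> bool" where
  "pairing_well_defined r l p k \<longleftrightarrow>
     (\<forall>A\<in>vcar (E_space r l p k). \<forall>H\<in>vcar (D_space l r (7 - p) (4 - k)).
        (\<forall>\<alpha>\<in>A. \<forall>\<eta>\<in>H. form_integrable (\<lambda>x. \<alpha> x \<and>\<and> \<eta> x)) \<and>
        (\<exists>!c. \<exists>\<alpha>\<in>A. \<exists>\<eta>\<in>H. c = form_integral (\<lambda>x. \<alpha> x \<and>\<and> \<eta> x)))"

definition pairing_nondegenerate :: "nat \<Rightarrow> nat \<Rightarrow> int \<Rightarrow> int \<Rightarrow> bool" where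
  "pairing_nondegenerate r l p k \<longleftrightarrow>
     (let V = E_space r l p k; W = D_space l r (7 - p) (4 - k) in
        (\<forall>A\<in>vcar V. (\<forall>H\<in>vcar W. pairing A H = 0) \<longrightarrow> A = vzero V) \<and>
        (\<forall>H\<in>vcar W. (\<forall>A\<in>vcar V. pairing A H = 0) \<longrightarrow> H = vzero W))"

text \<open>The term \<open>(p, k, r, l)\<close> stands for the space with lower indices \<open>r, l\<close>, weight \<open>p\<close>
  and degree \<open>k\<close>; it is followed by \<open>\<Delta>\<^sub>r\<close>.\<close>

type_synonym spectral_term = "int \<times> int \<times> nat \<times> nat"

definition complex1 :: "spectral_term list" where
  "complex1 = [(0, 0, 1, 1), (1, 1, 2, 1), (3, 2, 3, 2), (6, 3, 1, 3), (7, 4, 1, 1)]"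

definition complex2 :: "spectral_term list" where
  "complex2 = [(0, 0, 1, 1), (1, 1, 3, 1), (4, 2, 2, 3), (6, 3, 1, 2), (7, 4, 1, 1)]"

definition admissible :: "spectral_term set" where
  "admissible = set complex1 \<union> set complex2"

definition consecutive :: "spectral_term list \<Rightarrow> spectral_term \<Rightarrow> spectral_term \<Rightarrow> bool" where
  "consecutive ts t t' \<longleftrightarrow> (\<exists>i. Suc i < length ts \<and> ts ! i = t \<and> ts ! Suc i = t')"

definition E_term :: "spectral_term list \<Rightarrow> nat \<Rightarrow> form set rspace" where
  "E_term ts i = (case ts ! i of (p, k, r, l) \<Rightarrow> E_space r l p k)"

definition E_diff :: "spectral_term list \<Rightarrow> nat \<Rightarrow> form set \<Rightarrow> form set" where
  "E_diff ts i = (case ts ! i of (p, k, r, l) \<Rightarrow> spectral_diff Omega r p k)"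

definition C_term :: "spectral_term list \<Rightarrow> nat \<Rightarrow> (form set \<Rightarrow> real) rspace" where
  "C_term ts i = (case ts ! i of (p, k, r, l) \<Rightarrow> C_space r l p k)"

definition C_diff ::
  "spectral_term list \<Rightarrow> nat \<Rightarrow> (form set \<Rightarrow> real) \<Rightarrow> form set \<Rightarrow> real" where
  "C_diff ts i = (case ts ! i of (p, k, r, l) \<Rightarrow>
     case ts ! Suc i of (p', k', r', l') \<Rightarrow> current_boundary r' r p k)"

definition psi_term :: "spectral_term list \<Rightarrow> nat \<Rightarrow> form set \<Rightarrow> form set \<Rightarrow> real" where
  "psi_term ts i = (case ts ! i of (p, k, r, l) \<Rightarrow> psi r l p k)"

end

theory Submission
  imports Defs
begin

text \<open>A cycle is the lowest component of an inhomogeneous form \<open>\<alpha> - z\<^sub>p\<^sub>+\<^sub>1 - \<dots>\<close> whose differential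
  starts only \<open>r\<close> weights higher, and \<open>\<Delta>\<^sub>r\<close> takes that first component. Hence well-definedness of the
  pairing and the intertwining relation follow from Stokes and \<open>d\<^sup>2 = 0\<close> applied to inhomogeneous
  forms. The auxiliary forms can be produced by an algebraic inverse of \<open>d\<^sub>0\<close>, so \<open>\<Delta>\<^sub>r\<close> is induced by a
  differential operator and is continuous on test forms.

  For non-degeneracy, a form is mostly detected by pairing it with a bump function times its Hodge
  dual. The exceptions are the pairings of weight 6 with weight 1, where the cycle \<open>a \<theta>\<^sub>1\<^sub>3\<^sub>4 + b \<theta>\<^sub>2\<^sub>3\<^sub>4\<close> is
  shown to be a boundary by solving \<open>X\<^sub>2 X\<^sub>2 u = - b\<close> and \<open>(X\<^sub>1 X\<^sub>2 + X\<^sub>3) u = - a\<close> by integration along the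
  integral curves of \<open>X\<^sub>2\<close> and \<open>X\<^sub>3\<close>; the relation \<open>X\<^sub>1 b = X\<^sub>2 a\<close> needed for this comes from pairing with
  exact forms, and orthogonality to all cycles of weight 1 makes \<open>u\<close> compactly supported when
  \<open>a\<close> and \<open>b\<close> are.\<close>

section \<open>Smooth functions\<close>

text \<open>The pairing exchanges the two complexes: the test spaces dual to the terms of
  \<open>complex1\<close> are those of \<open>complex2\<close> in reverse order, with the two lower
  indices swapped. Stokes shows that B_l annihilates the cycles of order l; the question is whether
  the annihilator is larger. In most terms the cycle conditions are vacuous, so only the zero form
  is annihilated. Just two spaces of cycles are proper: Z_2 in weight 4, degree 2, where d_0 removes
  the coefficient of theta_24, and Z_3 in weight 1, degree 1, where a second-order differential
  equation remains. The annihilator of the latter cannot be found pointwise: membership in B_3 of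
  weight 6 means solving for a potential u. This is possible because X_2 and X_3 commute and have
  straight lines as integral curves. Orthogonality to exact forms suffices when u may be any smooth
  function; compact support of u costs the further cycles p theta_1 with X_2 X_2 p = 0. Since
  \<open>smooth\<close> only says that all iterated partial derivatives are differentiable, symmetry
  of second derivatives and all closure properties are derived from that.\<close>

lemma partial_deriv_eqI: "(f has_derivative D) (at x) \<Longrightarrow> partial_deriv i f x = D (axis i 1)"
  unfolding partial_deriv_def by (metis frechet_derivative_at)

lemma partial_deriv_frechet:
  assumes "f differentiable (at x)"
  shows "frechet_derivative f (at x) v = (\<Sum>i\<in>UNIV. v $ i *\<^sub>R partial_deriv i f x)"
proof -
  interpret linear "frechet_derivative f (at x)"
    by (rule linear_frechet_derivative[OF assms])
  have "frechet_derivative f (at x) (\<Sum>i\<in>UNIV. v $ i *\<^sub>R axis i 1) =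
      (\<Sum>i\<in>UNIV. v $ i *\<^sub>R partial_deriv i f x)"
    by (simp add: sum scale partial_deriv_def)
  also have "(\<Sum>i\<in>UNIV. v $ i *\<^sub>R axis i 1) = v"
    using basis_expansion[of v] by (simp add: scalar_mult_eq_scaleR)
  finally show ?thesis .
qed

lemma smooth_differentiable: "smooth f \<Longrightarrow> f differentiable (at x)"
  unfolding smooth_def by (metis foldr.simps(1) id_apply)

lemma smooth_has_derivative:
  "smooth f \<Longrightarrow> (f has_derivative frechet_derivative f (at x)) (at x)"
  using smooth_differentiable frechet_derivative_works by blast

lemma smooth_partial_deriv: "smooth f \<Longrightarrow> smooth (partial_deriv i f)"
  unfolding smooth_def
proof (intro allI)
  fix "is" x
  assume "\<forall>is x. foldr partial_deriv is f differentiable (at x)"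
  then have "foldr partial_deriv (is @ [i]) f differentiable (at x)" by blast
  then show "foldr partial_deriv is (partial_deriv i f) differentiable (at x)" by simp
qed

lemma smooth_continuous_on: "smooth f \<Longrightarrow> continuous_on S f"
  by (meson differentiable_imp_continuous_on differentiable_on_def
      differentiable_at_withinI smooth_differentiable)

text \<open>\<open>smooth\<close> speaks of iterated partial derivatives only, and these never leave
  the class \<open>C\<close>. This is the source of all smoothness proofs below.\<close>

lemma smooth_coinduct:
  assumes "C f" "\<And>f x. C f \<Longrightarrow> f differentiable (at x)" "\<And>f i. C f \<Longrightarrow> C (partial_deriv i f)"
  shows "smooth f"
proof -
  have "C (foldr partial_deriv is f)" for "is"
    by (induction "is") (auto simp: assms)
  then show ?thesis unfolding smooth_def using assms(2) by blast
qed

text \<open>The module over the smooth functions generated by \<open>P\<close>. Product and chain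
  rules produce such combinations rather than members of \<open>P\<close> itself.\<close>

inductive smooth_span :: "((engel \<Rightarrow> 'b::real_normed_vector) \<Rightarrow> bool) \<Rightarrow> (engel \<Rightarrow> 'b) \<Rightarrow> bool"
  for P where
  base: "P f \<Longrightarrow> smooth_span P f"
| mult: "smooth_span P f \<Longrightarrow> smooth h \<Longrightarrow> smooth_span P (\<lambda>x. h x *\<^sub>R f x)"
| add: "smooth_span P f \<Longrightarrow> smooth_span P g \<Longrightarrow> smooth_span P (\<lambda>x. f x + g x)"

lemma has_derivative_scaleR_fun:
  assumes "(h has_derivative h') (at x)" "(f has_derivative f') (at x)"
  shows "((\<lambda>x. h x *\<^sub>R f x) has_derivative (\<lambda>v. h' v *\<^sub>R f x + h x *\<^sub>R f' v)) (at x)"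
  using has_derivative_scaleR[OF assms] by (simp add: add.commute)

lemma smooth_span_partial_deriv:
  assumes "\<And>f x. P f \<Longrightarrow> f differentiable (at x)"
    "\<And>f i. P f \<Longrightarrow> smooth_span P (partial_deriv i f)"
    "smooth_span P f"
  shows "(\<forall>x. f differentiable (at x)) \<and> (\<forall>i. smooth_span P (partial_deriv i f))"
  using assms(3)
proof induction
  case (base f)
  then show ?case using assms by blast
next
  case (mult f h)
  have *: "((\<lambda>x. h x *\<^sub>R f x) has_derivative
      (\<lambda>v. frechet_derivative h (at x) v *\<^sub>R f x + h x *\<^sub>R frechet_derivative f (at x) v)) (at x)" for x
    using mult by (intro has_derivative_scaleR_fun smooth_has_derivative[of h])
      (simp_all add: frechet_derivative_works)
  have "partial_deriv i (\<lambda>x. h x *\<^sub>R f x) =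
      (\<lambda>x. partial_deriv i h x *\<^sub>R f x + h x *\<^sub>R partial_deriv i f x)" for i
    by (rule ext, subst partial_deriv_eqI[OF *]) (simp add: partial_deriv_def)
  moreover have "smooth_span P (\<lambda>x. partial_deriv i h x *\<^sub>R f x + h x *\<^sub>R partial_deriv i f x)" for i
    using mult by (intro smooth_span.add smooth_span.mult smooth_partial_deriv) auto
  ultimately show ?case using *[THEN differentiableI] by simp
next
  case (add f g)
  have *: "((\<lambda>x. f x + g x) has_derivative
      (\<lambda>v. frechet_derivative f (at x) v + frechet_derivative g (at x) v)) (at x)" for x
    using add by (intro has_derivative_add) (auto simp: frechet_derivative_works)
  have "partial_deriv i (\<lambda>x. f x + g x) = (\<lambda>x. partial_deriv i f x + partial_deriv i g x)" for i
    by (rule ext, subst partial_deriv_eqI[OF *]) (simp add: partial_deriv_def)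
  moreover have "smooth_span P (\<lambda>x. partial_deriv i f x + partial_deriv i g x)" for i
    using add by (intro smooth_span.add) auto
  ultimately show ?case using *[THEN differentiableI] by simp
qed

text \<open>Coinduction up to linear combinations with smooth coefficients.\<close>

lemma smooth_upto:
  assumes "\<And>f x. P f \<Longrightarrow> f differentiable (at x)"
    "\<And>f i. P f \<Longrightarrow> smooth_span P (partial_deriv i f)"
    "smooth_span P f"
  shows "smooth f"
  by (rule smooth_coinduct[of "smooth_span P"])
    (use assms smooth_span_partial_deriv[OF assms(1,2)] in blast)+

text \<open>Both are instances of \<open>smooth_upto\<close> with \<open>smooth\<close> itself as
  the generating class: by the product rule the derivatives stay in its span.\<close>

lemma smooth_scaleR: "smooth h \<Longrightarrow> smooth f \<Longrightarrow> smooth (\<lambda>x. h x *\<^sub>R f x)"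
  and smooth_add: "smooth f \<Longrightarrow> smooth g \<Longrightarrow> smooth (\<lambda>x. f x + g x)"
  for f g :: "engel \<Rightarrow> 'b::real_normed_vector"
  by (rule smooth_upto[of smooth]; blast intro: smooth_differentiable smooth_partial_deriv
      smooth_span.intros)+

lemma partial_deriv_const [simp]: "partial_deriv i (\<lambda>x. c) = (\<lambda>x. 0)"
  by (rule ext, subst partial_deriv_eqI[OF has_derivative_const]) simp

lemma smooth_const [simp, intro]: "smooth (\<lambda>x. c)"
  by (rule smooth_coinduct[of "\<lambda>f. \<exists>c. f = (\<lambda>x. c)"]) auto

lemma smooth_mult: "smooth f \<Longrightarrow> smooth g \<Longrightarrow> smooth (\<lambda>x. f x * g x :: real)"
  using smooth_scaleR[of f g] by simp

lemma smooth_power: "smooth f \<Longrightarrow> smooth (\<lambda>x. f x ^ n :: real)"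
  by (induction n) (auto intro: smooth_mult)

lemma partial_deriv_linear:
  assumes "bounded_linear A" "f differentiable (at x)"
  shows "partial_deriv i (\<lambda>x. A (f x)) x = A (partial_deriv i f x)"
  using partial_deriv_eqI[OF bounded_linear.has_derivative[OF assms(1)]]
    assms(2)[unfolded frechet_derivative_works] by (metis partial_deriv_def)

lemma smooth_linear:
  assumes A: "bounded_linear A" and "smooth f"
  shows "smooth (\<lambda>x. A (f x))"
proof (rule smooth_coinduct[of "\<lambda>g. \<exists>f. smooth f \<and> g = (\<lambda>x. A (f x))"])
  show "\<exists>f'. smooth f' \<and> (\<lambda>x. A (f x)) = (\<lambda>x. A (f' x))" using assms by blast
next
  fix g x assume "\<exists>f. smooth f \<and> g = (\<lambda>x. A (f x))"
  then obtain f where f: "smooth f" "g = (\<lambda>x. A (f x))" by blast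
  show "g differentiable at x"
    unfolding f(2) by (rule differentiableI[OF bounded_linear.has_derivative[OF A smooth_has_derivative[OF f(1)]]])
next
  fix g i assume "\<exists>f. smooth f \<and> g = (\<lambda>x. A (f x))"
  then obtain f where f: "smooth f" "g = (\<lambda>x. A (f x))" by blast
  then show "\<exists>f. smooth f \<and> partial_deriv i g = (\<lambda>x. A (f x))"
    using partial_deriv_linear[OF A smooth_differentiable[OF f(1)]]
    by (intro exI[of _ "partial_deriv i f"]) (auto intro: smooth_partial_deriv)
qed

lemma smooth_minus: "smooth f \<Longrightarrow> smooth (\<lambda>x. - f x)"
  by (rule smooth_linear[OF bounded_linear_minus[OF bounded_linear_ident]])

lemma smooth_diff: "smooth f \<Longrightarrow> smooth g \<Longrightarrow> smooth (\<lambda>x. f x - g x)"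
  using smooth_add[of f "\<lambda>x. - g x"] smooth_minus[of g] by simp

lemma smooth_sum: "(\<And>i. i \<in> S \<Longrightarrow> smooth (f i)) \<Longrightarrow> smooth (\<lambda>x. \<Sum>i\<in>S. f i x)"
  by (induction S rule: infinite_finite_induct) (auto intro: smooth_add)

lemma smooth_nth: "smooth (f :: engel \<Rightarrow> real^'n) \<Longrightarrow> smooth (\<lambda>x. f x $ i)"
  by (rule smooth_linear[OF bounded_linear_vec_nth])

lemma smooth_ident [simp, intro]: "smooth (\<lambda>x. x)"
proof (rule smooth_coinduct[of "\<lambda>f. f = (\<lambda>x. x) \<or> (\<exists>c. f = (\<lambda>x. c))"], blast, force)
  have "partial_deriv i (\<lambda>x. x) = (\<lambda>x. axis i 1)" for i
    by (rule ext, subst partial_deriv_eqI[OF has_derivative_ident]) simp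
  then show "\<And>f i. f = (\<lambda>x. x) \<or> (\<exists>c. f = (\<lambda>x. c)) \<Longrightarrow>
      partial_deriv i f = (\<lambda>x. x) \<or> (\<exists>c. partial_deriv i f = (\<lambda>x. c))"
    by auto
qed

lemma smooth_coord [simp, intro]: "smooth (\<lambda>x. x $ i)"
  by (rule smooth_nth) simp

text \<open>The increment of the j-th derivative over a segment in direction i is the integral of
  the i-th derivative of the j-th, by the fundamental theorem, and also that of the j-th derivative
  of the i-th, by differentiating the increment of \<open>f\<close> under the integral sign.\<close>

lemma partial_deriv_commute:
  fixes f :: "engel \<Rightarrow> 'b::banach"
  assumes f: "smooth f"
  shows "partial_deriv i (partial_deriv j f) = partial_deriv j (partial_deriv i f)"
proof (rule ext)
  fix x :: engel
  have dir: "((\<lambda>t. g (y + t *\<^sub>R axis k 1)) has_vector_derivative partial_deriv k g (y + s *\<^sub>R axis k 1)) (at s within S)"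
    if "smooth g" for g :: "engel \<Rightarrow> 'b" and y k s S
  proof -
    have "((\<lambda>t. y + t *\<^sub>R axis k 1) has_derivative (\<lambda>t. t *\<^sub>R axis k (1::real))) (at s within S)"
      by (auto intro!: derivative_eq_intros)
    from has_derivative_compose[OF this smooth_has_derivative[OF that]]
    show ?thesis
      using linear_frechet_derivative[OF smooth_differentiable[OF that]]
      by (simp add: has_vector_derivative_def partial_deriv_def linear_scale)
  qed
  have cont: "continuous_on S (\<lambda>z. g (x + F z))" if "smooth g" "continuous_on S F"
    for g :: "engel \<Rightarrow> 'b" and S and F :: "'z::topological_space \<Rightarrow> engel"
    by (intro continuous_on_compose2[OF smooth_continuous_on[OF that(1), of UNIV]] continuous_intros that) auto
  let ?ei = "axis i (1::real) :: engel" let ?ej = "axis j (1::real) :: engel"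
  let ?fi = "partial_deriv i f" let ?fj = "partial_deriv j f"
  have fij: "smooth ?fi" "smooth ?fj" "smooth (partial_deriv j ?fi)" "smooth (partial_deriv i ?fj)"
    using f by (auto intro: smooth_partial_deriv)
  have 1: "integral {0..s} (\<lambda>\<sigma>. ?fi (x + t *\<^sub>R ?ej + \<sigma> *\<^sub>R ?ei)) =
      f (x + t *\<^sub>R ?ej + s *\<^sub>R ?ei) - f (x + t *\<^sub>R ?ej)" if "s \<ge> 0" for s t
    using fundamental_theorem_of_calculus[OF that dir[OF f]] by (simp add: integral_unique)
  have 2: "integral {0..s} (\<lambda>\<sigma>. partial_deriv i ?fj (x + \<sigma> *\<^sub>R ?ei)) = ?fj (x + s *\<^sub>R ?ei) - ?fj x"
    if "s \<ge> 0" for s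
    using fundamental_theorem_of_calculus[OF that dir[OF fij(2)]] by (simp add: integral_unique)
  have 3: "integral {0..s} (\<lambda>\<sigma>. partial_deriv j ?fi (x + \<sigma> *\<^sub>R ?ei)) = ?fj (x + s *\<^sub>R ?ei) - ?fj x"
    if s: "s \<ge> 0" for s
  proof -
    have "((\<lambda>t. integral (cbox 0 s) (\<lambda>\<sigma>. ?fi (x + t *\<^sub>R ?ej + \<sigma> *\<^sub>R ?ei))) has_vector_derivative
        integral (cbox 0 s) (\<lambda>\<sigma>. partial_deriv j ?fi (x + 0 *\<^sub>R ?ej + \<sigma> *\<^sub>R ?ei))) (at 0 within UNIV)"
    proof (rule leibniz_rule_vector_derivative)
      fix t \<sigma> :: real
      show "((\<lambda>t. ?fi (x + t *\<^sub>R ?ej + \<sigma> *\<^sub>R ?ei)) has_vector_derivative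
          partial_deriv j ?fi (x + t *\<^sub>R ?ej + \<sigma> *\<^sub>R ?ei)) (at t within UNIV)"
        using dir[OF fij(1), of "x + \<sigma> *\<^sub>R ?ei" j t] by (simp add: ac_simps)
      show "(\<lambda>\<sigma>. ?fi (x + t *\<^sub>R ?ej + \<sigma> *\<^sub>R ?ei)) integrable_on cbox 0 s"
        unfolding add.assoc by (intro integrable_continuous cont fij continuous_intros)
      show "continuous_on (UNIV \<times> cbox 0 s) (\<lambda>(t, \<sigma>). partial_deriv j ?fi (x + t *\<^sub>R ?ej + \<sigma> *\<^sub>R ?ei))"
        unfolding add.assoc split_def by (intro cont fij continuous_intros)
    qed auto
    moreover have "((\<lambda>t. integral (cbox 0 s) (\<lambda>\<sigma>. ?fi (x + t *\<^sub>R ?ej + \<sigma> *\<^sub>R ?ei))) has_vector_derivative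
        ?fj (x + s *\<^sub>R ?ei) - ?fj x) (at 0)"
      using has_vector_derivative_diff[OF dir[OF f, of "x + s *\<^sub>R ?ei" j 0 UNIV] dir[OF f, of x j 0 UNIV]]
        1[OF s] by (simp add: ac_simps)
    ultimately show ?thesis
      using vector_derivative_unique_at by fastforce
  qed
  \<comment> \<open>The two integral formulas hold for s \<ge> 0 only, so they are compared through
    one-sided derivatives at s = 0, which return the integrands at \<open>x\<close>.\<close>
  have der: "((\<lambda>s. integral {0..s} (\<lambda>\<sigma>. g (x + \<sigma> *\<^sub>R ?ei))) has_vector_derivative g x) (at 0 within {0..1})"
    if "smooth g" for g :: "engel \<Rightarrow> 'b"
  proof -
    have "continuous_on {0..1} (\<lambda>\<sigma>. g (x + \<sigma> *\<^sub>R ?ei))"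
      by (intro cont that continuous_intros)
    from integral_has_vector_derivative[OF this, of 0] show ?thesis by simp
  qed
  have "((\<lambda>s. ?fj (x + s *\<^sub>R ?ei) - ?fj x) has_vector_derivative partial_deriv i ?fj x) (at 0 within {0..1})"
    by (rule has_vector_derivative_transform[OF _ _ der[OF fij(4)]]) (auto simp: 2)
  moreover have "((\<lambda>s. ?fj (x + s *\<^sub>R ?ei) - ?fj x) has_vector_derivative partial_deriv j ?fi x) (at 0 within {0..1})"
    by (rule has_vector_derivative_transform[OF _ _ der[OF fij(3)]]) (auto simp: 3)
  ultimately show "partial_deriv i ?fj x = partial_deriv j ?fi x"
    by (rule vector_derivative_unique_within[rotated]) (simp add: at_within_Icc_at_right trivial_limit_at_right_real)
qed

lemma smooth_compose_continuous:
  "smooth g \<Longrightarrow> continuous_on S F \<Longrightarrow> continuous_on S (\<lambda>z. g (F z))"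
  by (rule continuous_on_compose2[OF smooth_continuous_on[of g UNIV]]) auto

lemma frechet_derivative_eqI: "(f has_derivative D) (at x) \<Longrightarrow> frechet_derivative f (at x) = D"
  by (rule frechet_derivative_at[symmetric])

section \<open>Primitives along vector fields\<close>

text \<open>For \<open>n = 0\<close> this is the mean of \<open>f\<close> over the segment from x -
  W x to x. The powers of t - 1 are the factors that the chain rule produces, so the family over all
  \<open>n\<close> is closed under differentiation.\<close>

definition flow_mean :: "(engel \<Rightarrow> engel) \<Rightarrow> nat \<Rightarrow> (engel \<Rightarrow> real) \<Rightarrow> engel \<Rightarrow> real" where
  "flow_mean W n f x = integral {0..1} (\<lambda>t. (t - 1) ^ n * f (x + (t - 1) *\<^sub>R W x))"

text \<open>Differentiation under the integral sign. The rule asks for a derivative that is jointly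
  continuous as a bounded linear map; in finite dimension this is checked on basis vectors, where it
  becomes a polynomial in partial derivatives.\<close>

lemma flow_mean_has_derivative:
  assumes f: "smooth f" and W: "smooth W"
  shows "(flow_mean W n f has_derivative (\<lambda>v. integral {0..1} (\<lambda>t. (t - 1) ^ n *
    frechet_derivative f (at (x + (t - 1) *\<^sub>R W x)) (v + (t - 1) *\<^sub>R frechet_derivative W (at x) v)))) (at x)"
proof -
  let ?g = "\<lambda>x t. x + (t - 1) *\<^sub>R W x"
  let ?D = "\<lambda>x t v. (t - 1) ^ n *
    frechet_derivative f (at (?g x t)) (v + (t - 1) *\<^sub>R frechet_derivative W (at x) v)"
  have der: "((\<lambda>x. (t - 1) ^ n * f (?g x t)) has_derivative ?D x t) (at x)" for x t
  proof -
    have "((\<lambda>x. ?g x t) has_derivative (\<lambda>v. v + (t - 1) *\<^sub>R frechet_derivative W (at x) v)) (at x)"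
      by (intro has_derivative_add has_derivative_ident has_derivative_scaleR_right smooth_has_derivative W)
    from has_derivative_mult_right[OF has_derivative_compose[OF this smooth_has_derivative[OF f]]]
    show ?thesis .
  qed
  have app: "blinfun_apply (Blinfun (?D x t)) = ?D x t" for x t
    by (rule bounded_linear_Blinfun_apply[OF has_derivative_bounded_linear[OF der]])
  have g: "continuous_on S (\<lambda>z. ?g (F z) (G z))" if "continuous_on S F" "continuous_on S G"
    for S and F :: "'z::topological_space \<Rightarrow> engel" and G
    by (intro continuous_intros that smooth_compose_continuous[OF W])
  have cont: "continuous_on (UNIV \<times> cbox 0 1) (\<lambda>(x, t). Blinfun (?D x t))"
  proof (rule continuous_on_blinfun_componentwise)
    fix e :: engel assume "e \<in> Basis"
    then obtain j where e: "e = axis j 1" by (auto simp: Basis_vec_def)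
    have "continuous_on (UNIV \<times> cbox 0 1) (\<lambda>z. (snd z - 1) ^ n * (\<Sum>k\<in>UNIV.
        (axis j 1 + (snd z - 1) *\<^sub>R partial_deriv j W (fst z)) $ k *
          partial_deriv k f (?g (fst z) (snd z))))"
      by (intro continuous_intros g smooth_compose_continuous[OF smooth_partial_deriv[OF f]]
          smooth_compose_continuous[OF smooth_partial_deriv[OF W]])
    then show "continuous_on (UNIV \<times> cbox 0 1) (\<lambda>z. blinfun_apply (case z of (x, t) \<Rightarrow> Blinfun (?D x t)) e)"
      unfolding split_def app e
      by (simp add: partial_deriv_frechet[OF smooth_differentiable[OF f]]
          flip: partial_deriv_def)
  qed
  have "((\<lambda>x. integral (cbox 0 1) (\<lambda>t. (t - 1) ^ n * f (?g x t))) has_derivative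
      integral (cbox 0 1) (\<lambda>t. Blinfun (?D x t))) (at x within UNIV)"
  proof (rule leibniz_rule[OF _ _ cont])
    show "((\<lambda>x. (t - 1) ^ n * f (?g x t)) has_derivative blinfun_apply (Blinfun (?D x t))) (at x within UNIV)" for x t
      unfolding app using der by simp
    show "(\<lambda>t. (t - 1) ^ n * f (?g x t)) integrable_on cbox 0 1" for x
      by (intro integrable_continuous continuous_intros smooth_compose_continuous[OF f])
  qed auto
  moreover have "(\<lambda>t. Blinfun (?D x t)) integrable_on cbox 0 1"
    by (intro integrable_continuous continuous_on_compose2[OF cont, of _ "\<lambda>t. (x, t)", simplified]
        continuous_intros) auto
  then have "blinfun_apply (integral (cbox 0 1) (\<lambda>t. Blinfun (?D x t))) = (\<lambda>v. integral {0..1} (\<lambda>t. ?D x t v))"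
    by (simp add: fun_eq_iff blinfun_apply_integral app)
  ultimately show ?thesis
    by (simp add: flow_mean_def[abs_def])
qed

text \<open>A partial derivative of a mean is the mean of a partial derivative plus means of order
  \<open>Suc n\<close> with the derivatives of \<open>W\<close> as coefficients, so
  \<open>smooth_upto\<close> applies to the whole family.\<close>

lemma smooth_flow_mean:
  assumes f: "smooth f" and W: "smooth W"
  shows "smooth (flow_mean W n f)"
proof (rule smooth_upto[of "\<lambda>g. \<exists>n f. smooth f \<and> g = flow_mean W n f"])
  show "smooth_span (\<lambda>g. \<exists>n f. smooth f \<and> g = flow_mean W n f) (flow_mean W n f)"
    using f by (intro smooth_span.base) blast
next
  fix g x assume "\<exists>n f. smooth f \<and> g = flow_mean W n f"
  then show "g differentiable (at x)"
    using differentiableI[OF flow_mean_has_derivative[OF _ W]] by auto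
next
  fix g i assume "\<exists>n f. smooth f \<and> g = flow_mean W n f"
  then obtain n f where f: "smooth f" and g: "g = flow_mean W n f" by blast
  have "partial_deriv i g x = flow_mean W n (partial_deriv i f) x +
      (\<Sum>k\<in>UNIV. (partial_deriv i W x $ k) *\<^sub>R flow_mean W (Suc n) (partial_deriv k f) x)" for x
  proof -
    let ?g = "\<lambda>t. x + (t - 1) *\<^sub>R W x"
    have int: "(\<lambda>t. (t - 1) ^ m * partial_deriv k f (?g t)) integrable_on {0..1}" for m k
      unfolding box_real(2)[symmetric]
      by (intro integrable_continuous continuous_intros smooth_compose_continuous[OF smooth_partial_deriv[OF f]])
    have "partial_deriv i g x = integral {0..1} (\<lambda>t. (t - 1) ^ n *
        frechet_derivative f (at (?g t)) (axis i 1 + (t - 1) *\<^sub>R partial_deriv i W x))"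
      unfolding g partial_deriv_eqI[OF flow_mean_has_derivative[OF f W]] by (simp add: partial_deriv_def)
    also have "\<dots> = integral {0..1} (\<lambda>t. (t - 1) ^ n * partial_deriv i f (?g t) +
        (\<Sum>k\<in>UNIV. partial_deriv i W x $ k * ((t - 1) ^ Suc n * partial_deriv k f (?g t))))"
    proof (rule integral_cong)
      fix t :: real
      have "(\<Sum>k\<in>UNIV. axis i 1 $ k * partial_deriv k f (?g t)) = partial_deriv i f (?g t)"
        by (simp add: axis_def if_distrib[of "\<lambda>z. z * _"] cong: if_cong)
      then show "(t - 1) ^ n * frechet_derivative f (at (?g t)) (axis i 1 + (t - 1) *\<^sub>R partial_deriv i W x) =
          (t - 1) ^ n * partial_deriv i f (?g t) +
          (\<Sum>k\<in>UNIV. partial_deriv i W x $ k * ((t - 1) ^ Suc n * partial_deriv k f (?g t)))"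
        by (simp add: partial_deriv_frechet[OF smooth_differentiable[OF f]] distrib_left distrib_right
            sum.distrib sum_distrib_left ac_simps)
    qed
    also have "\<dots> = flow_mean W n (partial_deriv i f) x +
      (\<Sum>k\<in>UNIV. partial_deriv i W x $ k * flow_mean W (Suc n) (partial_deriv k f) x)"
    proof -
      have int': "(\<lambda>t. c * ((t - 1) ^ m * partial_deriv k f (?g t))) integrable_on {0..1}" for c m k
        using integrable_cmul[OF int, of c] by simp
      have "(\<lambda>t. \<Sum>k\<in>UNIV. partial_deriv i W x $ k * ((t - 1) ^ Suc n * partial_deriv k f (?g t))) integrable_on {0..1}"
        by (intro integrable_sum int') simp
      from integral_add[OF int[of n i] this] show ?thesis
        by (simp add: flow_mean_def integral_sum[OF _ int'] del: power_Suc)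
    qed
    finally show ?thesis by simp
  qed
  then have eq: "partial_deriv i g = (\<lambda>x. flow_mean W n (partial_deriv i f) x +
      (\<Sum>k\<in>UNIV. (partial_deriv i W x $ k) *\<^sub>R flow_mean W (Suc n) (partial_deriv k f) x))" by blast
  show "smooth_span (\<lambda>g. \<exists>n f. smooth f \<and> g = flow_mean W n f) (partial_deriv i g)"
    unfolding eq sum_4
    by (intro smooth_span.add smooth_span.mult smooth_nth smooth_partial_deriv W;
        rule smooth_span.base; use smooth_partial_deriv[OF f] in blast)
qed

text \<open>Integral of \<open>f\<close> along the integral curve of \<open>V\<close> from the hypersurface \<open>\<tau> = 0\<close>, for a field
  \<open>V\<close> that is constant along its integral curves and a function \<open>\<tau>\<close> with \<open>V \<tau> = 1\<close>.\<close>

definition primitive :: "(engel \<Rightarrow> engel) \<Rightarrow> (engel \<Rightarrow> real) \<Rightarrow> (engel \<Rightarrow> real) \<Rightarrow> engel \<Rightarrow> real" where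
  "primitive V \<tau> f x = \<tau> x * flow_mean (\<lambda>x. \<tau> x *\<^sub>R V x) 0 f x"

lemma smooth_primitive:
  "smooth V \<Longrightarrow> smooth \<tau> \<Longrightarrow> smooth f \<Longrightarrow> smooth (primitive V \<tau> f)"
  unfolding primitive_def[abs_def] by (intro smooth_mult smooth_flow_mean smooth_scaleR)

lemma primitive_eq_0:
  "(\<And>t. t \<in> {0..1} \<Longrightarrow> f (x + ((t - 1) * \<tau> x) *\<^sub>R V x) = 0) \<Longrightarrow> primitive V \<tau> f x = 0"
  unfolding primitive_def flow_mean_def by (subst integral_cong[of _ _ "\<lambda>t. 0"]) simp_all

text \<open>In direction V x the rescaled field changes by V x, and the integrand becomes a total
  derivative in t. In a direction \<open>u\<close> that moves neither \<tau> nor \<open>V\<close>,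
  every curve is merely translated by \<open>u\<close>, so only the derivative of \<open>f\<close>
  in direction \<open>u\<close> along the curve enters.\<close>

lemma
  assumes V: "smooth V" and \<tau>: "smooth \<tau>" and f: "smooth f"
  shows primitive_deriv:
    "\<lbrakk>frechet_derivative \<tau> (at x) (V x) = 1; frechet_derivative V (at x) (V x) = 0\<rbrakk> \<Longrightarrow>
      frechet_derivative (primitive V \<tau> f) (at x) (V x) = f x"
  and primitive_deriv_0:
    "\<lbrakk>frechet_derivative \<tau> (at x) u = 0; frechet_derivative V (at x) u = 0;
       \<And>s. frechet_derivative f (at (x + s *\<^sub>R V x)) u = 0\<rbrakk> \<Longrightarrow>
      frechet_derivative (primitive V \<tau> f) (at x) u = 0"
proof -
  let ?W = "\<lambda>x. \<tau> x *\<^sub>R V x" let ?K = "flow_mean ?W 0 f"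
  have W: "smooth ?W" by (intro smooth_scaleR V \<tau>)
  have DW: "frechet_derivative ?W (at x) v =
      frechet_derivative \<tau> (at x) v *\<^sub>R V x + \<tau> x *\<^sub>R frechet_derivative V (at x) v" for v
    by (rule fun_cong[OF frechet_derivative_eqI[OF
        has_derivative_scaleR_fun[OF smooth_has_derivative[OF \<tau>] smooth_has_derivative[OF V]]]])
  have DP: "frechet_derivative (primitive V \<tau> f) (at x) v =
      frechet_derivative \<tau> (at x) v * ?K x +
      \<tau> x * integral {0..1} (\<lambda>t. frechet_derivative f (at (x + (t - 1) *\<^sub>R ?W x))
        (v + (t - 1) *\<^sub>R frechet_derivative ?W (at x) v))" for v
  proof -
    have "(primitive V \<tau> f has_derivative (\<lambda>v. frechet_derivative \<tau> (at x) v *\<^sub>R ?K x +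
      \<tau> x *\<^sub>R integral {0..1} (\<lambda>t. (t - 1) ^ 0 * frechet_derivative f (at (x + (t - 1) *\<^sub>R ?W x))
        (v + (t - 1) *\<^sub>R frechet_derivative ?W (at x) v)))) (at x)"
      using has_derivative_scaleR_fun[OF smooth_has_derivative[OF \<tau>] flow_mean_has_derivative[OF f W, of 0]]
      by (simp add: primitive_def[abs_def])
    from frechet_derivative_eqI[OF this] show ?thesis by simp
  qed
  { assume a: "frechet_derivative \<tau> (at x) (V x) = 1" "frechet_derivative V (at x) (V x) = 0"
    let ?g = "\<lambda>t. x + (t - 1) *\<^sub>R ?W x"
    interpret Df: linear "frechet_derivative f (at y)" for y
      by (rule linear_frechet_derivative[OF smooth_differentiable[OF f]])
    \<comment> \<open>The derivative of t f along the segment is exactly the integrand of the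
      derivative of the primitive along \<open>V\<close>; its values at the ends are 0 and f
      x.\<close>
    have der: "((\<lambda>t. t * f (?g t)) has_vector_derivative
        f (?g t) + \<tau> x * frechet_derivative f (at (?g t)) (V x + (t - 1) *\<^sub>R V x)) (at t within {0..1})" for t
    proof -
      have "(?g has_derivative (\<lambda>h. h *\<^sub>R ?W x)) (at t within {0..1})"
        by (auto intro!: derivative_eq_intros)
      from has_derivative_mult[OF has_derivative_ident has_derivative_compose[OF this smooth_has_derivative[OF f]]]
      show ?thesis
        by (simp add: has_vector_derivative_def Df.scale Df.add algebra_simps)
    qed
    have i1: "(\<lambda>t. f (?g t)) integrable_on {0..1}"
      unfolding box_real(2)[symmetric]
      by (intro integrable_continuous continuous_intros smooth_compose_continuous[OF f])
    have "f x = integral {0..1} (\<lambda>t. f (?g t) + \<tau> x * frechet_derivative f (at (?g t)) (V x + (t - 1) *\<^sub>R V x))"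
      using fundamental_theorem_of_calculus[OF zero_le_one der] by (simp add: integral_unique)
    also have "\<dots> = integral {0..1} (\<lambda>t. f (?g t)) +
       integral {0..1} (\<lambda>t. \<tau> x * frechet_derivative f (at (?g t)) (V x + (t - 1) *\<^sub>R V x))"
    proof (rule integral_add[OF i1])
      have "(\<lambda>t. f (?g t) + \<tau> x * frechet_derivative f (at (?g t)) (V x + (t - 1) *\<^sub>R V x)) integrable_on {0..1}"
        using fundamental_theorem_of_calculus[OF zero_le_one der] by blast
      from integrable_diff[OF this i1]
      show "(\<lambda>t. \<tau> x * frechet_derivative f (at (?g t)) (V x + (t - 1) *\<^sub>R V x)) integrable_on {0..1}"
        by simp
    qed
    finally show "frechet_derivative (primitive V \<tau> f) (at x) (V x) = f x"
      unfolding DP DW a by (simp add: flow_mean_def) }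
  { assume a: "frechet_derivative \<tau> (at x) u = 0" "frechet_derivative V (at x) u = 0"
      and b: "\<And>s. frechet_derivative f (at (x + s *\<^sub>R V x)) u = 0"
    show "frechet_derivative (primitive V \<tau> f) (at x) u = 0"
      unfolding DP DW a using b[of "(_ - 1) * \<tau> x"] by simp }
qed

section \<open>Bump functions\<close>

text \<open>The exponent \<open>n\<close> makes the family closed under differentiation;
  \<open>n = 0\<close> is the usual flat function.\<close>

definition flat_exp :: "nat \<Rightarrow> real \<Rightarrow> real" where
  "flat_exp n t = (if t > 0 then exp (- 1 / t) / t ^ n else 0)"

lemma flat_exp_nonneg: "flat_exp n t \<ge> 0"
  by (simp add: flat_exp_def)

lemma flat_exp_pos: "t > 0 \<Longrightarrow> flat_exp n t > 0"
  by (simp add: flat_exp_def)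

text \<open>The exponential series at 1 / t dominates its single term of index n + 2. The two extra
  powers give a quadratic bound, enough for a zero derivative at the origin.\<close>

lemma flat_exp_le: "\<bar>flat_exp n t\<bar> \<le> fact (n + 2) * t\<^sup>2"
proof (cases "t > 0")
  case True
  define F :: real where "F = fact (n + 2)"
  have F: "F > 0" by (simp add: F_def del: fact_Suc)
  have "(\<Sum>k\<in>{n + 2}. (1 / t) ^ k /\<^sub>R fact k) \<le> exp (1 / t)"
    unfolding exp_def using True by (intro sum_le_suminf summable_exp_generic) auto
  then have "inverse F * (1 / t) ^ (n + 2) \<le> exp (1 / t)"
    by (simp add: F_def)
  then have "inverse F \<le> exp (1 / t) * t ^ (n + 2)"
    using True by (simp add: power_divide pos_divide_le_eq del: power_Suc power_add)
  then have "exp (- (1 / t)) \<le> t ^ (n + 2) * F"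
    using F by (simp add: exp_minus field_simps)
  then have "exp (- (1 / t)) / t ^ n \<le> t\<^sup>2 * F"
    using True by (simp add: pos_divide_le_eq power_add power2_eq_square mult_ac)
  then have "\<bar>flat_exp n t\<bar> \<le> F * t\<^sup>2"
    using True by (simp add: flat_exp_def mult.commute)
  then show ?thesis unfolding F_def .
qed (simp add: flat_exp_def)

lemma flat_exp_has_derivative:
  "(flat_exp n has_field_derivative flat_exp (n + 2) t - n * flat_exp (n + 1) t) (at t)"
proof -
  consider "t > 0" | "t < 0" | "t = 0" by linarith
  then show ?thesis
  proof cases
    case 1
    have "((\<lambda>t. exp (- 1 / t) / t ^ n) has_field_derivative flat_exp (n + 2) t - n * flat_exp (n + 1) t) (at t)"
    proof -
      have "((\<lambda>t. exp (- 1 / t) / t ^ n) has_field_derivative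
          (exp (- 1 / t) * (1 / t\<^sup>2) * t ^ n - exp (- 1 / t) * (real n * t ^ (n - Suc 0))) / (t ^ n * t ^ n)) (at t)"
        using 1 by (auto intro!: derivative_eq_intros simp: power2_eq_square)
      moreover have "real n * t ^ (n - Suc 0) = real n * t ^ n / t"
        using 1 by (cases n) auto
      moreover have "(e * (1 / t\<^sup>2) * T - e * (real n * T / t)) / (T * T) = e / (T * t\<^sup>2) - n * (e / (T * t))"
        if "T \<noteq> 0" for e T :: real
        using 1 that by (simp add: field_simps power2_eq_square)
      from this[of "t ^ n"]
      have "(exp (- 1 / t) * (1 / t\<^sup>2) * t ^ n - exp (- 1 / t) * (real n * t ^ n / t)) / (t ^ n * t ^ n) =
          flat_exp (n + 2) t - n * flat_exp (n + 1) t"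
        using 1 by (simp only: flat_exp_def if_True power_add power_one_right) simp
      ultimately show ?thesis by simp
    qed
    then show ?thesis
      by (rule has_field_derivative_transform_within_open[of _ _ _ "{0<..}"])
        (use 1 in \<open>auto simp: flat_exp_def\<close>)
  next
    case 2
    have "((\<lambda>t. 0) has_field_derivative 0) (at t)" by simp
    then have "(flat_exp n has_field_derivative 0) (at t)"
      by (rule has_field_derivative_transform_within_open[of _ _ _ "{..<0}"])
        (use 2 in \<open>auto simp: flat_exp_def\<close>)
    then show ?thesis using 2 by (simp add: flat_exp_def)
  next
    case 3
    define F :: real where "F = fact (n + 2)"
    have "norm (flat_exp n h / h) \<le> F * \<bar>h\<bar>" for h
    proof (cases "h = 0")
      case False
      have "\<bar>flat_exp n h\<bar> \<le> (F * \<bar>h\<bar>) * \<bar>h\<bar>"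
        using flat_exp_le[of n h] unfolding mult.assoc abs_mult_self_eq F_def
        by (simp only: power2_eq_square)
      then show ?thesis
        unfolding real_norm_def abs_divide
        by (intro mult_imp_div_pos_le) (simp_all only: zero_less_abs_iff False not_False_eq_True)
    qed simp
    then have "((\<lambda>h. flat_exp n h / h) \<longlongrightarrow> 0) (at 0)"
    proof (rule Lim_null_comparison[OF always_eventually, OF allI])
      have "((\<lambda>h. F * \<bar>h\<bar>) \<longlongrightarrow> F * \<bar>0\<bar>) (at 0)"
        by (intro tendsto_intros)
      then show "((\<lambda>h. F * \<bar>h\<bar>) \<longlongrightarrow> 0) (at 0)" by simp
    qed
    then show ?thesis
      using 3 by (simp add: DERIV_def flat_exp_def[of _ 0])
  qed
qed

lemma smooth_flat_exp:
  assumes h: "smooth h"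
  shows "smooth (\<lambda>x. flat_exp n (h x))"
proof (rule smooth_upto[of "\<lambda>g. \<exists>n. g = (\<lambda>x. flat_exp n (h x))"])
  have der: "((\<lambda>x. flat_exp n (h x)) has_derivative
      (\<lambda>v. frechet_derivative h (at x) v * (flat_exp (n + 2) (h x) - n * flat_exp (n + 1) (h x)))) (at x)" for n x
    using has_derivative_compose[OF smooth_has_derivative[OF h]
        flat_exp_has_derivative[unfolded has_field_derivative_def]]
    by (simp add: mult.commute)
  show "smooth_span (\<lambda>g. \<exists>n. g = (\<lambda>x. flat_exp n (h x))) (\<lambda>x. flat_exp n (h x))"
    by (rule smooth_span.base) blast
  fix g
  assume "\<exists>n. g = (\<lambda>x. flat_exp n (h x))"
  then obtain n where g: "g = (\<lambda>x. flat_exp n (h x))" by blast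
  show "g differentiable (at x)" for x
    unfolding g by (rule differentiableI[OF der])
  fix i
  have "partial_deriv i g = (\<lambda>x. partial_deriv i h x *\<^sub>R flat_exp (n + 2) (h x) +
      (- real n * partial_deriv i h x) *\<^sub>R flat_exp (n + 1) (h x))"
    unfolding g by (rule ext, subst partial_deriv_eqI[OF der]) (simp add: partial_deriv_def algebra_simps)
  moreover have "smooth_span (\<lambda>g. \<exists>n. g = (\<lambda>x. flat_exp n (h x)))
      (\<lambda>x. partial_deriv i h x *\<^sub>R flat_exp (n + 2) (h x) +
      (- real n * partial_deriv i h x) *\<^sub>R flat_exp (n + 1) (h x))"
    by (intro smooth_span.add smooth_span.mult smooth_mult smooth_const smooth_partial_deriv h;
        rule smooth_span.base; blast)
  ultimately show "smooth_span (\<lambda>g. \<exists>n. g = (\<lambda>x. flat_exp n (h x))) (partial_deriv i g)"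
    by simp
qed

lemma bump_exists:
  fixes c :: engel
  obtains \<phi> :: "engel \<Rightarrow> real"
  where "smooth \<phi>" "\<And>x. \<phi> x \<ge> 0" "\<phi> c > 0" "bounded {x. \<phi> x \<noteq> 0}"
proof
  let ?h = "\<lambda>x. 1 - (\<Sum>i\<in>UNIV. (x $ i - c $ i)\<^sup>2)"
  show "smooth (\<lambda>x. flat_exp 0 (?h x))"
    by (intro smooth_flat_exp smooth_diff smooth_sum smooth_power smooth_const smooth_coord)
  show "flat_exp 0 (?h x) \<ge> 0" for x by (rule flat_exp_nonneg)
  show "flat_exp 0 (?h c) > 0" by (rule flat_exp_pos) simp
  have "{x. flat_exp 0 (?h x) \<noteq> 0} \<subseteq> cball c 1"
  proof
    fix x assume "x \<in> {x. flat_exp 0 (?h x) \<noteq> 0}"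
    then have "(\<Sum>i\<in>UNIV. (x $ i - c $ i)\<^sup>2) \<le> 1" by (auto simp: flat_exp_def split: if_splits)
    then show "x \<in> cball c 1"
      by (simp add: dist_norm norm_vec_def L2_set_def power2_commute[of "c $ _"])
  qed
  then show "bounded {x. flat_exp 0 (?h x) \<noteq> 0}"
    by (rule bounded_subset[OF bounded_cball])
qed

section \<open>Integration\<close>

lemma integrable_bounded_support:
  fixes f :: "engel \<Rightarrow> real"
  assumes "continuous_on UNIV f" "bounded {x. f x \<noteq> 0}"
  shows "integrable lborel f"
proof -
  have "integrable lborel (\<lambda>x. indicator (closure {x. f x \<noteq> 0}) x *\<^sub>R f x)"
    using assms by (intro borel_integrable_compact) (auto intro: continuous_on_subset)
  moreover have "(\<lambda>x. indicator (closure {x. f x \<noteq> 0}) x *\<^sub>R f x) = f"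
    using closure_subset[of "{x. f x \<noteq> 0}"] by (auto simp: fun_eq_iff indicator_def)
  ultimately show ?thesis by simp
qed

text \<open>Differentiation under the integral sign is available for the gauge integral over a box,
  translation invariance for the Lebesgue integral; this passes between them.\<close>

lemma lebesgue_integral_cbox:
  fixes f :: "engel \<Rightarrow> real"
  assumes "continuous_on UNIV f" "{x. f x \<noteq> 0} \<subseteq> cbox a b"
  shows "integral (cbox a b) f = (LINT x|lborel. f x)"
proof -
  have "(f has_integral (LINT x|lborel. f x)) UNIV"
    using assms by (intro has_integral_integral_lborel integrable_bounded_support)
      (auto intro: bounded_subset[OF bounded_cbox])
  then have "((\<lambda>x. if x \<in> cbox a b then f x else 0) has_integral (LINT x|lborel. f x)) UNIV"
    by (rule has_integral_eq[rotated]) (use assms(2) in auto)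
  then show ?thesis
    unfolding has_integral_restrict_UNIV by (rule integral_unique)
qed

lemma lborel_integral_translate:
  fixes f :: "engel \<Rightarrow> real"
  assumes "continuous_on UNIV f"
  shows "(LINT x|lborel. f (c + x)) = (LINT x|lborel. f x)"
proof -
  have "f \<in> borel_measurable borel"
    by (rule borel_measurable_continuous_onI[OF assms])
  then have "(LINT x|distr lborel borel ((+) c). f x) = (LINT x|lborel. f (c + x))"
    by (intro integral_distr) auto
  then show ?thesis by (simp add: lborel_distr_plus)
qed

lemma partial_deriv_support:
  assumes "closed K" "{x. f x \<noteq> 0} \<subseteq> K"
  shows "{x. partial_deriv i f x \<noteq> 0} \<subseteq> K"
proof
  fix x assume x: "x \<in> {x. partial_deriv i f x \<noteq> 0}"
  show "x \<in> K"
  proof (rule ccontr)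
    assume "x \<notin> K"
    then have "((\<lambda>x. 0) has_derivative (\<lambda>v. 0)) (at x)" "open (- K)" "x \<in> - K"
      using assms by auto
    then have "(f has_derivative (\<lambda>v. 0)) (at x)"
      by (rule has_derivative_transform_within_open) (use assms in auto)
    then show False using x partial_deriv_eqI by fastforce
  qed
qed

text \<open>The integral of a translate does not depend on the translation; differentiating it under
  the integral sign at translation 0 gives the claim.\<close>

lemma integral_partial_deriv_eq_0:
  fixes f :: "engel \<Rightarrow> real"
  assumes f: "smooth f" and bd: "bounded {x. f x \<noteq> 0}"
  shows "(LINT x|lborel. partial_deriv i f x) = 0"
proof -
  let ?e = "axis i (1::real) :: engel"
  obtain R where R: "{x. f x \<noteq> 0} \<subseteq> cball 0 R"
    using bd unfolding bounded_iff by (auto simp: subset_iff)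
  \<comment> \<open>The extra 1 leaves room for the translations by \<open>h\<close> in {0..1}, so
    that one box contains the supports of all translates.\<close>
  obtain a b :: engel where ab: "cball 0 (R + 1) \<subseteq> cbox a b"
    using bounded_subset_cbox_symmetric[OF bounded_cball] by metis
  let ?F = "\<lambda>h. integral (cbox a b) (\<lambda>x. f (h *\<^sub>R ?e + x))"
  have F: "?F h = (LINT x|lborel. f x)" if "h \<in> {0..1}" for h
  proof -
    have "x \<in> cball 0 (R + 1)" if x: "f (h *\<^sub>R ?e + x) \<noteq> 0" for x
    proof -
      have "norm (h *\<^sub>R ?e + x) \<le> R" using R x by auto
      moreover have "norm x \<le> norm (h *\<^sub>R ?e + x) + norm (h *\<^sub>R ?e)"
        using norm_triangle_ineq4[of "h *\<^sub>R ?e + x" "h *\<^sub>R ?e"] by simp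
      ultimately show ?thesis using \<open>h \<in> {0..1}\<close> by auto
    qed
    then have supp: "{x. f (h *\<^sub>R ?e + x) \<noteq> 0} \<subseteq> cbox a b" using ab by blast
    have "?F h = (LINT x|lborel. f (h *\<^sub>R ?e + x))"
      by (intro lebesgue_integral_cbox[OF _ supp] smooth_compose_continuous[OF f] continuous_intros)
    then show ?thesis
      by (simp add: lborel_integral_translate smooth_continuous_on[OF f])
  qed
  have dir: "((\<lambda>h. f (h *\<^sub>R ?e + x)) has_vector_derivative partial_deriv i f (h *\<^sub>R ?e + x)) (at h within {0..1})"
    for h x
  proof -
    have "((\<lambda>h. h *\<^sub>R ?e + x) has_derivative (\<lambda>t. t *\<^sub>R ?e)) (at h within {0..1})"
      by (auto intro!: derivative_eq_intros)
    from has_derivative_compose[OF this smooth_has_derivative[OF f]]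
    show ?thesis
      using linear_frechet_derivative[OF smooth_differentiable[OF f]]
      by (simp add: has_vector_derivative_def partial_deriv_def linear_scale)
  qed
  have "(?F has_vector_derivative integral (cbox a b) (\<lambda>x. partial_deriv i f (0 *\<^sub>R ?e + x))) (at 0 within {0..1})"
  proof (rule leibniz_rule_vector_derivative[OF dir])
    show "(\<lambda>x. f (h *\<^sub>R ?e + x)) integrable_on cbox a b" for h
      by (intro integrable_continuous smooth_compose_continuous[OF f] continuous_intros)
    show "continuous_on ({0..1} \<times> cbox a b) (\<lambda>(h, x). partial_deriv i f (h *\<^sub>R ?e + x))"
      unfolding split_def
      by (intro smooth_compose_continuous[OF smooth_partial_deriv[OF f]] continuous_intros)
  qed auto
  moreover have "(?F has_vector_derivative 0) (at 0 within {0..1})"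
    by (rule has_vector_derivative_transform[OF _ _ has_vector_derivative_const[of "LINT x|lborel. f x"]])
      (simp_all add: F)
  moreover have "at (0::real) within {0..1} \<noteq> bot"
    by (simp add: at_within_Icc_at_right trivial_limit_at_right_real)
  ultimately have 1: "integral (cbox a b) (partial_deriv i f) = 0"
    using vector_derivative_unique_within[of 0 "{0..1}" ?F "integral (cbox a b) (partial_deriv i f)" 0]
    by simp
  have 2: "{x. partial_deriv i f x \<noteq> 0} \<subseteq> cbox a b"
    using partial_deriv_support[OF closed_cball R] ab by force
  from 1 show ?thesis
    by (simp add: lebesgue_integral_cbox[OF smooth_continuous_on[OF smooth_partial_deriv[OF f]] 2])
qed

text \<open>The zero set is closed and of full measure, and such a set is the whole space.\<close>

lemma nonneg_integral_0_imp_0: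
  fixes f :: "engel \<Rightarrow> real"
  assumes cont: "continuous_on UNIV f" and bd: "bounded {x. f x \<noteq> 0}" and nn: "\<And>x. f x \<ge> 0"
    and 0: "(LINT x|lborel. f x) = 0"
  shows "f x = 0"
proof -
  have "AE x in lborel. f x = 0"
    using integral_nonneg_eq_0_iff_AE[OF integrable_bounded_support[OF cont bd]] nn 0 by simp
  moreover have "closed {x. f x = 0}"
    by (rule closed_Collect_eq[OF cont continuous_on_const])
  ultimately show ?thesis
    using mem_closed_if_AE_lebesgue[of "{x. f x = 0}" x] AE_completion[of "\<lambda>x. f x = 0" lborel]
    by simp
qed

section \<open>Left-invariant derivatives\<close>

definition left_inv_deriv :: "4 \<Rightarrow> (engel \<Rightarrow> 'b::real_normed_vector) \<Rightarrow> engel \<Rightarrow> 'b" ("\<X>") where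
  "\<X> i f x = frechet_derivative f (at x) (left_inv_field i x)"

lemma index4_cases: "(i::4) = 1 \<or> i = 2 \<or> i = 3 \<or> i = 4"
  using forall_4[of "\<lambda>i. i = 1 \<or> i = 2 \<or> i = 3 \<or> i = 4"] by blast

lemma smooth_left_inv_field: "smooth (left_inv_field i)"
  using index4_cases[of i]
  by (auto simp: left_inv_field_eq power2_eq_square
      intro!: smooth_add smooth_scaleR smooth_mult smooth_coord smooth_const smooth_linear[OF bounded_linear_divide])

lemma left_inv_deriv_sum:
  "smooth f \<Longrightarrow> \<X> i f x = (\<Sum>j\<in>UNIV. left_inv_field i x $ j *\<^sub>R partial_deriv j f x)"
  unfolding left_inv_deriv_def by (rule partial_deriv_frechet[OF smooth_differentiable])

lemma smooth_left_inv_deriv: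
  assumes "smooth f"
  shows "smooth (\<X> i f)"
proof -
  have "\<X> i f = (\<lambda>x. \<Sum>j\<in>UNIV. left_inv_field i x $ j *\<^sub>R partial_deriv j f x)"
    using left_inv_deriv_sum[OF assms] by blast
  then show ?thesis
    by (simp add: assms smooth_sum smooth_scaleR smooth_nth smooth_left_inv_field smooth_partial_deriv)
qed

lemma left_inv_deriv_const [simp]: "\<X> i (\<lambda>x. c) = (\<lambda>x. 0)"
  by (simp add: left_inv_deriv_def fun_eq_iff)

lemma left_inv_deriv_add:
  assumes "smooth f" "smooth g"
  shows "\<X> i (\<lambda>x. f x + g x) = (\<lambda>x. \<X> i f x + \<X> i g x)"
  unfolding left_inv_deriv_def
  by (rule ext, subst frechet_derivative_eqI[OF has_derivative_add]) (rule smooth_has_derivative assms refl)+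

lemma left_inv_deriv_scaleR_fun:
  assumes "smooth h" "smooth f"
  shows "\<X> i (\<lambda>x. h x *\<^sub>R f x) = (\<lambda>x. \<X> i h x *\<^sub>R f x + h x *\<^sub>R \<X> i f x)"
  unfolding left_inv_deriv_def
  by (rule ext, subst frechet_derivative_eqI[OF has_derivative_scaleR_fun]) (rule smooth_has_derivative assms refl)+

lemma left_inv_deriv_mult:
  fixes f h :: "engel \<Rightarrow> real"
  assumes "smooth h" "smooth f"
  shows "\<X> i (\<lambda>x. h x * f x) = (\<lambda>x. \<X> i h x * f x + h x * \<X> i f x)"
  using left_inv_deriv_scaleR_fun[OF assms] by simp

lemma left_inv_deriv_linear:
  assumes "bounded_linear A" "smooth f"
  shows "\<X> i (\<lambda>x. A (f x)) = (\<lambda>x. A (\<X> i f x))"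
  unfolding left_inv_deriv_def
  by (rule ext, subst frechet_derivative_eqI[OF bounded_linear.has_derivative[OF assms(1)]])
    (rule smooth_has_derivative assms refl)+

lemma left_inv_deriv_minus: "smooth f \<Longrightarrow> \<X> i (\<lambda>x. - f x) = (\<lambda>x. - \<X> i f x)"
  by (rule left_inv_deriv_linear[OF bounded_linear_minus[OF bounded_linear_ident]])

lemma left_inv_deriv_diff:
  assumes "smooth f" "smooth g"
  shows "\<X> i (\<lambda>x. f x - g x) = (\<lambda>x. \<X> i f x - \<X> i g x)"
  using left_inv_deriv_add[OF assms(1) smooth_minus[OF assms(2)]] left_inv_deriv_minus[OF assms(2)] by simp

lemma frechet_derivative_support:
  assumes "closed K" "{x. f x \<noteq> 0} \<subseteq> K" "x \<notin> K"
  shows "frechet_derivative f (at x) = (\<lambda>v. 0)"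
proof (rule frechet_derivative_eqI)
  have "((\<lambda>x. 0) has_derivative (\<lambda>v. 0)) (at x)" "open (- K)" "x \<in> - K"
    using assms by auto
  then show "(f has_derivative (\<lambda>v. 0)) (at x)"
    by (rule has_derivative_transform_within_open) (use assms in auto)
qed

lemma left_inv_deriv_support:
  "closed K \<Longrightarrow> {x. f x \<noteq> 0} \<subseteq> K \<Longrightarrow> {x. \<X> i f x \<noteq> 0} \<subseteq> K"
  using frechet_derivative_support[of K f] by (fastforce simp: left_inv_deriv_def)

lemma bounded_left_inv_deriv:
  "bounded {x. f x \<noteq> 0} \<Longrightarrow> bounded {x. \<X> i f x \<noteq> 0}"
  by (rule bounded_subset[OF bounded_closure left_inv_deriv_support[OF closed_closure closure_subset]])

lemma left_inv_deriv_coord: "\<X> i (\<lambda>x. x $ j) x = left_inv_field i x $ j"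
  unfolding left_inv_deriv_def
  by (subst frechet_derivative_eqI[OF bounded_linear_imp_has_derivative[OF bounded_linear_vec_nth]]) simp

lemma left_inv_deriv_explicit:
  assumes "smooth f"
  shows "\<X> 1 f = partial_deriv 1 f"
    "\<X> 2 f = (\<lambda>x. partial_deriv 2 f x + x$1 *\<^sub>R partial_deriv 3 f x + (x$1 * x$1 / 2) *\<^sub>R partial_deriv 4 f x)"
    "\<X> 3 f = (\<lambda>x. partial_deriv 3 f x + x$1 *\<^sub>R partial_deriv 4 f x)"
    "\<X> 4 f = partial_deriv 4 f"
  by (simp_all add: fun_eq_iff left_inv_deriv_sum[OF assms] sum_4 left_inv_field_eq axis_def power2_eq_square)

lemma partial_deriv_add:
  assumes "smooth f" "smooth g"
  shows "partial_deriv i (\<lambda>x. f x + g x) = (\<lambda>x. partial_deriv i f x + partial_deriv i g x)"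
  unfolding partial_deriv_def
  by (rule ext, subst frechet_derivative_eqI[OF has_derivative_add]) (rule smooth_has_derivative assms refl)+

lemma partial_deriv_scaleR_fun:
  assumes "smooth h" "smooth f"
  shows "partial_deriv i (\<lambda>x. h x *\<^sub>R f x) = (\<lambda>x. partial_deriv i h x *\<^sub>R f x + h x *\<^sub>R partial_deriv i f x)"
  unfolding partial_deriv_def
  by (rule ext, subst frechet_derivative_eqI[OF has_derivative_scaleR_fun]) (rule smooth_has_derivative assms refl)+

lemma partial_deriv_coord: "partial_deriv i (\<lambda>x. x $ j) = (\<lambda>x. axis i 1 $ j)"
  unfolding partial_deriv_def
  by (rule ext, subst frechet_derivative_eqI[OF bounded_linear_imp_has_derivative[OF bounded_linear_vec_nth]]) simp

lemma partial_deriv_half_square: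
  "partial_deriv i (\<lambda>x. x$1 * x$1 / 2) = (\<lambda>x. x$1 * axis i 1 $ 1)"
proof (rule ext)
  fix x :: engel
  have "((\<lambda>x::engel. x$1) has_derivative (\<lambda>v. v$1)) (at x)"
    by (rule bounded_linear_imp_has_derivative[OF bounded_linear_vec_nth])
  from has_derivative_mult_left[OF has_derivative_mult[OF this this], of "1/2"]
  have "((\<lambda>x. x$1 * x$1 / 2) has_derivative (\<lambda>v. x$1 * v$1)) (at x)"
    by (simp add: mult.commute)
  then show "partial_deriv i (\<lambda>x. x$1 * x$1 / 2) x = x$1 * axis i 1 $ 1"
    by (rule partial_deriv_eqI)
qed

lemma smooth_half_square: "smooth (\<lambda>x. x$1 * x$1 / 2)"
  by (intro smooth_linear[OF bounded_linear_divide] smooth_mult smooth_coord)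

text \<open>The bracket relations for the fields acting as differential operators on vector-valued
  functions. In coordinates only x_1 occurs in the coefficients, and symmetry of second derivatives
  does the rest.\<close>

lemma left_inv_deriv_commute:
  fixes f :: "engel \<Rightarrow> 'b::banach"
  assumes f: "smooth f"
  shows "\<X> 1 (\<X> 2 f) = (\<lambda>x. \<X> 2 (\<X> 1 f) x + \<X> 3 f x)"
    "\<X> 1 (\<X> 3 f) = (\<lambda>x. \<X> 3 (\<X> 1 f) x + \<X> 4 f x)"
    "\<X> 1 (\<X> 4 f) = \<X> 4 (\<X> 1 f)"
    "\<X> 2 (\<X> 3 f) = \<X> 3 (\<X> 2 f)"
    "\<X> 2 (\<X> 4 f) = \<X> 4 (\<X> 2 f)"
    "\<X> 3 (\<X> 4 f) = \<X> 4 (\<X> 3 f)"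
proof -
  let ?d = "\<lambda>i. partial_deriv i f"
  have s: "smooth (?d i)" "smooth (partial_deriv j (?d i))" "smooth (\<lambda>x. x$1 *\<^sub>R ?d i x)"
    "smooth (\<lambda>x. (x$1 * x$1 / 2) *\<^sub>R ?d i x)" for i j
    by (intro smooth_scaleR smooth_half_square smooth_coord smooth_partial_deriv f)+
  have s': "smooth (\<lambda>x. ?d i x + x$1 *\<^sub>R ?d j x)" 
    "smooth (\<lambda>x. ?d i x + x$1 *\<^sub>R ?d j x + (x$1 * x$1 / 2) *\<^sub>R ?d k x)" for i j k
    by (intro smooth_add s)+
  have c: "partial_deriv 2 (?d 1) = partial_deriv 1 (?d 2)" "partial_deriv 3 (?d 1) = partial_deriv 1 (?d 3)"
    "partial_deriv 4 (?d 1) = partial_deriv 1 (?d 4)" "partial_deriv 3 (?d 2) = partial_deriv 2 (?d 3)"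
    "partial_deriv 4 (?d 2) = partial_deriv 2 (?d 4)" "partial_deriv 4 (?d 3) = partial_deriv 3 (?d 4)"
    by (rule partial_deriv_commute[OF f])+
  note simps = left_inv_deriv_explicit[OF f] left_inv_deriv_explicit[OF s(1)]
    left_inv_deriv_explicit[OF s'(1)] left_inv_deriv_explicit[OF s'(2)]
    partial_deriv_add[OF s(1,3)] partial_deriv_add[OF s'(1) s(4)] c
    partial_deriv_scaleR_fun[OF smooth_coord s(1)] partial_deriv_scaleR_fun[OF smooth_half_square s(1)]
    partial_deriv_coord partial_deriv_half_square
  show "\<X> 1 (\<X> 2 f) = (\<lambda>x. \<X> 2 (\<X> 1 f) x + \<X> 3 f x)"
    "\<X> 1 (\<X> 3 f) = (\<lambda>x. \<X> 3 (\<X> 1 f) x + \<X> 4 f x)"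
    "\<X> 1 (\<X> 4 f) = \<X> 4 (\<X> 1 f)"
    "\<X> 2 (\<X> 3 f) = \<X> 3 (\<X> 2 f)"
    "\<X> 2 (\<X> 4 f) = \<X> 4 (\<X> 2 f)"
    "\<X> 3 (\<X> 4 f) = \<X> 4 (\<X> 3 f)"
    by (simp_all only: simps) (simp_all add: fun_eq_iff axis_def algebra_simps)
qed

text \<open>The fields are divergence-free: the coefficients 1, x_1 and x_1^2 / 2 do not depend on
  the coordinate being differentiated, so they can be moved inside the partial derivative.\<close>

lemma integral_left_inv_deriv_eq_0:
  fixes f :: "engel \<Rightarrow> real"
  assumes f: "smooth f" and bd: "bounded {x. f x \<noteq> 0}"
  shows "(LINT x|lborel. \<X> i f x) = 0"
proof -
  \<comment> \<open>A coefficient \<open>h\<close> that is constant in direction j turns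
    \<open>h\<close> times the partial derivative of \<open>f\<close> into the partial derivative of
    their product.\<close>
  have key: "(LINT x|lborel. h x * partial_deriv j f x) = 0 \<and> integrable lborel (\<lambda>x. h x * partial_deriv j f x)"
    if h: "smooth h" "\<And>x. partial_deriv j h x = 0" for h j
  proof -
    have eq: "partial_deriv j (\<lambda>x. h x *\<^sub>R f x) = (\<lambda>x. h x * partial_deriv j f x)"
      using partial_deriv_scaleR_fun[OF h(1) f] h(2) by simp
    have b: "bounded {x. h x *\<^sub>R f x \<noteq> 0}"
      by (rule bounded_subset[OF bd]) auto
    have s: "smooth (\<lambda>x. h x *\<^sub>R f x)" by (intro smooth_scaleR h f)
    have "bounded {x. partial_deriv j (\<lambda>x. h x *\<^sub>R f x) x \<noteq> 0}"
      by (rule bounded_subset[OF bounded_closure[OF b] partial_deriv_support[OF closed_closure closure_subset]])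
    then have "integrable lborel (partial_deriv j (\<lambda>x. h x *\<^sub>R f x))"
      by (intro integrable_bounded_support smooth_continuous_on smooth_partial_deriv s)
    with integral_partial_deriv_eq_0[OF s b, of j] show ?thesis unfolding eq by blast
  qed
  have *: "(LINT x|lborel. partial_deriv j f x) = 0" "integrable lborel (partial_deriv j f)" for j
    using key[of "\<lambda>x. 1" j] by auto
  have **: "(LINT x|lborel. x$1 * partial_deriv j f x) = 0" "integrable lborel (\<lambda>x. x$1 * partial_deriv j f x)"
    "(LINT x|lborel. x$1 * x$1 / 2 * partial_deriv j f x) = 0" "integrable lborel (\<lambda>x. x$1 * x$1 / 2 * partial_deriv j f x)"
    if "j \<noteq> 1" for j
    using key[of "\<lambda>x. x$1" j] key[of "\<lambda>x. x$1 * x$1 / 2" j] that smooth_half_square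
    by (auto simp: partial_deriv_coord partial_deriv_half_square axis_def)
  show ?thesis
    using index4_cases[of i]
    by (elim disjE) (simp_all add: left_inv_deriv_explicit[OF f] * ** del: times_divide_eq_left)
qed

lemma left_inv_deriv_by_parts:
  fixes f g :: "engel \<Rightarrow> real"
  assumes f: "smooth f" and g: "smooth g" and bd: "bounded {x. f x \<noteq> 0} \<or> bounded {x. g x \<noteq> 0}"
  shows "(LINT x|lborel. \<X> i f x * g x) = - (LINT x|lborel. f x * \<X> i g x)"
proof -
  have b: "bounded {x. \<X> i f x * g x \<noteq> 0}" "bounded {x. f x * \<X> i g x \<noteq> 0}" "bounded {x. f x * g x \<noteq> 0}"
  proof -
    have "bounded {x. u x * v x \<noteq> 0}" if "bounded {x. u x \<noteq> 0} \<or> bounded {x. v x \<noteq> 0}"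
      for u v :: "engel \<Rightarrow> real"
      using that bounded_subset[of "{x. u x \<noteq> 0}" "{x. u x * v x \<noteq> 0}"]
        bounded_subset[of "{x. v x \<noteq> 0}" "{x. u x * v x \<noteq> 0}"] by fastforce
    then show "bounded {x. \<X> i f x * g x \<noteq> 0}" "bounded {x. f x * \<X> i g x \<noteq> 0}" "bounded {x. f x * g x \<noteq> 0}"
      using bd bounded_left_inv_deriv[of f i] bounded_left_inv_deriv[of g i] by blast+
  qed
  have "integrable lborel (\<lambda>x. \<X> i f x * g x)" "integrable lborel (\<lambda>x. f x * \<X> i g x)"
    by (intro integrable_bounded_support b smooth_continuous_on smooth_mult smooth_left_inv_deriv f g)+
  moreover have "(LINT x|lborel. \<X> i f x * g x + f x * \<X> i g x) = 0"
    using integral_left_inv_deriv_eq_0[OF smooth_mult[OF f g] b(3), of i] left_inv_deriv_mult[OF f g] by simp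
  ultimately show ?thesis by simp
qed

section \<open>Solving along the fields \<open>X\<^sub>2\<close> and \<open>X\<^sub>3\<close>\<close>

text \<open>For \<open>i \<noteq> 1\<close> the field depends on x_1 only and does not move x_1,
  hence its integral curves are the lines occurring here.\<close>

lemma left_inv_deriv_0_imp_const:
  fixes f :: "engel \<Rightarrow> real"
  assumes f: "smooth f" and 0: "\<And>x. \<X> i f x = 0" and i: "i \<noteq> 1"
  shows "f (x + s *\<^sub>R left_inv_field i x) = f x"
proof -
  let ?V = "left_inv_field i"
  have V: "?V (x + s *\<^sub>R ?V x) = ?V x" for s
    using i index4_cases[of i] by (auto simp: left_inv_field_eq axis_def)
  have "((\<lambda>s. f (x + s *\<^sub>R ?V x)) has_derivative (\<lambda>h. 0)) (at s within UNIV)" for s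
  proof -
    have "((\<lambda>s. x + s *\<^sub>R ?V x) has_derivative (\<lambda>h. h *\<^sub>R ?V x)) (at s)"
      by (auto intro!: derivative_eq_intros)
    from has_derivative_compose[OF this smooth_has_derivative[OF f]]
    show ?thesis
      using 0[of "x + s *\<^sub>R ?V x"] linear_frechet_derivative[OF smooth_differentiable[OF f]]
      by (simp add: V left_inv_deriv_def linear_scale)
  qed
  from has_derivative_zero_constant[OF convex_UNIV this]
  obtain c where "\<And>s. f (x + s *\<^sub>R ?V x) = c" by auto
  from this[of s] this[of 0] show ?thesis by simp
qed

lemma frechet_derivative_left_inv_field_0:
  assumes "i \<noteq> 1" "j \<noteq> 1"
  shows "frechet_derivative (left_inv_field i) (at x) (left_inv_field j x) = 0"
proof -
  have "left_inv_field j x $ 1 = 0"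
    using assms index4_cases[of j] by (auto simp: left_inv_field_eq axis_def)
  then show ?thesis
    using assms index4_cases[of i] by (elim disjE) (simp_all add: frechet_derivative_left_inv_field)
qed

text \<open>Starting from the hyperplane x_2 = c, on which X_2 is transversal. The values c = -R and
  c = R give the primitives that vanish below and above a slab containing the support.\<close>

definition primitive2 :: "real \<Rightarrow> (engel \<Rightarrow> real) \<Rightarrow> engel \<Rightarrow> real" where
  "primitive2 c f = primitive (left_inv_field 2) (\<lambda>x. x$2 - c) f"

text \<open>The function x_3 - x_1 x_2 has derivative 1 along X_3 and 0 along X_2. The second
  property is what keeps the primitive of an X_2-invariant function X_2-invariant.\<close>

definition primitive3 :: "(engel \<Rightarrow> real) \<Rightarrow> engel \<Rightarrow> real" where
  "primitive3 f = primitive (left_inv_field 3) (\<lambda>x. x$3 - x$1 * x$2) f"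

lemma smooth_primitive2: "smooth f \<Longrightarrow> smooth (primitive2 c f)"
  unfolding primitive2_def
  by (intro smooth_primitive smooth_left_inv_field smooth_diff smooth_coord smooth_const)

lemma smooth_primitive3: "smooth f \<Longrightarrow> smooth (primitive3 f)"
  unfolding primitive3_def
  by (intro smooth_primitive smooth_left_inv_field smooth_diff smooth_mult smooth_coord)

lemma left_inv_deriv_primitive2:
  assumes f: "smooth f"
  shows "\<X> 2 (primitive2 c f) = f"
proof (rule ext)
  fix x
  have "\<X> 2 (\<lambda>x. x$2 - c) x = 1"
    by (subst left_inv_deriv_diff) (auto simp: left_inv_deriv_coord left_inv_field_eq axis_def)
  then show "\<X> 2 (primitive2 c f) x = f x"
    unfolding left_inv_deriv_def primitive2_def
    by (intro primitive_deriv smooth_left_inv_field smooth_diff smooth_coord smooth_const f)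
      (auto intro: frechet_derivative_left_inv_field_0)
qed

lemma left_inv_deriv_primitive3:
  assumes f: "smooth f"
  shows "\<X> 3 (primitive3 f) = f"
    and "(\<And>x. \<X> 2 f x = 0) \<Longrightarrow> \<X> 2 (primitive3 f) = (\<lambda>x. 0)"
proof -
  have \<tau>: "\<X> i (\<lambda>x. x$3 - x$1 * x$2) x =
      left_inv_field i x $ 3 - (left_inv_field i x $ 1 * x$2 + x$1 * left_inv_field i x $ 2)" for i x
    by (subst left_inv_deriv_diff; (subst left_inv_deriv_mult)?)
      (auto simp: left_inv_deriv_coord intro: smooth_mult)
  show "\<X> 3 (primitive3 f) = f"
  proof (rule ext)
    fix x
    show "\<X> 3 (primitive3 f) x = f x"
      unfolding left_inv_deriv_def primitive3_def
    proof (intro primitive_deriv smooth_left_inv_field smooth_diff smooth_mult smooth_coord f)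
      show "frechet_derivative (\<lambda>x. x $ 3 - x $ 1 * x $ 2) (at x) (left_inv_field 3 x) = 1"
        using \<tau>[of 3 x] by (simp add: left_inv_deriv_def left_inv_field_eq axis_def)
    qed (simp add: frechet_derivative_left_inv_field_0)
  qed
  assume 0: "\<And>x. \<X> 2 f x = 0"
  show "\<X> 2 (primitive3 f) = (\<lambda>x. 0)"
  proof (rule ext)
    fix x
    have V: "left_inv_field 2 (x + s *\<^sub>R left_inv_field 3 x) = left_inv_field 2 x" for s
      by (simp add: left_inv_field_eq axis_def)
    show "\<X> 2 (primitive3 f) x = 0"
      unfolding left_inv_deriv_def primitive3_def
    proof (intro primitive_deriv_0 smooth_left_inv_field smooth_diff smooth_mult smooth_coord f)
      show "frechet_derivative (\<lambda>x. x $ 3 - x $ 1 * x $ 2) (at x) (left_inv_field 2 x) = 0"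
        using \<tau>[of 2 x] by (simp add: left_inv_deriv_def left_inv_field_eq axis_def)
      show "frechet_derivative (left_inv_field 3) (at x) (left_inv_field 2 x) = 0"
        by (rule frechet_derivative_left_inv_field_0) simp_all
      show "frechet_derivative f (at (x + s *\<^sub>R left_inv_field 3 x)) (left_inv_field 2 x) = 0" for s
        using 0[of "x + s *\<^sub>R left_inv_field 3 x"] by (simp add: left_inv_deriv_def V)
    qed
  qed
qed

lemma bounded_left_inv_field_2:
  assumes "norm x \<le> R"
  shows "norm (left_inv_field 2 x) \<le> 1 + R + R\<^sup>2"
proof -
  have x1: "\<bar>x$1\<bar> \<le> R" using assms component_le_norm_cart[of x 1] by linarith
  have "norm (left_inv_field 2 x) \<le> 1 + \<bar>x$1\<bar> + \<bar>(x$1)\<^sup>2 / 2\<bar>"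
    unfolding left_inv_field_eq
    by (rule order_trans[OF norm_triangle_ineq], rule add_mono, rule order_trans[OF norm_triangle_ineq])
      (auto simp: norm_axis_1)
  also have "\<dots> \<le> 1 + R + R\<^sup>2"
  proof (intro add_mono order_refl x1)
    have "(x$1)\<^sup>2 \<le> R\<^sup>2" using x1 by (simp add: abs_le_square_iff[symmetric])
    then have "(x$1)\<^sup>2 / 2 \<le> R\<^sup>2" using zero_le_power2[of R] by linarith
    then show "\<bar>(x$1)\<^sup>2 / 2\<bar> \<le> R\<^sup>2" by simp
  qed
  finally show ?thesis .
qed

text \<open>A nonzero value needs a point of the support of \<open>b\<close> on the line through
  \<open>x\<close>, reached in parameter time at most 2 R; the field is constant on this line and
  bounded by 1 + R + R^2 on the ball of radius R.\<close>

lemma primitive2_support: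
  assumes b: "\<And>x. b x \<noteq> 0 \<Longrightarrow> norm x \<le> R" and R: "R > 0" and x: "\<bar>x$2\<bar> \<le> R" and c: "\<bar>c\<bar> \<le> R"
    and ne: "primitive2 c b x \<noteq> 0"
  shows "norm x \<le> R + 2 * R * (1 + R + R\<^sup>2)"
proof -
  let ?V = "left_inv_field 2"
  obtain t where t: "t \<in> {0..1}" "b (x + ((t - 1) * (x$2 - c)) *\<^sub>R ?V x) \<noteq> 0"
    using ne unfolding primitive2_def using primitive_eq_0[of b x "\<lambda>x. x$2 - c" ?V] by blast
  define s where "s = (t - 1) * (x$2 - c)"
  have s: "\<bar>s\<bar> \<le> 2 * R"
  proof -
    have "\<bar>s\<bar> \<le> 1 * \<bar>x$2 - c\<bar>"
      unfolding s_def abs_mult by (rule mult_right_mono) (use t in auto)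
    also have "\<dots> \<le> \<bar>x$2\<bar> + \<bar>c\<bar>" using abs_triangle_ineq4[of "x$2" c] by simp
    also have "\<dots> \<le> R + R" by (rule add_mono[OF x c])
    finally show ?thesis by simp
  qed
  let ?y = "x + s *\<^sub>R ?V x"
  have y: "norm ?y \<le> R" using b t by (simp add: s_def)
  have V: "?V x = ?V ?y" by (simp add: left_inv_field_eq axis_def)
  have "norm x \<le> norm ?y + norm (s *\<^sub>R ?V x)"
    using norm_triangle_ineq4[of ?y "s *\<^sub>R ?V x"] by simp
  also have "\<dots> \<le> R + 2 * R * (1 + R + R\<^sup>2)"
    unfolding norm_scaleR using R s bounded_left_inv_field_2[OF y, folded V]
    by (intro add_mono y mult_mono) auto
  finally show ?thesis .
qed

text \<open>The segment from the hyperplane x_2 = c to \<open>x\<close> stays on the outer side of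
  the slab that contains the support.\<close>

lemma primitive2_eq_0:
  assumes b: "\<And>x. b x \<noteq> 0 \<Longrightarrow> \<bar>x$2\<bar> < R" and "(c = - R \<and> x$2 \<le> - R) \<or> (c = R \<and> R \<le> x$2)"
  shows "primitive2 c b x = 0"
  unfolding primitive2_def
proof (rule primitive_eq_0, rule ccontr)
  fix t :: real assume t: "t \<in> {0..1}"
  have 2: "(x + ((t - 1) * (x$2 - c)) *\<^sub>R left_inv_field 2 x) $ 2 = c + t * (x$2 - c)"
    by (simp add: left_inv_field_eq axis_def algebra_simps)
  assume "b (x + ((t - 1) * (x$2 - c)) *\<^sub>R left_inv_field 2 x) \<noteq> 0"
  from b[OF this] have "\<bar>c + t * (x$2 - c)\<bar> < R" unfolding 2 .
  moreover have "t * (x$2 - c) \<le> 0" if "x$2 \<le> c" using t that by (simp add: mult_nonneg_nonpos)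
  moreover have "t * (x$2 - c) \<ge> 0" if "x$2 \<ge> c" using t that by simp
  ultimately show False using assms(2) by auto
qed

text \<open>The total integral \<open>g\<close> of \<open>b\<close> along the curves of \<open>X\<^sub>2\<close> is itself invariant along these
  curves. Subtracting from the primitive of \<open>b\<close> a multiple of that of a bump \<open>\<rho>\<close> gives
  a compactly supported \<open>w\<close>, and \<open>\<integral> X\<^sub>2(w g) = 0\<close> turns into \<open>\<integral> g\<^sup>2 \<rho> = 0\<close>.\<close>

lemma compact_primitive2_exists:
  fixes b :: "engel \<Rightarrow> real"
  assumes b: "smooth b" "bounded {x. b x \<noteq> 0}"
    and orth: "\<And>p. smooth p \<Longrightarrow> \<X> 2 p = (\<lambda>x. 0) \<Longrightarrow> (LINT x|lborel. b x * p x) = 0"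
  obtains v where "smooth v" "bounded {x. v x \<noteq> 0}" "\<X> 2 v = b"
proof -
  obtain R where R: "R > 0" "\<And>x. b x \<noteq> 0 \<Longrightarrow> norm x < R"
  proof -
    obtain R where "\<And>x. b x \<noteq> 0 \<Longrightarrow> norm x \<le> R" using b(2) by (auto simp: bounded_iff)
    then have "\<bar>R\<bar> + 1 > 0" "\<And>x. b x \<noteq> 0 \<Longrightarrow> norm x < \<bar>R\<bar> + 1" by force+
    then show ?thesis using that by blast
  qed
  have bR: "\<bar>x$2\<bar> < R" if "b x \<noteq> 0" for x
    using R(2)[OF that] component_le_norm_cart[of x 2] by linarith
  \<comment> \<open>A function of x_2 alone, positive exactly for \<bar>x_2\<bar> < R. Its support
    is unbounded; boundedness will come from the factor \<open>g\<close>.\<close>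
  define \<rho> where "\<rho> = (\<lambda>x::engel. flat_exp 0 (R\<^sup>2 - (x$2)\<^sup>2))"
  have \<rho>: "smooth \<rho>" unfolding \<rho>_def
    by (intro smooth_flat_exp smooth_diff smooth_const smooth_power smooth_coord)
  have \<rho>R: "\<bar>x$2\<bar> < R" if "\<rho> x \<noteq> 0" for x
  proof -
    have "(x$2)\<^sup>2 < R\<^sup>2" using that by (auto simp: \<rho>_def flat_exp_def split: if_splits)
    then show ?thesis using R(1) by (intro power2_less_imp_less[of "\<bar>x$2\<bar>"]) simp_all
  qed
  define v where "v = primitive2 (- R) b"
  define g where "g = (\<lambda>x. v x - primitive2 R b x)"
  define T where "T = primitive2 (- R) \<rho>"
  define k where "k = (\<lambda>x. T x - primitive2 R \<rho> x)"
  \<comment> \<open>Cross-multiplying with the total integral \<open>k\<close> of \<rho> avoids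
    dividing by it. Below the slab \<open>v\<close> and \<open>T\<close> vanish; above it
    \<open>g = v\<close> and \<open>k = T\<close>, so the two products cancel.\<close>
  define w where "w = (\<lambda>x. k x * v x - g x * T x)"
  have s: "smooth v" "smooth g" "smooth T" "smooth k" "smooth w"
    unfolding v_def g_def T_def k_def w_def
    by (intro smooth_mult smooth_diff smooth_primitive2 b \<rho>)+
  have X: "\<X> 2 v = b" "\<X> 2 T = \<rho>"
    unfolding v_def T_def by (intro left_inv_deriv_primitive2 b \<rho>)+
  have Xg: "\<X> 2 g = (\<lambda>x. 0)" "\<X> 2 k = (\<lambda>x. 0)"
    unfolding g_def k_def
    by (subst left_inv_deriv_diff; simp add: s smooth_primitive2 b \<rho> X left_inv_deriv_primitive2)+
  have Xw: "\<X> 2 w = (\<lambda>x. k x * b x - g x * \<rho> x)"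
    unfolding w_def
    by (subst left_inv_deriv_diff; (subst left_inv_deriv_mult)?; (subst left_inv_deriv_mult)?)
      (simp_all add: s smooth_mult X Xg)
  have low: "v x = 0" "T x = 0" if "x$2 \<le> - R" for x
    unfolding v_def T_def using that primitive2_eq_0[OF bR] primitive2_eq_0[OF \<rho>R] by blast+
  have high: "g x = v x" "k x = T x" if "x$2 \<ge> R" for x
    unfolding g_def k_def using that primitive2_eq_0[OF bR] primitive2_eq_0[OF \<rho>R] by auto
  have supp: "norm x \<le> R + 2 * R * (1 + R + R\<^sup>2)" if "\<bar>x$2\<bar> < R" "v x \<noteq> 0 \<or> g x \<noteq> 0" for x
  proof -
    have "primitive2 (- R) b x \<noteq> 0 \<or> primitive2 R b x \<noteq> 0"
      using that by (auto simp: g_def v_def)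
    then show ?thesis
      using primitive2_support[of b R x "- R"] primitive2_support[of b R x R] that(1) R
      by (auto intro: less_imp_le)
  qed
  have bw: "bounded {x. w x * g x \<noteq> 0}"
    unfolding bounded_iff
  proof (intro exI ballI)
    fix x assume "x \<in> {x. w x * g x \<noteq> 0}"
    then have "w x \<noteq> 0" by simp
    moreover have "w x = 0" if "\<not> \<bar>x$2\<bar> < R"
      using that low[of x] high[of x] by (auto simp: w_def abs_if split: if_splits)
    ultimately show "norm x \<le> R + 2 * R * (1 + R + R\<^sup>2)"
      by (intro supp) (auto simp: w_def)
  qed
  have bg: "bounded {x. g x * g x * \<rho> x \<noteq> 0}"
    unfolding bounded_iff using supp \<rho>R by auto
  have bb: "bounded {x. b x * (k x * g x) \<noteq> 0}"
    by (rule bounded_subset[OF b(2)]) auto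
  have int: "integrable lborel (\<lambda>x. g x * g x * \<rho> x)" "integrable lborel (\<lambda>x. b x * (k x * g x))"
    by (intro integrable_bounded_support smooth_continuous_on smooth_mult s b \<rho> bg bb)+
  have "(LINT x|lborel. \<X> 2 (\<lambda>x. w x * g x) x) = 0"
    by (intro integral_left_inv_deriv_eq_0 smooth_mult s bw)
  moreover have "\<X> 2 (\<lambda>x. w x * g x) = (\<lambda>x. b x * (k x * g x) - g x * g x * \<rho> x)"
    by (subst left_inv_deriv_mult) (simp_all add: s Xw Xg algebra_simps)
  moreover have "(LINT x|lborel. b x * (k x * g x)) = 0"
    by (intro orth smooth_mult s, subst left_inv_deriv_mult) (simp_all add: s Xg)
  ultimately have "(LINT x|lborel. g x * g x * \<rho> x) = 0"
    using int by simp
  then have g\<rho>: "g x * g x * \<rho> x = 0" for x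
    by (intro nonneg_integral_0_imp_0[of "\<lambda>x. g x * g x * \<rho> x"] smooth_continuous_on smooth_mult s \<rho> bg)
      (auto simp: \<rho>_def flat_exp_nonneg)
  \<comment> \<open>Slide along the curve of X_2 to the hyperplane x_2 = 0, where \<rho> is
    positive; \<open>g\<close> does not change on the way.\<close>
  have g0: "g x = 0" for x
  proof -
    define y where "y = x + (- x$2) *\<^sub>R left_inv_field 2 x"
    have "y$2 = 0" by (simp add: y_def left_inv_field_eq axis_def)
    then have "\<rho> y > 0" using R(1) by (auto simp: \<rho>_def intro: flat_exp_pos)
    then have "g y = 0" using g\<rho>[of y] by simp
    moreover have "g y = g x"
      unfolding y_def by (rule left_inv_deriv_0_imp_const[OF s(2)]) (auto simp: Xg)
    ultimately show ?thesis by simp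
  qed
  have "bounded {x. v x \<noteq> 0}"
    unfolding bounded_iff
  proof (intro exI ballI)
    fix x assume x: "x \<in> {x. v x \<noteq> 0}"
    moreover have "v x = 0" if "\<not> \<bar>x$2\<bar> < R"
      using that low[of x] high[of x] g0[of x] by (auto simp: abs_if split: if_splits)
    ultimately show "norm x \<le> R + 2 * R * (1 + R + R\<^sup>2)"
      by (intro supp) auto
  qed
  with s(1) X(1) that show ?thesis by blast
qed

text \<open>Since X_1 X_2 = X_2 X_1 + X_3, applying X_2 to X_1 X_2 u + X_3 u gives X_1 X_2 X_2 u. So
  the error in the second equation is X_2-invariant as soon as the first equation holds.\<close>

lemma compatibility:
  fixes a b u :: "engel \<Rightarrow> real"
  assumes u: "smooth u" and a: "smooth a" and b: "smooth b"
    and Xu: "\<X> 2 (\<X> 2 u) = (\<lambda>x. - b x)" and ab: "\<X> 1 b = \<X> 2 a"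
  shows "\<X> 2 (\<lambda>x. \<X> 1 (\<X> 2 u) x + \<X> 3 u x + a x) = (\<lambda>x. 0)"
proof -
  note s = smooth_left_inv_deriv
  have "\<X> 2 (\<lambda>x. \<X> 1 (\<X> 2 u) x + \<X> 3 u x + a x) =
      (\<lambda>x. \<X> 2 (\<X> 1 (\<X> 2 u)) x + \<X> 2 (\<X> 3 u) x + \<X> 2 a x)"
    by (simp add: left_inv_deriv_add smooth_add s u a)
  also have "\<dots> = (\<lambda>x. \<X> 1 (\<X> 2 (\<X> 2 u)) x + \<X> 2 a x)"
    using left_inv_deriv_commute(1)[OF s[OF u], of 2] left_inv_deriv_commute(4)[OF u]
    by (simp add: fun_eq_iff)
  also have "\<dots> = (\<lambda>x. 0)"
    unfolding Xu using left_inv_deriv_minus[OF b] ab by simp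
  finally show ?thesis .
qed

text \<open>Two primitives along X_2 solve the first equation. The remaining error \<open>e\<close>
  is X_2-invariant and is removed by subtracting some \<open>p\<close> with X_3 p = e and X_2 p = 0,
  which does not disturb the first equation.\<close>

lemma smooth_potential_exists:
  fixes a b :: "engel \<Rightarrow> real"
  assumes a: "smooth a" and b: "smooth b" and ab: "\<X> 1 b = \<X> 2 a"
  obtains u where "smooth u" "\<X> 2 (\<X> 2 u) = (\<lambda>x. - b x)" "\<And>x. \<X> 1 (\<X> 2 u) x + \<X> 3 u x = - a x"
proof -
  define u0 where "u0 = (\<lambda>x. - primitive2 0 (primitive2 0 b) x)"
  have u0: "smooth u0" unfolding u0_def by (intro smooth_minus smooth_primitive2 b)
  have X22: "\<X> 2 (\<X> 2 u0) = (\<lambda>x. - b x)"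
    by (simp add: u0_def left_inv_deriv_minus smooth_primitive2 left_inv_deriv_primitive2 b)
  define e where "e = (\<lambda>x. \<X> 1 (\<X> 2 u0) x + \<X> 3 u0 x + a x)"
  have e: "smooth e" unfolding e_def by (intro smooth_add smooth_left_inv_deriv u0 a)
  have Xe: "\<X> 2 e = (\<lambda>x. 0)" unfolding e_def by (rule compatibility[OF u0 a b X22 ab])
  define p where "p = primitive3 e"
  have p: "smooth p" unfolding p_def by (rule smooth_primitive3[OF e])
  have Xp: "\<X> 3 p = e" "\<X> 2 p = (\<lambda>x. 0)"
    unfolding p_def using left_inv_deriv_primitive3[OF e] Xe by simp_all
  show ?thesis
  proof
    show "smooth (\<lambda>x. u0 x - p x)" by (intro smooth_diff u0 p)
    show "\<X> 2 (\<X> 2 (\<lambda>x. u0 x - p x)) = (\<lambda>x. - b x)"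
      by (simp add: left_inv_deriv_diff u0 p Xp X22)
    show "\<X> 1 (\<X> 2 (\<lambda>x. u0 x - p x)) x + \<X> 3 (\<lambda>x. u0 x - p x) x = - a x" for x
      by (simp add: left_inv_deriv_diff u0 p Xp) (simp add: e_def)
  qed
qed

text \<open>Two compactly supported primitives along X_2 are taken. The error in the second equation
  then needs no correction: it is X_2-invariant with bounded support, hence zero.\<close>

lemma compact_potential_exists:
  fixes a b :: "engel \<Rightarrow> real"
  assumes a: "smooth a" "bounded {x. a x \<noteq> 0}" and b: "smooth b" "bounded {x. b x \<noteq> 0}"
    and ab: "\<X> 1 b = \<X> 2 a"
    and orth: "\<And>p. smooth p \<Longrightarrow> \<X> 2 (\<X> 2 p) = (\<lambda>x. 0) \<Longrightarrow> (LINT x|lborel. b x * p x) = 0"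
  obtains u where "smooth u" "bounded {x. u x \<noteq> 0}" "\<X> 2 (\<X> 2 u) = (\<lambda>x. - b x)"
    "\<And>x. \<X> 1 (\<X> 2 u) x + \<X> 3 u x = - a x"
proof -
  obtain v where v: "smooth v" "bounded {x. v x \<noteq> 0}" "\<X> 2 v = b"
    by (rule compact_primitive2_exists[OF b]) (auto intro: orth)
  obtain u' where u': "smooth u'" "bounded {x. u' x \<noteq> 0}" "\<X> 2 u' = v"
  proof (rule compact_primitive2_exists[OF v(1,2)])
    fix q :: "engel \<Rightarrow> real" assume q: "smooth q" "\<X> 2 q = (\<lambda>x. 0)"
    have s: "smooth (\<lambda>x. x$2 * q x)" by (intro smooth_mult smooth_coord q)
    \<comment> \<open>Writing q as X_2 (x_2 q) and integrating by parts moves the condition on the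
      first primitive \<open>v\<close> back to \<open>b\<close>; the function x_2 q is killed by X_2
      X_2.\<close>
    have "\<X> 2 (\<lambda>x. x$2 * q x) = q"
      by (subst left_inv_deriv_mult) (simp_all add: q fun_eq_iff left_inv_deriv_coord left_inv_field_eq axis_def)
    then show "(LINT x|lborel. v x * q x) = 0"
      using left_inv_deriv_by_parts[OF v(1) s, of 2] v orth[OF s] q by simp
  qed
  define u where "u = (\<lambda>x. - u' x)"
  have u: "smooth u" "bounded {x. u x \<noteq> 0}" using u' by (auto simp: u_def intro: smooth_minus)
  have X22: "\<X> 2 (\<X> 2 u) = (\<lambda>x. - b x)"
    by (simp add: u_def left_inv_deriv_minus u' v)
  define e where "e = (\<lambda>x. \<X> 1 (\<X> 2 u) x + \<X> 3 u x + a x)"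
  have e: "smooth e" unfolding e_def by (intro smooth_add smooth_left_inv_deriv u a)
  have Xe: "\<X> 2 e = (\<lambda>x. 0)" unfolding e_def by (rule compatibility[OF u(1) a(1) b(1) X22 ab])
  have "bounded ({x. \<X> 1 (\<X> 2 u) x \<noteq> 0} \<union> {x. \<X> 3 u x \<noteq> 0} \<union> {x. a x \<noteq> 0})"
    using u a by (simp add: bounded_left_inv_deriv)
  then have "bounded {x. e x \<noteq> 0}"
    by (rule bounded_subset) (auto simp: e_def)
  then obtain R where R: "\<And>x. e x \<noteq> 0 \<Longrightarrow> norm x \<le> R" by (auto simp: bounded_iff)
  have "e x = 0" for x
  proof -
    \<comment> \<open>Follow the curve of X_2 until x_2 exceeds the radius of the support.\<close>
    define s where "s = \<bar>R\<bar> + 1 - x$2"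
    have "(x + s *\<^sub>R left_inv_field 2 x) $ 2 = \<bar>R\<bar> + 1"
      by (simp add: s_def left_inv_field_eq axis_def)
    then have "norm (x + s *\<^sub>R left_inv_field 2 x) > R"
      using component_le_norm_cart[of "x + s *\<^sub>R left_inv_field 2 x" 2] by linarith
    then have "e (x + s *\<^sub>R left_inv_field 2 x) = 0" using R by force
    then show ?thesis using left_inv_deriv_0_imp_const[OF e, of 2 x s] Xe by simp
  qed
  then have "\<X> 1 (\<X> 2 u) x + \<X> 3 u x = - a x" for x
    by (simp add: e_def eq_neg_iff_add_eq_0)
  with u X22 that show ?thesis by blast
qed

section \<open>The exterior algebra\<close>

lemma UNIV_4: "(UNIV :: 4 set) = {1, 2, 3, 4}"
  using index4_cases by auto

lemma sum_Pow_insert: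
  assumes "finite A" "a \<notin> A"
  shows "sum f (Pow (insert a A)) = sum f (Pow A) + (\<Sum>I\<in>Pow A. f (insert a I))"
proof -
  have "inj_on (insert a) (Pow A)" using assms(2) by (auto simp: inj_on_def)
  then show ?thesis
    unfolding Pow_insert using assms by (subst sum.union_disjoint) (auto simp: sum.reindex)
qed

lemma ball_Pow_insert_iff:
  "(\<forall>I\<in>Pow (insert a A). P I) \<longleftrightarrow> (\<forall>I\<in>Pow A. P I) \<and> (\<forall>I\<in>Pow A. P (insert a I))"
  unfolding Pow_insert by auto

lemma all_index_set:
  "(\<forall>I :: 4 set. P I) \<longleftrightarrow> P {} \<and> P {1} \<and> P {2} \<and> P {3} \<and> P {4} \<and> P {1, 2} \<and> P {1, 3} \<and> P {1, 4} \<and>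
    P {2, 3} \<and> P {2, 4} \<and> P {3, 4} \<and> P {1, 2, 3} \<and> P {1, 2, 4} \<and> P {1, 3, 4} \<and> P {2, 3, 4} \<and> P {1, 2, 3, 4}"
proof -
  have "(\<forall>I :: 4 set. P I) \<longleftrightarrow> (\<forall>I\<in>Pow {1, 2, 3, 4}. P I)"
    by (simp add: UNIV_4[symmetric])
  then show ?thesis
    unfolding ball_Pow_insert_iff by auto
qed

lemma sum_index_set:
  "(\<Sum>I\<in>(UNIV :: 4 set set). f I) = f {} + f {1} + f {2} + f {3} + f {4} + f {1, 2} + f {1, 3} + f {1, 4} +
    f {2, 3} + f {2, 4} + f {3, 4} + f {1, 2, 3} + f {1, 2, 4} + f {1, 3, 4} + f {2, 3, 4} + f {1, 2, 3, 4}"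
  for f :: "4 set \<Rightarrow> 'a::comm_monoid_add"
  unfolding Pow_UNIV[symmetric] UNIV_4 by (simp add: sum_Pow_insert add_ac)

lemma covector_eq_iff: "a = b \<longleftrightarrow> (\<forall>I. a $ I = b $ I)" for a b :: covector
  by (rule vec_eq_iff)

text \<open>The sign in \<open>wedge\<close> as a product instead of a power of a cardinality, so
  that it can be evaluated on explicit index sets by simplification.\<close>

definition shuffle_sign :: "4 set \<Rightarrow> 4 set \<Rightarrow> real" where
  "shuffle_sign I J = (\<Prod>i\<in>I. \<Prod>j\<in>J. if pos j < pos i then - 1 else 1)"

lemma wedge_nth: "(a \<and>\<and> b) $ K = (\<Sum>I\<in>Pow K. shuffle_sign I (K - I) * (a $ I) * (b $ (K - I)))"
proof -
  have "(- 1) ^ card {(i, j). i \<in> I \<and> j \<in> J \<and> pos j < pos i} = shuffle_sign I J" for I J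
  proof -
    have "shuffle_sign I J = (\<Prod>(i, j)\<in>I \<times> J. if pos j < pos i then - 1 else 1)"
      unfolding shuffle_sign_def by (simp add: prod.cartesian_product)
    also have "\<dots> = (\<Prod>(i, j)\<in>{(i, j). i \<in> I \<and> j \<in> J \<and> pos j < pos i}. - 1)"
      by (rule prod.mono_neutral_cong_right) (auto simp: split_def)
    finally show ?thesis by (simp add: split_def)
  qed
  then show ?thesis by (simp only: wedge_def vec_lambda_beta)
qed

lemma bounded_bilinear_wedge: "bounded_bilinear (\<and>\<and>)"
  unfolding bilinear_conv_bounded_bilinear[symmetric] bilinear_def
  by (auto intro!: linearI simp: covector_eq_iff wedge_nth sum.distrib[symmetric] sum_distrib_left algebra_simps)

interpretation wedge: bounded_bilinear "(\<and>\<and>)"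
  by (rule bounded_bilinear_wedge)

lemma axis_wedge_axis:
  "axis I 1 \<and>\<and> axis J 1 = (if I \<inter> J = {} then shuffle_sign I J *\<^sub>R axis (I \<union> J) 1 else 0)"
proof -
  have "(axis I 1 \<and>\<and> axis J 1) $ K =
      (if I \<inter> J = {} then shuffle_sign I J *\<^sub>R axis (I \<union> J) 1 else 0 :: covector) $ K" for K
  proof -
    have "(axis I 1 \<and>\<and> axis J 1) $ K =
        (\<Sum>I'\<in>Pow K. if I' = I then shuffle_sign I (K - I) * axis J 1 $ (K - I) else 0)"
      unfolding wedge_nth by (rule sum.cong) (auto simp: axis_def)
    also have "\<dots> = (if I \<subseteq> K then shuffle_sign I (K - I) * axis J 1 $ (K - I) else 0)"
      by (subst sum.delta) auto
    also have "\<dots> = (if I \<inter> J = {} then shuffle_sign I J *\<^sub>R axis (I \<union> J) 1 else 0 :: covector) $ K"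
    proof (cases "I \<inter> J = {} \<and> K = I \<union> J")
      case True
      then have "K - I = J" by auto
      with True show ?thesis by (auto simp: axis_def)
    next
      case False
      then show ?thesis by (auto simp: axis_def)
    qed
    finally show ?thesis .
  qed
  then show ?thesis by (simp add: covector_eq_iff)
qed

lemma theta_wedge_nth:
  "(theta i \<and>\<and> b) $ K = (if i \<in> K then shuffle_sign {i} (K - {i}) * b $ (K - {i}) else 0)"
proof -
  have "(theta i \<and>\<and> b) $ K = (\<Sum>I\<in>Pow K. if I = {i} then shuffle_sign {i} (K - {i}) * b $ (K - {i}) else 0)"
    unfolding wedge_nth theta_def by (rule sum.cong) (auto simp: axis_def)
  also have "\<dots> = (if i \<in> K then shuffle_sign {i} (K - {i}) * b $ (K - {i}) else 0)"
    by (subst sum.delta) auto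
  finally show ?thesis .
qed

text \<open>Only theta_3, theta_4, theta_24 and theta_34 have a nonzero differential, and their
  images are distinct basis forms up to sign. All later statements about d_0 rest on this
  table.\<close>

lemma d_left_inv_eq:
  "d_left_inv \<xi> = - (\<xi> $ {3}) *\<^sub>R axis {1, 2} 1 - (\<xi> $ {4}) *\<^sub>R axis {1, 3} 1
     - (\<xi> $ {2, 4}) *\<^sub>R axis {1, 2, 3} 1 - (\<xi> $ {3, 4}) *\<^sub>R axis {1, 2, 4} 1"
proof -
  have [simp]: "({2, 1} :: 4 set) = {1, 2}" "({3, 1} :: 4 set) = {1, 3}" "({4, 2, 1} :: 4 set) = {1, 2, 4}"
    "({1, 3, 2} :: 4 set) = {1, 2, 3}" "({4, 1, 2} :: 4 set) = {1, 2, 4}"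
    by auto
  show ?thesis
    unfolding d_left_inv_def sum_index_set
    by (simp add: d_theta_def theta_def axis_wedge_axis shuffle_sign_def pos_def wedge.minus_left
        wedge.minus_right wedge.zero_left wedge.zero_right wedge.scaleR_right wedge.scaleR_left)
qed

lemma bounded_linear_d_left_inv: "bounded_linear d_left_inv"
  unfolding linear_conv_bounded_linear[symmetric]
  by (rule linearI) (simp_all add: d_left_inv_eq algebra_simps)

lemmas d_left_inv_add = linear_add[OF bounded_linear.linear[OF bounded_linear_d_left_inv]]
  and d_left_inv_scaleR = linear_scale[OF bounded_linear.linear[OF bounded_linear_d_left_inv]]
  and d_left_inv_zero = linear_0[OF bounded_linear.linear[OF bounded_linear_d_left_inv]]

lemmas covector_simps = covector_eq_iff theta_wedge_nth d_left_inv_eq all_index_set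

lemma theta_wedge_theta_wedge:
  "theta i \<and>\<and> theta i \<and>\<and> b = 0"
  "i \<noteq> j \<Longrightarrow> theta j \<and>\<and> theta i \<and>\<and> b = - (theta i \<and>\<and> theta j \<and>\<and> b)"
proof -
  have "theta i \<and>\<and> theta i \<and>\<and> b = 0" for i
    unfolding covector_eq_iff by (simp add: theta_wedge_nth)
  from this[of i] show "theta i \<and>\<and> theta i \<and>\<and> b = 0" .
  assume "i \<noteq> j"
  show "theta j \<and>\<and> theta i \<and>\<and> b = - (theta i \<and>\<and> theta j \<and>\<and> b)"
    unfolding covector_eq_iff
  proof
    fix K
    have "shuffle_sign {j} (K - {j}) * shuffle_sign {i} (K - {j} - {i}) =
        - (shuffle_sign {i} (K - {i}) * shuffle_sign {j} (K - {i} - {j}))" if "i \<in> K" "j \<in> K"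
    proof -
      have K: "K - {j} = insert i (K - {i, j})" "K - {i} = insert j (K - {i, j})"
        "K - {j} - {i} = K - {i, j}" "K - {i} - {j} = K - {i, j}"
        using that \<open>i \<noteq> j\<close> by auto
      have "pos i \<noteq> pos j"
        using \<open>i \<noteq> j\<close> index4_cases[of i] index4_cases[of j] by (auto simp: pos_def)
      then show ?thesis
        unfolding K by (simp add: shuffle_sign_def)
    qed
    moreover have "K - {j} - {i} = K - {i} - {j}" by auto
    ultimately show "(theta j \<and>\<and> theta i \<and>\<and> b) $ K = (- (theta i \<and>\<and> theta j \<and>\<and> b)) $ K"
      using \<open>i \<noteq> j\<close> by (auto simp: theta_wedge_nth mult.assoc[symmetric])
  qed
qed

lemma d_left_inv_d_left_inv: "d_left_inv (d_left_inv \<xi>) = 0"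
  by (simp add: d_left_inv_eq axis_def set_eq_iff forall_4)

text \<open>The Leibniz rule for d_0, with the structure equations inserted.\<close>

lemma d_left_inv_theta_wedge:
  "d_left_inv (theta 1 \<and>\<and> b) = - (theta 1 \<and>\<and> d_left_inv b)"
  "d_left_inv (theta 2 \<and>\<and> b) = - (theta 2 \<and>\<and> d_left_inv b)"
  "d_left_inv (theta 3 \<and>\<and> b) = - (theta 1 \<and>\<and> theta 2 \<and>\<and> b) - theta 3 \<and>\<and> d_left_inv b"
  "d_left_inv (theta 4 \<and>\<and> b) = - (theta 1 \<and>\<and> theta 3 \<and>\<and> b) - theta 4 \<and>\<and> d_left_inv b"
  unfolding covector_simps
  by (simp_all add: theta_wedge_nth axis_def shuffle_sign_def pos_def insert_Diff_if set_eq_iff forall_4)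

lemma Compl_index_set: 
  "- {} = {1,2,3,4::4}" "- {1} = {2,3,4::4}" "- {2} = {1,3,4::4}" "- {3} = {1,2,4::4}" "- {4} = {1,2,3::4}"
  "- {1,2} = {3,4::4}" "- {1,3} = {2,4::4}" "- {1,4} = {2,3::4}" "- {2,3} = {1,4::4}" "- {2,4} = {1,3::4}" "- {3,4} = {1,2::4}"
  "- {1,2,3} = {4::4}" "- {1,2,4} = {3::4}" "- {1,3,4} = {2::4}" "- {2,3,4} = {1::4}" "- {1,2,3,4::4} = {}"
  by (simp_all only: set_eq_iff forall_4 Compl_iff insert_iff empty_iff idx4_distinct simp_thms)
lemma shuffle_sign_Compl:
  "shuffle_sign {} J = 1" "shuffle_sign J {} = 1" "shuffle_sign {1} {2,3,4} = 1" "shuffle_sign {2} {1,3,4} = -1" "shuffle_sign {3} {1,2,4} = 1" "shuffle_sign {4} {1,2,3} = -1"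
  "shuffle_sign {1,2} {3,4} = 1" "shuffle_sign {1,3} {2,4} = -1" "shuffle_sign {1,4} {2,3} = 1"
  "shuffle_sign {2,3} {1,4} = 1" "shuffle_sign {2,4} {1,3} = -1" "shuffle_sign {3,4} {1,2} = 1"
  "shuffle_sign {1,2,3} {4} = 1" "shuffle_sign {1,2,4} {3} = -1" "shuffle_sign {1,3,4} {2} = 1" "shuffle_sign {2,3,4} {1} = -1"
  by (simp_all add: shuffle_sign_def pos_def)
lemma wedge_top:
  "(a \<and>\<and> b) $ UNIV = a${} * b${1,2,3,4} + a${1} * b${2,3,4} - a${2} * b${1,3,4} + a${3} * b${1,2,4}
    - a${4} * b${1,2,3} + a${1,2} * b${3,4} - a${1,3} * b${2,4} + a${1,4} * b${2,3} + a${2,3} * b${1,4}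
    - a${2,4} * b${1,3} + a${3,4} * b${1,2} + a${1,2,3} * b${4} - a${1,2,4} * b${3} + a${1,3,4} * b${2}
    - a${2,3,4} * b${1} + a${1,2,3,4} * b${}"
  unfolding wedge_nth Pow_UNIV sum_index_set Compl_eq_Diff_UNIV[symmetric] Compl_index_set
    shuffle_sign_Compl
  by simp
lemma theta_wedge_index_set:
  "(theta 1 \<and>\<and> b) $ {1} = b $ {}" "(theta 1 \<and>\<and> b) $ {1, 2} = b $ {2}"
  "(theta 1 \<and>\<and> b) $ {1, 3} = b $ {3}" "(theta 1 \<and>\<and> b) $ {1, 4} = b $ {4}"
  "(theta 1 \<and>\<and> b) $ {1, 2, 3} = b $ {2, 3}" "(theta 1 \<and>\<and> b) $ {1, 2, 4} = b $ {2, 4}"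
  "(theta 1 \<and>\<and> b) $ {1, 3, 4} = b $ {3, 4}" "(theta 1 \<and>\<and> b) $ {1, 2, 3, 4} = b $ {2, 3, 4}"
  "(theta 2 \<and>\<and> b) $ {2} = b $ {}" "(theta 2 \<and>\<and> b) $ {1, 2} = - b $ {1}"
  "(theta 2 \<and>\<and> b) $ {2, 3} = b $ {3}" "(theta 2 \<and>\<and> b) $ {2, 4} = b $ {4}"
  "(theta 2 \<and>\<and> b) $ {1, 2, 3} = - b $ {1, 3}" "(theta 2 \<and>\<and> b) $ {1, 2, 4} = - b $ {1, 4}"
  "(theta 2 \<and>\<and> b) $ {2, 3, 4} = b $ {3, 4}" "(theta 2 \<and>\<and> b) $ {1, 2, 3, 4} = - b $ {1, 3, 4}"
  "(theta 3 \<and>\<and> b) $ {3} = b $ {}" "(theta 3 \<and>\<and> b) $ {1, 3} = - b $ {1}"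
  "(theta 3 \<and>\<and> b) $ {2, 3} = - b $ {2}" "(theta 3 \<and>\<and> b) $ {3, 4} = b $ {4}"
  "(theta 3 \<and>\<and> b) $ {1, 2, 3} = b $ {1, 2}" "(theta 3 \<and>\<and> b) $ {1, 3, 4} = - b $ {1, 4}"
  "(theta 3 \<and>\<and> b) $ {2, 3, 4} = - b $ {2, 4}" "(theta 3 \<and>\<and> b) $ {1, 2, 3, 4} = b $ {1, 2, 4}"
  "(theta 4 \<and>\<and> b) $ {4} = b $ {}" "(theta 4 \<and>\<and> b) $ {1, 4} = - b $ {1}"
  "(theta 4 \<and>\<and> b) $ {2, 4} = - b $ {2}" "(theta 4 \<and>\<and> b) $ {3, 4} = - b $ {3}"
  "(theta 4 \<and>\<and> b) $ {1, 2, 4} = b $ {1, 2}" "(theta 4 \<and>\<and> b) $ {1, 3, 4} = b $ {1, 3}"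
  "(theta 4 \<and>\<and> b) $ {2, 3, 4} = b $ {2, 3}" "(theta 4 \<and>\<and> b) $ {1, 2, 3, 4} = - b $ {1, 2, 3}"
  by (simp_all add: theta_wedge_nth shuffle_sign_def pos_def insert_Diff_if)

lemma theta_wedge_notin: "i \<notin> K \<Longrightarrow> (theta i \<and>\<and> b) $ K = 0"
  by (simp add: theta_wedge_nth)

text \<open>The sign that a 1-form picks up when it is moved past a form, for forms of mixed
  degree.\<close>

definition grading :: "covector \<Rightarrow> covector" where
  "grading a = (\<chi> I. (- 1) ^ card I * a $ I)"

lemma theta_wedge_top: "((theta i \<and>\<and> a) \<and>\<and> b) $ UNIV = (grading a \<and>\<and> (theta i \<and>\<and> b)) $ UNIV"
  using index4_cases[of i]
  by (elim disjE) (simp_all add: wedge_top theta_wedge_index_set theta_wedge_notin grading_def)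

text \<open>This is the Leibniz rule for d_0 (a \<and> b): no differential of a left-invariant form
  has a component in the top degree.\<close>

lemma d_left_inv_top: "(d_left_inv a \<and>\<and> b) $ UNIV = - (grading a \<and>\<and> d_left_inv b) $ UNIV"
  by (simp add: wedge_top d_left_inv_eq grading_def axis_def set_eq_iff forall_4)

section \<open>The components of the exterior differential\<close>

lemma weight_sets:
  "{i. weight i = Suc 0} = {1, 2}" "{i. weight i = 2} = {3}" "{i. weight i = 3} = {4}" "m > 3 \<Longrightarrow> {i. weight i = m} = {}"
  by (auto simp: set_eq_iff forall_4 weight_def split: if_splits)

lemma dd_eq:
  "dd 0 \<omega> = (\<lambda>x. d_left_inv (\<omega> x))"
  "dd 1 \<omega> = (\<lambda>x. theta 1 \<and>\<and> \<X> 1 \<omega> x + theta 2 \<and>\<and> \<X> 2 \<omega> x)"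
  "dd (Suc 0) \<omega> = (\<lambda>x. theta 1 \<and>\<and> \<X> 1 \<omega> x + theta 2 \<and>\<and> \<X> 2 \<omega> x)"
  "dd 2 \<omega> = (\<lambda>x. theta 3 \<and>\<and> \<X> 3 \<omega> x)"
  "dd 3 \<omega> = (\<lambda>x. theta 4 \<and>\<and> \<X> 4 \<omega> x)"
  "m > 3 \<Longrightarrow> dd m \<omega> = (\<lambda>x. 0)"
  by (simp_all add: dd_def left_inv_deriv_def weight_sets)

lemma smooth_dd:
  assumes "smooth \<omega>"
  shows "smooth (dd m \<omega>)"
proof (cases "m = 0")
  case True
  then show ?thesis using smooth_linear[OF bounded_linear_d_left_inv assms] by (simp add: dd_eq)
next
  case False
  then have "dd m \<omega> = (\<lambda>x. \<Sum>i | weight i = m. theta i \<and>\<and> \<X> i \<omega> x)"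
    by (simp add: dd_def left_inv_deriv_def)
  then show ?thesis
    by (simp add: smooth_sum smooth_linear[OF wedge.bounded_linear_right] smooth_left_inv_deriv assms)
qed

lemma left_inv_deriv_theta_wedge:
  "smooth \<omega> \<Longrightarrow> \<X> i (\<lambda>x. theta j \<and>\<and> \<omega> x) = (\<lambda>x. theta j \<and>\<and> \<X> i \<omega> x)"
  by (rule left_inv_deriv_linear[OF wedge.bounded_linear_right])

lemma left_inv_deriv_d_left_inv:
  "smooth \<omega> \<Longrightarrow> \<X> i (\<lambda>x. d_left_inv (\<omega> x)) = (\<lambda>x. d_left_inv (\<X> i \<omega> x))"
  by (rule left_inv_deriv_linear[OF bounded_linear_d_left_inv])

text \<open>The components of d d = 0, separated by the weight they add, from 0 to 6. The terms
  theta_12 X_3 and theta_13 X_4 produced by d_0 cancel against the commutators of X_1 with X_2 and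
  X_3.\<close>

lemma dd_dd:
  assumes s: "smooth \<omega>"
  shows "dd 0 (dd 0 \<omega>) = 0"
    "dd 0 (dd 1 \<omega>) + dd 1 (dd 0 \<omega>) = 0"
    "dd 0 (dd 2 \<omega>) + dd 1 (dd 1 \<omega>) + dd 2 (dd 0 \<omega>) = 0"
    "dd 0 (dd 3 \<omega>) + dd 1 (dd 2 \<omega>) + dd 2 (dd 1 \<omega>) + dd 3 (dd 0 \<omega>) = 0"
    "dd 1 (dd 3 \<omega>) + dd 2 (dd 2 \<omega>) + dd 3 (dd 1 \<omega>) = 0"
    "dd 2 (dd 3 \<omega>) + dd 3 (dd 2 \<omega>) = 0"
    "dd 3 (dd 3 \<omega>) = 0"
proof -
  have t: "theta 2 \<and>\<and> theta 1 \<and>\<and> b = - (theta 1 \<and>\<and> theta 2 \<and>\<and> b)"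
    "theta 3 \<and>\<and> theta 1 \<and>\<and> b = - (theta 1 \<and>\<and> theta 3 \<and>\<and> b)"
    "theta 4 \<and>\<and> theta 1 \<and>\<and> b = - (theta 1 \<and>\<and> theta 4 \<and>\<and> b)"
    "theta 3 \<and>\<and> theta 2 \<and>\<and> b = - (theta 2 \<and>\<and> theta 3 \<and>\<and> b)"
    "theta 4 \<and>\<and> theta 2 \<and>\<and> b = - (theta 2 \<and>\<and> theta 4 \<and>\<and> b)"
    "theta 4 \<and>\<and> theta 3 \<and>\<and> b = - (theta 3 \<and>\<and> theta 4 \<and>\<and> b)" for b
    by (rule theta_wedge_theta_wedge(2); simp)+
  have sm: "smooth (\<X> i \<omega>)" "smooth (\<lambda>x. theta j \<and>\<and> \<X> i \<omega> x)" for i j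
    by (intro smooth_linear[OF wedge.bounded_linear_right] smooth_left_inv_deriv s)+
  note simps = dd_eq left_inv_deriv_add[OF sm(2) sm(2)] left_inv_deriv_theta_wedge[OF sm(1)]
    left_inv_deriv_d_left_inv[OF s] d_left_inv_d_left_inv d_left_inv_add d_left_inv_theta_wedge
    wedge.add_right t theta_wedge_theta_wedge(1) left_inv_deriv_commute[OF s]
  show "dd 0 (dd 0 \<omega>) = 0"
    "dd 0 (dd 1 \<omega>) + dd 1 (dd 0 \<omega>) = 0"
    "dd 0 (dd 2 \<omega>) + dd 1 (dd 1 \<omega>) + dd 2 (dd 0 \<omega>) = 0"
    "dd 0 (dd 3 \<omega>) + dd 1 (dd 2 \<omega>) + dd 2 (dd 1 \<omega>) + dd 3 (dd 0 \<omega>) = 0"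
    "dd 1 (dd 3 \<omega>) + dd 2 (dd 2 \<omega>) + dd 3 (dd 1 \<omega>) = 0"
    "dd 2 (dd 3 \<omega>) + dd 3 (dd 2 \<omega>) = 0"
    "dd 3 (dd 3 \<omega>) = 0"
    by (simp_all add: simps fun_eq_iff)
qed

lemma dd_add: "smooth \<omega> \<Longrightarrow> smooth \<eta> \<Longrightarrow> dd m (\<omega> + \<eta>) = dd m \<omega> + dd m \<eta>"
  using left_inv_deriv_add[of \<omega> \<eta>]
  by (auto simp: dd_def fun_eq_iff plus_fun_def d_left_inv_add wedge.add_right sum.distrib
      simp flip: left_inv_deriv_def)

lemma dd_scaleR: "smooth \<omega> \<Longrightarrow> dd m (c *\<^sub>R \<omega>) = c *\<^sub>R dd m \<omega>"
  using left_inv_deriv_linear[OF bounded_linear_scaleR_right[of c], of \<omega>]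
  by (auto simp: dd_def fun_eq_iff scaleR_fun_def d_left_inv_scaleR wedge.scaleR_right scaleR_sum_right
      simp flip: left_inv_deriv_def)

lemma dd_support: "closed K \<Longrightarrow> {x. \<omega> x \<noteq> 0} \<subseteq> K \<Longrightarrow> {x. dd m \<omega> x \<noteq> 0} \<subseteq> K"
proof
  fix x assume K: "closed K" "{x. \<omega> x \<noteq> 0} \<subseteq> K" and x: "x \<in> {x. dd m \<omega> x \<noteq> 0}"
  show "x \<in> K"
  proof (rule ccontr)
    assume "x \<notin> K"
    then have "\<omega> x = 0" "frechet_derivative \<omega> (at x) = (\<lambda>v. 0)"
      using K frechet_derivative_support by auto
    then have "dd m \<omega> x = 0" by (simp add: dd_def d_left_inv_zero wedge.zero_right)
    then show False using x by simp
  qed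
qed

lemma Omega_zero: "0 \<in> Omega p k"
  using smooth_const[of "0::covector"] by (simp add: Omega_def zero_fun_def)

lemma Omega_add: "\<omega> \<in> Omega p k \<Longrightarrow> \<eta> \<in> Omega p k \<Longrightarrow> \<omega> + \<eta> \<in> Omega p k"
  unfolding Omega_def plus_fun_def by (auto intro: smooth_add) (metis add_0)+

lemma Omega_scaleR: "\<omega> \<in> Omega p k \<Longrightarrow> c *\<^sub>R \<omega> \<in> Omega p k"
  unfolding Omega_def scaleR_fun_def
  by (auto intro: smooth_linear[OF bounded_linear_scaleR_right])

lemma Omega_c_iff: "\<omega> \<in> Omega_c p k \<longleftrightarrow> \<omega> \<in> Omega p k \<and> bounded {x. \<omega> x \<noteq> 0}"
  by (simp add: Omega_c_def compact_closure)

lemma Omega_c_zero: "0 \<in> Omega_c p k"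
  by (simp add: Omega_c_iff Omega_zero)

lemma Omega_c_add:
  assumes "\<omega> \<in> Omega_c p k" "\<eta> \<in> Omega_c p k"
  shows "\<omega> + \<eta> \<in> Omega_c p k"
proof -
  have "bounded {x. (\<omega> + \<eta>) x \<noteq> 0}"
    by (rule bounded_subset[of "{x. \<omega> x \<noteq> 0} \<union> {x. \<eta> x \<noteq> 0}"]) (use assms in \<open>auto simp: Omega_c_iff\<close>)
  then show ?thesis using assms by (simp add: Omega_c_iff Omega_add)
qed

lemma Omega_c_scaleR: "\<omega> \<in> Omega_c p k \<Longrightarrow> c *\<^sub>R \<omega> \<in> Omega_c p k"
  unfolding Omega_c_iff
  by (auto intro: Omega_scaleR bounded_subset[of "{x. \<omega> x \<noteq> 0}"])

lemma d_left_inv_nth: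
  "d_left_inv \<xi> $ I = (if I = {1, 2} then - (\<xi> $ {3}) else if I = {1, 3} then - (\<xi> $ {4})
     else if I = {1, 2, 3} then - (\<xi> $ {2, 4}) else if I = {1, 2, 4} then - (\<xi> $ {3, 4}) else 0)"
proof -
  have "({1, 2} :: 4 set) \<noteq> {1, 3}" "({1, 2} :: 4 set) \<noteq> {1, 2, 3}" "({1, 2} :: 4 set) \<noteq> {1, 2, 4}"
    "({1, 3} :: 4 set) \<noteq> {1, 2, 3}" "({1, 3} :: 4 set) \<noteq> {1, 2, 4}" "({1, 2, 3} :: 4 set) \<noteq> {1, 2, 4}"
    by (simp_all only: set_eq_iff forall_4 insert_iff empty_iff idx4_distinct simp_thms)
  then show ?thesis
    by (simp add: d_left_inv_eq axis_def)
qed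

lemma d_left_inv_homogeneous:
  assumes "d_left_inv \<xi> $ I \<noteq> 0"
  shows "\<exists>J. \<xi> $ J \<noteq> 0 \<and> (\<Sum>i\<in>I. weight i) = (\<Sum>i\<in>J. weight i) \<and> card I = Suc (card J)"
proof -
  consider "\<xi> $ {3} \<noteq> 0" "I = {1, 2}" | "\<xi> $ {4} \<noteq> 0" "I = {1, 3}"
    | "\<xi> $ {2, 4} \<noteq> 0" "I = {1, 2, 3}" | "\<xi> $ {3, 4} \<noteq> 0" "I = {1, 2, 4}"
    using assms unfolding d_left_inv_nth by (simp split: if_splits)
  then show ?thesis
  proof cases
    case 1
    then show ?thesis by (intro exI[of _ "{3}"]) (simp add: weight_def)
  next
    case 2
    then show ?thesis by (intro exI[of _ "{4}"]) (simp add: weight_def)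
  next
    case 3
    then show ?thesis by (intro exI[of _ "{2, 4}"]) (simp add: weight_def)
  next
    case 4
    then show ?thesis by (intro exI[of _ "{3, 4}"]) (simp add: weight_def)
  qed
qed

lemma Omega_dd:
  assumes \<omega>: "\<omega> \<in> Omega p k"
  shows "dd m \<omega> \<in> Omega (p + int m) (k + 1)"
proof -
  have s: "smooth \<omega>" and hom: "\<And>x I. \<omega> x $ I \<noteq> 0 \<Longrightarrow> int (\<Sum>i\<in>I. weight i) = p \<and> int (card I) = k"
    using \<omega> by (auto simp: Omega_def)
  have "int (\<Sum>i\<in>I. weight i) = p + int m \<and> int (card I) = k + 1" if ne: "dd m \<omega> x $ I \<noteq> 0" for x I
  proof (cases "m = 0")
    case True
    then obtain J where "\<omega> x $ J \<noteq> 0" "(\<Sum>i\<in>I. weight i) = (\<Sum>i\<in>J. weight i)" "card I = Suc (card J)"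
      using ne d_left_inv_homogeneous[of "\<omega> x" I] by (auto simp: dd_eq)
    then show ?thesis using hom[of x J] True by simp
  next
    case False
    have "dd m \<omega> x $ I = (\<Sum>i | weight i = m. (theta i \<and>\<and> \<X> i \<omega> x) $ I)"
      using False by (simp add: dd_def left_inv_deriv_def)
    with ne obtain i where i: "weight i = m" "(theta i \<and>\<and> \<X> i \<omega> x) $ I \<noteq> 0"
      by (metis (mono_tags, lifting) mem_Collect_eq sum.neutral)
    then have I: "i \<in> I" "\<X> i \<omega> x $ (I - {i}) \<noteq> 0"
      by (auto simp: theta_wedge_nth split: if_splits)
    \<comment> \<open>The weight and degree condition is about values of \<omega>, while here a
      derivative is nonzero; a coefficient that vanished everywhere would have zero
      derivative.\<close>
    have "\<exists>y. \<omega> y $ (I - {i}) \<noteq> 0"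
    proof (rule ccontr)
      assume "\<not> ?thesis"
      then have "\<X> i (\<lambda>y. \<omega> y $ (I - {i})) = (\<lambda>y. 0)" by simp
      then show False
        using I(2) left_inv_deriv_linear[OF bounded_linear_vec_nth s, of i "I - {i}"] by (simp add: fun_eq_iff)
    qed
    then have "int (\<Sum>j\<in>I - {i}. weight j) = p" "int (card (I - {i})) = k"
      using hom by blast+
    moreover have "(\<Sum>j\<in>I. weight j) = weight i + (\<Sum>j\<in>I - {i}. weight j)" "card I = Suc (card (I - {i}))"
      using I(1) sum.remove[of I i weight] card.remove[of I i] by simp_all
    ultimately show ?thesis using i(1) by simp
  qed
  then show ?thesis using smooth_dd[OF s] by (simp add: Omega_def)
qed

lemma Omega_c_dd:
  assumes "\<omega> \<in> Omega_c p k"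
  shows "dd m \<omega> \<in> Omega_c (p + int m) (k + 1)"
proof -
  have "bounded {x. dd m \<omega> x \<noteq> 0}"
    by (rule bounded_subset[OF bounded_closure dd_support[OF closed_closure closure_subset]])
      (use assms in \<open>auto simp: Omega_c_iff\<close>)
  then show ?thesis using assms by (simp add: Omega_c_iff Omega_dd)
qed

section \<open>Integration by parts\<close>

lemma bounded_bilinear_has_derivative_smooth:
  assumes "bounded_bilinear B" "smooth f" "smooth g"
  shows "((\<lambda>x. B (f x) (g x)) has_derivative
    (\<lambda>v. B (f x) (frechet_derivative g (at x) v) + B (frechet_derivative f (at x) v) (g x))) (at x)"
  by (rule bounded_bilinear.FDERIV[OF assms(1)]) (rule smooth_has_derivative assms)+

lemma smooth_bilinear:
  assumes B: "bounded_bilinear B" and fg: "smooth f" "smooth g"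
  shows "smooth (\<lambda>x. B (f x) (g x))"
proof -
  let ?P = "\<lambda>h. \<exists>f g. smooth f \<and> smooth g \<and> h = (\<lambda>x. B (f x) (g x))"
  have P: "?P (\<lambda>x. B (f x) (g x))" if "smooth f" "smooth g" for f g
    by (rule exI[of _ f], rule exI[of _ g]) (simp add: that)
  show ?thesis
  proof (rule smooth_upto[of ?P])
    show "smooth_span ?P (\<lambda>x. B (f x) (g x))"
      by (rule smooth_span.base, rule P[OF fg])
  next
    fix h x assume "?P h"
    then obtain f g where fg: "smooth f" "smooth g" and h: "h = (\<lambda>x. B (f x) (g x))" by blast
    show "h differentiable (at x)"
      unfolding h by (rule differentiableI[OF bounded_bilinear_has_derivative_smooth[OF B fg]])
  next
    fix h i assume "?P h"
    then obtain f g where fg: "smooth f" "smooth g" and h: "h = (\<lambda>x. B (f x) (g x))" by blast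
    have eq: "partial_deriv i h = (\<lambda>x. B (f x) (partial_deriv i g x) + B (partial_deriv i f x) (g x))"
      unfolding h
      by (rule ext, subst partial_deriv_eqI[OF bounded_bilinear_has_derivative_smooth[OF B fg]])
        (simp add: partial_deriv_def)
    show "smooth_span ?P (partial_deriv i h)"
      unfolding eq by (intro smooth_span.add; rule smooth_span.base, rule P)
        (rule fg smooth_partial_deriv)+
  qed
qed

lemma left_inv_deriv_bilinear:
  assumes "bounded_bilinear B" "smooth f" "smooth g"
  shows "\<X> i (\<lambda>x. B (f x) (g x)) = (\<lambda>x. B (f x) (\<X> i g x) + B (\<X> i f x) (g x))"
  unfolding left_inv_deriv_def
  by (rule ext, subst frechet_derivative_eqI[OF bounded_bilinear_has_derivative_smooth[OF assms]]) (rule refl)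

lemma smooth_wedge_top: "smooth \<alpha> \<Longrightarrow> smooth \<eta> \<Longrightarrow> smooth (\<lambda>x. (\<alpha> x \<and>\<and> \<eta> x) $ UNIV)"
  by (intro smooth_nth smooth_bilinear[OF bounded_bilinear_wedge])

lemma wedge_integrable:
  assumes "smooth \<alpha>" "smooth \<eta>" "bounded {x. \<alpha> x \<noteq> 0} \<or> bounded {x. \<eta> x \<noteq> 0}"
  shows "integrable lborel (\<lambda>x. (\<alpha> x \<and>\<and> \<eta> x) $ UNIV)"
proof (rule integrable_bounded_support)
  show "continuous_on UNIV (\<lambda>x. (\<alpha> x \<and>\<and> \<eta> x) $ UNIV)"
    by (intro smooth_continuous_on smooth_wedge_top assms)
  have "{x. (\<alpha> x \<and>\<and> \<eta> x) $ UNIV \<noteq> 0} \<subseteq> {x. \<alpha> x \<noteq> 0} \<inter> {x. \<eta> x \<noteq> 0}"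
    by (auto simp: wedge.zero_left wedge.zero_right)
  then show "bounded {x. (\<alpha> x \<and>\<and> \<eta> x) $ UNIV \<noteq> 0}"
    using assms(3) bounded_subset by blast
qed

definition form_pairing :: "form \<Rightarrow> form \<Rightarrow> real" where
  "form_pairing \<alpha> \<eta> = form_integral (\<lambda>x. \<alpha> x \<and>\<and> \<eta> x)"

lemma grading_homogeneous:
  assumes "\<alpha> \<in> Omega p k"
  shows "grading (\<alpha> x) = ((- 1) powi k) *\<^sub>R \<alpha> x"
proof -
  have "(- 1) ^ card I * \<alpha> x $ I = (- 1) powi k * \<alpha> x $ I" for I
  proof (cases "\<alpha> x $ I = 0")
    case False
    then have "k = int (card I)" using assms by (auto simp: Omega_def)
    then show ?thesis by simp
  qed simp
  then show ?thesis by (simp add: covector_eq_iff grading_def)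
qed

text \<open>Each component d_m can be integrated by parts separately. For m > 0 the integral of X_i
  applied to the top coefficient of theta_i \<and> \<alpha> \<and> \<eta> vanishes, and moving
  theta_i past \<alpha> gives the sign; for m = 0 the identity is pointwise.\<close>

lemma stokes:
  assumes \<alpha>: "\<alpha> \<in> Omega p k" and \<eta>: "smooth \<eta>"
    and bd: "bounded {x. \<alpha> x \<noteq> 0} \<or> bounded {x. \<eta> x \<noteq> 0}"
  shows "form_pairing (dd m \<alpha>) \<eta> = (- 1) powi (k + 1) * form_pairing \<alpha> (dd m \<eta>)"
proof -
  have s: "smooth \<alpha>" using \<alpha> by (simp add: Omega_def)
  have sign: "(- 1 :: real) powi (k + 1) = - ((- 1) powi k)"
    by (simp add: power_int_add)
  have gr: "(grading (\<alpha> x) \<and>\<and> b) $ UNIV = (- 1) powi k * (\<alpha> x \<and>\<and> b) $ UNIV" for x b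
    by (simp add: grading_homogeneous[OF \<alpha>] wedge.scaleR_left)
  show ?thesis
  proof (cases "m = 0")
    case True
    then show ?thesis
      by (simp add: form_pairing_def form_integral_def dd_eq d_left_inv_top gr sign)
  next
    case False
    have 1: "(LINT x|lborel. ((theta i \<and>\<and> \<X> i \<alpha> x) \<and>\<and> \<eta> x) $ UNIV) =
        (- 1) powi (k + 1) * (LINT x|lborel. (\<alpha> x \<and>\<and> (theta i \<and>\<and> \<X> i \<eta> x)) $ UNIV)" 
      "integrable lborel (\<lambda>x. ((theta i \<and>\<and> \<X> i \<alpha> x) \<and>\<and> \<eta> x) $ UNIV)"
      "integrable lborel (\<lambda>x. (\<alpha> x \<and>\<and> (theta i \<and>\<and> \<X> i \<eta> x)) $ UNIV)" for i
    proof -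
      let ?a = "\<lambda>x. theta i \<and>\<and> \<alpha> x"
      have sa: "smooth ?a" by (rule smooth_linear[OF wedge.bounded_linear_right s])
      have ba: "bounded {x. ?a x \<noteq> 0} \<or> bounded {x. \<eta> x \<noteq> 0}"
      proof -
        have "{x. ?a x \<noteq> 0} \<subseteq> {x. \<alpha> x \<noteq> 0}" by (auto simp: wedge.zero_right)
        then show ?thesis using bd bounded_subset by blast
      qed
      have b1: "bounded {x. \<X> i ?a x \<noteq> 0} \<or> bounded {x. \<eta> x \<noteq> 0}"
        "bounded {x. ?a x \<noteq> 0} \<or> bounded {x. \<X> i \<eta> x \<noteq> 0}"
        using ba bounded_left_inv_deriv[of ?a i] bounded_left_inv_deriv[of \<eta> i] by blast+
      have i: "integrable lborel (\<lambda>x. (\<X> i ?a x \<and>\<and> \<eta> x) $ UNIV)"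
        "integrable lborel (\<lambda>x. (?a x \<and>\<and> \<X> i \<eta> x) $ UNIV)"
        by (intro wedge_integrable smooth_left_inv_deriv sa \<eta> b1)+
      have "\<X> i (\<lambda>x. (?a x \<and>\<and> \<eta> x) $ UNIV) = (\<lambda>x. (?a x \<and>\<and> \<X> i \<eta> x) $ UNIV + (\<X> i ?a x \<and>\<and> \<eta> x) $ UNIV)"
        by (subst left_inv_deriv_linear[OF bounded_linear_vec_nth smooth_bilinear[OF bounded_bilinear_wedge sa \<eta>]])
          (simp add: left_inv_deriv_bilinear[OF bounded_bilinear_wedge sa \<eta>])
      moreover have "(LINT x|lborel. \<X> i (\<lambda>x. (?a x \<and>\<and> \<eta> x) $ UNIV) x) = 0"
      proof (rule integral_left_inv_deriv_eq_0[OF smooth_wedge_top[OF sa \<eta>]])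
        have "{x. (?a x \<and>\<and> \<eta> x) $ UNIV \<noteq> 0} \<subseteq> {x. ?a x \<noteq> 0} \<inter> {x. \<eta> x \<noteq> 0}"
          by (auto simp: wedge.zero_left wedge.zero_right)
        then show "bounded {x. (?a x \<and>\<and> \<eta> x) $ UNIV \<noteq> 0}"
          using ba bounded_subset by blast
      qed
      ultimately have eq: "(LINT x|lborel. (\<X> i ?a x \<and>\<and> \<eta> x) $ UNIV) = - (LINT x|lborel. (?a x \<and>\<and> \<X> i \<eta> x) $ UNIV)"
        using i by simp
      have r: "(?a x \<and>\<and> \<X> i \<eta> x) $ UNIV = (- 1) powi k * (\<alpha> x \<and>\<and> (theta i \<and>\<and> \<X> i \<eta> x)) $ UNIV" for x
        by (simp add: theta_wedge_top gr)
      show "(LINT x|lborel. ((theta i \<and>\<and> \<X> i \<alpha> x) \<and>\<and> \<eta> x) $ UNIV) =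
        (- 1) powi (k + 1) * (LINT x|lborel. (\<alpha> x \<and>\<and> (theta i \<and>\<and> \<X> i \<eta> x)) $ UNIV)"
        using eq by (simp add: left_inv_deriv_theta_wedge[OF s] r sign)
      show "integrable lborel (\<lambda>x. ((theta i \<and>\<and> \<X> i \<alpha> x) \<and>\<and> \<eta> x) $ UNIV)"
        using i(1) by (simp add: left_inv_deriv_theta_wedge[OF s])
      show "integrable lborel (\<lambda>x. (\<alpha> x \<and>\<and> (theta i \<and>\<and> \<X> i \<eta> x)) $ UNIV)"
        using i(2) unfolding r by simp
    qed
    have dd: "dd m \<omega> x = (\<Sum>i | weight i = m. theta i \<and>\<and> \<X> i \<omega> x)" for \<omega> x
      using False by (simp add: dd_def left_inv_deriv_def)
    show ?thesis
      unfolding form_pairing_def form_integral_def dd wedge.sum_left wedge.sum_right sum_component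
      by (simp add: 1 Bochner_Integration.integral_sum sum_distrib_left)
  qed
qed

section \<open>Quotient spaces\<close>

lemma mem_coset_iff: "x \<in> y +o B \<longleftrightarrow> x - y \<in> B" for x y :: "'a::ab_group_add"
proof
  assume "x - y \<in> B"
  then show "x \<in> y +o B" unfolding elt_set_plus_def by (auto intro!: bexI[of _ "x - y"])
qed (auto simp: elt_set_plus_def)

lemma coset_eq_iff:
  assumes B: "subspace B"
  shows "x +o B = y +o B \<longleftrightarrow> x - y \<in> B"
proof
  assume "x +o B = y +o B"
  moreover have "x \<in> x +o B" using subspace_0[OF B] by (force simp: elt_set_plus_def)
  ultimately obtain b where "b \<in> B" "x = y + b" by (auto simp: elt_set_plus_def)
  then show "x - y \<in> B" by simp
next
  assume xy: "x - y \<in> B"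
  have "u +o B \<subseteq> v +o B" if "u - v \<in> B" for u v
  proof
    fix z assume "z \<in> u +o B"
    then obtain b where "b \<in> B" "z = u + b" by (auto simp: elt_set_plus_def)
    then have "z - v = (u - v) + b" "(u - v) + b \<in> B"
      using subspace_add[OF B that] by auto
    then show "z \<in> v +o B" by (simp only: mem_coset_iff)
  qed
  moreover have "y - x \<in> B" using subspace_neg[OF B xy] by simp
  ultimately show "x +o B = y +o B" using xy by blast
qed

lemma coset_add:
  assumes B: "subspace B"
  shows "(x +o B) + (y +o B) = (x + y) +o B"
proof -
  have "B + B = B"
  proof
    show "B + B \<subseteq> B" using subspace_add[OF B] by (auto simp: set_plus_def)
    show "B \<subseteq> B + B" using subspace_0[OF B] by (force simp: set_plus_def)
  qed
  then show ?thesis by (simp add: set_plus_rearrange)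
qed

lemma coset_scale:
  assumes B: "subspace B"
  shows "(*\<^sub>R) c ` (x +o B) + B = (c *\<^sub>R x) +o B"
proof
  show "(*\<^sub>R) c ` (x +o B) + B \<subseteq> (c *\<^sub>R x) +o B"
  proof
    fix z assume "z \<in> (*\<^sub>R) c ` (x +o B) + B"
    then obtain b b' where b: "b \<in> B" "b' \<in> B" and z: "z = c *\<^sub>R (x + b) + b'"
      by (auto simp: set_plus_def elt_set_plus_def)
    have "z = c *\<^sub>R x + (c *\<^sub>R b + b')" by (simp add: z scaleR_add_right add.assoc)
    moreover have "c *\<^sub>R b + b' \<in> B" by (intro subspace_add[OF B] subspace_scale[OF B] b)
    ultimately show "z \<in> (c *\<^sub>R x) +o B" by (auto simp: elt_set_plus_def)
  qed
  show "(c *\<^sub>R x) +o B \<subseteq> (*\<^sub>R) c ` (x +o B) + B"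
  proof
    fix z assume "z \<in> (c *\<^sub>R x) +o B"
    then obtain b where "b \<in> B" "z = c *\<^sub>R (x + 0) + b" by (auto simp: elt_set_plus_def)
    then show "z \<in> (*\<^sub>R) c ` (x +o B) + B"
      using subspace_0[OF B] by (auto simp: set_plus_def elt_set_plus_def)
  qed
qed

section \<open>Spectral complexes\<close>

text \<open>A family \<open>w\<close> of homogeneous components stands for the inhomogeneous form \<open>\<Sum>\<^sub>q w q\<close>, and
  \<open>total_diff w q\<close> is the component of weight \<open>q\<close> of its exterior differential. A cycle of weight
  \<open>p\<close> is the lowest component of a form whose differential starts in weight \<open>p + r\<close>, and
  \<open>\<Delta>\<^sub>r\<close> takes that first component of the differential.\<close>

definition total_diff :: "(int \<Rightarrow> form) \<Rightarrow> int \<Rightarrow> form" where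
  "total_diff w q = dd 0 (w q) + dd 1 (w (q - 1)) + dd 2 (w (q - 2)) + dd 3 (w (q - 3))"

lemma dd_zero [simp]: "dd m 0 = 0"
  using dd_scaleR[of "0::form" m 0] smooth_const[of "0::covector"] by (simp add: zero_fun_def[symmetric])

lemma dd_large [simp]: "m > 3 \<Longrightarrow> dd m \<omega> = 0"
  by (simp add: dd_eq zero_fun_def)

lemma smooth_plus: "smooth \<omega> \<Longrightarrow> smooth \<eta> \<Longrightarrow> smooth (\<omega> + \<eta>)"
  unfolding plus_fun_def by (rule smooth_add)

lemma smooth_scale: "smooth \<omega> \<Longrightarrow> smooth (c *\<^sub>R \<omega>)"
  unfolding scaleR_fun_def by (rule smooth_linear[OF bounded_linear_scaleR_right])

lemma total_diff_add:
  "(\<And>q. smooth (w q)) \<Longrightarrow> (\<And>q. smooth (v q)) \<Longrightarrow>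
    total_diff (\<lambda>q. w q + v q) q = total_diff w q + total_diff v q"
  by (simp add: total_diff_def dd_add)

lemma total_diff_scaleR:
  "(\<And>q. smooth (w q)) \<Longrightarrow> total_diff (\<lambda>q. c *\<^sub>R w q) q = c *\<^sub>R total_diff w q"
  by (simp add: total_diff_def dd_scaleR scaleR_add_right)

lemma dd_minus: "smooth \<omega> \<Longrightarrow> dd m (- \<omega>) = - dd m \<omega>"
  using dd_scaleR[of \<omega> m "- 1"] by simp

lemma total_diff_diff:
  assumes "\<And>q. smooth (w q)" "\<And>q. smooth (v q)"
  shows "total_diff (\<lambda>q. w q - v q) q = total_diff w q - total_diff v q"
proof -
  have "smooth (- v q)" for q
    using smooth_scale[OF assms(2)[of q], of "- 1"] by simp
  then have "dd m (w q - v q) = dd m (w q) - dd m (v q)" for m q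
    using dd_add[of "w q" "- v q" m] assms dd_minus[of "v q" m] by simp
  then show ?thesis by (simp add: total_diff_def)
qed

text \<open>The sixteen compositions, grouped by the weight they add, are the seven identities of
  \<open>dd_dd\<close>.\<close>

lemma total_diff_total_diff:
  assumes s: "\<And>q. smooth (w q)"
  shows "total_diff (total_diff w) q = 0"
proof -
  note d = dd_dd[OF s]
  have "total_diff (total_diff w) q =
    dd 0 (dd 0 (w q)) +
    (dd 0 (dd 1 (w (q - 1))) + dd 1 (dd 0 (w (q - 1)))) +
    (dd 0 (dd 2 (w (q - 2))) + dd 1 (dd 1 (w (q - 2))) + dd 2 (dd 0 (w (q - 2)))) +
    (dd 0 (dd 3 (w (q - 3))) + dd 1 (dd 2 (w (q - 3))) + dd 2 (dd 1 (w (q - 3))) + dd 3 (dd 0 (w (q - 3)))) +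
    (dd 1 (dd 3 (w (q - 4))) + dd 2 (dd 2 (w (q - 4))) + dd 3 (dd 1 (w (q - 4)))) +
    (dd 2 (dd 3 (w (q - 5))) + dd 3 (dd 2 (w (q - 5)))) +
    dd 3 (dd 3 (w (q - 6)))"
    unfolding total_diff_def by (simp add: dd_add smooth_plus smooth_dd s ac_simps)
  also have "\<dots> = 0" unfolding d by simp
  finally show ?thesis .
qed

text \<open>Passes from the fixed four terms to the index ranges in the definitions of cycles and
  boundaries: indices above 3 contribute nothing because d_i = 0, the missing ones because
  \<open>w\<close> vanishes there.\<close>

lemma total_diff_eq_sum:
  assumes "finite S" "\<And>i. i < 4 \<Longrightarrow> i \<notin> S \<Longrightarrow> w (q - int i) = 0"
  shows "total_diff w q = (\<Sum>i\<in>S. dd i (w (q - int i)))"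
proof -
  have "total_diff w q = (\<Sum>i\<in>{0, 1, 2, 3}. dd i (w (q - int i)))"
    by (simp add: total_diff_def add_ac)
  also have "\<dots> = (\<Sum>i\<in>S \<union> {0, 1, 2, 3}. dd i (w (q - int i)))"
    using assms(1) by (intro sum.mono_neutral_left) auto
  also have "\<dots> = (\<Sum>i\<in>S. dd i (w (q - int i)))"
  proof (rule sum.mono_neutral_right)
    show "\<forall>i\<in>S \<union> {0, 1, 2, 3} - S. dd i (w (q - int i)) = 0"
    proof
      fix i assume "i \<in> S \<union> {0, 1, 2, 3} - S"
      then have "w (q - int i) = 0" by (intro assms(2)) auto
      then show "dd i (w (q - int i)) = 0" by simp
    qed
  qed (use assms(1) in auto)
  finally show ?thesis .
qed

text \<open>Everything that depends only on d is shown once and then used for smooth forms and for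
  test forms.\<close>

locale graded_forms =
  fixes \<O> :: "int \<Rightarrow> int \<Rightarrow> form set"
  assumes zero_mem: "0 \<in> \<O> p k"
    and add_mem: "\<omega> \<in> \<O> p k \<Longrightarrow> \<eta> \<in> \<O> p k \<Longrightarrow> \<omega> + \<eta> \<in> \<O> p k"
    and scaleR_mem: "\<omega> \<in> \<O> p k \<Longrightarrow> c *\<^sub>R \<omega> \<in> \<O> p k"
    and dd_mem: "\<omega> \<in> \<O> p k \<Longrightarrow> dd m \<omega> \<in> \<O> (p + int m) (k + 1)"
    and smooth_mem: "\<omega> \<in> \<O> p k \<Longrightarrow> smooth \<omega>"
begin

lemma minus_mem: "\<omega> \<in> \<O> p k \<Longrightarrow> - \<omega> \<in> \<O> p k"
  using scaleR_mem[of \<omega> p k "- 1"] by simp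

lemma diff_mem: "\<omega> \<in> \<O> p k \<Longrightarrow> \<eta> \<in> \<O> p k \<Longrightarrow> \<omega> - \<eta> \<in> \<O> p k"
  using add_mem[of \<omega> p k "- \<eta>"] minus_mem by simp

lemma total_diff_mem:
  assumes "\<And>q. w q \<in> \<O> q k"
  shows "total_diff w q \<in> \<O> q (k + 1)"
  unfolding total_diff_def
  using dd_mem[OF assms[of q], of 0] dd_mem[OF assms[of "q - 1"], of 1]
    dd_mem[OF assms[of "q - 2"], of 2] dd_mem[OF assms[of "q - 3"], of 3]
  by (intro add_mem) simp_all

text \<open>Components of weight p + r and above are left free. Their choice alters the first
  component of the differential only by d_0 of a form, and the freedom lets any total differential
  serve as a lift. The auxiliary forms are the negatives of the higher components.\<close>

definition cycle_lift :: "nat \<Rightarrow> int \<Rightarrow> int \<Rightarrow> (int \<Rightarrow> form) \<Rightarrow> bool" where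
  "cycle_lift r p k w \<longleftrightarrow> (\<forall>q. w q \<in> \<O> q k) \<and> (\<forall>q<p. w q = 0) \<and> (\<forall>q<p + int r. total_diff w q = 0)"

text \<open>Here the components must stop at \<open>p\<close>, so that no further terms enter the
  differential in weight \<open>p\<close>; the \<open>r\<close> weights up to \<open>p\<close>
  correspond to the auxiliary forms.\<close>

definition boundary_lift :: "nat \<Rightarrow> int \<Rightarrow> int \<Rightarrow> (int \<Rightarrow> form) \<Rightarrow> bool" where
  "boundary_lift r p k c \<longleftrightarrow> (\<forall>q. c q \<in> \<O> q (k - 1)) \<and> (\<forall>q>p. c q = 0) \<and> (\<forall>q\<le>p - int r. c q = 0) \<and>
     (\<forall>q<p. total_diff c q = 0)"

lemma cycle_lift_smooth: "cycle_lift r p k w \<Longrightarrow> smooth (w q)"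
  and boundary_lift_smooth: "boundary_lift r p k c \<Longrightarrow> smooth (c q)"
  unfolding cycle_lift_def boundary_lift_def using smooth_mem by blast+

text \<open>The lift is cut off at weight p + r, so that its differential there is exactly the
  expression defining the spectral differential.\<close>

lemma cycle_aux_lift:
  assumes \<alpha>: "\<alpha> \<in> \<O> p k" "dd 0 \<alpha> = 0" and z: "cycle_aux \<O> r p k \<alpha> z" and r: "r \<ge> 1"
  obtains w where "cycle_lift r p k w" "w p = \<alpha>"
    "total_diff w (p + int r) = dd r \<alpha> - (\<Sum>i\<in>{1..<r}. dd i (z (r - i)))"
proof -
  define w where "w q = (if q = p then \<alpha> else if p < q \<and> q < p + int r then - z (nat (q - p)) else 0)" for q
  have wp: "w p = \<alpha>" "w (p + int j) = - z j" if "1 \<le> j" "j < r" for j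
    using that by (auto simp: w_def)
  have w0: "w p = \<alpha>" "w (p + int r) = 0" "\<And>q. q < p \<Longrightarrow> w q = 0" using r by (auto simp: w_def)
  have zm: "z j \<in> \<O> (p + int j) k" if "1 \<le> j" "j < r" for j
    using z that by (auto simp: cycle_aux_def)
  have neg: "dd i (- z j) = - dd i (z j)" if "1 \<le> j" "j < r" for i j
    using dd_scaleR[OF smooth_mem[OF zm[OF that]], of i "- 1"] by simp
  have wO: "w q \<in> \<O> q k" for q
  proof (cases "p < q \<and> q < p + int r")
    case True
    have "z (nat (q - p)) \<in> \<O> (p + int (nat (q - p))) k"
      by (rule zm) (use True in auto)
    with True show ?thesis by (simp add: minus_mem w_def)
  next
    case False
    then show ?thesis using \<alpha> zero_mem by (auto simp: w_def)
  qed
  have td: "total_diff w (p + int m) = dd m \<alpha> + (\<Sum>i<m. dd i (w (p + int m - int i)))" for m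
  proof -
    have "total_diff w (p + int m) = (\<Sum>i\<in>insert m {..<m}. dd i (w (p + int m - int i)))"
      by (rule total_diff_eq_sum) (auto simp: w_def)
    then show ?thesis by (simp add: w0)
  qed
  have "total_diff w q = 0" if q: "q < p + int r" for q
  proof (cases "q < p")
    case True
    then show ?thesis by (simp add: total_diff_def w_def)
  next
    case False
    then obtain m where m: "q = p + int m" "m < r"
      using q by (metis add_diff_cancel_left' add_less_cancel_left diff_add_cancel le_add_diff_inverse
          linorder_not_less of_nat_less_iff zle_iff_zadd)
    show ?thesis
    proof (cases "m = 0")
      case True
      then show ?thesis unfolding m td using \<alpha> by simp
    next
      case False
      then have "dd m \<alpha> = (\<Sum>i<m. dd i (z (m - i)))"
        using z m by (auto simp: cycle_aux_def)
      moreover have "(\<Sum>i<m. dd i (w (p + int m - int i))) = (\<Sum>i<m. - dd i (z (m - i)))"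
      proof (rule sum.cong)
        fix i assume "i \<in> {..<m}"
        then have i: "1 \<le> m - i" "m - i < r" "p + int m - int i = p + int (m - i)" using m by auto
        show "dd i (w (p + int m - int i)) = - dd i (z (m - i))"
          unfolding i(3) wp(2)[OF i(1,2)] neg[OF i(1,2)] ..
      qed simp
      ultimately show ?thesis unfolding m td by (simp add: sum_negf)
    qed
  qed
  then have lift: "cycle_lift r p k w" using wO w0 by (simp add: cycle_lift_def)
  have "(\<Sum>i<r. dd i (w (p + int r - int i))) = (\<Sum>i\<in>{1..<r}. dd i (w (p + int r - int i)))"
    using w0 by (intro sum.mono_neutral_right) (auto simp: not_le)
  also have "\<dots> = (\<Sum>i\<in>{1..<r}. - dd i (z (r - i)))"
  proof (rule sum.cong)
    fix i assume "i \<in> {1..<r}"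
    then have i: "1 \<le> r - i" "r - i < r" "p + int r - int i = p + int (r - i)" by auto
    show "dd i (w (p + int r - int i)) = - dd i (z (r - i))"
      unfolding i(3) wp(2)[OF i(1,2)] neg[OF i(1,2)] ..
  qed simp
  finally have "total_diff w (p + int r) = dd r \<alpha> - (\<Sum>i\<in>{1..<r}. dd i (z (r - i)))"
    unfolding td by (simp add: sum_negf)
  with lift w0(1) that show ?thesis by blast
qed

lemma cycle_lift_aux:
  assumes w: "cycle_lift r p k w" and r: "r \<ge> 1"
  shows "w p \<in> \<O> p k" "dd 0 (w p) = 0" "cycle_aux \<O> r p k (w p) (\<lambda>j. - w (p + int j))"
proof -
  have wO: "\<And>q. w q \<in> \<O> q k" and w0: "\<And>q. q < p \<Longrightarrow> w q = 0" and
    t0: "\<And>q. q < p + int r \<Longrightarrow> total_diff w q = 0" using w by (auto simp: cycle_lift_def)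
  have td: "total_diff w (p + int m) = dd m (w p) + (\<Sum>i<m. dd i (w (p + int (m - i))))" for m
  proof -
    have "total_diff w (p + int m) = (\<Sum>i\<in>insert m {..<m}. dd i (w (p + int m - int i)))"
      by (rule total_diff_eq_sum) (auto intro: w0)
    also have "\<dots> = dd m (w p) + (\<Sum>i<m. dd i (w (p + int m - int i)))" by simp
    also have "(\<Sum>i<m. dd i (w (p + int m - int i))) = (\<Sum>i<m. dd i (w (p + int (m - i))))"
      by (rule sum.cong) (auto simp: of_nat_diff algebra_simps)
    finally show ?thesis .
  qed
  show "w p \<in> \<O> p k" by (rule wO)
  show "dd 0 (w p) = 0" using td[of 0] t0[of p] r by simp
  have neg: "dd i (- w q) = - dd i (w q)" for i q
    using dd_scaleR[OF smooth_mem[OF wO], of i "- 1" q] by simp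
  show "cycle_aux \<O> r p k (w p) (\<lambda>j. - w (p + int j))"
    unfolding cycle_aux_def
  proof (intro conjI ballI)
    fix m assume "m \<in> {1..<r}"
    then have "dd m (w p) + (\<Sum>i<m. dd i (w (p + int (m - i)))) = 0"
      using td[of m] t0[of "p + int m"] by simp
    then show "dd m (w p) = (\<Sum>i<m. dd i (- w (p + int (m - i))))"
      unfolding neg sum_negf by (simp add: eq_neg_iff_add_eq_0)
  qed (rule minus_mem[OF wO])
qed

lemma cycles_iff_lift:
  assumes "r \<ge> 1"
  shows "\<alpha> \<in> cycles \<O> r p k \<longleftrightarrow> (\<exists>w. cycle_lift r p k w \<and> w p = \<alpha>)"
proof
  assume "\<alpha> \<in> cycles \<O> r p k"
  then obtain z where "\<alpha> \<in> \<O> p k" "dd 0 \<alpha> = 0" "cycle_aux \<O> r p k \<alpha> z" by (auto simp: cycles_def)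
  then show "\<exists>w. cycle_lift r p k w \<and> w p = \<alpha>" using cycle_aux_lift assms by metis
next
  assume "\<exists>w. cycle_lift r p k w \<and> w p = \<alpha>"
  then show "\<alpha> \<in> cycles \<O> r p k" using cycle_lift_aux assms unfolding cycles_def by blast
qed

lemma boundaries_iff_lift:
  "\<alpha> \<in> boundaries \<O> r p k \<longleftrightarrow> (\<exists>c. boundary_lift r p k c \<and> total_diff c p = \<alpha>)"
proof
  assume "\<alpha> \<in> boundaries \<O> r p k"
  then obtain c where c': "\<forall>j<r. c j \<in> \<O> (p - int j) (k - 1)" "\<alpha> = (\<Sum>j<r. dd j (c j))"
    "\<forall>i\<in>{1..<r}. 0 = (\<Sum>j\<in>{i..<r}. dd (j - i) (c j))"
    unfolding boundaries_def by blast
  note c = c'(1)[rule_format] c'(2) c'(3)[rule_format]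
  define w where "w q = (if p - int r < q \<and> q \<le> p then c (nat (p - q)) else 0)" for q
  have wO: "w q \<in> \<O> q (k - 1)" for q
  proof (cases "p - int r < q \<and> q \<le> p")
    case True
    then have "c (nat (p - q)) \<in> \<O> (p - int (nat (p - q))) (k - 1)" by (intro c) auto
    with True show ?thesis by (simp add: w_def)
  qed (auto simp: w_def zero_mem)
  have td: "total_diff w (p - int i) = (\<Sum>j\<in>{i..<r}. dd (j - i) (c j))" for i
  proof -
    have "total_diff w (p - int i) = (\<Sum>s\<in>{..<r - i}. dd s (w (p - int i - int s)))"
      by (rule total_diff_eq_sum) (auto simp: w_def)
    also have "\<dots> = (\<Sum>j\<in>{i..<r}. dd (j - i) (c j))"
      by (rule sum.reindex_bij_witness[of _ "\<lambda>j. j - i" "\<lambda>s. s + i"]) (auto simp: w_def nat_add_distrib add.commute)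
    finally show ?thesis .
  qed
  have "total_diff w q = 0" if "q < p" for q
  proof (cases "q \<le> p - int r")
    case True
    then show ?thesis by (simp add: total_diff_def w_def)
  next
    case False
    then have "nat (p - q) \<in> {1..<r}" "q = p - int (nat (p - q))" using that by auto
    then show ?thesis using td[of "nat (p - q)"] c(3) by metis
  qed
  moreover have "total_diff w p = \<alpha>"
    using td[of 0] c(2) by (simp add: atLeast0LessThan)
  ultimately show "\<exists>c. boundary_lift r p k c \<and> total_diff c p = \<alpha>"
    using wO by (intro exI[of _ w]) (auto simp: boundary_lift_def w_def)
next
  assume "\<exists>c. boundary_lift r p k c \<and> total_diff c p = \<alpha>"
  then obtain c where c: "boundary_lift r p k c" "total_diff c p = \<alpha>" by blast
  then have cO: "\<And>q. c q \<in> \<O> q (k - 1)" and c0: "\<And>q. q > p \<Longrightarrow> c q = 0" "\<And>q. q \<le> p - int r \<Longrightarrow> c q = 0"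
    and t0: "\<And>q. q < p \<Longrightarrow> total_diff c q = 0" by (auto simp: boundary_lift_def)
  have td: "total_diff c (p - int i) = (\<Sum>j\<in>{i..<r}. dd (j - i) (c (p - int j)))" for i
  proof -
    have "total_diff c (p - int i) = (\<Sum>s\<in>{..<r - i}. dd s (c (p - int i - int s)))"
      by (rule total_diff_eq_sum) (auto intro: c0)
    also have "\<dots> = (\<Sum>j\<in>{i..<r}. dd (j - i) (c (p - int j)))"
      by (rule sum.reindex_bij_witness[of _ "\<lambda>j. j - i" "\<lambda>s. s + i"]) (auto simp: algebra_simps)
    finally show ?thesis .
  qed
  have "\<alpha> \<in> \<O> p k" using total_diff_mem[OF cO, of p] c(2) by simp
  moreover have "\<alpha> = (\<Sum>j<r. dd j (c (p - int j)))"
    using td[of 0] c(2) by (simp add: atLeast0LessThan)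
  moreover have "0 = (\<Sum>j\<in>{i..<r}. dd (j - i) (c (p - int j)))" if "i \<in> {1..<r}" for i
    using td[of i] t0[of "p - int i"] that by simp
  ultimately show "\<alpha> \<in> boundaries \<O> r p k"
    unfolding boundaries_def using cO by (auto intro!: exI[of _ "\<lambda>j. c (p - int j)"])
qed

lemma cycle_lift_add:
  assumes "cycle_lift r p k w" "cycle_lift r p k v"
  shows "cycle_lift r p k (\<lambda>q. w q + v q)"
  using assms cycle_lift_smooth[OF assms(1)] cycle_lift_smooth[OF assms(2)]
  by (auto simp: cycle_lift_def total_diff_add intro: add_mem)

lemma cycle_lift_scaleR:
  assumes "cycle_lift r p k w"
  shows "cycle_lift r p k (\<lambda>q. c *\<^sub>R w q)"
  using assms cycle_lift_smooth[OF assms] by (auto simp: cycle_lift_def total_diff_scaleR intro: scaleR_mem)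

lemma boundary_lift_add:
  assumes "boundary_lift r p k w" "boundary_lift r p k v"
  shows "boundary_lift r p k (\<lambda>q. w q + v q)"
  using assms boundary_lift_smooth[OF assms(1)] boundary_lift_smooth[OF assms(2)]
  by (auto simp: boundary_lift_def total_diff_add intro: add_mem)

lemma boundary_lift_scaleR:
  assumes "boundary_lift r p k w"
  shows "boundary_lift r p k (\<lambda>q. c *\<^sub>R w q)"
  using assms boundary_lift_smooth[OF assms] by (auto simp: boundary_lift_def total_diff_scaleR intro: scaleR_mem)

lemma subspace_boundaries: "subspace (boundaries \<O> r p k)"
  unfolding subspace_def boundaries_iff_lift
proof (intro conjI ballI allI)
  have "boundary_lift r p k (\<lambda>q. 0)" by (simp add: boundary_lift_def zero_mem total_diff_def)
  then show "\<exists>c. boundary_lift r p k c \<and> total_diff c p = 0" by (force simp: total_diff_def)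
next
  fix x y assume "x \<in> boundaries \<O> r p k" "y \<in> boundaries \<O> r p k"
  then obtain c c' where "boundary_lift r p k c" "total_diff c p = x" "boundary_lift r p k c'" "total_diff c' p = y"
    unfolding boundaries_iff_lift by blast
  then show "\<exists>c. boundary_lift r p k c \<and> total_diff c p = x + y"
    using boundary_lift_add boundary_lift_smooth by (intro exI[of _ "\<lambda>q. c q + c' q"]) (simp add: total_diff_add)
next
  fix a x assume "x \<in> boundaries \<O> r p k"
  then obtain c where "boundary_lift r p k c" "total_diff c p = x"
    unfolding boundaries_iff_lift by blast
  then show "\<exists>c. boundary_lift r p k c \<and> total_diff c p = a *\<^sub>R x"
    using boundary_lift_scaleR boundary_lift_smooth by (intro exI[of _ "\<lambda>q. a *\<^sub>R c q"]) (simp add: total_diff_scaleR)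
qed

text \<open>By d d = 0 the differential of a lift is closed in every weight; hence the value of a
  spectral differential is a cycle of every order m.\<close>

lemma total_diff_cycle_lift:
  assumes w: "cycle_lift r p k w"
  shows "cycle_lift m (p + int r) (k + 1) (total_diff w)"
  using w total_diff_mem total_diff_total_diff[of w] cycle_lift_smooth[OF w] by (auto simp: cycle_lift_def)

lemma boundary_lift_cycle_lift:
  assumes "boundary_lift l p k c"
  shows "cycle_lift m p k (total_diff c)"
  using assms total_diff_mem[of c "k - 1"] total_diff_total_diff[of c] boundary_lift_smooth[OF assms]
  by (auto simp: cycle_lift_def boundary_lift_def)

lemma boundaries_subset_cycles: "r \<ge> 1 \<Longrightarrow> boundaries \<O> l p k \<subseteq> cycles \<O> r p k"
  unfolding boundaries_iff_lift cycles_iff_lift subset_iff using boundary_lift_cycle_lift by metis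

lemma subspace_cycles: 
  assumes r: "r \<ge> 1"
  shows "subspace (cycles \<O> r p k)"
  unfolding subspace_def cycles_iff_lift[OF r]
proof (intro conjI ballI allI)
  show "\<exists>w. cycle_lift r p k w \<and> w p = 0"
    by (intro exI[of _ "\<lambda>q. 0"]) (simp add: cycle_lift_def zero_mem total_diff_def)
next
  fix x y assume "x \<in> cycles \<O> r p k" "y \<in> cycles \<O> r p k"
  then obtain c c' where "cycle_lift r p k c" "c p = x" "cycle_lift r p k c'" "c' p = y"
    unfolding cycles_iff_lift[OF r] by blast
  then show "\<exists>c. cycle_lift r p k c \<and> c p = x + y"
    using cycle_lift_add by (intro exI[of _ "\<lambda>q. c q + c' q"]) simp
next
  fix a x assume "x \<in> cycles \<O> r p k"
  then obtain c where "cycle_lift r p k c" "c p = x"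
    unfolding cycles_iff_lift[OF r] by blast
  then show "\<exists>c. cycle_lift r p k c \<and> c p = a *\<^sub>R x"
    using cycle_lift_scaleR by (intro exI[of _ "\<lambda>q. a *\<^sub>R c q"]) simp
qed

text \<open>If the lowest component of \<open>v\<close> is that of a differential \<open>d c\<close>, then \<open>v - d c\<close>
  has the same differential as \<open>v\<close> but starts in a higher weight.\<close>

lemma total_diff_mem_boundaries:
  assumes v: "cycle_lift r p k v" and vp: "v p \<in> boundaries \<O> m p k"
  shows "total_diff v (p + int r) \<in> boundaries \<O> r (p + int r) (k + 1)"
proof -
  obtain c where c: "boundary_lift m p k c" "total_diff c p = v p"
    using vp by (auto simp: boundaries_iff_lift)
  define u where "u q = v q - total_diff c q" for q
  have c': "cycle_lift r p k (total_diff c)" by (rule boundary_lift_cycle_lift[OF c(1)])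
  have uO: "u q \<in> \<O> q k" for q
    using v c' by (auto simp: u_def cycle_lift_def intro: diff_mem)
  have u0: "u q = 0" if "q \<le> p" for q
    using that v c' c(2) by (cases "q = p") (auto simp: u_def cycle_lift_def)
  have tu: "total_diff u q = total_diff v q" for q
    unfolding u_def using cycle_lift_smooth[OF v] cycle_lift_smooth[OF c'] boundary_lift_smooth[OF c(1)]
    by (subst total_diff_diff) (auto simp: total_diff_total_diff)
  \<comment> \<open>A boundary lift may not extend above its top weight; cutting there leaves the
    differential unchanged in all weights up to p + r.\<close>
  define u' where "u' q = (if q \<le> p + int r then u q else 0)" for q
  have tu': "total_diff u' q = total_diff v q" if "q \<le> p + int r" for q
    using that tu[of q] by (simp add: total_diff_def u'_def)
  have "boundary_lift r (p + int r) (k + 1) u'"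
    using uO u0 v by (auto simp: boundary_lift_def tu' u'_def zero_mem cycle_lift_def)
  with tu'[of "p + int r"] show ?thesis
    by (auto simp: boundaries_iff_lift)
qed

text \<open>The spectral differential may be computed from any lift: the difference of two lifts of
  representatives of one class starts with a boundary, and \<open>total_diff_mem_boundaries\<close>
  absorbs its differential.\<close>

lemma spectral_diff_eq:
  assumes r: "r \<ge> 1" and w: "cycle_lift r p k w" and A: "A = w p +o boundaries \<O> m p k"
  shows "spectral_diff \<O> r p k A = total_diff w (p + int r) +o boundaries \<O> r (p + int r) (k + 1)"
proof -
  let ?B = "boundaries \<O> r (p + int r) (k + 1)"
  have eq: "(dd r \<alpha> - (\<Sum>i\<in>{1..<r}. dd i (z (r - i)))) +o ?B = total_diff w (p + int r) +o ?B"
    if \<alpha>: "\<alpha> \<in> A" and z: "cycle_aux \<O> r p k \<alpha> z" for \<alpha> z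
  proof -
    have \<alpha>B: "\<alpha> - w p \<in> boundaries \<O> m p k" using \<alpha> by (simp add: A mem_coset_iff)
    moreover have "w p \<in> cycles \<O> r p k" using w cycles_iff_lift[OF r] by blast
    ultimately have "w p + (\<alpha> - w p) \<in> cycles \<O> r p k"
      using boundaries_subset_cycles[OF r] subspace_cycles[OF r] by (blast intro: subspace_add)
    then have "\<alpha> \<in> \<O> p k" "dd 0 \<alpha> = 0" by (auto simp: cycles_def)
    then obtain w' where w': "cycle_lift r p k w'" "w' p = \<alpha>"
      "total_diff w' (p + int r) = dd r \<alpha> - (\<Sum>i\<in>{1..<r}. dd i (z (r - i)))"
      using cycle_aux_lift[OF _ _ z r] by blast
    define v where "v q = w' q - w q" for q
    have v: "cycle_lift r p k v"
      using cycle_lift_add[OF w'(1) cycle_lift_scaleR[OF w, of "- 1"]] by (simp add: v_def[abs_def])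
    have tv: "total_diff v q = total_diff w' q - total_diff w q" for q
      unfolding v_def by (rule total_diff_diff[OF cycle_lift_smooth[OF w'(1)] cycle_lift_smooth[OF w]])
    have "total_diff v (p + int r) \<in> ?B"
      by (rule total_diff_mem_boundaries[OF v, of m]) (use \<alpha>B w' in \<open>simp add: v_def\<close>)
    then show ?thesis
      using w'(3) by (simp add: coset_eq_iff[OF subspace_boundaries] tv)
  qed
  \<comment> \<open>The union in the definition consists of one coset only, and this choice shows
    that it is not an empty union.\<close>
  moreover have "w p \<in> A" using subspace_0[OF subspace_boundaries] by (simp add: A mem_coset_iff)
  moreover have "cycle_aux \<O> r p k (w p) (\<lambda>j. - w (p + int j))" by (rule cycle_lift_aux(3)[OF w r])
  ultimately show ?thesis
    unfolding spectral_diff_def by blast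
qed

lemma quotient_carE:
  assumes "r \<ge> 1" "A \<in> vcar (quotient_rspace (cycles \<O> r p k) (boundaries \<O> l p k))"
  obtains w where "cycle_lift r p k w" "A = w p +o boundaries \<O> l p k"
  using assms cycles_iff_lift[OF assms(1)] by (auto simp: quotient_rspace_def)

lemma spectral_diff_lin_map:
  assumes r: "r \<ge> 1" and m': "m' \<ge> 1"
  shows "lin_map (quotient_rspace (cycles \<O> r p k) (boundaries \<O> m p k))
    (quotient_rspace (cycles \<O> m' (p + int r) (k + 1)) (boundaries \<O> r (p + int r) (k + 1)))
    (spectral_diff \<O> r p k)"
  unfolding lin_map_def
proof (intro conjI ballI allI)
  let ?V = "quotient_rspace (cycles \<O> r p k) (boundaries \<O> m p k)"
  let ?W = "quotient_rspace (cycles \<O> m' (p + int r) (k + 1)) (boundaries \<O> r (p + int r) (k + 1))"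
  fix A assume "A \<in> vcar ?V"
  then obtain w where w: "cycle_lift r p k w" "A = w p +o boundaries \<O> m p k"
    by (rule quotient_carE[OF r])
  have "total_diff w (p + int r) \<in> cycles \<O> m' (p + int r) (k + 1)"
    unfolding cycles_iff_lift[OF m'] using total_diff_cycle_lift[OF w(1)] by blast
  then show "spectral_diff \<O> r p k A \<in> vcar ?W"
    unfolding spectral_diff_eq[OF r w] by (simp add: quotient_rspace_def)
  {
    fix A' assume "A' \<in> vcar ?V"
    then obtain w' where w': "cycle_lift r p k w'" "A' = w' p +o boundaries \<O> m p k"
      by (rule quotient_carE[OF r])
    have "vadd ?V A A' = (w p + w' p) +o boundaries \<O> m p k"
      by (simp add: quotient_rspace_def w(2) w'(2) coset_add[OF subspace_boundaries])
    note eq = spectral_diff_eq[OF r cycle_lift_add[OF w(1) w'(1)] this]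
    have td: "total_diff (\<lambda>q. w q + w' q) q = total_diff w q + total_diff w' q" for q
      by (rule total_diff_add[OF cycle_lift_smooth[OF w(1)] cycle_lift_smooth[OF w'(1)]])
    show "spectral_diff \<O> r p k (vadd ?V A A') = vadd ?W (spectral_diff \<O> r p k A) (spectral_diff \<O> r p k A')"
      unfolding eq td spectral_diff_eq[OF r w] spectral_diff_eq[OF r w']
      by (simp add: quotient_rspace_def coset_add[OF subspace_boundaries])
  }
  fix c
  have "vscale ?V c A = (c *\<^sub>R w p) +o boundaries \<O> m p k"
    by (simp add: quotient_rspace_def w(2) coset_scale[OF subspace_boundaries])
  note eq = spectral_diff_eq[OF r cycle_lift_scaleR[OF w(1)] this]
  have td: "total_diff (\<lambda>q. c *\<^sub>R w q) q = c *\<^sub>R total_diff w q" for q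
    by (rule total_diff_scaleR[OF cycle_lift_smooth[OF w(1)]])
  show "spectral_diff \<O> r p k (vscale ?V c A) = vscale ?W c (spectral_diff \<O> r p k A)"
    unfolding eq td spectral_diff_eq[OF r w]
    by (simp add: quotient_rspace_def coset_scale[OF subspace_boundaries])
qed

text \<open>The differential of a lift is itself a lift of the next class, and its own differential
  is zero.\<close>

lemma spectral_diff_spectral_diff:
  assumes r: "r \<ge> 1" and r': "r' \<ge> 1"
    and A: "A \<in> vcar (quotient_rspace (cycles \<O> r p k) (boundaries \<O> m p k))"
  shows "spectral_diff \<O> r' (p + int r) (k + 1) (spectral_diff \<O> r p k A) =
    boundaries \<O> r' (p + int r + int r') (k + 1 + 1)"
proof -
  obtain w where w: "cycle_lift r p k w" "A = w p +o boundaries \<O> m p k"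
    using A by (rule quotient_carE[OF r])
  have "total_diff (total_diff w) q = 0" for q
    by (rule total_diff_total_diff[OF cycle_lift_smooth[OF w(1)]])
  then show ?thesis
    using spectral_diff_eq[OF r' total_diff_cycle_lift[OF w(1)] spectral_diff_eq[OF r w]] by simp
qed

end

lemma Omega_smooth: "\<omega> \<in> Omega p k \<Longrightarrow> smooth \<omega>"
  by (simp add: Omega_def)

lemma Omega_c_Omega: "\<omega> \<in> Omega_c p k \<Longrightarrow> \<omega> \<in> Omega p k"
  by (simp add: Omega_c_def)

interpretation Omega: graded_forms Omega
  by unfold_locales (erule Omega_add Omega_scaleR Omega_dd Omega_smooth | rule Omega_zero | assumption)+

interpretation Omega_c: graded_forms Omega_c
  by unfold_locales
    (erule Omega_c_add Omega_c_scaleR Omega_c_dd Omega_smooth[OF Omega_c_Omega] | rule Omega_c_zero | assumption)+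

section \<open>The pairing\<close>

lemma Omega_c_bounded: "\<eta> \<in> Omega_c p k \<Longrightarrow> bounded {x. \<eta> x \<noteq> 0}"
  by (simp add: Omega_c_iff)

lemma form_pairing_add_left:
  assumes "smooth \<alpha>" "smooth \<beta>" "smooth \<eta>" "bounded {x. \<eta> x \<noteq> 0}"
  shows "form_pairing (\<alpha> + \<beta>) \<eta> = form_pairing \<alpha> \<eta> + form_pairing \<beta> \<eta>"
  using wedge_integrable[of \<alpha> \<eta>] wedge_integrable[of \<beta> \<eta>] assms
  by (simp add: form_pairing_def form_integral_def wedge.add_left)

lemma form_pairing_add_right:
  assumes "smooth \<alpha>" "smooth \<eta>" "bounded {x. \<eta> x \<noteq> 0}" "smooth \<eta>'" "bounded {x. \<eta>' x \<noteq> 0}"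
  shows "form_pairing \<alpha> (\<eta> + \<eta>') = form_pairing \<alpha> \<eta> + form_pairing \<alpha> \<eta>'"
  using wedge_integrable[of \<alpha> \<eta>] wedge_integrable[of \<alpha> \<eta>'] assms
  by (simp add: form_pairing_def form_integral_def wedge.add_right)

lemma form_pairing_scaleR_left: "form_pairing (c *\<^sub>R \<alpha>) \<eta> = c * form_pairing \<alpha> \<eta>"
  by (simp add: form_pairing_def form_integral_def wedge.scaleR_left)

lemma form_pairing_scaleR_right: "form_pairing \<alpha> (c *\<^sub>R \<eta>) = c * form_pairing \<alpha> \<eta>"
  by (simp add: form_pairing_def form_integral_def wedge.scaleR_right)

lemma form_pairing_zero [simp]: "form_pairing 0 \<eta> = 0" "form_pairing \<alpha> 0 = 0"
  using form_pairing_scaleR_left[of 0] form_pairing_scaleR_right[of _ 0] by simp_all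

lemma Omega_range:
  assumes "\<omega> \<in> Omega p k" "p < 0 \<or> p > 7"
  shows "\<omega> = 0"
proof -
  have "\<omega> x $ I = 0" for x I
  proof (rule ccontr)
    assume "\<omega> x $ I \<noteq> 0"
    then have p: "int (\<Sum>i\<in>I. weight i) = p" using assms(1) by (auto simp: Omega_def)
    have "(\<Sum>i\<in>I. weight i) \<le> (\<Sum>i\<in>UNIV. weight i)" by (rule sum_mono2) auto
    also have "\<dots> = 7" by (simp add: sum_4 weight_def)
    finally show False using p assms(2) by linarith
  qed
  then show ?thesis by (simp add: fun_eq_iff covector_eq_iff)
qed

text \<open>All nonzero terms of these sums have \<open>0 \<le> q \<le> 7\<close>; the larger range makes shifting harmless.\<close>

lemma total_stokes:
  assumes v: "\<And>q. v q \<in> Omega q k" and w: "\<And>q. w q \<in> Omega_c q k'"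
  shows "(\<Sum>q\<in>{-4..11}. form_pairing (total_diff v q) (w (7 - q))) =
    (- 1) powi (k + 1) * (\<Sum>q\<in>{-4..11}. form_pairing (v q) (total_diff w (7 - q)))"
proof -
  note sv = Omega_smooth[OF v] and sw = Omega_smooth[OF Omega_c_Omega[OF w]] and bw = Omega_c_bounded[OF w]
  have bd: "bounded {x. dd m (w q) x \<noteq> 0}" for m q
    by (rule Omega_c_bounded[OF Omega_c_dd[OF w]])
  let ?good = "\<lambda>a :: form. smooth a \<and> bounded {x. a x \<noteq> 0}"
  have gd: "?good (dd m (w q))" for m q
    using smooth_dd[OF sw] bd by blast
  have gp: "?good (a + b)" if "?good a" "?good b" for a b
  proof -
    have "bounded {x. (a + b) x \<noteq> 0}"
    proof (rule bounded_subset)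
      show "bounded ({x. a x \<noteq> 0} \<union> {x. b x \<noteq> 0})" using that by simp
    qed auto
    then show ?thesis using that smooth_plus by blast
  qed
  have ga: "form_pairing (v q) (a + b) = form_pairing (v q) a + form_pairing (v q) b"
    if "?good a" "?good b" for a b q
    using that form_pairing_add_right[OF sv] by blast
  \<comment> \<open>Both sides add up the same terms after replacing q by q - m; the terms lost or
    gained at the ends of the range are zero.\<close>
  have shift: "(\<Sum>q\<in>{-4..11}. form_pairing (v (q - int m)) (dd m (w (7 - q)))) =
      (\<Sum>q\<in>{-4..11}. form_pairing (v q) (dd m (w (7 - q - int m))))" if "m \<le> 3" for m
  proof -
    let ?h = "\<lambda>q. form_pairing (v q) (dd m (w (7 - q - int m)))"
    have h: "?h q = 0" if "q \<notin> {0..7}" for q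
      using that Omega_range[OF v, of q] by auto
    have "(\<Sum>q\<in>{-4..11}. ?h (q - int m)) = (\<Sum>q\<in>{-4 - int m..11 - int m}. ?h q)"
      by (rule sum.reindex_bij_witness[of _ "\<lambda>q. q + int m" "\<lambda>q. q - int m"]) auto
    also have "\<dots> = (\<Sum>q\<in>{0..7}. ?h q)"
      using that by (intro sum.mono_neutral_right) (auto intro: h)
    also have "\<dots> = (\<Sum>q\<in>{-4..11}. ?h q)"
      by (intro sum.mono_neutral_left) (auto intro: h)
    finally show ?thesis by simp
  qed
  have left: "form_pairing (total_diff v q) (w (7 - q)) =
      (- 1) powi (k + 1) * (form_pairing (v q) (dd 0 (w (7 - q))) + form_pairing (v (q - 1)) (dd 1 (w (7 - q))) +
        form_pairing (v (q - 2)) (dd 2 (w (7 - q))) + form_pairing (v (q - 3)) (dd 3 (w (7 - q))))" for q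
    unfolding total_diff_def
    by (simp add: form_pairing_add_left smooth_plus smooth_dd sv sw bw distrib_left stokes[OF v sw] bw)
  have right: "form_pairing (v q) (total_diff w (7 - q)) =
      form_pairing (v q) (dd 0 (w (7 - q))) + form_pairing (v q) (dd 1 (w (7 - q - 1))) +
        form_pairing (v q) (dd 2 (w (7 - q - 2))) + form_pairing (v q) (dd 3 (w (7 - q - 3)))" for q
    unfolding total_diff_def
    by (simp only: ga gp gd)
  show ?thesis
    unfolding left right sum_distrib_left[symmetric] sum.distrib
    using shift[of 1] shift[of 2] shift[of 3] by simp
qed

lemma sum_single:
  fixes f :: "int \<Rightarrow> real"
  assumes "\<And>q. q \<noteq> p \<Longrightarrow> f q = 0" "p \<notin> {0..7} \<Longrightarrow> f p = 0"
  shows "(\<Sum>q\<in>{-4..11}. f q) = f p"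
proof (cases "p \<in> {-4..11}")
  case True
  have "(\<Sum>q\<in>{-4..11}. f q) = (\<Sum>q\<in>{p}. f q)"
    using assms True by (intro sum.mono_neutral_right) auto
  then show ?thesis by simp
next
  case False
  then have "f q = 0" if "q \<in> {-4..11}" for q
    by (intro assms(1)) (use that in auto)
  moreover have "f p = 0" using False assms(2) by auto
  ultimately show ?thesis by simp
qed

text \<open>In \<open>total_stokes\<close> the vanishing conditions below the starting weights leave
  a single term on each side, because the two weights in every term add up to 7.\<close>

lemma pairing_total_diff:
  assumes v: "Omega.cycle_lift r p k v" and w: "Omega_c.cycle_lift r (7 - p - int r) k' w"
  shows "form_pairing (total_diff v (p + int r)) (w (7 - p - int r)) =
    (- 1) powi (k + 1) * form_pairing (v p) (total_diff w (7 - p))"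
proof -
  have vO: "\<And>q. v q \<in> Omega q k" and wO: "\<And>q. w q \<in> Omega_c q k'"
    and v0: "\<And>q. q < p \<Longrightarrow> v q = 0" "\<And>q. q < p + int r \<Longrightarrow> total_diff v q = 0"
    and w0: "\<And>q. q < 7 - p - int r \<Longrightarrow> w q = 0" "\<And>q. q < 7 - p \<Longrightarrow> total_diff w q = 0"
    using v w by (auto simp: Omega.cycle_lift_def Omega_c.cycle_lift_def)
  have "(\<Sum>q\<in>{-4..11}. form_pairing (total_diff v q) (w (7 - q))) =
      form_pairing (total_diff v (p + int r)) (w (7 - (p + int r)))"
  proof (rule sum_single)
    fix q assume "q \<noteq> p + int r"
    then consider "q < p + int r" | "7 - q < 7 - p - int r" by linarith
    then show "form_pairing (total_diff v q) (w (7 - q)) = 0" by cases (simp_all add: v0 w0)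
  next
    assume "p + int r \<notin> {0..7}"
    then show "form_pairing (total_diff v (p + int r)) (w (7 - (p + int r))) = 0"
      using Omega_range[OF Omega.total_diff_mem[OF vO], of "p + int r"] by auto
  qed
  moreover have "(\<Sum>q\<in>{-4..11}. form_pairing (v q) (total_diff w (7 - q))) =
      form_pairing (v p) (total_diff w (7 - p))"
  proof (rule sum_single)
    fix q assume "q \<noteq> p"
    then consider "q < p" | "7 - q < 7 - p" by linarith
    then show "form_pairing (v q) (total_diff w (7 - q)) = 0" by cases (simp_all add: v0 w0)
  next
    assume "p \<notin> {0..7}"
    then show "form_pairing (v p) (total_diff w (7 - p)) = 0"
      using Omega_range[OF vO, of p] by auto
  qed
  ultimately show ?thesis
    using total_stokes[OF vO wO] by (simp add: algebra_simps)
qed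

text \<open>On the side where the test form is differentiated every term vanishes: \<open>c\<close>
  lives in weights above p - l, and exactly there the complementary component of the differential of
  \<open>w\<close> is zero. This is why B_l is paired with cycles of order l.\<close>

lemma pairing_boundary_left:
  assumes c: "Omega.boundary_lift l p k c" and w: "Omega_c.cycle_lift l (7 - p) k' w"
  shows "form_pairing (total_diff c p) (w (7 - p)) = 0"
proof -
  have cO: "\<And>q. c q \<in> Omega q (k - 1)" and wO: "\<And>q. w q \<in> Omega_c q k'"
    and c0: "\<And>q. q > p \<Longrightarrow> c q = 0" "\<And>q. q \<le> p - int l \<Longrightarrow> c q = 0" "\<And>q. q < p \<Longrightarrow> total_diff c q = 0"
    and w0: "\<And>q. q < 7 - p \<Longrightarrow> w q = 0" "\<And>q. q < 7 - p + int l \<Longrightarrow> total_diff w q = 0"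
    using c w by (auto simp: Omega.boundary_lift_def Omega_c.cycle_lift_def)
  have "(\<Sum>q\<in>{-4..11}. form_pairing (total_diff c q) (w (7 - q))) = form_pairing (total_diff c p) (w (7 - p))"
  proof (rule sum_single)
    fix q assume "q \<noteq> p"
    then consider "q < p" | "7 - q < 7 - p" by linarith
    then show "form_pairing (total_diff c q) (w (7 - q)) = 0" by cases (simp_all add: c0 w0)
  next
    assume "p \<notin> {0..7}"
    then show "form_pairing (total_diff c p) (w (7 - p)) = 0"
      using Omega_range[OF Omega.total_diff_mem[OF cO], of p] by auto
  qed
  moreover have "form_pairing (c q) (total_diff w (7 - q)) = 0" for q
  proof -
    consider "q \<le> p - int l" | "7 - q < 7 - p + int l" by linarith
    then show ?thesis by cases (simp_all add: c0 w0)
  qed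
  ultimately show ?thesis using total_stokes[OF cO wO] by simp
qed

lemma pairing_boundary_right:
  assumes v: "Omega.cycle_lift r p k v" and c: "Omega_c.boundary_lift r (7 - p) k' c"
  shows "form_pairing (v p) (total_diff c (7 - p)) = 0"
proof -
  have vO: "\<And>q. v q \<in> Omega q k" and cO: "\<And>q. c q \<in> Omega_c q (k' - 1)"
    and c0: "\<And>q. q > 7 - p \<Longrightarrow> c q = 0" "\<And>q. q \<le> 7 - p - int r \<Longrightarrow> c q = 0" "\<And>q. q < 7 - p \<Longrightarrow> total_diff c q = 0"
    and v0: "\<And>q. q < p \<Longrightarrow> v q = 0" "\<And>q. q < p + int r \<Longrightarrow> total_diff v q = 0"
    using c v by (auto simp: Omega.cycle_lift_def Omega_c.boundary_lift_def)
  have "(\<Sum>q\<in>{-4..11}. form_pairing (v q) (total_diff c (7 - q))) = form_pairing (v p) (total_diff c (7 - p))"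
  proof (rule sum_single)
    fix q assume "q \<noteq> p"
    then consider "q < p" | "7 - q < 7 - p" by linarith
    then show "form_pairing (v q) (total_diff c (7 - q)) = 0" by cases (simp_all add: c0 v0)
  next
    assume "p \<notin> {0..7}"
    then show "form_pairing (v p) (total_diff c (7 - p)) = 0"
      using Omega_range[OF vO, of p] by auto
  qed
  moreover have "form_pairing (total_diff v q) (c (7 - q)) = 0" for q
  proof -
    consider "q < p + int r" | "7 - q \<le> 7 - p - int r" by linarith
    then show ?thesis by cases (simp_all add: c0 v0)
  qed
  moreover have "(- 1 :: real) powi (k + 1) \<noteq> 0" by simp
  ultimately show ?thesis using total_stokes[OF vO cO] by simp
qed

section \<open>Pairing of classes\<close>

context
  fixes r l :: nat and p k :: int
  assumes rl: "r \<ge> 1" "l \<ge> 1"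
begin

text \<open>Both representatives can be changed one at a time, since boundaries are cycles of every
  order and therefore the orthogonality relations apply to mixed pairs too.\<close>

lemma form_pairing_coset:
  assumes \<alpha>: "\<alpha> \<in> cycles Omega r p k" and \<eta>: "\<eta> \<in> cycles Omega_c l (7 - p) (4 - k)"
    and \<alpha>': "\<alpha>' \<in> \<alpha> +o boundaries Omega l p k"
    and \<eta>': "\<eta>' \<in> \<eta> +o boundaries Omega_c r (7 - p) (4 - k)"
  shows "form_pairing \<alpha>' \<eta>' = form_pairing \<alpha> \<eta>" "form_integrable (\<lambda>x. \<alpha>' x \<and>\<and> \<eta>' x)"
proof -
  define \<beta> where "\<beta> = \<alpha>' - \<alpha>"
  define \<theta> where "\<theta> = \<eta>' - \<eta>"
  have \<beta>: "\<beta> \<in> boundaries Omega l p k" and \<theta>: "\<theta> \<in> boundaries Omega_c r (7 - p) (4 - k)"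
    using \<alpha>' \<eta>' by (simp_all add: \<beta>_def \<theta>_def mem_coset_iff)
  have Z: "\<beta> \<in> cycles Omega r p k" "\<theta> \<in> cycles Omega_c l (7 - p) (4 - k)"
    using \<beta> \<theta> Omega.boundaries_subset_cycles[OF rl(1)] Omega_c.boundaries_subset_cycles[OF rl(2)] by blast+
  have \<alpha>'Z: "\<alpha>' \<in> cycles Omega r p k"
    using subspace_add[OF Omega.subspace_cycles[OF rl(1)] \<alpha> Z(1)] by (simp add: \<beta>_def)
  have s: "smooth \<alpha>" "smooth \<beta>" "smooth \<alpha>'" "smooth \<eta>" "smooth \<theta>"
    "bounded {x. \<eta> x \<noteq> 0}" "bounded {x. \<theta> x \<noteq> 0}"
    using \<alpha> \<eta> Z \<alpha>'Z by (auto simp: cycles_def Omega_smooth Omega_c_bounded dest: Omega_c_Omega)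
  have "form_pairing \<alpha>' \<theta> = 0"
    using \<alpha>'Z \<theta> pairing_boundary_right
    unfolding Omega.cycles_iff_lift[OF rl(1)] Omega_c.boundaries_iff_lift by blast
  moreover have "form_pairing \<beta> \<eta> = 0"
    using \<beta> \<eta> pairing_boundary_left
    unfolding Omega_c.cycles_iff_lift[OF rl(2)] Omega.boundaries_iff_lift by blast
  moreover have "form_pairing \<alpha>' \<eta>' = form_pairing \<alpha>' \<eta> + form_pairing \<alpha>' \<theta>"
    using form_pairing_add_right[of \<alpha>' \<eta> \<theta>] s by (simp add: \<theta>_def)
  moreover have "form_pairing \<alpha>' \<eta> = form_pairing \<alpha> \<eta> + form_pairing \<beta> \<eta>"
    using form_pairing_add_left[of \<alpha> \<beta> \<eta>] s by (simp add: \<beta>_def)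
  ultimately show "form_pairing \<alpha>' \<eta>' = form_pairing \<alpha> \<eta>" by simp
  have "\<eta>' \<in> cycles Omega_c l (7 - p) (4 - k)"
    using subspace_add[OF Omega_c.subspace_cycles[OF rl(2)] \<eta> Z(2)] by (simp add: \<theta>_def)
  then have "\<eta>' \<in> Omega_c (7 - p) (4 - k)" by (simp add: cycles_def)
  then show "form_integrable (\<lambda>x. \<alpha>' x \<and>\<and> \<eta>' x)"
    unfolding form_integrable_def
    using wedge_integrable[of \<alpha>' \<eta>'] s Omega_smooth[OF Omega_c_Omega] Omega_c_bounded by blast
qed

lemma mem_coset_self:
  "\<alpha> \<in> \<alpha> +o boundaries Omega l' p' k'" "\<alpha> \<in> \<alpha> +o boundaries Omega_c l' p' k'"
  by (simp_all add: mem_coset_iff subspace_0 Omega.subspace_boundaries Omega_c.subspace_boundaries)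

lemma pairing_eq:
  assumes \<alpha>: "\<alpha> \<in> cycles Omega r p k" and \<eta>: "\<eta> \<in> cycles Omega_c l (7 - p) (4 - k)"
  shows "pairing (\<alpha> +o boundaries Omega l p k) (\<eta> +o boundaries Omega_c r (7 - p) (4 - k)) = form_pairing \<alpha> \<eta>"
  unfolding pairing_def form_pairing_def[symmetric]
proof (rule the_equality)
  show "\<exists>\<alpha>'\<in>\<alpha> +o boundaries Omega l p k. \<exists>\<eta>'\<in>\<eta> +o boundaries Omega_c r (7 - p) (4 - k).
      form_pairing \<alpha> \<eta> = form_pairing \<alpha>' \<eta>'"
    using mem_coset_self by blast
qed (use form_pairing_coset(1)[OF \<alpha> \<eta>] in auto)

lemma E_space_carE:
  assumes "A \<in> vcar (E_space r l p k)"
  obtains \<alpha> where "\<alpha> \<in> cycles Omega r p k" "A = \<alpha> +o boundaries Omega l p k"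
  using assms by (auto simp: E_space_def quotient_rspace_def)

lemma D_space_carE:
  assumes "H \<in> vcar (D_space l r (7 - p) (4 - k))"
  obtains \<eta> where "\<eta> \<in> cycles Omega_c l (7 - p) (4 - k)" "H = \<eta> +o boundaries Omega_c r (7 - p) (4 - k)"
  using assms by (auto simp: D_space_def quotient_rspace_def)

lemma pairing_well_defined: "pairing_well_defined r l p k"
  unfolding pairing_well_defined_def
proof (intro ballI conjI)
  fix A H assume "A \<in> vcar (E_space r l p k)" "H \<in> vcar (D_space l r (7 - p) (4 - k))"
  then obtain \<alpha> \<eta> where \<alpha>: "\<alpha> \<in> cycles Omega r p k" "A = \<alpha> +o boundaries Omega l p k"
    and \<eta>: "\<eta> \<in> cycles Omega_c l (7 - p) (4 - k)" "H = \<eta> +o boundaries Omega_c r (7 - p) (4 - k)"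
    by (metis E_space_carE D_space_carE)
  note coset = form_pairing_coset[OF \<alpha>(1) \<eta>(1), folded \<alpha>(2) \<eta>(2)]
  show "form_integrable (\<lambda>x. \<alpha>' x \<and>\<and> \<eta>' x)" if "\<alpha>' \<in> A" "\<eta>' \<in> H" for \<alpha>' \<eta>'
    using coset(2)[OF that] .
  show "\<exists>!c. \<exists>\<alpha>\<in>A. \<exists>\<eta>\<in>H. c = form_integral (\<lambda>x. \<alpha> x \<and>\<and> \<eta> x)"
    unfolding form_pairing_def[symmetric]
  proof (rule ex1I[of _ "form_pairing \<alpha> \<eta>"])
    show "\<exists>\<alpha>'\<in>A. \<exists>\<eta>'\<in>H. form_pairing \<alpha> \<eta> = form_pairing \<alpha>' \<eta>'"
      unfolding \<alpha>(2) \<eta>(2) using mem_coset_self by blast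
  qed (use coset(1) in auto)
qed

lemma pairing_bilinear:
  shows "A \<in> vcar (E_space r l p k) \<Longrightarrow> lin_map (D_space l r (7 - p) (4 - k)) real_rspace (pairing A)"
    and "H \<in> vcar (D_space l r (7 - p) (4 - k)) \<Longrightarrow>
      lin_map (E_space r l p k) real_rspace (\<lambda>A. pairing A H)"
proof -
  note SB = Omega.subspace_boundaries Omega_c.subspace_boundaries
  note SZ = Omega.subspace_cycles[OF rl(1)] Omega_c.subspace_cycles[OF rl(2)]
  have sb: "smooth \<alpha>" if "\<alpha> \<in> cycles Omega r p k" for \<alpha>
    using that by (auto simp: cycles_def Omega_smooth)
  have sb': "smooth \<eta>" "bounded {x. \<eta> x \<noteq> 0}" if "\<eta> \<in> cycles Omega_c l (7 - p) (4 - k)" for \<eta>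
    using that Omega_smooth[OF Omega_c_Omega] Omega_c_bounded by (auto simp: cycles_def)
  have car: "x \<in> vcar (E_space r l p k) \<longleftrightarrow> (\<exists>\<alpha>\<in>cycles Omega r p k. x = \<alpha> +o boundaries Omega l p k)"
    "y \<in> vcar (D_space l r (7 - p) (4 - k)) \<longleftrightarrow>
      (\<exists>\<eta>\<in>cycles Omega_c l (7 - p) (4 - k). y = \<eta> +o boundaries Omega_c r (7 - p) (4 - k))" for x y
    by (auto simp: E_space_def D_space_def quotient_rspace_def)
  have ops: "vadd (E_space r l p k) (\<alpha> +o boundaries Omega l p k) (\<beta> +o boundaries Omega l p k) =
      (\<alpha> + \<beta>) +o boundaries Omega l p k"
    "vscale (E_space r l p k) c (\<alpha> +o boundaries Omega l p k) = (c *\<^sub>R \<alpha>) +o boundaries Omega l p k"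
    "vadd (D_space l r (7 - p) (4 - k)) (\<alpha> +o boundaries Omega_c r (7 - p) (4 - k)) (\<beta> +o boundaries Omega_c r (7 - p) (4 - k)) =
      (\<alpha> + \<beta>) +o boundaries Omega_c r (7 - p) (4 - k)"
    "vscale (D_space l r (7 - p) (4 - k)) c (\<alpha> +o boundaries Omega_c r (7 - p) (4 - k)) =
      (c *\<^sub>R \<alpha>) +o boundaries Omega_c r (7 - p) (4 - k)" for \<alpha> \<beta> c
    by (simp_all add: E_space_def D_space_def quotient_rspace_def coset_add SB coset_scale)
  show "lin_map (D_space l r (7 - p) (4 - k)) real_rspace (pairing A)" if "A \<in> vcar (E_space r l p k)"
    using that unfolding lin_map_def Ball_def car
    by (auto simp: ops pairing_eq SZ subspace_add subspace_scale form_pairing_add_right form_pairing_scaleR_right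
        sb sb' real_rspace_def)
  show "lin_map (E_space r l p k) real_rspace (\<lambda>A. pairing A H)" if "H \<in> vcar (D_space l r (7 - p) (4 - k))"
    using that unfolding lin_map_def Ball_def car
    by (auto simp: ops pairing_eq SZ subspace_add subspace_scale form_pairing_add_left form_pairing_scaleR_left
        sb sb' real_rspace_def)
qed

end

text \<open>With lifts on both sides this is \<open>pairing_total_diff\<close>, whose sign is the
  one in the definition of the boundary operator.\<close>

lemma psi_spectral_diff:
  assumes l: "l \<ge> 1" and r: "r \<ge> 1" and m: "m \<ge> 1"
    and A: "A \<in> vcar (E_space l m p k)"
  shows "psi r l (p + int l) (k + 1) (spectral_diff Omega l p k A) =
    current_boundary r l p k (psi l m p k A)"
proof -
  obtain v where v: "Omega.cycle_lift l p k v" "A = v p +o boundaries Omega m p k"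
    using A unfolding E_space_def by (rule Omega.quotient_carE[OF l])
  have \<Delta>A: "spectral_diff Omega l p k A = total_diff v (p + int l) +o boundaries Omega l (p + int l) (k + 1)"
    by (rule Omega.spectral_diff_eq[OF l v])
  have tv: "total_diff v (p + int l) \<in> cycles Omega r (p + int l) (k + 1)"
    unfolding Omega.cycles_iff_lift[OF r] using Omega.total_diff_cycle_lift[OF v(1)] by blast
  have vp: "v p \<in> cycles Omega l p k"
    unfolding Omega.cycles_iff_lift[OF l] using v(1) by blast
  have dims: "7 - (p + int l) = 7 - p - int l" "4 - (k + 1) = 4 - k - 1" by simp_all
  have "pairing (spectral_diff Omega l p k A) H =
      (- 1) powi (k + 1) * psi l m p k A (spectral_diff Omega_c l (7 - p - int l) (4 - k - 1) H)"
    if H: "H \<in> vcar (D_space l r (7 - p - int l) (4 - k - 1))" for H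
  proof -
    obtain w where w: "Omega_c.cycle_lift l (7 - p - int l) (4 - k - 1) w"
      "H = w (7 - p - int l) +o boundaries Omega_c r (7 - p - int l) (4 - k - 1)"
      using H unfolding D_space_def by (rule Omega_c.quotient_carE[OF l])
    have \<Delta>H: "spectral_diff Omega_c l (7 - p - int l) (4 - k - 1) H =
        total_diff w (7 - p) +o boundaries Omega_c l (7 - p) (4 - k)"
      using Omega_c.spectral_diff_eq[OF l w] by simp
    have tw: "total_diff w (7 - p) \<in> cycles Omega_c m (7 - p) (4 - k)"
      unfolding Omega_c.cycles_iff_lift[OF m] using Omega_c.total_diff_cycle_lift[OF w(1), of m]
      by (intro exI[of _ "total_diff w"]) simp
    have wp: "w (7 - p - int l) \<in> cycles Omega_c l (7 - p - int l) (4 - k - 1)"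
      unfolding Omega_c.cycles_iff_lift[OF l] using w(1) by blast
    have "spectral_diff Omega_c l (7 - p - int l) (4 - k - 1) H \<in> vcar (D_space m l (7 - p) (4 - k))"
      unfolding \<Delta>H using tw by (simp add: D_space_def quotient_rspace_def)
    then have "psi l m p k A (spectral_diff Omega_c l (7 - p - int l) (4 - k - 1) H) =
        form_pairing (v p) (total_diff w (7 - p))"
      unfolding psi_def \<Delta>H v(2) using pairing_eq[OF l m vp tw] by simp
    moreover have "pairing (spectral_diff Omega l p k A) H =
        form_pairing (total_diff v (p + int l)) (w (7 - p - int l))"
      unfolding \<Delta>A w(2) using pairing_eq[OF r l tv, unfolded dims, OF wp] .
    ultimately show ?thesis using pairing_total_diff[OF v(1) w(1)] by simp
  qed
  then show ?thesis
    unfolding psi_def[of r] current_boundary_def dims by (intro restrict_ext) auto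
qed

section \<open>Continuity of functionals on test forms\<close>

lemma LF_nhd0_Omega_c: "LF_nhd0 p k (Omega_c p k)"
  unfolding LF_nhd0_def
proof (intro conjI allI impI ballI)
  show "convex (Omega_c p k)"
    by (intro convexI Omega_c_add Omega_c_scaleR)
  show "\<exists>m. \<exists>\<epsilon>>0. \<forall>\<omega>\<in>Omega_c p k. {x. \<omega> x \<noteq> 0} \<subseteq> K \<and>
     (\<forall>is x. length is \<le> m \<longrightarrow> norm (foldr partial_deriv is \<omega> x) < \<epsilon>) \<longrightarrow> \<omega> \<in> Omega_c p k" for K
    by (intro exI[of _ 0] exI[of _ 1]) simp
qed (auto intro: Omega_c_scaleR)

lemma topspace_LF_top: "topspace (LF_top p k) = Omega_c p k"
proof
  show "topspace (LF_top p k) \<subseteq> Omega_c p k"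
    using openin_topspace[of "LF_top p k"] unfolding openin_LF_top by blast
  have "openin (LF_top p k) (Omega_c p k)"
    unfolding openin_LF_top
    using LF_nhd0_Omega_c Omega_c_add by (auto intro!: exI[of _ "Omega_c p k"] simp: elt_set_plus_def)
  then show "Omega_c p k \<subseteq> topspace (LF_top p k)" by (rule openin_subset)
qed

lemma partial_deriv_scaleR:
  "smooth f \<Longrightarrow> partial_deriv i (c *\<^sub>R f) = c *\<^sub>R partial_deriv i f"
  unfolding scaleR_fun_def
  by (rule ext) (rule partial_deriv_linear[OF bounded_linear_scaleR_right smooth_differentiable])

lemma foldr_partial_deriv_scaleR:
  "smooth f \<Longrightarrow> smooth (foldr partial_deriv is f) \<and>
    foldr partial_deriv is (c *\<^sub>R f) = c *\<^sub>R foldr partial_deriv is f"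
  by (induction "is") (auto simp: smooth_partial_deriv partial_deriv_scaleR)

lemma LF_nhd0_scale:
  assumes N: "LF_nhd0 p k N" and c: "c > 0"
  shows "LF_nhd0 p k ((*\<^sub>R) c ` N)"
  unfolding LF_nhd0_def
proof (intro conjI allI impI)
  show "(*\<^sub>R) c ` N \<subseteq> Omega_c p k"
    using N by (auto simp: LF_nhd0_def intro: Omega_c_scaleR)
  show "convex ((*\<^sub>R) c ` N)"
    using N by (auto simp: LF_nhd0_def intro: convex_scaling)
  show "\<forall>\<omega>\<in>(*\<^sub>R) c ` N. a *\<^sub>R \<omega> \<in> (*\<^sub>R) c ` N" if "\<bar>a\<bar> \<le> 1" for a
  proof
    fix \<omega> assume "\<omega> \<in> (*\<^sub>R) c ` N"
    then obtain \<eta> where "\<eta> \<in> N" "\<omega> = c *\<^sub>R \<eta>" by blast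
    then have "a *\<^sub>R \<omega> = c *\<^sub>R (a *\<^sub>R \<eta>)" "a *\<^sub>R \<eta> \<in> N"
      using N that by (auto simp: LF_nhd0_def)
    then show "a *\<^sub>R \<omega> \<in> (*\<^sub>R) c ` N" by blast
  qed
  fix K :: "engel set" assume K: "compact K"
  obtain m \<epsilon> where m: "\<epsilon> > 0" "\<And>\<omega>. \<omega> \<in> Omega_c p k \<Longrightarrow> {x. \<omega> x \<noteq> 0} \<subseteq> K \<Longrightarrow>
      \<forall>is x. length is \<le> m \<longrightarrow> norm (foldr partial_deriv is \<omega> x) < \<epsilon> \<Longrightarrow> \<omega> \<in> N"
    using N K unfolding LF_nhd0_def by meson
  show "\<exists>m. \<exists>\<epsilon>>0. \<forall>\<omega>\<in>Omega_c p k. {x. \<omega> x \<noteq> 0} \<subseteq> K \<and>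
      (\<forall>is x. length is \<le> m \<longrightarrow> norm (foldr partial_deriv is \<omega> x) < \<epsilon>) \<longrightarrow> \<omega> \<in> (*\<^sub>R) c ` N"
  proof (intro exI[of _ m] exI[of _ "c * \<epsilon>"] conjI ballI impI)
    show "c * \<epsilon> > 0" using c m by simp
    fix \<omega> assume \<omega>: "\<omega> \<in> Omega_c p k"
      and s: "{x. \<omega> x \<noteq> 0} \<subseteq> K \<and> (\<forall>is x. length is \<le> m \<longrightarrow> norm (foldr partial_deriv is \<omega> x) < c * \<epsilon>)"
    have "inverse c *\<^sub>R \<omega> \<in> N"
    proof (rule m(2))
      show "inverse c *\<^sub>R \<omega> \<in> Omega_c p k" using \<omega> by (rule Omega_c_scaleR)
      show "{x. (inverse c *\<^sub>R \<omega>) x \<noteq> 0} \<subseteq> K" using s by auto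
      show "\<forall>is x. length is \<le> m \<longrightarrow> norm (foldr partial_deriv is (inverse c *\<^sub>R \<omega>) x) < \<epsilon>"
      proof (intro allI impI)
        fix "is" :: "4 list" and x assume "length is \<le> m"
        then have "norm (foldr partial_deriv is \<omega> x) < c * \<epsilon>" using s by blast
        moreover have "foldr partial_deriv is (inverse c *\<^sub>R \<omega>) = inverse c *\<^sub>R foldr partial_deriv is \<omega>"
          using foldr_partial_deriv_scaleR[OF Omega_smooth[OF Omega_c_Omega[OF \<omega>]]] by blast
        ultimately show "norm (foldr partial_deriv is (inverse c *\<^sub>R \<omega>) x) < \<epsilon>"
          using c by (simp add: field_simps)
      qed
    qed
    then have "c *\<^sub>R (inverse c *\<^sub>R \<omega>) \<in> (*\<^sub>R) c ` N" by blast
    then show "\<omega> \<in> (*\<^sub>R) c ` N" using c by simp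
  qed
qed

lemma topspace_subtopology_cycles:
  "topspace (subtopology (LF_top p k) (cycles Omega_c r p k)) = cycles Omega_c r p k"
  by (auto simp: topspace_LF_top cycles_def)

lemma openin_D_top:
  "openin (D_top r l p k) {H \<in> (\<lambda>\<eta>. \<eta> +o boundaries Omega_c l p k) ` cycles Omega_c r p k. P H} \<longleftrightarrow>
    openin (subtopology (LF_top p k) (cycles Omega_c r p k))
      {\<eta> \<in> cycles Omega_c r p k. P (\<eta> +o boundaries Omega_c l p k)}"
proof -
  have "{\<eta> \<in> cycles Omega_c r p k. \<eta> +o boundaries Omega_c l p k \<in>
      {H \<in> (\<lambda>\<eta>. \<eta> +o boundaries Omega_c l p k) ` cycles Omega_c r p k. P H}} =
    {\<eta> \<in> cycles Omega_c r p k. P (\<eta> +o boundaries Omega_c l p k)}" by blast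
  then show ?thesis
    unfolding D_top_def openin_quotient_top topspace_subtopology_cycles by simp
qed

lemma topspace_D_top:
  "topspace (D_top r l p k) = (\<lambda>\<eta>. \<eta> +o boundaries Omega_c l p k) ` cycles Omega_c r p k"
proof
  show "topspace (D_top r l p k) \<subseteq> (\<lambda>\<eta>. \<eta> +o boundaries Omega_c l p k) ` cycles Omega_c r p k"
    using openin_topspace[of "D_top r l p k"]
    unfolding D_top_def openin_quotient_top topspace_subtopology_cycles by blast
  show "(\<lambda>\<eta>. \<eta> +o boundaries Omega_c l p k) ` cycles Omega_c r p k \<subseteq> topspace (D_top r l p k)"
    using openin_subset[OF openin_D_top[of r l p k "\<lambda>H. True", THEN iffD2]]
      openin_topspace[of "subtopology (LF_top p k) (cycles Omega_c r p k)"]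
    unfolding topspace_subtopology_cycles by simp
qed

text \<open>Together with the converse below, this replaces continuity on the quotient by a bound on
  a basic neighbourhood of 0 among the representatives.\<close>

lemma D_top_continuous_imp_bounded:
  assumes r: "r \<ge> 1" and T: "continuous_map (D_top r l p k) euclideanreal T"
    and T0: "T (boundaries Omega_c l p k) = 0"
  obtains N where "LF_nhd0 p k N"
    "\<And>\<eta>. \<eta> \<in> N \<Longrightarrow> \<eta> \<in> cycles Omega_c r p k \<Longrightarrow> \<bar>T (\<eta> +o boundaries Omega_c l p k)\<bar> < 1"
proof -
  let ?Z = "cycles Omega_c r p k" let ?B = "boundaries Omega_c l p k"
  let ?X = "subtopology (LF_top p k) ?Z"
  have "openin (D_top r l p k) {H \<in> (\<lambda>\<eta>. \<eta> +o ?B) ` ?Z. T H \<in> {-1<..<1}}"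
    using openin_continuous_map_preimage[OF T, of "{-1<..<1}"] unfolding topspace_D_top by simp
  then have "openin ?X {\<eta> \<in> ?Z. T (\<eta> +o ?B) \<in> {-1<..<1}}"
    unfolding openin_D_top .
  then obtain W where W: "openin (LF_top p k) W" "{\<eta> \<in> ?Z. T (\<eta> +o ?B) \<in> {-1<..<1}} = W \<inter> ?Z"
    unfolding openin_subtopology by blast
  have "0 \<in> ?Z" by (rule subspace_0[OF Omega_c.subspace_cycles[OF r]])
  then have "0 \<in> {\<eta> \<in> ?Z. T (\<eta> +o ?B) \<in> {-1<..<1}}" using T0 by simp
  then have "0 \<in> W" unfolding W(2) by blast
  then obtain N where N: "LF_nhd0 p k N" "0 +o N \<subseteq> W"
    using W(1) unfolding openin_LF_top by blast
  have "\<bar>T (\<eta> +o ?B)\<bar> < 1" if "\<eta> \<in> N" "\<eta> \<in> ?Z" for \<eta>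
  proof -
    have "\<eta> \<in> W \<inter> ?Z" using N(2) that by auto
    then have "\<eta> \<in> {\<eta> \<in> ?Z. T (\<eta> +o ?B) \<in> {-1<..<1}}" by (simp only: W(2))
    then show ?thesis by (simp add: abs_less_iff)
  qed
  with N(1) that show ?thesis by blast
qed

text \<open>The functional lives on cycles only, whereas a relatively open set must be cut out by an
  open set of all test forms; such a set has to be built by hand from multiples of
  \<open>N\<close>.\<close>

lemma D_top_bounded_imp_continuous:
  assumes r: "r \<ge> 1" and T: "lin_map (D_space r l p k) real_rspace T" and N: "LF_nhd0 p k N"
    and bound: "\<And>\<eta>. \<eta> \<in> N \<Longrightarrow> \<eta> \<in> cycles Omega_c r p k \<Longrightarrow> \<bar>T (\<eta> +o boundaries Omega_c l p k)\<bar> \<le> 1"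
  shows "continuous_map (D_top r l p k) euclideanreal T"
proof -
  let ?Z = "cycles Omega_c r p k" let ?B = "boundaries Omega_c l p k"
  let ?X = "subtopology (LF_top p k) ?Z" let ?f = "\<lambda>\<eta>. T (\<eta> +o ?B)"
  note SZ = Omega_c.subspace_cycles[OF r, of p k] and SB = Omega_c.subspace_boundaries[of l p k]
  have f_add: "?f (\<eta> + \<theta>) = ?f \<eta> + ?f \<theta>" if "\<eta> \<in> ?Z" "\<theta> \<in> ?Z" for \<eta> \<theta>
    using T that unfolding lin_map_def D_space_def quotient_rspace_def real_rspace_def
    by (simp add: coset_add[OF SB, symmetric])
  have f_scale: "?f (c *\<^sub>R \<eta>) = c * ?f \<eta>" if "\<eta> \<in> ?Z" for c \<eta>
    using T that unfolding lin_map_def D_space_def quotient_rspace_def real_rspace_def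
    by (simp add: coset_scale[OF SB, symmetric])
  have NO: "N \<subseteq> Omega_c p k" and conv: "convex N" using N by (auto simp: LF_nhd0_def)
  have opn: "openin ?X {\<eta> \<in> ?Z. ?f \<eta> \<in> U}" if U: "open U" for U
  proof -
    \<comment> \<open>Around each cycle \<eta> in the preimage the radius e of a ball in
      \<open>U\<close> allows translation by e s \<open>N\<close> with s < 1. The strict inequality
      leaves the margin that makes the set open: by convexity, s \<nu> + t \<mu> is s + t times a
      point of \<open>N\<close>.\<close>
    define W where "W = {\<eta> + (e * s) *\<^sub>R \<nu> | \<eta> e s \<nu>. \<eta> \<in> ?Z \<and> e > 0 \<and> ball (?f \<eta>) e \<subseteq> U \<and> 0 \<le> s \<and> s < 1 \<and> \<nu> \<in> N}"
    have "openin (LF_top p k) W"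
      unfolding openin_LF_top
    proof (intro conjI ballI)
      show "W \<subseteq> Omega_c p k"
        using NO by (auto simp: W_def cycles_def intro!: Omega_c_add Omega_c_scaleR)
      fix \<omega> assume "\<omega> \<in> W"
      then obtain \<eta> e s \<nu> where \<omega>: "\<omega> = \<eta> + (e * s) *\<^sub>R \<nu>" and \<eta>: "\<eta> \<in> ?Z" and e: "e > 0" "ball (?f \<eta>) e \<subseteq> U"
        and s: "0 \<le> s" "s < 1" and \<nu>: "\<nu> \<in> N" unfolding W_def by blast
      define t where "t = (1 - s) / 2"
      have t: "t > 0" "0 < s + t" "s + t < 1" using s by (simp_all add: t_def field_simps)
      have "\<omega> +o (*\<^sub>R) (e * t) ` N \<subseteq> W"
      proof
        fix z assume "z \<in> \<omega> +o (*\<^sub>R) (e * t) ` N"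
        then obtain \<mu> where \<mu>: "\<mu> \<in> N" "z = \<eta> + (e * s) *\<^sub>R \<nu> + (e * t) *\<^sub>R \<mu>"
          by (auto simp: elt_set_plus_def \<omega>)
        define \<kappa> where "\<kappa> = (s / (s + t)) *\<^sub>R \<nu> + (t / (s + t)) *\<^sub>R \<mu>"
        have "\<kappa> \<in> N"
          unfolding \<kappa>_def using t s by (intro convexD[OF conv \<nu> \<mu>(1)]) (auto simp: add_divide_distrib[symmetric])
        moreover have "z = \<eta> + (e * (s + t)) *\<^sub>R \<kappa>"
          using t by (simp add: \<mu>(2) \<kappa>_def scaleR_add_right)
        ultimately show "z \<in> W"
          unfolding W_def using \<eta> e s t
          by (intro CollectI exI[of _ \<eta>] exI[of _ e] exI[of _ "s + t"] exI[of _ \<kappa>]) auto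
      qed
      then show "\<exists>N. LF_nhd0 p k N \<and> \<omega> +o N \<subseteq> W"
        using LF_nhd0_scale[OF N, of "e * t"] e t by (intro exI[of _ "(*\<^sub>R) (e * t) ` N"]) simp
    qed
    moreover have "{\<eta> \<in> ?Z. ?f \<eta> \<in> U} = W \<inter> ?Z"
    proof (intro equalityI subsetI)
      fix \<eta> assume "\<eta> \<in> {\<eta> \<in> ?Z. ?f \<eta> \<in> U}"
      then have \<eta>: "\<eta> \<in> ?Z" "?f \<eta> \<in> U" by auto
      then obtain e where e: "e > 0" "ball (?f \<eta>) e \<subseteq> U" using U open_contains_ball by blast
      obtain \<nu> where \<nu>: "\<nu> \<in> N"
      proof -
        obtain m \<epsilon> where "\<epsilon> > 0" "\<And>\<omega>. \<omega> \<in> Omega_c p k \<Longrightarrow> {x. \<omega> x \<noteq> 0} \<subseteq> {} \<Longrightarrow>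
          \<forall>is x. length is \<le> m \<longrightarrow> norm (foldr partial_deriv is \<omega> x) < \<epsilon> \<Longrightarrow> \<omega> \<in> N"
          using N compact_empty unfolding LF_nhd0_def by meson
        moreover have "foldr partial_deriv is (0 :: form) = 0" for "is"
          using foldr_partial_deriv_scaleR[of "0 :: form" "is" 0] smooth_const[of "0 :: covector"]
          by (simp add: zero_fun_def[symmetric])
        ultimately have "0 \<in> N" using Omega_c_zero by simp
        then show ?thesis using that by blast
      qed
      have "\<eta> = \<eta> + (e * 0) *\<^sub>R \<nu>" by simp
      then have "\<eta> \<in> W" unfolding W_def using \<eta> e \<nu>
        by (intro CollectI exI[of _ \<eta>] exI[of _ e] exI[of _ 0] exI[of _ \<nu>]) auto
      then show "\<eta> \<in> W \<inter> ?Z" using \<eta> by blast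
    next
      fix \<omega> assume "\<omega> \<in> W \<inter> ?Z"
      then obtain \<eta> e s \<nu> where \<omega>: "\<omega> = \<eta> + (e * s) *\<^sub>R \<nu>" "\<omega> \<in> ?Z" and \<eta>: "\<eta> \<in> ?Z" and e: "e > 0" "ball (?f \<eta>) e \<subseteq> U"
        and s: "0 \<le> s" "s < 1" and \<nu>: "\<nu> \<in> N" unfolding W_def by blast
      have "?f \<omega> \<in> ball (?f \<eta>) e"
      proof (cases "s = 0")
        case True
        then show ?thesis using \<omega>(1) e by simp
      next
        case False
        \<comment> \<open>An element of \<open>N\<close> need not be a cycle, but here it is a
          multiple of the difference of two cycles, so the bound applies to it.\<close>
        have "(e * s) *\<^sub>R \<nu> \<in> ?Z"
          using subspace_diff[OF SZ \<omega>(2) \<eta>] \<omega>(1) by simp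
        then have \<nu>Z: "\<nu> \<in> ?Z"
        proof -
          have "inverse (e * s) *\<^sub>R ((e * s) *\<^sub>R \<nu>) = \<nu>"
            unfolding scaleR_scaleR using e False by (subst left_inverse) auto
          then show ?thesis
            using subspace_scale[OF SZ \<open>(e * s) *\<^sub>R \<nu> \<in> ?Z\<close>, of "inverse (e * s)"] by metis
        qed
        have "\<bar>?f \<omega> - ?f \<eta>\<bar> = e * s * \<bar>?f \<nu>\<bar>"
          using e s \<eta> \<nu>Z by (simp add: \<omega>(1) f_add f_scale subspace_scale[OF SZ] abs_mult)
        also have "\<dots> \<le> e * s * 1"
          using e s by (intro mult_left_mono bound \<nu> \<nu>Z) simp
        also have "\<dots> < e" using e s by simp
        finally show ?thesis by (simp add: dist_real_def abs_minus_commute)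
      qed
      then show "\<omega> \<in> {\<eta> \<in> ?Z. ?f \<eta> \<in> U}" using \<omega>(2) e by blast
    qed
    ultimately show ?thesis unfolding openin_subtopology by blast
  qed
  show ?thesis
    unfolding continuous_map_def
  proof (intro conjI allI impI)
    show "T \<in> topspace (D_top r l p k) \<rightarrow> topspace euclideanreal" by simp
    fix U :: "real set" assume "openin euclideanreal U"
    then have "openin ?X {\<eta> \<in> ?Z. ?f \<eta> \<in> U}" by (intro opn) simp
    then show "openin (D_top r l p k) {x \<in> topspace (D_top r l p k). T x \<in> U}"
      unfolding topspace_D_top openin_D_top .
  qed
qed

section \<open>Continuity of differential operators\<close>

text \<open>The basic neighbourhoods of \<open>LF_nhd0\<close>, without the condition on the
  support.\<close>

definition small :: "nat \<Rightarrow> real \<Rightarrow> form \<Rightarrow> bool" where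
  "small m \<epsilon> \<omega> \<longleftrightarrow> (\<forall>is x. length is \<le> m \<longrightarrow> norm (foldr partial_deriv is \<omega> x) < \<epsilon>)"

lemma small_0: "small 0 \<epsilon> \<omega> \<longleftrightarrow> (\<forall>x. norm (\<omega> x) < \<epsilon>)"
  by (simp add: small_def)

text \<open>\<open>foldr\<close> applies the last index of the list first, hence the list is split
  at its end. This recursion drives the inductions on the order of differentiation.\<close>

lemma small_Suc: "small (Suc m) \<epsilon> \<omega> \<longleftrightarrow> small 0 \<epsilon> \<omega> \<and> (\<forall>i. small m \<epsilon> (partial_deriv i \<omega>))"
proof
  assume s: "small (Suc m) \<epsilon> \<omega>"
  have "norm (foldr partial_deriv is (partial_deriv i \<omega>) x) < \<epsilon>" if "length is \<le> m" for i "is" x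
  proof -
    have "length (is @ [i]) \<le> Suc m" using that by simp
    then have "norm (foldr partial_deriv (is @ [i]) \<omega> x) < \<epsilon>" using s unfolding small_def by blast
    then show ?thesis by simp
  qed
  moreover have "small 0 \<epsilon> \<omega>"
    using s[unfolded small_def, rule_format, of "[]"] by (simp add: small_0)
  ultimately show "small 0 \<epsilon> \<omega> \<and> (\<forall>i. small m \<epsilon> (partial_deriv i \<omega>))"
    by (simp add: small_def)
next
  assume s: "small 0 \<epsilon> \<omega> \<and> (\<forall>i. small m \<epsilon> (partial_deriv i \<omega>))"
  show "small (Suc m) \<epsilon> \<omega>"
    unfolding small_def
  proof (intro allI impI)
    fix "is" :: "4 list" and x assume "length is \<le> Suc m"
    then show "norm (foldr partial_deriv is \<omega> x) < \<epsilon>"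
      using s by (cases "is" rule: rev_cases) (auto simp: small_def)
  qed
qed

lemma small_mono: "small m \<delta> \<omega> \<Longrightarrow> m' \<le> m \<Longrightarrow> \<delta> \<le> \<epsilon> \<Longrightarrow> small m' \<epsilon> \<omega>"
  unfolding small_def by (meson order_less_le_trans order_trans)

lemma small_add:
  "smooth \<omega> \<Longrightarrow> smooth \<eta> \<Longrightarrow> small m a \<omega> \<Longrightarrow> small m b \<eta> \<Longrightarrow> small m (a + b) (\<lambda>x. \<omega> x + \<eta> x)"
proof (induction m arbitrary: \<omega> \<eta>)
  case 0
  then show ?case by (auto simp: small_0 intro: order_le_less_trans[OF norm_triangle_ineq add_strict_mono])
next
  case (Suc m)
  then show ?case
    unfolding small_Suc partial_deriv_add[OF Suc.prems(1,2)]
    by (auto simp: small_0 smooth_partial_deriv intro: order_le_less_trans[OF norm_triangle_ineq add_strict_mono])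
qed

text \<open>Local operators that are continuous on the forms supported in each compact set. The same
  \<open>K\<close> may be used before and after because supports do not grow; linearity is kept
  apart.\<close>

definition cont_op :: "(form \<Rightarrow> form) \<Rightarrow> bool" where
  "cont_op L \<longleftrightarrow> (\<forall>\<omega>. smooth \<omega> \<longrightarrow> smooth (L \<omega>)) \<and>
     (\<forall>K \<omega>. closed K \<longrightarrow> {x. \<omega> x \<noteq> 0} \<subseteq> K \<longrightarrow> {x. L \<omega> x \<noteq> 0} \<subseteq> K) \<and>
     (\<forall>K m \<epsilon>. compact K \<longrightarrow> \<epsilon> > 0 \<longrightarrow> (\<exists>m' \<delta>. \<delta> > 0 \<and>
       (\<forall>\<omega>. smooth \<omega> \<longrightarrow> {x. \<omega> x \<noteq> 0} \<subseteq> K \<longrightarrow> small m' \<delta> \<omega> \<longrightarrow> small m \<epsilon> (L \<omega>))))"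

lemma cont_op_smooth: "cont_op L \<Longrightarrow> smooth \<omega> \<Longrightarrow> smooth (L \<omega>)"
  and cont_op_support: "cont_op L \<Longrightarrow> closed K \<Longrightarrow> {x. \<omega> x \<noteq> 0} \<subseteq> K \<Longrightarrow> {x. L \<omega> x \<noteq> 0} \<subseteq> K"
  by (simp_all only: cont_op_def)

lemma cont_op_compose:
  assumes L: "cont_op L" and M: "cont_op M"
  shows "cont_op (\<lambda>\<omega>. L (M \<omega>))"
  unfolding cont_op_def
proof (intro conjI allI impI)
  fix K :: "engel set" and m and \<epsilon> :: real assume K: "compact K" "\<epsilon> > 0"
  obtain m' \<delta> where 1: "\<delta> > 0" "\<And>\<omega>. smooth \<omega> \<Longrightarrow> {x. \<omega> x \<noteq> 0} \<subseteq> K \<Longrightarrow> small m' \<delta> \<omega> \<Longrightarrow> small m \<epsilon> (L \<omega>)"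
    using L K unfolding cont_op_def by meson
  obtain m'' \<delta>' where 2: "\<delta>' > 0" "\<And>\<omega>. smooth \<omega> \<Longrightarrow> {x. \<omega> x \<noteq> 0} \<subseteq> K \<Longrightarrow> small m'' \<delta>' \<omega> \<Longrightarrow> small m' \<delta> (M \<omega>)"
    using M K(1) 1(1) unfolding cont_op_def by meson
  show "\<exists>m' \<delta>. \<delta> > 0 \<and> (\<forall>\<omega>. smooth \<omega> \<longrightarrow> {x. \<omega> x \<noteq> 0} \<subseteq> K \<longrightarrow> small m' \<delta> \<omega> \<longrightarrow> small m \<epsilon> (L (M \<omega>)))"
  proof (intro exI[of _ m''] exI[of _ \<delta>'] conjI allI impI)
    fix \<omega> assume \<omega>: "smooth \<omega>" "{x. \<omega> x \<noteq> 0} \<subseteq> K" "small m'' \<delta>' \<omega>"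
    have "smooth (M \<omega>)" "{x. M \<omega> x \<noteq> 0} \<subseteq> K"
      using M \<omega> compact_imp_closed[OF K(1)] by (simp_all add: cont_op_def)
    then show "small m \<epsilon> (L (M \<omega>))" by (rule 1(2)[OF _ _ 2(2)[OF \<omega>]])
  qed (rule 2(1))
next
  show "smooth (L (M \<omega>))" if "smooth \<omega>" for \<omega>
    by (intro cont_op_smooth[OF L] cont_op_smooth[OF M] that)
  show "{x. L (M \<omega>) x \<noteq> 0} \<subseteq> K" if "closed K" "{x. \<omega> x \<noteq> 0} \<subseteq> K" for K \<omega>
    by (intro cont_op_support[OF L] cont_op_support[OF M] that)
qed

lemma cont_op_add:
  assumes L: "cont_op L" and M: "cont_op M"
  shows "cont_op (\<lambda>\<omega> x. L \<omega> x + M \<omega> x)"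
  unfolding cont_op_def
proof (intro conjI allI impI)
  fix K :: "engel set" and m and \<epsilon> :: real assume K: "compact K" "\<epsilon> > 0"
  then have e2: "\<epsilon> / 2 > 0" by simp
  obtain m' \<delta> where 1: "\<delta> > 0" "\<And>\<omega>. smooth \<omega> \<Longrightarrow> {x. \<omega> x \<noteq> 0} \<subseteq> K \<Longrightarrow> small m' \<delta> \<omega> \<Longrightarrow> small m (\<epsilon> / 2) (L \<omega>)"
    using L K(1) e2 unfolding cont_op_def by meson
  obtain m'' \<delta>' where 2: "\<delta>' > 0" "\<And>\<omega>. smooth \<omega> \<Longrightarrow> {x. \<omega> x \<noteq> 0} \<subseteq> K \<Longrightarrow> small m'' \<delta>' \<omega> \<Longrightarrow> small m (\<epsilon> / 2) (M \<omega>)"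
    using M K(1) e2 unfolding cont_op_def by meson
  show "\<exists>m' \<delta>. \<delta> > 0 \<and> (\<forall>\<omega>. smooth \<omega> \<longrightarrow> {x. \<omega> x \<noteq> 0} \<subseteq> K \<longrightarrow> small m' \<delta> \<omega> \<longrightarrow> small m \<epsilon> (\<lambda>x. L \<omega> x + M \<omega> x))"
  proof (intro exI[of _ "max m' m''"] exI[of _ "min \<delta> \<delta>'"] conjI allI impI)
    show "min \<delta> \<delta>' > 0" using 1 2 by simp
    fix \<omega> assume \<omega>: "smooth \<omega>" "{x. \<omega> x \<noteq> 0} \<subseteq> K" "small (max m' m'') (min \<delta> \<delta>') \<omega>"
    have "small m (\<epsilon> / 2) (L \<omega>)" "small m (\<epsilon> / 2) (M \<omega>)"
      by (rule 1(2)[OF \<omega>(1,2) small_mono[OF \<omega>(3)]] 2(2)[OF \<omega>(1,2) small_mono[OF \<omega>(3)]]; simp)+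
    from small_add[OF cont_op_smooth[OF L \<omega>(1)] cont_op_smooth[OF M \<omega>(1)] this]
    show "small m \<epsilon> (\<lambda>x. L \<omega> x + M \<omega> x)" by simp
  qed
next
  show "smooth (\<lambda>x. L \<omega> x + M \<omega> x)" if "smooth \<omega>" for \<omega>
    by (intro smooth_add cont_op_smooth[OF L] cont_op_smooth[OF M] that)
  show "{x. L \<omega> x + M \<omega> x \<noteq> 0} \<subseteq> K" if "closed K" "{x. \<omega> x \<noteq> 0} \<subseteq> K" for K \<omega>
    using cont_op_support[OF L that] cont_op_support[OF M that] by force
qed

lemma cont_op_zero: "cont_op (\<lambda>\<omega> x. 0)"
proof -
  have "foldr partial_deriv is (\<lambda>x. 0 :: covector) = (\<lambda>x. 0)" for "is"
    by (induction "is") auto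
  then show ?thesis unfolding cont_op_def small_def by auto
qed

lemma cont_op_sum: "finite S \<Longrightarrow> (\<And>i. i \<in> S \<Longrightarrow> cont_op (L i)) \<Longrightarrow> cont_op (\<lambda>\<omega> x. \<Sum>i\<in>S. L i \<omega> x)"
  by (induction S rule: finite_induct) (auto intro: cont_op_zero cont_op_add)

lemma cont_op_linear:
  assumes A: "bounded_linear A"
  shows "cont_op (\<lambda>\<omega> x. A (\<omega> x))"
  unfolding cont_op_def
proof (intro conjI allI impI)
  obtain C where C: "C > 0" "\<And>y. norm (A y) \<le> norm y * C"
    using bounded_linear.pos_bounded[OF A] by blast
  have *: "small m (\<delta> * C) (\<lambda>x. A (\<omega> x))" if "smooth \<omega>" "small m \<delta> \<omega>" for m \<delta> \<omega>
    using that
  proof (induction m arbitrary: \<omega>)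
    case 0
    then show ?case
      using C by (auto simp: small_0 intro: order_le_less_trans[OF C(2)])
  next
    case (Suc m)
    have "partial_deriv i (\<lambda>x. A (\<omega> x)) = (\<lambda>x. A (partial_deriv i \<omega> x))" for i
      using partial_deriv_linear[OF A smooth_differentiable[OF Suc.prems(1)]] by blast
    then show ?case
      using Suc C unfolding small_Suc
      by (auto simp: small_0 smooth_partial_deriv intro: order_le_less_trans[OF C(2)])
  qed
  fix K :: "engel set" and m and \<epsilon> :: real assume "\<epsilon> > 0"
  then show "\<exists>m' \<delta>. \<delta> > 0 \<and> (\<forall>\<omega>. smooth \<omega> \<longrightarrow> {x. \<omega> x \<noteq> 0} \<subseteq> K \<longrightarrow> small m' \<delta> \<omega> \<longrightarrow> small m \<epsilon> (\<lambda>x. A (\<omega> x)))"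
    using *[of _ m "\<epsilon> / C"] C by (intro exI[of _ m] exI[of _ "\<epsilon> / C"]) auto
qed (use smooth_linear[OF A] linear_0[OF bounded_linear.linear[OF A]] in auto)

lemma cont_op_partial_deriv: "cont_op (partial_deriv i)"
  unfolding cont_op_def
proof (intro conjI allI impI)
  fix K :: "engel set" and m and \<epsilon> :: real assume "\<epsilon> > 0"
  then show "\<exists>m' \<delta>. \<delta> > 0 \<and> (\<forall>\<omega>. smooth \<omega> \<longrightarrow> {x. \<omega> x \<noteq> 0} \<subseteq> K \<longrightarrow> small m' \<delta> \<omega> \<longrightarrow> small m \<epsilon> (partial_deriv i \<omega>))"
    by (intro exI[of _ "Suc m"] exI[of _ \<epsilon>]) (auto simp: small_Suc)
qed (auto intro: smooth_partial_deriv dest: partial_deriv_support)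

text \<open>Induction on the order of differentiation with \<open>h\<close> arbitrary, since the
  product rule puts derivatives of \<open>h\<close> in its place; the bound on order 0 uses that
  \<open>h\<close> is bounded on the compact set.\<close>

lemma cont_op_mult:
  assumes "smooth h"
  shows "cont_op (\<lambda>\<omega> x. h x *\<^sub>R \<omega> x)"
  unfolding cont_op_def
proof (intro conjI allI impI)
  fix K :: "engel set" and m and \<epsilon> :: real assume K: "compact K" and "\<epsilon> > 0"
  then have "\<exists>\<delta>>0. \<forall>\<omega>. smooth \<omega> \<longrightarrow> {x. \<omega> x \<noteq> 0} \<subseteq> K \<longrightarrow> small m \<delta> \<omega> \<longrightarrow> small m \<epsilon> (\<lambda>x. h x *\<^sub>R \<omega> x)"
    using assms
  proof (induction m arbitrary: h \<epsilon>)
    case (0 h \<epsilon>)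
    obtain M where M: "\<And>x. x \<in> K \<Longrightarrow> \<bar>h x\<bar> \<le> M"
      using compact_imp_bounded[OF compact_continuous_image[OF smooth_continuous_on[OF 0(3)] 0(1)]]
      by (auto simp: bounded_iff)
    have "norm (h x *\<^sub>R \<omega> x) < \<epsilon>" if \<omega>: "{x. \<omega> x \<noteq> 0} \<subseteq> K" "small 0 (\<epsilon> / (\<bar>M\<bar> + 1)) \<omega>" for \<omega> :: form and x
    proof (cases "\<omega> x = 0")
      case True
      then show ?thesis using 0 by simp
    next
      case False
      then have "\<bar>h x\<bar> < \<bar>M\<bar> + 1" using M[of x] \<omega>(1) by fastforce
      moreover have "norm (\<omega> x) < \<epsilon> / (\<bar>M\<bar> + 1)" using \<omega>(2) by (simp add: small_0)
      ultimately have "\<bar>h x\<bar> * norm (\<omega> x) < (\<bar>M\<bar> + 1) * (\<epsilon> / (\<bar>M\<bar> + 1))"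
        by (intro mult_strict_mono) auto
      then show ?thesis by simp
    qed
    then show ?case
      using 0(2) by (intro exI[of _ "\<epsilon> / (\<bar>M\<bar> + 1)"]) (auto simp: small_0 add_nonneg_pos)
  next
    case (Suc m h \<epsilon>)
    have e2: "\<epsilon> / 2 > 0" using Suc.prems by simp
    have "\<forall>i. \<exists>\<delta>>0. \<forall>\<omega>. smooth \<omega> \<longrightarrow> {x. \<omega> x \<noteq> 0} \<subseteq> K \<longrightarrow> small m \<delta> \<omega> \<longrightarrow>
        small m (\<epsilon> / 2) (\<lambda>x. partial_deriv i h x *\<^sub>R \<omega> x)"
      by (intro allI Suc.IH[OF K e2 smooth_partial_deriv[OF Suc.prems(3)]])
    from choice[OF this] obtain d where "\<forall>i. d i > 0 \<and> (\<forall>\<omega>. smooth \<omega> \<longrightarrow> {x. \<omega> x \<noteq> 0} \<subseteq> K \<longrightarrow>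
        small m (d i) \<omega> \<longrightarrow> small m (\<epsilon> / 2) (\<lambda>x. partial_deriv i h x *\<^sub>R \<omega> x))" ..
    then have d: "d i > 0" "smooth \<omega> \<Longrightarrow> {x. \<omega> x \<noteq> 0} \<subseteq> K \<Longrightarrow> small m (d i) \<omega> \<Longrightarrow>
        small m (\<epsilon> / 2) (\<lambda>x. partial_deriv i h x *\<^sub>R \<omega> x)" for i \<omega> by blast+
    obtain d' where d': "d' > 0" "\<And>\<omega>. smooth \<omega> \<Longrightarrow> {x. \<omega> x \<noteq> 0} \<subseteq> K \<Longrightarrow> small m d' \<omega> \<Longrightarrow>
        small m (\<epsilon> / 2) (\<lambda>x. h x *\<^sub>R \<omega> x)"
      using Suc.IH[OF K e2 Suc.prems(3)] by meson
    define \<delta> where "\<delta> = min d' (Min (range d))"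
    have \<delta>: "\<delta> > 0" "\<delta> \<le> d'" "\<delta> \<le> d i" for i
      using d(1) d'(1) by (auto simp: \<delta>_def intro: min.coboundedI2)
    show ?case
    proof (intro exI[of _ \<delta>] conjI allI impI \<delta>(1))
      fix \<omega> assume \<omega>: "smooth \<omega>" "{x. \<omega> x \<noteq> 0} \<subseteq> K" "small (Suc m) \<delta> \<omega>"
      have s: "small m \<delta> \<omega>" "small m \<delta> (partial_deriv i \<omega>)" for i
        using \<omega>(3) small_mono[OF \<omega>(3), of m \<delta>] by (auto simp: small_Suc)
      have supp: "{x. partial_deriv i \<omega> x \<noteq> 0} \<subseteq> K" for i
        by (rule partial_deriv_support[OF compact_imp_closed[OF K] \<omega>(2)])
      have "small m (\<epsilon> / 2) (\<lambda>x. h x *\<^sub>R \<omega> x)"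
        by (rule d'(2)[OF \<omega>(1,2) small_mono[OF s(1) order_refl \<delta>(2)]])
      then have "small 0 (\<epsilon> / 2) (\<lambda>x. h x *\<^sub>R \<omega> x)" by (rule small_mono) simp_all
      then have 1: "small 0 \<epsilon> (\<lambda>x. h x *\<^sub>R \<omega> x)" by (rule small_mono) (use e2 in simp_all)
      have "small m (\<epsilon> / 2 + \<epsilon> / 2) (\<lambda>x. partial_deriv i h x *\<^sub>R \<omega> x + h x *\<^sub>R partial_deriv i \<omega> x)" for i
      proof (rule small_add)
        show "small m (\<epsilon> / 2) (\<lambda>x. partial_deriv i h x *\<^sub>R \<omega> x)"
          by (rule d(2)[OF \<omega>(1,2) small_mono[OF s(1) order_refl \<delta>(3)]])
        show "small m (\<epsilon> / 2) (\<lambda>x. h x *\<^sub>R partial_deriv i \<omega> x)"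
          by (rule d'(2)[OF smooth_partial_deriv[OF \<omega>(1)] supp small_mono[OF s(2) order_refl \<delta>(2)]])
      qed (intro smooth_scaleR smooth_partial_deriv Suc.prems \<omega>)+
      then show "small (Suc m) \<epsilon> (\<lambda>x. h x *\<^sub>R \<omega> x)"
        unfolding small_Suc partial_deriv_scaleR_fun[OF Suc.prems(3) \<omega>(1)] using 1 by simp
    qed
  qed
  then show "\<exists>m' \<delta>. \<delta> > 0 \<and> (\<forall>\<omega>. smooth \<omega> \<longrightarrow> {x. \<omega> x \<noteq> 0} \<subseteq> K \<longrightarrow> small m' \<delta> \<omega> \<longrightarrow> small m \<epsilon> (\<lambda>x. h x *\<^sub>R \<omega> x))"
    by blast
qed (use smooth_scaleR[OF assms] in auto)

lemma cont_op_left_inv_deriv_sum: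
  assumes "\<And>i. i \<in> S \<Longrightarrow> bounded_linear (A i)"
  shows "cont_op (\<lambda>\<omega> x. \<Sum>i\<in>S. A i (\<Sum>j\<in>UNIV. left_inv_field i x $ j *\<^sub>R partial_deriv j \<omega> x))"
proof (rule cont_op_sum)
  show "finite S" by simp
  fix i assume "i \<in> S"
  have "cont_op (\<lambda>\<omega> x. \<Sum>j\<in>UNIV. left_inv_field i x $ j *\<^sub>R partial_deriv j \<omega> x)"
    by (intro cont_op_sum finite cont_op_compose[OF cont_op_mult cont_op_partial_deriv]
        smooth_nth smooth_left_inv_field)
  from cont_op_compose[OF cont_op_linear[OF assms[OF \<open>i \<in> S\<close>]] this]
  show "cont_op (\<lambda>\<omega> x. A i (\<Sum>j\<in>UNIV. left_inv_field i x $ j *\<^sub>R partial_deriv j \<omega> x))" .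
qed

text \<open>The expression of d_m by partial derivatives is valid for smooth forms only, while the
  support condition in \<open>cont_op\<close> ranges over all forms and is therefore supplied
  separately.\<close>

lemma cont_op_cong:
  assumes L: "cont_op L" and eq: "\<And>\<omega>. smooth \<omega> \<Longrightarrow> M \<omega> = L \<omega>"
    and supp: "\<And>K \<omega>. closed K \<Longrightarrow> {x. \<omega> x \<noteq> 0} \<subseteq> K \<Longrightarrow> {x. M \<omega> x \<noteq> 0} \<subseteq> K"
  shows "cont_op M"
  unfolding cont_op_def
proof (intro conjI allI impI)
  fix K :: "engel set" and m and \<epsilon> :: real assume "compact K" "\<epsilon> > 0"
  then obtain m' \<delta> where "\<delta> > 0" "\<And>\<omega>. smooth \<omega> \<Longrightarrow> {x. \<omega> x \<noteq> 0} \<subseteq> K \<Longrightarrow> small m' \<delta> \<omega> \<Longrightarrow> small m \<epsilon> (L \<omega>)"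
    using L unfolding cont_op_def by meson
  then show "\<exists>m' \<delta>. \<delta> > 0 \<and> (\<forall>\<omega>. smooth \<omega> \<longrightarrow> {x. \<omega> x \<noteq> 0} \<subseteq> K \<longrightarrow> small m' \<delta> \<omega> \<longrightarrow> small m \<epsilon> (M \<omega>))"
    by (intro exI[of _ m'] exI[of _ \<delta>]) (simp add: eq)
qed (use cont_op_smooth[OF L] eq supp in simp_all)

lemma cont_op_dd: "cont_op (dd m)"
proof (cases "m = 0")
  case True
  then have "dd m = (\<lambda>\<omega> x. d_left_inv (\<omega> x))" by (simp add: fun_eq_iff dd_eq)
  then show ?thesis using cont_op_linear[OF bounded_linear_d_left_inv] by simp
next
  case False
  show ?thesis
  proof (rule cont_op_cong[OF cont_op_left_inv_deriv_sum[OF wedge.bounded_linear_right]])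
    show "dd m \<omega> = (\<lambda>x. \<Sum>i | weight i = m. theta i \<and>\<and> (\<Sum>j\<in>UNIV. left_inv_field i x $ j *\<^sub>R partial_deriv j \<omega> x))"
      if "smooth \<omega>" for \<omega>
      using False by (simp add: dd_def left_inv_deriv_sum[OF that, symmetric] left_inv_deriv_def)
  qed (rule dd_support)
qed

lemma cont_op_plus: "cont_op L \<Longrightarrow> cont_op M \<Longrightarrow> cont_op (\<lambda>\<omega>. L \<omega> + M \<omega>)"
  unfolding plus_fun_def by (rule cont_op_add)

lemma cont_op_minus: "cont_op L \<Longrightarrow> cont_op M \<Longrightarrow> cont_op (\<lambda>\<omega>. L \<omega> - M \<omega>)"
  using cont_op_add[of L "\<lambda>\<omega> x. - M \<omega> x"]
    cont_op_compose[OF cont_op_linear[OF bounded_linear_minus[OF bounded_linear_ident]], of M]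
  by (simp add: fun_diff_def)

text \<open>Linear local operators are continuous for the inductive limit topology. Linearity is
  required on test forms only, which is where d_m is known to be linear.\<close>

lemma LF_nhd0_vimage:
  assumes L: "cont_op L" and LO: "\<And>\<omega>. \<omega> \<in> Omega_c p k \<Longrightarrow> L \<omega> \<in> Omega_c p' k'"
    and add: "\<And>\<omega> \<eta>. \<omega> \<in> Omega_c p k \<Longrightarrow> \<eta> \<in> Omega_c p k \<Longrightarrow> L (\<omega> + \<eta>) = L \<omega> + L \<eta>"
    and scale: "\<And>c \<omega>. \<omega> \<in> Omega_c p k \<Longrightarrow> L (c *\<^sub>R \<omega>) = c *\<^sub>R L \<omega>"
    and N: "LF_nhd0 p' k' N"
  shows "LF_nhd0 p k {\<omega> \<in> Omega_c p k. L \<omega> \<in> N}"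
  unfolding LF_nhd0_def
proof (intro conjI allI impI)
  have conv: "convex N" and bal: "\<And>c \<omega>. \<bar>c\<bar> \<le> 1 \<Longrightarrow> \<omega> \<in> N \<Longrightarrow> c *\<^sub>R \<omega> \<in> N"
    using N by (auto simp: LF_nhd0_def)
  show "convex {\<omega> \<in> Omega_c p k. L \<omega> \<in> N}"
    using convexD[OF conv] by (auto intro!: convexI simp: add scale Omega_c_add Omega_c_scaleR)
  show "\<forall>\<omega>\<in>{\<omega> \<in> Omega_c p k. L \<omega> \<in> N}. c *\<^sub>R \<omega> \<in> {\<omega> \<in> Omega_c p k. L \<omega> \<in> N}" if "\<bar>c\<bar> \<le> 1" for c
    using bal[OF that] by (auto simp: scale Omega_c_scaleR)
  fix K :: "engel set" assume K: "compact K"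
  obtain m \<epsilon> where 1: "\<epsilon> > 0" "\<And>\<omega>. \<omega> \<in> Omega_c p' k' \<Longrightarrow> {x. \<omega> x \<noteq> 0} \<subseteq> K \<Longrightarrow> small m \<epsilon> \<omega> \<Longrightarrow> \<omega> \<in> N"
    using N K unfolding LF_nhd0_def small_def by meson
  obtain m' \<delta> where 2: "\<delta> > 0" "\<And>\<omega>. smooth \<omega> \<Longrightarrow> {x. \<omega> x \<noteq> 0} \<subseteq> K \<Longrightarrow> small m' \<delta> \<omega> \<Longrightarrow> small m \<epsilon> (L \<omega>)"
    using L K 1(1) unfolding cont_op_def by meson
  show "\<exists>m. \<exists>\<epsilon>>0. \<forall>\<omega>\<in>Omega_c p k. {x. \<omega> x \<noteq> 0} \<subseteq> K \<and>
      (\<forall>is x. length is \<le> m \<longrightarrow> norm (foldr partial_deriv is \<omega> x) < \<epsilon>) \<longrightarrow> \<omega> \<in> {\<omega> \<in> Omega_c p k. L \<omega> \<in> N}"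
    unfolding small_def[symmetric]
  proof (intro exI[of _ m'] exI[of _ \<delta>] conjI ballI impI 2(1))
    fix \<omega> assume \<omega>: "\<omega> \<in> Omega_c p k" "{x. \<omega> x \<noteq> 0} \<subseteq> K \<and> small m' \<delta> \<omega>"
    have "small m \<epsilon> (L \<omega>)"
      using 2(2)[OF Omega_smooth[OF Omega_c_Omega[OF \<omega>(1)]]] \<omega>(2) by blast
    moreover have "{x. L \<omega> x \<noteq> 0} \<subseteq> K"
      using cont_op_support[OF L compact_imp_closed[OF K]] \<omega>(2) by blast
    ultimately have "L \<omega> \<in> N" using 1(2)[OF LO[OF \<omega>(1)]] by blast
    then show "\<omega> \<in> {\<omega> \<in> Omega_c p k. L \<omega> \<in> N}" using \<omega>(1) by simp
  qed
qed blast

text \<open>On forms supported in a compact set \<open>K\<close> the pairing is bounded by sup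
  \<bar>\<alpha>\<bar> times the measure of \<open>K\<close> times sup \<bar>\<eta>\<bar>, so order
  0 of differentiation suffices.\<close>

lemma LF_nhd0_pairing:
  assumes \<alpha>: "smooth \<alpha>"
  shows "LF_nhd0 p k {\<eta> \<in> Omega_c p k. \<bar>form_pairing \<alpha> \<eta>\<bar> \<le> 1}"
  unfolding LF_nhd0_def
proof (intro conjI allI impI)
  have s: "smooth \<eta>" "bounded {x. \<eta> x \<noteq> 0}" if "\<eta> \<in> Omega_c p k" for \<eta>
    using that Omega_smooth[OF Omega_c_Omega] Omega_c_bounded by blast+
  show "convex {\<eta> \<in> Omega_c p k. \<bar>form_pairing \<alpha> \<eta>\<bar> \<le> 1}"
  proof (rule convexI)
    fix \<eta> \<theta> and u v :: real
    assume \<eta>: "\<eta> \<in> {\<eta> \<in> Omega_c p k. \<bar>form_pairing \<alpha> \<eta>\<bar> \<le> 1}" "\<theta> \<in> {\<eta> \<in> Omega_c p k. \<bar>form_pairing \<alpha> \<eta>\<bar> \<le> 1}"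
      and uv: "0 \<le> u" "0 \<le> v" "u + v = 1"
    then have O: "u *\<^sub>R \<eta> \<in> Omega_c p k" "v *\<^sub>R \<theta> \<in> Omega_c p k" by (auto intro: Omega_c_scaleR)
    have "form_pairing \<alpha> (u *\<^sub>R \<eta> + v *\<^sub>R \<theta>) = u * form_pairing \<alpha> \<eta> + v * form_pairing \<alpha> \<theta>"
      by (simp only: form_pairing_add_right[OF \<alpha> s[OF O(1)] s[OF O(2)]] form_pairing_scaleR_right)
    also have "\<bar>\<dots>\<bar> \<le> u * \<bar>form_pairing \<alpha> \<eta>\<bar> + v * \<bar>form_pairing \<alpha> \<theta>\<bar>"
      using abs_triangle_ineq[of "u * form_pairing \<alpha> \<eta>" "v * form_pairing \<alpha> \<theta>"] uv by (simp add: abs_mult)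
    also have "\<dots> \<le> u * 1 + v * 1" using \<eta> uv by (intro add_mono mult_left_mono) auto
    finally show "u *\<^sub>R \<eta> + v *\<^sub>R \<theta> \<in> {\<eta> \<in> Omega_c p k. \<bar>form_pairing \<alpha> \<eta>\<bar> \<le> 1}"
      using O uv by (simp add: Omega_c_add)
  qed
  show "\<forall>\<eta>\<in>{\<eta> \<in> Omega_c p k. \<bar>form_pairing \<alpha> \<eta>\<bar> \<le> 1}. c *\<^sub>R \<eta> \<in> {\<eta> \<in> Omega_c p k. \<bar>form_pairing \<alpha> \<eta>\<bar> \<le> 1}"
    if "\<bar>c\<bar> \<le> 1" for c
    using that by (auto simp: form_pairing_scaleR_right abs_mult Omega_c_scaleR intro: mult_le_one)
  fix K :: "engel set" assume K: "compact K"
  obtain C where C: "C > 0" "\<And>a b. norm (a \<and>\<and> b) \<le> norm a * norm b * C"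
    using wedge.pos_bounded by blast
  obtain M where M: "\<And>x. x \<in> K \<Longrightarrow> norm (\<alpha> x) \<le> M"
    using compact_imp_bounded[OF compact_continuous_image[OF smooth_continuous_on[OF \<alpha>] K]]
    by (auto simp: bounded_iff)
  define \<mu> where "\<mu> = measure lborel K"
  \<comment> \<open>The added 1 keeps the denominator positive when \<alpha> or the measure of
    \<open>K\<close> vanishes.\<close>
  define D where "D = \<bar>M\<bar> * C * \<mu> + 1"
  have "\<mu> \<ge> 0" by (simp add: \<mu>_def)
  then have D: "D > 0" "\<bar>M\<bar> * C * \<mu> \<le> D"
    using C by (simp_all add: D_def add_nonneg_pos)
  show "\<exists>m. \<exists>\<epsilon>>0. \<forall>\<omega>\<in>Omega_c p k. {x. \<omega> x \<noteq> 0} \<subseteq> K \<and>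
      (\<forall>is x. length is \<le> m \<longrightarrow> norm (foldr partial_deriv is \<omega> x) < \<epsilon>) \<longrightarrow>
      \<omega> \<in> {\<eta> \<in> Omega_c p k. \<bar>form_pairing \<alpha> \<eta>\<bar> \<le> 1}"
    unfolding small_def[symmetric]
  proof (intro exI[of _ "0 :: nat"] exI[of _ "1 / D"] conjI ballI impI)
    show "1 / D > 0" using D by simp
    fix \<eta> assume \<eta>: "\<eta> \<in> Omega_c p k" and small: "{x. \<eta> x \<noteq> 0} \<subseteq> K \<and> small 0 (1 / D) \<eta>"
    have bd: "norm ((\<alpha> x \<and>\<and> \<eta> x) $ UNIV) \<le> indicator K x * (\<bar>M\<bar> * (1 / D) * C)" for x
    proof (cases "x \<in> K")
      case True
      have "norm ((\<alpha> x \<and>\<and> \<eta> x) $ UNIV) \<le> norm (\<alpha> x \<and>\<and> \<eta> x)" by (simp add: component_le_norm_cart)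
      also have "\<dots> \<le> norm (\<alpha> x) * norm (\<eta> x) * C" by (rule C)
      also have "\<dots> \<le> \<bar>M\<bar> * (1 / D) * C"
      proof (intro mult_right_mono mult_mono)
        show "norm (\<alpha> x) \<le> \<bar>M\<bar>" using M[OF True] by linarith
        show "norm (\<eta> x) \<le> 1 / D" using small by (auto simp: small_0 intro: less_imp_le)
      qed (use C in auto)
      finally show ?thesis using True by simp
    next
      case False
      then have "\<eta> x = 0" using small by blast
      then show ?thesis using False by (simp add: wedge.zero_right)
    qed
    have ik: "integrable lborel (\<lambda>x. indicator K x * (\<bar>M\<bar> * (1 / D) * C))"
      using borel_integrable_compact[OF K continuous_on_const, of "\<bar>M\<bar> * (1 / D) * C"] by simp
    have "norm (LINT x|lborel. (\<alpha> x \<and>\<and> \<eta> x) $ UNIV) \<le> (LINT x|lborel. indicator K x * (\<bar>M\<bar> * (1 / D) * C))"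
      by (rule Bochner_Integration.integral_norm_bound_integral[OF wedge_integrable[OF \<alpha> s(1)[OF \<eta>]] ik bd])
        (use s(2)[OF \<eta>] in simp)
    also have "\<dots> = \<mu> * (\<bar>M\<bar> * (1 / D) * C)"
      using K by (simp add: \<mu>_def borel_compact)
    also have "\<dots> = (\<bar>M\<bar> * C * \<mu>) / D" by simp
    also have "\<dots> \<le> 1" using D by simp
    finally show "\<eta> \<in> {\<eta> \<in> Omega_c p k. \<bar>form_pairing \<alpha> \<eta>\<bar> \<le> 1}"
      using \<eta> by (simp add: form_pairing_def form_integral_def)
  qed
qed blast

section \<open>The maps into currents\<close>

lemma dual_rspace_lin_map:
  assumes T: "T \<in> vcar (dual_rspace (quotient_rspace Z B) X)" and B: "subspace B" "0 \<in> Z"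
  shows "T B = 0"
proof -
  have "lin_map (quotient_rspace Z B) real_rspace T" using T by (simp add: dual_rspace_def)
  moreover have "0 +o B \<in> vcar (quotient_rspace Z B)" using B(2) by (simp add: quotient_rspace_def del: set_zero_plus)
  ultimately have "T (vscale (quotient_rspace Z B) 0 (0 +o B)) = 0 * T (0 +o B)"
    unfolding lin_map_def by (simp add: real_rspace_def)
  then show ?thesis using coset_scale[OF B(1), of 0 0] by (simp add: quotient_rspace_def)
qed

lemma lin_map_restrict:
  assumes "lin_map V W f" "\<And>x y. x \<in> vcar V \<Longrightarrow> y \<in> vcar V \<Longrightarrow> vadd V x y \<in> vcar V"
    "\<And>c x. x \<in> vcar V \<Longrightarrow> vscale V c x \<in> vcar V"
  shows "lin_map V W (restrict f (vcar V))"
  using assms by (simp add: lin_map_def)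

lemma quotient_closed:
  assumes "subspace Z" "subspace B"
  shows "x \<in> vcar (quotient_rspace Z B) \<Longrightarrow> y \<in> vcar (quotient_rspace Z B) \<Longrightarrow>
      vadd (quotient_rspace Z B) x y \<in> vcar (quotient_rspace Z B)"
    and "x \<in> vcar (quotient_rspace Z B) \<Longrightarrow> vscale (quotient_rspace Z B) c x \<in> vcar (quotient_rspace Z B)"
  using assms
  by (auto simp: quotient_rspace_def coset_add coset_scale subspace_add subspace_scale)

lemma D_space_closed:
  assumes "r \<ge> 1"
  shows "x \<in> vcar (D_space r l p k) \<Longrightarrow> y \<in> vcar (D_space r l p k) \<Longrightarrow>
      vadd (D_space r l p k) x y \<in> vcar (D_space r l p k)"
    and "x \<in> vcar (D_space r l p k) \<Longrightarrow> vscale (D_space r l p k) c x \<in> vcar (D_space r l p k)"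
  unfolding D_space_def
  by (intro quotient_closed Omega_c.subspace_cycles[OF assms] Omega_c.subspace_boundaries; assumption)+

lemma continuous_map_restrict:
  assumes "continuous_map X Y f" "topspace X \<subseteq> S"
  shows "continuous_map X Y (restrict f S)"
  by (rule continuous_map_eq[OF assms(1)]) (use assms(2) in auto)

lemma topspace_D_top_car: "topspace (D_top r l p k) = vcar (D_space r l p k)"
  by (simp add: topspace_D_top D_space_def quotient_rspace_def)

lemma psi_lin_map:
  assumes rl: "r \<ge> 1" "l \<ge> 1"
  shows "lin_map (E_space r l p k) (C_space r l p k) (psi r l p k)"
proof -
  let ?D = "D_space l r (7 - p) (4 - k)"
  have mem: "psi r l p k A \<in> vcar (C_space r l p k)" if A: "A \<in> vcar (E_space r l p k)" for A
  proof -
    obtain \<alpha> where \<alpha>: "\<alpha> \<in> cycles Omega r p k" "A = \<alpha> +o boundaries Omega l p k"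
      using A by (rule E_space_carE[OF rl])
    have lin: "lin_map ?D real_rspace (pairing A)" by (rule pairing_bilinear(1)[OF rl A])
    have s: "smooth \<alpha>" using \<alpha>(1) by (auto simp: cycles_def Omega_smooth)
    have "continuous_map (D_top l r (7 - p) (4 - k)) euclideanreal (pairing A)"
    proof (rule D_top_bounded_imp_continuous[OF rl(2) lin LF_nhd0_pairing[OF s]])
      fix \<eta> assume "\<eta> \<in> {\<eta> \<in> Omega_c (7 - p) (4 - k). \<bar>form_pairing \<alpha> \<eta>\<bar> \<le> 1}" "\<eta> \<in> cycles Omega_c l (7 - p) (4 - k)"
      then show "\<bar>pairing A (\<eta> +o boundaries Omega_c r (7 - p) (4 - k))\<bar> \<le> 1"
        unfolding \<alpha>(2) using pairing_eq[OF rl \<alpha>(1)] by simp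
    qed
    then have "continuous_map (D_top l r (7 - p) (4 - k)) euclideanreal (psi r l p k A)"
      unfolding psi_def by (rule continuous_map_restrict) (simp add: topspace_D_top_car)
    moreover have "lin_map ?D real_rspace (psi r l p k A)"
      unfolding psi_def by (rule lin_map_restrict[OF lin]) (rule D_space_closed[OF rl(2)], assumption+)+
    ultimately show ?thesis by (simp add: C_space_def dual_rspace_def psi_def)
  qed
  show ?thesis
    unfolding lin_map_def
  proof (intro conjI ballI allI mem)
    have lin: "lin_map (E_space r l p k) real_rspace (\<lambda>A. pairing A H)" if "H \<in> vcar ?D" for H
      by (rule pairing_bilinear(2)[OF rl that])
    fix A assume A: "A \<in> vcar (E_space r l p k)"
    show "psi r l p k (vadd (E_space r l p k) A B) = vadd (C_space r l p k) (psi r l p k A) (psi r l p k B)"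
      if B: "B \<in> vcar (E_space r l p k)" for B
      using lin A B by (auto simp: C_space_def dual_rspace_def psi_def lin_map_def real_rspace_def intro!: restrict_ext)
    show "psi r l p k (vscale (E_space r l p k) c A) = vscale (C_space r l p k) c (psi r l p k A)" for c
      using lin A by (auto simp: C_space_def dual_rspace_def psi_def lin_map_def real_rspace_def intro!: restrict_ext)
  qed
qed

text \<open>The spectral differential is described by choices of auxiliary forms; here it is induced
  by one linear continuous operator on representatives, valid for all cycles at once.\<close>

definition continuous_diff :: "nat \<Rightarrow> int \<Rightarrow> int \<Rightarrow> bool" where
  "continuous_diff r p k \<longleftrightarrow> (\<exists>L. cont_op L \<and> (\<forall>\<omega>\<in>Omega_c p k. L \<omega> \<in> Omega_c (p + int r) (k + 1)) \<and>
     (\<forall>\<omega>\<in>Omega_c p k. \<forall>\<eta>\<in>Omega_c p k. L (\<omega> + \<eta>) = L \<omega> + L \<eta>) \<and>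
     (\<forall>c. \<forall>\<omega>\<in>Omega_c p k. L (c *\<^sub>R \<omega>) = c *\<^sub>R L \<omega>) \<and>
     (\<forall>m. \<forall>\<eta>\<in>cycles Omega_c r p k. spectral_diff Omega_c r p k (\<eta> +o boundaries Omega_c m p k) =
        L \<eta> +o boundaries Omega_c r (p + int r) (k + 1)))"

lemma D_space_diff:
  assumes "r \<ge> 1" "l \<ge> 1"
  shows "lin_map (D_space r m (7 - p - int r) (4 - k - 1)) (D_space l r (7 - p) (4 - k))
    (spectral_diff Omega_c r (7 - p - int r) (4 - k - 1))"
  using Omega_c.spectral_diff_lin_map[OF assms, of "7 - p - int r" "4 - k - 1" m]
  by (simp add: D_space_def)

text \<open>Continuity of the transposed functional: the neighbourhood on which \<open>T\<close> is
  bounded is pulled back along the operator \<open>L\<close> that induces the test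
  differential.\<close>

lemma current_boundary_lin_map:
  assumes r: "r \<ge> 1" and l: "l \<ge> 1"
    and cd: "continuous_diff r (7 - p - int r) (4 - k - 1)"
  shows "lin_map (C_space r l p k) (C_space m r (p + int r) (k + 1)) (current_boundary m r p k)"
proof -
  let ?D = "D_space l r (7 - p) (4 - k)" and ?D' = "D_space r m (7 - p - int r) (4 - k - 1)"
  let ?\<Delta> = "spectral_diff Omega_c r (7 - p - int r) (4 - k - 1)"
  let ?s = "(- 1 :: real) powi (k + 1)"
  have dims: "7 - (p + int r) = 7 - p - int r" "4 - (k + 1) = 4 - k - 1"
    "7 - p - int r + int r = 7 - p" "4 - k - 1 + 1 = 4 - k" by simp_all
  have sgn: "\<bar>?s\<bar> = 1" by (simp add: power_int_abs)
  note \<Delta> = D_space_diff[OF r l, of m p k]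
  have \<Delta>car: "?\<Delta> H \<in> vcar ?D" if "H \<in> vcar ?D'" for H using \<Delta> that by (simp add: lin_map_def)
  have mem: "current_boundary m r p k T \<in> vcar (C_space m r (p + int r) (k + 1))"
    if T: "T \<in> vcar (C_space r l p k)" for T
  proof -
    have lin: "lin_map ?D real_rspace T" and cont: "continuous_map (D_top l r (7 - p) (4 - k)) euclideanreal T"
      using T by (auto simp: C_space_def dual_rspace_def)
    have T0: "T (boundaries Omega_c r (7 - p) (4 - k)) = 0"
      using T unfolding C_space_def D_space_def
      by (rule dual_rspace_lin_map[OF _ Omega_c.subspace_boundaries subspace_0[OF Omega_c.subspace_cycles[OF l]]])
    have lin': "lin_map ?D' real_rspace (\<lambda>H. ?s * T (?\<Delta> H))"
      using lin \<Delta> unfolding lin_map_def real_rspace_def by (simp add: algebra_simps)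
    obtain N where N: "LF_nhd0 (7 - p) (4 - k) N" "\<And>\<eta>. \<eta> \<in> N \<Longrightarrow> \<eta> \<in> cycles Omega_c l (7 - p) (4 - k) \<Longrightarrow>
        \<bar>T (\<eta> +o boundaries Omega_c r (7 - p) (4 - k))\<bar> < 1"
      using D_top_continuous_imp_bounded[OF l cont T0] by blast
    obtain L where L: "cont_op L"
      "\<And>\<omega>. \<omega> \<in> Omega_c (7 - p - int r) (4 - k - 1) \<Longrightarrow> L \<omega> \<in> Omega_c (7 - p) (4 - k)"
      "\<And>\<omega> \<eta>. \<omega> \<in> Omega_c (7 - p - int r) (4 - k - 1) \<Longrightarrow> \<eta> \<in> Omega_c (7 - p - int r) (4 - k - 1) \<Longrightarrow> L (\<omega> + \<eta>) = L \<omega> + L \<eta>"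
      "\<And>c \<omega>. \<omega> \<in> Omega_c (7 - p - int r) (4 - k - 1) \<Longrightarrow> L (c *\<^sub>R \<omega>) = c *\<^sub>R L \<omega>"
      "\<And>\<eta>. \<eta> \<in> cycles Omega_c r (7 - p - int r) (4 - k - 1) \<Longrightarrow>
        ?\<Delta> (\<eta> +o boundaries Omega_c m (7 - p - int r) (4 - k - 1)) = L \<eta> +o boundaries Omega_c r (7 - p) (4 - k)"
      using cd unfolding continuous_diff_def dims by blast
    have "continuous_map (D_top r m (7 - p - int r) (4 - k - 1)) euclideanreal (\<lambda>H. ?s * T (?\<Delta> H))"
    proof (rule D_top_bounded_imp_continuous[OF r lin' LF_nhd0_vimage[OF L(1-4) N(1)]])
      fix \<eta> assume \<eta>: "\<eta> \<in> {\<omega> \<in> Omega_c (7 - p - int r) (4 - k - 1). L \<omega> \<in> N}" "\<eta> \<in> cycles Omega_c r (7 - p - int r) (4 - k - 1)"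
      then have "\<eta> +o boundaries Omega_c m (7 - p - int r) (4 - k - 1) \<in> vcar ?D'"
        by (simp add: D_space_def quotient_rspace_def)
      from \<Delta>car[OF this] have "L \<eta> +o boundaries Omega_c r (7 - p) (4 - k) \<in> vcar ?D"
        unfolding L(5)[OF \<eta>(2)] .
      then obtain z where z: "z \<in> cycles Omega_c l (7 - p) (4 - k)"
        "L \<eta> +o boundaries Omega_c r (7 - p) (4 - k) = z +o boundaries Omega_c r (7 - p) (4 - k)"
        by (auto simp: D_space_def quotient_rspace_def)
      \<comment> \<open>The class of L \<eta> is that of a cycle, and boundaries are cycles; so L
        \<eta> is itself a cycle and the bound on \<open>N\<close> may be used.\<close>
      then have "L \<eta> - z \<in> cycles Omega_c l (7 - p) (4 - k)"
        using Omega_c.boundaries_subset_cycles[OF l] by (auto simp: coset_eq_iff Omega_c.subspace_boundaries)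
      from subspace_add[OF Omega_c.subspace_cycles[OF l] this z(1)]
      have "L \<eta> \<in> cycles Omega_c l (7 - p) (4 - k)" by simp
      then have "\<bar>T (L \<eta> +o boundaries Omega_c r (7 - p) (4 - k))\<bar> < 1" using N(2) \<eta>(1) by blast
      then show "\<bar>?s * T (?\<Delta> (\<eta> +o boundaries Omega_c m (7 - p - int r) (4 - k - 1)))\<bar> \<le> 1"
        unfolding L(5)[OF \<eta>(2)] abs_mult sgn by simp
    qed
    then have "continuous_map (D_top r m (7 - p - int r) (4 - k - 1)) euclideanreal (current_boundary m r p k T)"
      unfolding current_boundary_def by (rule continuous_map_restrict) (simp add: topspace_D_top_car)
    moreover have "lin_map ?D' real_rspace (current_boundary m r p k T)"
      unfolding current_boundary_def by (rule lin_map_restrict[OF lin']) (rule D_space_closed[OF r], assumption+)+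
    ultimately show ?thesis
      unfolding C_space_def dims dual_rspace_def by (simp add: current_boundary_def)
  qed
  show ?thesis
    unfolding lin_map_def
  proof (intro conjI ballI allI mem)
    fix S assume S: "S \<in> vcar (C_space r l p k)"
    show "current_boundary m r p k (vadd (C_space r l p k) S T) =
        vadd (C_space m r (p + int r) (k + 1)) (current_boundary m r p k S) (current_boundary m r p k T)"
      if T: "T \<in> vcar (C_space r l p k)" for T
      using \<Delta>car unfolding C_space_def dims dual_rspace_def current_boundary_def
      by (auto simp: algebra_simps intro!: restrict_ext)
    show "current_boundary m r p k (vscale (C_space r l p k) c S) =
        vscale (C_space m r (p + int r) (k + 1)) c (current_boundary m r p k S)" for c
      using \<Delta>car unfolding C_space_def dims dual_rspace_def current_boundary_def
      by (auto simp: algebra_simps intro!: restrict_ext)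
  qed
qed

lemma current_boundary_current_boundary:
  assumes r: "r \<ge> 1" and l: "l \<ge> 1" and m: "m \<ge> 1" and T: "T \<in> vcar (C_space r l p k)"
  shows "current_boundary m' m (p + int r) (k + 1) (current_boundary m r p k T) =
    vzero (C_space m' m (p + int r + int m) (k + 1 + 1))"
proof -
  have dims: "7 - (p + int r) - int m = 7 - p - int r - int m" "4 - (k + 1) - 1 = 4 - k - 1 - 1"
    "7 - (p + int r + int m) = 7 - p - int r - int m" "4 - (k + 1 + 1) = 4 - k - 1 - 1" by simp_all
  have T0: "T (boundaries Omega_c r (7 - p) (4 - k)) = 0"
    using T unfolding C_space_def D_space_def
    by (rule dual_rspace_lin_map[OF _ Omega_c.subspace_boundaries subspace_0[OF Omega_c.subspace_cycles[OF l]]])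
  have "current_boundary m r p k T (spectral_diff Omega_c m (7 - p - int r - int m) (4 - k - 1 - 1) H) = 0"
    if H: "H \<in> vcar (D_space m m' (7 - p - int r - int m) (4 - k - 1 - 1))" for H
  proof -
    have car: "spectral_diff Omega_c m (7 - p - int r - int m) (4 - k - 1 - 1) H \<in> vcar (D_space r m (7 - p - int r) (4 - k - 1))"
      using D_space_diff[OF m r, of m' "p + int r" "k + 1"] H unfolding dims lin_map_def
      by (simp add: algebra_simps)
    have "spectral_diff Omega_c r (7 - p - int r) (4 - k - 1)
        (spectral_diff Omega_c m (7 - p - int r - int m) (4 - k - 1 - 1) H) = boundaries Omega_c r (7 - p) (4 - k)"
      using Omega_c.spectral_diff_spectral_diff[OF m r H[unfolded D_space_def]] by simp
    then show ?thesis
      unfolding current_boundary_def using car T0 by simp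
  qed
  then show ?thesis
    unfolding current_boundary_def[of m'] dims C_space_def dual_rspace_def
    by (auto intro!: restrict_ext)
qed

section \<open>An algebraic inverse of the component of weight zero\<close>

lemma index_set_distinct:
  "({3} :: 4 set) \<noteq> {4}" "({3} :: 4 set) \<noteq> {2, 4}" "({3} :: 4 set) \<noteq> {3, 4}"
  "({4} :: 4 set) \<noteq> {2, 4}" "({4} :: 4 set) \<noteq> {3, 4}" "({2, 4} :: 4 set) \<noteq> {3, 4}"
  "({1, 2} :: 4 set) \<noteq> {1, 3}" "({1, 2} :: 4 set) \<noteq> {1, 2, 3}" "({1, 2} :: 4 set) \<noteq> {1, 2, 4}"
  "({1, 3} :: 4 set) \<noteq> {1, 2, 3}" "({1, 3} :: 4 set) \<noteq> {1, 2, 4}" "({1, 2, 3} :: 4 set) \<noteq> {1, 2, 4}"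
  by (simp_all only: set_eq_iff forall_4 insert_iff empty_iff idx4_distinct simp_thms)

text \<open>The transpose of d_0 in the basis theta_I. Because d_0 maps four basis forms to distinct
  basis forms up to sign, and all others to 0, the transpose is a generalised inverse.\<close>

definition d0_inv :: "covector \<Rightarrow> covector" where
  "d0_inv \<xi> = - (\<xi> $ {1, 2}) *\<^sub>R axis {3} 1 - (\<xi> $ {1, 3}) *\<^sub>R axis {4} 1
     - (\<xi> $ {1, 2, 3}) *\<^sub>R axis {2, 4} 1 - (\<xi> $ {1, 2, 4}) *\<^sub>R axis {3, 4} 1"

lemma bounded_linear_d0_inv: "bounded_linear d0_inv"
  unfolding linear_conv_bounded_linear[symmetric]
  by (rule linearI) (simp_all add: d0_inv_def algebra_simps)

lemma d0_inv_nth: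
  "d0_inv \<xi> $ I = (if I = {3} then - (\<xi> $ {1, 2}) else if I = {4} then - (\<xi> $ {1, 3})
     else if I = {2, 4} then - (\<xi> $ {1, 2, 3}) else if I = {3, 4} then - (\<xi> $ {1, 2, 4}) else 0)"
  using index_set_distinct by (simp add: d0_inv_def axis_def)

lemma d_left_inv_d0_inv_nth:
  "d_left_inv (d0_inv \<xi>) $ I = (if I = {1, 2} \<or> I = {1, 3} \<or> I = {1, 2, 3} \<or> I = {1, 2, 4} then \<xi> $ I else 0)"
  unfolding d_left_inv_nth d0_inv_nth using index_set_distinct
  by (cases "I = {1, 2}"; cases "I = {1, 3}"; cases "I = {1, 2, 3}"; cases "I = {1, 2, 4}"; simp)

lemma d0_inv_d_left_inv_nth:
  "d0_inv (d_left_inv \<xi>) $ I = (if I = {3} \<or> I = {4} \<or> I = {2, 4} \<or> I = {3, 4} then \<xi> $ I else 0)"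
  unfolding d_left_inv_nth d0_inv_nth using index_set_distinct
  by (cases "I = {3}"; cases "I = {4}"; cases "I = {2, 4}"; cases "I = {3, 4}"; simp)

lemma d_left_inv_d0_inv_d_left_inv: "d_left_inv (d0_inv (d_left_inv \<xi>)) = d_left_inv \<xi>"
proof -
  have "d_left_inv (d0_inv (d_left_inv \<xi>)) $ I = d_left_inv \<xi> $ I" for I
  proof (cases "I = {1, 2} \<or> I = {1, 3} \<or> I = {1, 2, 3} \<or> I = {1, 2, 4}")
    case True
    then show ?thesis unfolding d_left_inv_d0_inv_nth by (simp only: if_True)
  next
    case False
    then have "d_left_inv \<xi> $ I = 0" by (simp add: d_left_inv_nth)
    with False show ?thesis unfolding d_left_inv_d0_inv_nth by (simp only: if_False)
  qed
  then show ?thesis by (simp add: covector_eq_iff)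
qed

definition dd0_inv :: "form \<Rightarrow> form" where
  "dd0_inv \<omega> = (\<lambda>x. d0_inv (\<omega> x))"

lemma cont_op_dd0_inv: "cont_op dd0_inv"
  unfolding dd0_inv_def[abs_def] by (rule cont_op_linear[OF bounded_linear_d0_inv])

lemma dd0_inv_add: "dd0_inv (\<omega> + \<eta>) = dd0_inv \<omega> + dd0_inv \<eta>"
  and dd0_inv_scaleR: "dd0_inv (c *\<^sub>R \<omega>) = c *\<^sub>R dd0_inv \<omega>"
  using linear_add[OF bounded_linear.linear[OF bounded_linear_d0_inv]]
    linear_scale[OF bounded_linear.linear[OF bounded_linear_d0_inv]]
  by (simp_all add: dd0_inv_def fun_eq_iff)

lemma Omega_dd0_inv:
  assumes "\<omega> \<in> Omega p k"
  shows "dd0_inv \<omega> \<in> Omega p (k - 1)"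
proof -
  have hom: "\<And>x I. \<omega> x $ I \<noteq> 0 \<Longrightarrow> int (\<Sum>i\<in>I. weight i) = p \<and> int (card I) = k"
    using assms by (auto simp: Omega_def)
  have "int (\<Sum>i\<in>I. weight i) = p \<and> int (card I) = k - 1" if ne: "d0_inv (\<omega> x) $ I \<noteq> 0" for x I
  proof -
    consider "\<omega> x $ {1, 2} \<noteq> 0" "I = {3}" | "\<omega> x $ {1, 3} \<noteq> 0" "I = {4}"
      | "\<omega> x $ {1, 2, 3} \<noteq> 0" "I = {2, 4}" | "\<omega> x $ {1, 2, 4} \<noteq> 0" "I = {3, 4}"
      using ne unfolding d0_inv_nth by (simp split: if_splits)
    then show ?thesis
    proof cases
      case 1
      then show ?thesis using hom[of x "{1, 2}"] by (simp add: weight_def)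
    next
      case 2
      then show ?thesis using hom[of x "{1, 3}"] by (simp add: weight_def)
    next
      case 3
      then show ?thesis using hom[of x "{1, 2, 3}"] by (simp add: weight_def)
    next
      case 4
      then show ?thesis using hom[of x "{1, 2, 4}"] by (simp add: weight_def)
    qed
  qed
  moreover have "smooth (dd0_inv \<omega>)"
    unfolding dd0_inv_def using assms by (intro smooth_linear[OF bounded_linear_d0_inv]) (rule Omega_smooth)
  ultimately show ?thesis by (simp add: Omega_def dd0_inv_def)
qed

lemma Omega_c_dd0_inv:
  assumes "\<omega> \<in> Omega_c p k"
  shows "dd0_inv \<omega> \<in> Omega_c p (k - 1)"
proof -
  have "d0_inv 0 = 0" by (rule linear_0[OF bounded_linear.linear[OF bounded_linear_d0_inv]])
  then have "{x. dd0_inv \<omega> x \<noteq> 0} \<subseteq> {x. \<omega> x \<noteq> 0}" by (auto simp: dd0_inv_def)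
  then show ?thesis
    using assms Omega_dd0_inv bounded_subset by (auto simp: Omega_c_iff)
qed

lemma dd_dd0_inv_dd: "dd 0 (dd0_inv (dd 0 \<omega>)) = dd 0 \<omega>"
  by (simp add: dd_eq dd0_inv_def d_left_inv_d0_inv_d_left_inv)

lemma Omega_nth_eq_0:
  "\<omega> \<in> Omega p k \<Longrightarrow> \<not> (int (\<Sum>i\<in>I. weight i) = p \<and> int (card I) = k) \<Longrightarrow> \<omega> x $ I = 0"
  by (auto simp: Omega_def)

text \<open>In these bidegrees the only basis forms are theta_12, theta_123 and theta_124, all of
  which are images of d_0.\<close>

lemma Omega_dd_dd0_inv:
  assumes "\<omega> \<in> Omega p k" "(p, k) \<in> {(2, 2), (4, 3), (5, 3)}"
  shows "dd 0 (dd0_inv \<omega>) = \<omega>"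
proof -
  have "d_left_inv (d0_inv (\<omega> x)) $ I = \<omega> x $ I" for x I
  proof -
    have "\<forall>I. int (\<Sum>i\<in>I. weight i) = p \<and> int (card I) = k \<longrightarrow>
        I = {1, 2} \<or> I = {1, 3} \<or> I = {1, 2, 3} \<or> I = {1, 2, 4}"
      using assms(2) unfolding all_index_set by (elim insertE emptyE) (simp_all add: weight_def)
    then have 0: "\<omega> x $ I = 0" if "\<not> (I = {1, 2} \<or> I = {1, 3} \<or> I = {1, 2, 3} \<or> I = {1, 2, 4})"
      using that by (intro Omega_nth_eq_0[OF assms(1)]) blast
    show ?thesis
    proof (cases "I = {1, 2} \<or> I = {1, 3} \<or> I = {1, 2, 3} \<or> I = {1, 2, 4}")
      case True
      then show ?thesis unfolding d_left_inv_d0_inv_nth by (simp only: if_True)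
    next
      case False
      from 0[OF False] False show ?thesis unfolding d_left_inv_d0_inv_nth by (simp only: if_False)
    qed
  qed
  then show ?thesis by (simp add: dd_eq dd0_inv_def fun_eq_iff covector_eq_iff)
qed

text \<open>The only basis form of weight 2 and degree 1 is theta_3, on which d_0 is
  injective.\<close>

lemma Omega_dd0_inv_dd:
  assumes "\<omega> \<in> Omega 2 1"
  shows "dd0_inv (dd 0 \<omega>) = \<omega>"
proof -
  have "d0_inv (d_left_inv (\<omega> x)) $ I = \<omega> x $ I" for x I
  proof -
    have "\<forall>I. int (\<Sum>i\<in>I. weight i) = 2 \<and> int (card I) = 1 \<longrightarrow> I = {3} \<or> I = {4} \<or> I = {2, 4} \<or> I = {3, 4}"
      unfolding all_index_set by (simp add: weight_def)
    then have 0: "\<omega> x $ I = 0" if "\<not> (I = {3} \<or> I = {4} \<or> I = {2, 4} \<or> I = {3, 4})"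
      using that by (intro Omega_nth_eq_0[OF assms]) blast
    show ?thesis
    proof (cases "I = {3} \<or> I = {4} \<or> I = {2, 4} \<or> I = {3, 4}")
      case True
      then show ?thesis unfolding d0_inv_d_left_inv_nth by (simp only: if_True)
    next
      case False
      from 0[OF False] False show ?thesis unfolding d0_inv_d_left_inv_nth by (simp only: if_False)
    qed
  qed
  then show ?thesis by (simp add: dd_eq dd0_inv_def fun_eq_iff covector_eq_iff)
qed

context graded_forms
begin

lemma spectral_diff_aux:
  assumes r: "r \<ge> 1" and \<alpha>: "\<alpha> \<in> cycles \<O> r p k" and z: "cycle_aux \<O> r p k \<alpha> z"
  shows "spectral_diff \<O> r p k (\<alpha> +o boundaries \<O> m p k) =
    (dd r \<alpha> - (\<Sum>i\<in>{1..<r}. dd i (z (r - i)))) +o boundaries \<O> r (p + int r) (k + 1)"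
proof -
  have "\<alpha> \<in> \<O> p k" "dd 0 \<alpha> = 0" using \<alpha> by (auto simp: cycles_def)
  from cycle_aux_lift[OF this z r] obtain w where w: "cycle_lift r p k w" "w p = \<alpha>"
    "total_diff w (p + int r) = dd r \<alpha> - (\<Sum>i\<in>{1..<r}. dd i (z (r - i)))" by blast
  show ?thesis using spectral_diff_eq[OF r w(1), of _ m] w(2,3) by simp
qed

end

section \<open>Canonical auxiliary forms and continuity of the spectral differentials\<close>

definition z1 :: "form \<Rightarrow> form" where "z1 \<omega> = dd0_inv (dd 1 \<omega>)"
definition z2 :: "form \<Rightarrow> form" where "z2 \<omega> = dd0_inv (dd 2 \<omega> - dd 1 (z1 \<omega>))"

lemma z1_Omega: "\<omega> \<in> Omega p k \<Longrightarrow> z1 \<omega> \<in> Omega (p + 1) k"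
  and z1_Omega_c: "\<omega> \<in> Omega_c p k \<Longrightarrow> z1 \<omega> \<in> Omega_c (p + 1) k"
  unfolding z1_def using Omega_dd0_inv[OF Omega_dd[of \<omega> p k 1]] Omega_c_dd0_inv[OF Omega_c_dd[of \<omega> p k 1]] by simp_all

lemma z2_Omega: "\<omega> \<in> Omega p k \<Longrightarrow> z2 \<omega> \<in> Omega (p + 2) k"
  and z2_Omega_c: "\<omega> \<in> Omega_c p k \<Longrightarrow> z2 \<omega> \<in> Omega_c (p + 2) k"
proof -
  assume "\<omega> \<in> Omega p k"
  then have "dd 2 \<omega> \<in> Omega (p + 2) (k + 1)" "dd 1 (z1 \<omega>) \<in> Omega (p + 2) (k + 1)"
    using Omega_dd[of \<omega> p k 2] Omega_dd[OF z1_Omega, of \<omega> p k 1] by (simp_all add: algebra_simps)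
  from Omega_dd0_inv[OF Omega.diff_mem[OF this]] show "z2 \<omega> \<in> Omega (p + 2) k" by (simp add: z2_def)
next
  assume "\<omega> \<in> Omega_c p k"
  then have "dd 2 \<omega> \<in> Omega_c (p + 2) (k + 1)" "dd 1 (z1 \<omega>) \<in> Omega_c (p + 2) (k + 1)"
    using Omega_c_dd[of \<omega> p k 2] Omega_c_dd[OF z1_Omega_c, of \<omega> p k 1] by (simp_all add: algebra_simps)
  from Omega_c_dd0_inv[OF Omega_c.diff_mem[OF this]] show "z2 \<omega> \<in> Omega_c (p + 2) k" by (simp add: z2_def)
qed

lemma sum_lt_2: "(\<Sum>i<2. f i) = f 0 + f (1 :: nat)" for f :: "nat \<Rightarrow> form"
  by (simp add: numeral_2_eq_2)

lemma cycle_aux_1: "cycle_aux \<O> 1 p k \<alpha> z"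
  by (simp add: cycle_aux_def)

lemma cycle_aux_2:
  "cycle_aux \<O> 2 p k \<alpha> z \<longleftrightarrow> z 1 \<in> \<O> (p + 1) k \<and> dd 1 \<alpha> = dd 0 (z 1)"
proof -
  have "{1..<2} = {1::nat}" by auto
  then show ?thesis by (simp add: cycle_aux_def)
qed

lemma cycle_aux_3:
  "cycle_aux \<O> 3 p k \<alpha> z \<longleftrightarrow> z 1 \<in> \<O> (p + 1) k \<and> z 2 \<in> \<O> (p + 2) k \<and>
    dd 1 \<alpha> = dd 0 (z 1) \<and> dd 2 \<alpha> = dd 0 (z 2) + dd 1 (z 1)"
proof -
  have "{1..<3} = {1, 2::nat}" by auto
  then show ?thesis unfolding cycle_aux_def by (simp add: sum_lt_2)
qed

text \<open>For r = 2, whenever d_1 \<alpha> is in the image of d_0, the generalised inverse finds a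
  preimage. For r = 3 the choice of the first auxiliary form could spoil the second equation; in the
  two bidegrees listed it does not, for two different reasons.\<close>

lemma cycle_aux_canonical:
  assumes \<O>: "\<O> = Omega \<or> \<O> = Omega_c" and \<alpha>: "\<alpha> \<in> cycles \<O> r p k"
    and r: "r = 1 \<or> r = 2 \<or> (r = 3 \<and> (p, k) \<in> {(1, 1), (3, 2)})"
  shows "cycle_aux \<O> r p k \<alpha> (\<lambda>j. if j = 1 then z1 \<alpha> else z2 \<alpha>)"
proof -
  have \<alpha>O: "\<alpha> \<in> \<O> p k" using \<alpha> by (simp add: cycles_def)
  have sub: "\<And>\<omega> p k. \<omega> \<in> \<O> p k \<Longrightarrow> \<omega> \<in> Omega p k" using \<O> Omega_c_Omega by blast
  have zO: "z1 \<alpha> \<in> \<O> (p + 1) k" "z2 \<alpha> \<in> \<O> (p + 2) k"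
    using \<O> \<alpha>O z1_Omega z1_Omega_c z2_Omega z2_Omega_c by blast+
  obtain z where z: "cycle_aux \<O> r p k \<alpha> z" using \<alpha> by (auto simp: cycles_def)
  have 1: "dd 1 \<alpha> = dd 0 (z1 \<alpha>)" if "dd 1 \<alpha> = dd 0 (z 1)"
    unfolding z1_def that dd_dd0_inv_dd ..
  consider "r = 1" | "r = 2" | "r = 3" "p = 1" "k = 1" | "r = 3" "p = 3" "k = 2" using r by auto
  then show ?thesis
  proof cases
    case 1
    show ?thesis unfolding 1 by (rule cycle_aux_1)
  next
    case 2
    then show ?thesis using z zO 1 by (simp add: cycle_aux_2)
  next
    case 3
    then have z': "z 1 \<in> \<O> 2 1" "dd 1 \<alpha> = dd 0 (z 1)" "dd 2 \<alpha> = dd 0 (z 2) + dd 1 (z 1)"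
      using z by (auto simp: cycle_aux_3)
    \<comment> \<open>In weight 2 and degree 1 the first auxiliary form is unique, so the given
      second one still solves its equation.\<close>
    have "z1 \<alpha> = z 1"
      unfolding z1_def z'(2) by (rule Omega_dd0_inv_dd[OF sub[OF z'(1)]])
    then have "dd 2 \<alpha> - dd 1 (z1 \<alpha>) = dd 0 (z 2)" using z'(3) by simp
    then have "dd 0 (z2 \<alpha>) = dd 2 \<alpha> - dd 1 (z1 \<alpha>)"
      by (simp add: z2_def dd_dd0_inv_dd)
    then show ?thesis using 3 zO 1[OF z'(2)] by (simp add: cycle_aux_3)
  next
    case 4
    then have z': "dd 1 \<alpha> = dd 0 (z 1)" using z by (simp add: cycle_aux_3)
    \<comment> \<open>Here the first auxiliary form is not unique, since d_0 theta_14 = 0, but in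
      weight 5 and degree 3 every form is in the image of d_0.\<close>
    have "dd 2 \<alpha> \<in> Omega 5 3" "dd 1 (z1 \<alpha>) \<in> Omega 5 3"
      using Omega_dd[OF sub[OF \<alpha>O], of 2] Omega_dd[OF sub[OF zO(1)], of 1] 4 by simp_all
    then have "dd 0 (z2 \<alpha>) = dd 2 \<alpha> - dd 1 (z1 \<alpha>)"
      unfolding z2_def by (intro Omega_dd_dd0_inv[of _ 5 3] Omega.diff_mem) simp_all
    then show ?thesis using 4 zO 1[OF z'] by (simp add: cycle_aux_3)
  qed
qed

lemma z1_linear:
  "smooth \<omega> \<Longrightarrow> smooth \<eta> \<Longrightarrow> z1 (\<omega> + \<eta>) = z1 \<omega> + z1 \<eta>"
  "smooth \<omega> \<Longrightarrow> z1 (c *\<^sub>R \<omega>) = c *\<^sub>R z1 \<omega>"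
  by (simp_all add: z1_def dd_add dd_scaleR dd0_inv_add dd0_inv_scaleR)

lemma cont_op_z1: "cont_op z1"
  unfolding z1_def[abs_def] by (intro cont_op_compose[OF cont_op_dd0_inv] cont_op_dd)

lemma cont_op_z2: "cont_op z2"
  unfolding z2_def[abs_def]
  by (intro cont_op_compose[OF cont_op_dd0_inv] cont_op_minus cont_op_compose[OF cont_op_dd] cont_op_z1 cont_op_dd)

lemma z2_linear:
  assumes "smooth \<omega>"
  shows "smooth \<eta> \<Longrightarrow> z2 (\<omega> + \<eta>) = z2 \<omega> + z2 \<eta>" "z2 (c *\<^sub>R \<omega>) = c *\<^sub>R z2 \<omega>"
proof -
  note s = cont_op_smooth[OF cont_op_z1]
  assume \<eta>: "smooth \<eta>"
  have "dd 2 (\<omega> + \<eta>) - dd 1 (z1 (\<omega> + \<eta>)) = (dd 2 \<omega> - dd 1 (z1 \<omega>)) + (dd 2 \<eta> - dd 1 (z1 \<eta>))"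
    by (simp add: z1_linear dd_add assms \<eta> s)
  then show "z2 (\<omega> + \<eta>) = z2 \<omega> + z2 \<eta>" by (simp only: z2_def dd0_inv_add)
next
  note s = cont_op_smooth[OF cont_op_z1]
  have "dd 2 (c *\<^sub>R \<omega>) - dd 1 (z1 (c *\<^sub>R \<omega>)) = c *\<^sub>R (dd 2 \<omega> - dd 1 (z1 \<omega>))"
    by (simp add: z1_linear dd_scaleR assms s scaleR_diff_right)
  then show "z2 (c *\<^sub>R \<omega>) = c *\<^sub>R z2 \<omega>" by (simp only: z2_def dd0_inv_scaleR)
qed

lemma continuous_diff:
  assumes r: "r = 1 \<or> r = 2 \<or> (r = 3 \<and> (p, k) \<in> {(1, 1), (3, 2)})"
  shows "continuous_diff r p k"
proof -
  define L where "L \<omega> = dd r \<omega> - (\<Sum>i\<in>{1..<r}. dd i (if r - i = 1 then z1 \<omega> else z2 \<omega>))" for \<omega>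
  have set3: "{1..<2} = {1::nat}" "{1..<3} = {1, 2::nat}" "{1..<1} = ({} :: nat set)" by auto
  have L1: "L = dd 1" if "r = 1" by (simp add: L_def that fun_eq_iff)
  have L2: "L = (\<lambda>\<omega>. dd 2 \<omega> - dd 1 (z1 \<omega>))" if "r = 2" unfolding L_def that set3 by (simp add: fun_eq_iff)
  have L3: "L = (\<lambda>\<omega>. dd 3 \<omega> - (dd 1 (z2 \<omega>) + dd 2 (z1 \<omega>)))" if "r = 3"
    unfolding L_def that set3 by (simp add: fun_eq_iff)
  have s: "smooth (z1 \<omega>)" "smooth (z2 \<omega>)" if "smooth \<omega>" for \<omega>
    using that cont_op_smooth cont_op_z1 cont_op_z2 by blast+
  have c: "cont_op (\<lambda>\<omega>. dd i (z1 \<omega>))" "cont_op (\<lambda>\<omega>. dd i (z2 \<omega>))" for i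
    by (rule cont_op_compose[OF cont_op_dd cont_op_z1] cont_op_compose[OF cont_op_dd cont_op_z2])+
  have "r = 1 \<or> r = 2 \<or> r = 3" using r by blast
  then have contL: "cont_op L"
  proof (elim disjE)
    assume "r = 1"
    show ?thesis unfolding L1[OF \<open>r = 1\<close>] by (rule cont_op_dd)
  next
    assume "r = 2"
    show ?thesis unfolding L2[OF \<open>r = 2\<close>] by (rule cont_op_minus[OF cont_op_dd c(1)])
  next
    assume "r = 3"
    show ?thesis unfolding L3[OF \<open>r = 3\<close>] by (rule cont_op_minus[OF cont_op_dd cont_op_plus[OF c(2) c(1)]])
  qed
  have addL: "L (\<omega> + \<eta>) = L \<omega> + L \<eta>" if "smooth \<omega>" "smooth \<eta>" for \<omega> \<eta>
    using \<open>r = 1 \<or> r = 2 \<or> r = 3\<close>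
  proof (elim disjE)
    assume r: "r = 1"
    show ?thesis unfolding L1[OF r]
      by (simp only: dd_add z1_linear z2_linear that s) (simp only: algebra_simps)?
  next
    assume r: "r = 2"
    show ?thesis unfolding L2[OF r]
      by (simp only: dd_add z1_linear z2_linear that s) (simp only: algebra_simps)?
  next
    assume r: "r = 3"
    show ?thesis unfolding L3[OF r]
      by (simp only: dd_add z1_linear z2_linear that s) (simp only: algebra_simps)?
  qed
  have scaleL: "L (c *\<^sub>R \<omega>) = c *\<^sub>R L \<omega>" if "smooth \<omega>" for \<omega> c
    using \<open>r = 1 \<or> r = 2 \<or> r = 3\<close>
  proof (elim disjE)
    assume r: "r = 1"
    show ?thesis unfolding L1[OF r]
      by (simp only: dd_scaleR z1_linear z2_linear that s scaleR_diff_right scaleR_add_right)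
  next
    assume r: "r = 2"
    show ?thesis unfolding L2[OF r]
      by (simp only: dd_scaleR z1_linear z2_linear that s scaleR_diff_right scaleR_add_right)
  next
    assume r: "r = 3"
    show ?thesis unfolding L3[OF r]
      by (simp only: dd_scaleR z1_linear z2_linear that s scaleR_diff_right scaleR_add_right)
  qed
  have memL: "L \<omega> \<in> Omega_c (p + int r) (k + 1)" if \<omega>: "\<omega> \<in> Omega_c p k" for \<omega>
  proof -
    have "dd r \<omega> \<in> Omega_c (p + int r) (k + 1)" by (rule Omega_c_dd[OF \<omega>])
    moreover have "dd 1 (z1 \<omega>) \<in> Omega_c (p + 2) (k + 1)" "dd 2 (z1 \<omega>) \<in> Omega_c (p + 3) (k + 1)"
      "dd 1 (z2 \<omega>) \<in> Omega_c (p + 3) (k + 1)"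
      using Omega_c_dd[OF z1_Omega_c[OF \<omega>], of 1] Omega_c_dd[OF z1_Omega_c[OF \<omega>], of 2]
        Omega_c_dd[OF z2_Omega_c[OF \<omega>], of 1] by (simp_all add: algebra_simps)
    ultimately show ?thesis
      using \<open>r = 1 \<or> r = 2 \<or> r = 3\<close>
      by (elim disjE) (simp_all only: L1 L2 L3 Omega_c.diff_mem Omega_c_add of_nat_numeral)
  qed
  have specL: "spectral_diff Omega_c r p k (\<eta> +o boundaries Omega_c m p k) =
      L \<eta> +o boundaries Omega_c r (p + int r) (k + 1)" if \<eta>: "\<eta> \<in> cycles Omega_c r p k" for \<eta> m
    using Omega_c.spectral_diff_aux[OF _ \<eta> cycle_aux_canonical[OF _ \<eta> r]] r by (auto simp: L_def)
  note sm = Omega_smooth[OF Omega_c_Omega]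
  show ?thesis
    unfolding continuous_diff_def
    by (intro exI[of _ L] conjI allI ballI) (fact contL | rule memL addL scaleL specL sm | assumption)+
qed

section \<open>Non-degeneracy\<close>

lemma shuffle_sign_sq: "shuffle_sign I J * shuffle_sign I J = 1"
proof -
  have "(if c then - 1 else 1) * (if c then - 1 else 1) = (1::real)" for c by simp
  then show ?thesis unfolding shuffle_sign_def by (simp flip: prod.distrib)
qed

lemma wedge_top_sum: "(a \<and>\<and> b) $ UNIV = (\<Sum>I\<in>UNIV. shuffle_sign I (- I) * a $ I * b $ (- I))"
  unfolding wedge_nth Pow_UNIV Compl_eq_Diff_UNIV ..

text \<open>The Hodge star for the orthonormal basis theta_I, with the sign \<open>s\<close> still
  to be chosen and with only the components in \<open>Q\<close> kept. The restriction to
  \<open>Q\<close> produces test forms that are cycles.\<close>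

definition hodge :: "(4 set \<Rightarrow> real) \<Rightarrow> (4 set \<Rightarrow> bool) \<Rightarrow> covector \<Rightarrow> covector" where
  "hodge s Q a = (\<chi> J. if Q J then s J * a $ (- J) else 0)"

lemma bounded_linear_hodge: "bounded_linear (hodge s Q)"
  unfolding linear_conv_bounded_linear[symmetric]
  by (rule linearI) (simp_all add: hodge_def covector_eq_iff algebra_simps)

lemma wedge_hodge_right:
  "(a \<and>\<and> hodge (\<lambda>J. shuffle_sign (- J) J) Q a) $ UNIV = (\<Sum>I\<in>UNIV. if Q (- I) then (a $ I)\<^sup>2 else 0)"
proof -
  have "shuffle_sign I (- I) * a $ I * (shuffle_sign I (- I) * a $ I) = (a $ I)\<^sup>2" for I
    using shuffle_sign_sq[of I "- I"] by (simp add: power2_eq_square algebra_simps)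
  then show ?thesis unfolding wedge_top_sum by (intro sum.cong) (simp_all add: hodge_def)
qed

lemma wedge_hodge_left:
  "(hodge (\<lambda>J. shuffle_sign J (- J)) Q b \<and>\<and> b) $ UNIV = (\<Sum>I\<in>UNIV. if Q I then (b $ (- I))\<^sup>2 else 0)"
proof -
  have "shuffle_sign I (- I) * (shuffle_sign I (- I) * b $ (- I)) * b $ (- I) = (b $ (- I))\<^sup>2" for I
    using shuffle_sign_sq[of I "- I"] by (simp add: power2_eq_square algebra_simps)
  then show ?thesis unfolding wedge_top_sum by (intro sum.cong) (simp_all add: hodge_def)
qed

lemma Omega_hodge:
  assumes "\<alpha> \<in> Omega p k"
  shows "(\<lambda>x. hodge s Q (\<alpha> x)) \<in> Omega (7 - p) (4 - k)"
proof -
  have "int (\<Sum>i\<in>J. weight i) = 7 - p \<and> int (card J) = 4 - k" if "hodge s Q (\<alpha> x) $ J \<noteq> 0" for x J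
  proof -
    have "\<alpha> x $ (- J) \<noteq> 0" using that by (auto simp: hodge_def split: if_splits)
    then have "int (\<Sum>i\<in>- J. weight i) = p" "int (card (- J)) = k"
      using assms by (auto simp: Omega_def)
    moreover have "sum f UNIV = sum f (- J) + sum f J" for f :: "4 \<Rightarrow> nat"
      using sum.subset_diff[of J UNIV f] by (simp add: Compl_eq_Diff_UNIV)
    from this[of weight] this[of "\<lambda>i. 1"]
    have "(\<Sum>i\<in>- J. weight i) + (\<Sum>i\<in>J. weight i) = 7" "card (- J) + card J = 4"
      by (simp_all add: sum_4 weight_def)
    ultimately show ?thesis by linarith
  qed
  moreover have "smooth (\<lambda>x. hodge s Q (\<alpha> x))"
    by (rule smooth_linear[OF bounded_linear_hodge Omega_smooth[OF assms]])
  ultimately show ?thesis by (simp add: Omega_def)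
qed

lemma sum_squares_eq_0:
  fixes a :: covector and P :: "4 set \<Rightarrow> bool" and f :: "4 set \<Rightarrow> 4 set"
  assumes "(\<Sum>I\<in>UNIV. if P I then (a $ f I)\<^sup>2 else 0) = 0" "P I"
  shows "a $ f I = 0"
proof -
  have "\<forall>I\<in>UNIV. (if P I then (a $ f I)\<^sup>2 else 0) = 0"
    using assms(1) by (subst (asm) sum_nonneg_eq_0_iff) auto
  then show ?thesis using assms(2) by (metis UNIV_I power_eq_0_iff)
qed

lemma smooth_sum_squares:
  fixes P :: "4 set \<Rightarrow> bool" and f :: "4 set \<Rightarrow> 4 set" and \<alpha> :: form
  assumes "smooth \<alpha>"
  shows "smooth (\<lambda>x. \<Sum>I\<in>UNIV. if P I then (\<alpha> x $ f I)\<^sup>2 else 0 :: real)"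
proof (rule smooth_sum)
  fix I :: "4 set"
  show "smooth (\<lambda>x. if P I then (\<alpha> x $ f I)\<^sup>2 else 0 :: real)"
    by (cases "P I") (simp_all add: smooth_power smooth_nth assms)
qed

text \<open>Pairing with a bump function times the restricted Hodge dual gives the integral of the
  bump times a sum of squares of the coefficients complementary to \<open>Q\<close>.\<close>

lemma pairing_nondegenerate_left:
  assumes \<alpha>: "\<alpha> \<in> Omega p k"
    and orth: "\<And>\<eta>. \<eta> \<in> Omega_c (7 - p) (4 - k) \<Longrightarrow> (\<And>x J. \<not> Q J \<Longrightarrow> \<eta> x $ J = 0) \<Longrightarrow> form_pairing \<alpha> \<eta> = 0"
    and Q: "Q (- I)"
  shows "\<alpha> x $ I = 0"
proof -
  obtain \<phi> :: "engel \<Rightarrow> real" where \<phi>: "smooth \<phi>" "\<And>x. \<phi> x \<ge> 0" "\<phi> x > 0" "bounded {x. \<phi> x \<noteq> 0}"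
    using bump_exists[of x] by blast
  let ?h = "hodge (\<lambda>J. shuffle_sign (- J) J) Q"
  let ?S = "\<lambda>y. \<Sum>I\<in>UNIV. if Q (- I) then (\<alpha> y $ I)\<^sup>2 else 0"
  define \<eta> where "\<eta> = (\<lambda>y. \<phi> y *\<^sub>R ?h (\<alpha> y))"
  have h: "(\<lambda>y. ?h (\<alpha> y)) \<in> Omega (7 - p) (4 - k)" by (rule Omega_hodge[OF \<alpha>])
  have "\<eta> \<in> Omega (7 - p) (4 - k)"
    using h smooth_scaleR[OF \<phi>(1) Omega_smooth[OF h]] by (auto simp: Omega_def \<eta>_def)
  moreover have "bounded {y. \<eta> y \<noteq> 0}" by (rule bounded_subset[OF \<phi>(4)]) (auto simp: \<eta>_def)
  ultimately have "form_pairing \<alpha> \<eta> = 0"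
    by (intro orth) (auto simp: Omega_c_iff \<eta>_def hodge_def)
  moreover have "(\<alpha> y \<and>\<and> \<eta> y) $ UNIV = \<phi> y * ?S y" for y
    by (simp add: \<eta>_def wedge.scaleR_right wedge_hodge_right)
  ultimately have "(LINT y|lborel. \<phi> y * ?S y) = 0"
    by (simp add: form_pairing_def form_integral_def)
  moreover have "smooth (\<lambda>y. \<phi> y * ?S y)"
    by (intro smooth_mult \<phi> smooth_sum_squares[where f = "\<lambda>I. I"] Omega_smooth[OF \<alpha>])
  moreover have "bounded {y. \<phi> y * ?S y \<noteq> 0}" by (rule bounded_subset[OF \<phi>(4)]) auto
  ultimately have "\<phi> x * ?S x = 0"
    using \<phi>(2) by (intro nonneg_integral_0_imp_0[of "\<lambda>y. \<phi> y * ?S y"] smooth_continuous_on)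
      (auto intro!: mult_nonneg_nonneg sum_nonneg)
  then have "?S x = 0" using \<phi>(3) by simp
  from sum_squares_eq_0[OF this Q] show ?thesis .
qed

lemma pairing_nondegenerate_right:
  assumes \<eta>: "\<eta> \<in> Omega_c p k"
    and orth: "\<And>\<alpha>. \<alpha> \<in> Omega (7 - p) (4 - k) \<Longrightarrow> (\<And>x J. \<not> Q J \<Longrightarrow> \<alpha> x $ J = 0) \<Longrightarrow> form_pairing \<alpha> \<eta> = 0"
    and Q: "Q (- I)"
  shows "\<eta> x $ I = 0"
proof -
  let ?h = "hodge (\<lambda>J. shuffle_sign J (- J)) Q"
  let ?S = "\<lambda>y. \<Sum>I\<in>UNIV. if Q I then (\<eta> y $ (- I))\<^sup>2 else 0"
  note \<eta>O = Omega_c_Omega[OF \<eta>]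
  have h: "(\<lambda>y. ?h (\<eta> y)) \<in> Omega (7 - p) (4 - k)" by (rule Omega_hodge[OF \<eta>O])
  have "form_pairing (\<lambda>y. ?h (\<eta> y)) \<eta> = 0"
    by (intro orth h) (simp add: hodge_def)
  then have "(LINT y|lborel. ?S y) = 0"
    by (simp add: form_pairing_def form_integral_def wedge_hodge_left)
  moreover have "smooth (\<lambda>y. ?S y)"
    by (intro smooth_sum_squares Omega_smooth[OF \<eta>O])
  moreover have "?S y = 0" if "\<eta> y = 0" for y using that by (simp cong: if_cong)
  then have "bounded {y. ?S y \<noteq> 0}"
    by (intro bounded_subset[OF Omega_c_bounded[OF \<eta>]]) blast
  ultimately have "?S x = 0"
    by (intro nonneg_integral_0_imp_0[of ?S] smooth_continuous_on) (auto intro!: sum_nonneg)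
  from sum_squares_eq_0[OF this Q] show ?thesis by simp
qed

section \<open>Reduction of non-degeneracy and injectivity to representatives\<close>

definition left_nondegenerate :: "nat \<Rightarrow> nat \<Rightarrow> int \<Rightarrow> int \<Rightarrow> bool" where
  "left_nondegenerate r l p k \<longleftrightarrow> (\<forall>\<alpha>\<in>cycles Omega r p k.
     (\<forall>\<eta>\<in>cycles Omega_c l (7 - p) (4 - k). form_pairing \<alpha> \<eta> = 0) \<longrightarrow> \<alpha> \<in> boundaries Omega l p k)"

definition right_nondegenerate :: "nat \<Rightarrow> nat \<Rightarrow> int \<Rightarrow> int \<Rightarrow> bool" where
  "right_nondegenerate r l p k \<longleftrightarrow> (\<forall>\<eta>\<in>cycles Omega_c l (7 - p) (4 - k).
     (\<forall>\<alpha>\<in>cycles Omega r p k. form_pairing \<alpha> \<eta> = 0) \<longrightarrow> \<eta> \<in> boundaries Omega_c r (7 - p) (4 - k))"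

lemma pairing_nondegenerateI:
  assumes rl: "r \<ge> 1" "l \<ge> 1" and nd: "left_nondegenerate r l p k" "right_nondegenerate r l p k"
  shows "pairing_nondegenerate r l p k"
proof -
  have coset: "\<alpha> +o boundaries Omega l p k = boundaries Omega l p k" if "\<alpha> \<in> boundaries Omega l p k" for \<alpha>
    using coset_eq_iff[OF Omega.subspace_boundaries, of \<alpha> l p k 0] that by simp
  have coset': "\<eta> +o boundaries Omega_c r (7 - p) (4 - k) = boundaries Omega_c r (7 - p) (4 - k)"
    if "\<eta> \<in> boundaries Omega_c r (7 - p) (4 - k)" for \<eta>
    using coset_eq_iff[OF Omega_c.subspace_boundaries, of \<eta> r "7 - p" "4 - k" 0] that by simp
  have car: "\<alpha> +o boundaries Omega l p k \<in> vcar (E_space r l p k)" if "\<alpha> \<in> cycles Omega r p k" for \<alpha>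
    using that by (simp add: E_space_def quotient_rspace_def)
  have car': "\<eta> +o boundaries Omega_c r (7 - p) (4 - k) \<in> vcar (D_space l r (7 - p) (4 - k))"
    if "\<eta> \<in> cycles Omega_c l (7 - p) (4 - k)" for \<eta>
    using that by (simp add: D_space_def quotient_rspace_def)
  have vz: "vzero (E_space r l p k) = boundaries Omega l p k"
    "vzero (D_space l r (7 - p) (4 - k)) = boundaries Omega_c r (7 - p) (4 - k)"
    by (simp_all add: E_space_def D_space_def quotient_rspace_def)
  show ?thesis
    unfolding pairing_nondegenerate_def Let_def vz
  proof (intro conjI ballI impI)
    fix A assume A: "A \<in> vcar (E_space r l p k)" and 0: "\<forall>H\<in>vcar (D_space l r (7 - p) (4 - k)). pairing A H = 0"
    obtain \<alpha> where \<alpha>: "\<alpha> \<in> cycles Omega r p k" "A = \<alpha> +o boundaries Omega l p k"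
      using A by (rule E_space_carE[OF rl])
    have "form_pairing \<alpha> \<eta> = 0" if "\<eta> \<in> cycles Omega_c l (7 - p) (4 - k)" for \<eta>
      using 0 car'[OF that] pairing_eq[OF rl \<alpha>(1) that] by (simp add: \<alpha>(2))
    then show "A = boundaries Omega l p k"
      using nd(1) \<alpha> coset unfolding left_nondegenerate_def by blast
  next
    fix H assume H: "H \<in> vcar (D_space l r (7 - p) (4 - k))" and 0: "\<forall>A\<in>vcar (E_space r l p k). pairing A H = 0"
    obtain \<eta> where \<eta>: "\<eta> \<in> cycles Omega_c l (7 - p) (4 - k)" "H = \<eta> +o boundaries Omega_c r (7 - p) (4 - k)"
      using H by (rule D_space_carE[OF rl])
    have "form_pairing \<alpha> \<eta> = 0" if "\<alpha> \<in> cycles Omega r p k" for \<alpha>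
      using 0 car[OF that] pairing_eq[OF rl that \<eta>(1)] by (simp add: \<eta>(2))
    then show "H = boundaries Omega_c r (7 - p) (4 - k)"
      using nd(2) \<eta> coset' unfolding right_nondegenerate_def by blast
  qed
qed

text \<open>The difference of two classes with the same functional is orthogonal to all test cycles,
  so left non-degeneracy applies to it.\<close>

lemma psi_inj_on:
  assumes rl: "r \<ge> 1" "l \<ge> 1" and nd: "left_nondegenerate r l p k"
  shows "inj_on (psi r l p k) (vcar (E_space r l p k))"
proof (rule inj_onI)
  fix A A' assume A: "A \<in> vcar (E_space r l p k)" "A' \<in> vcar (E_space r l p k)" and eq: "psi r l p k A = psi r l p k A'"
  obtain \<alpha> where \<alpha>: "\<alpha> \<in> cycles Omega r p k" "A = \<alpha> +o boundaries Omega l p k"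
    using A(1) by (rule E_space_carE[OF rl])
  obtain \<alpha>' where \<alpha>': "\<alpha>' \<in> cycles Omega r p k" "A' = \<alpha>' +o boundaries Omega l p k"
    using A(2) by (rule E_space_carE[OF rl])
  have d: "\<alpha> - \<alpha>' \<in> cycles Omega r p k"
    by (rule subspace_diff[OF Omega.subspace_cycles[OF rl(1)] \<alpha>(1) \<alpha>'(1)])
  have "form_pairing (\<alpha> - \<alpha>') \<eta> = 0" if \<eta>: "\<eta> \<in> cycles Omega_c l (7 - p) (4 - k)" for \<eta>
  proof -
    let ?H = "\<eta> +o boundaries Omega_c r (7 - p) (4 - k)"
    have "?H \<in> vcar (D_space l r (7 - p) (4 - k))" using \<eta> by (simp add: D_space_def quotient_rspace_def)
    then have "pairing A ?H = pairing A' ?H"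
      using fun_cong[OF eq, of ?H] by (simp add: psi_def)
    then have "form_pairing \<alpha> \<eta> = form_pairing \<alpha>' \<eta>"
      unfolding \<alpha>(2) \<alpha>'(2) pairing_eq[OF rl \<alpha>(1) \<eta>] pairing_eq[OF rl \<alpha>'(1) \<eta>] .
    moreover have "form_pairing (\<alpha>' + (\<alpha> - \<alpha>')) \<eta> = form_pairing \<alpha>' \<eta> + form_pairing (\<alpha> - \<alpha>') \<eta>"
      using \<eta> \<alpha>'(1) d by (intro form_pairing_add_left)
        (auto simp: cycles_def Omega_c_iff intro: Omega_smooth)
    ultimately show ?thesis by simp
  qed
  then have "\<alpha> - \<alpha>' \<in> boundaries Omega l p k"
    using nd d unfolding left_nondegenerate_def by blast
  then show "A = A'" unfolding \<alpha>(2) \<alpha>'(2) by (simp add: coset_eq_iff[OF Omega.subspace_boundaries])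
qed

section \<open>Spaces of cycles with vacuous or algebraic conditions\<close>

lemma dd_0_eq_0:
  assumes "\<alpha> \<in> Omega p k" "(p, k) \<notin> {(2, 1), (3, 1), (4, 2), (5, 2)}"
  shows "dd 0 \<alpha> = 0"
proof -
  have "\<alpha> x $ {3} = 0" "\<alpha> x $ {4} = 0" "\<alpha> x $ {2, 4} = 0" "\<alpha> x $ {3, 4} = 0" for x
    using assms(2) by (auto intro!: Omega_nth_eq_0[OF assms(1)] simp: weight_def)
  then show ?thesis by (simp add: dd_eq d_left_inv_eq fun_eq_iff)
qed

lemma cycles_1: "cycles \<O> 1 p k = {\<alpha> \<in> \<O> p k. dd 0 \<alpha> = 0}"
  by (auto simp: cycles_def cycle_aux_def)

text \<open>In these bidegrees d_1 lands in bidegree (2, 2) or (5, 3), where d_0 is onto, so the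
  auxiliary form always exists.\<close>

lemma cycles_2:
  assumes \<O>: "\<O> = Omega \<or> \<O> = Omega_c" and pk: "(p, k) = (1, 1) \<or> (p, k) = (4, 2)"
  shows "cycles \<O> 2 p k = {\<alpha> \<in> \<O> p k. dd 0 \<alpha> = 0}"
proof -
  have "cycle_aux \<O> 2 p k \<alpha> (\<lambda>j. z1 \<alpha>)" if "\<alpha> \<in> \<O> p k" for \<alpha>
  proof -
    have "\<alpha> \<in> Omega p k" using that \<O> Omega_c_Omega by blast
    then have "dd 1 \<alpha> = dd 0 (z1 \<alpha>)"
      unfolding z1_def using pk Omega_dd[of \<alpha> p k 1] by (intro Omega_dd_dd0_inv[symmetric]) auto
    moreover have "z1 \<alpha> \<in> \<O> (p + 1) k" using that \<O> z1_Omega z1_Omega_c by blast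
    ultimately show ?thesis by (simp add: cycle_aux_2)
  qed
  then show ?thesis by (auto simp: cycles_def)
qed

text \<open>On weight 3, degree 2 the operator d_0 vanishes, and both equations for the auxiliary
  forms take place in bidegrees where d_0 is onto, (4, 3) and (5, 3).\<close>

lemma cycles_3:
  assumes \<O>: "\<O> = Omega \<or> \<O> = Omega_c"
  shows "cycles \<O> 3 3 2 = \<O> 3 2"
proof -
  have "dd 0 \<alpha> = 0 \<and> cycle_aux \<O> 3 3 2 \<alpha> (\<lambda>j. if j = 1 then z1 \<alpha> else z2 \<alpha>)" if \<alpha>: "\<alpha> \<in> \<O> 3 2" for \<alpha>
  proof -
    have \<alpha>': "\<alpha> \<in> Omega 3 2" using \<alpha> \<O> Omega_c_Omega by blast
    have "dd 0 \<alpha> = 0" by (rule dd_0_eq_0[OF \<alpha>']) auto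
    moreover have z: "z1 \<alpha> \<in> \<O> 4 2" "z2 \<alpha> \<in> \<O> 5 2"
      using \<O> \<alpha> z1_Omega[of \<alpha> 3 2] z1_Omega_c[of \<alpha> 3 2] z2_Omega[of \<alpha> 3 2] z2_Omega_c[of \<alpha> 3 2] by auto
    moreover have "dd 1 \<alpha> = dd 0 (z1 \<alpha>)"
      unfolding z1_def using Omega_dd[OF \<alpha>', of 1] by (intro Omega_dd_dd0_inv[of _ 4 3, symmetric]) auto
    moreover have "dd 2 \<alpha> - dd 1 (z1 \<alpha>) \<in> Omega 5 3"
      using Omega_dd[OF \<alpha>', of 2] Omega_dd[OF z1_Omega[OF \<alpha>'], of 1] by (intro Omega.diff_mem) auto
    then have "dd 0 (z2 \<alpha>) = dd 2 \<alpha> - dd 1 (z1 \<alpha>)"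
      unfolding z2_def by (rule Omega_dd_dd0_inv) simp
    ultimately show ?thesis by (simp add: cycle_aux_3)
  qed
  then show ?thesis by (auto simp: cycles_def)
qed

lemma cycles_full:
  assumes \<O>: "\<O> = Omega \<or> \<O> = Omega_c"
    and "(r, p, k) \<in> {(1, 0, 0), (1, 1, 1), (2, 1, 1), (3, 3, 2), (1, 6, 3), (1, 7, 4)}"
  shows "cycles \<O> r p k = \<O> p k"
proof -
  have sub: "\<alpha> \<in> Omega p k" if "\<alpha> \<in> \<O> p k" for \<alpha> p k using that \<O> Omega_c_Omega by blast
  have 1: "cycles \<O> 1 p k = \<O> p k" if "(p, k) \<in> {(0, 0), (1, 1), (6, 3), (7, 4)}" for p k
    unfolding cycles_1 using that dd_0_eq_0[OF sub] by auto
  have 2: "cycles \<O> 2 1 1 = \<O> 1 1"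
    using cycles_2[OF \<O>, of 1 1] dd_0_eq_0[OF sub, of _ 1 1] by auto
  show ?thesis using assms(2) 1[of p k] 2 cycles_3[OF \<O>] by auto
qed

text \<open>If all test forms are cycles, orthogonality forces \<alpha> = 0, which is a boundary of
  any order.\<close>

lemma left_nondegenerate_full:
  assumes full: "cycles Omega_c l (7 - p) (4 - k) = Omega_c (7 - p) (4 - k)"
  shows "left_nondegenerate r l p k"
  unfolding left_nondegenerate_def full
proof (intro ballI impI)
  fix \<alpha> assume \<alpha>: "\<alpha> \<in> cycles Omega r p k" and 0: "\<forall>\<eta>\<in>Omega_c (7 - p) (4 - k). form_pairing \<alpha> \<eta> = 0"
  have "\<alpha> x $ I = 0" for x I
    using \<alpha> 0 by (intro pairing_nondegenerate_left[of \<alpha> p k "\<lambda>J. True"]) (auto simp: cycles_def)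
  then have "\<alpha> = 0" by (simp add: fun_eq_iff covector_eq_iff)
  then show "\<alpha> \<in> boundaries Omega l p k" by (simp add: subspace_0 Omega.subspace_boundaries)
qed

lemma right_nondegenerate_full:
  assumes full: "cycles Omega r p k = Omega p k"
  shows "right_nondegenerate r l p k"
  unfolding right_nondegenerate_def full
proof (intro ballI impI)
  fix \<eta> assume \<eta>: "\<eta> \<in> cycles Omega_c l (7 - p) (4 - k)" and 0: "\<forall>\<alpha>\<in>Omega p k. form_pairing \<alpha> \<eta> = 0"
  have "\<eta> x $ I = 0" for x I
    using \<eta> 0 by (intro pairing_nondegenerate_right[of \<eta> "7 - p" "4 - k" "\<lambda>J. True"]) (auto simp: cycles_def)
  then have "\<eta> = 0" by (simp add: fun_eq_iff covector_eq_iff)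
  then show "\<eta> \<in> boundaries Omega_c r (7 - p) (4 - k)" by (simp add: subspace_0 Omega_c.subspace_boundaries)
qed

text \<open>A multiple of theta_13 is d_0 of a multiple of theta_4; the auxiliary form of weight 2
  can be taken to be 0.\<close>

lemma boundaries_2_mem:
  assumes \<O>: "\<O> = Omega \<or> \<O> = Omega_c" and \<alpha>: "\<alpha> \<in> \<O> 3 2" and 0: "\<And>x I. I \<noteq> {1, 3} \<Longrightarrow> \<alpha> x $ I = 0"
  shows "\<alpha> \<in> boundaries \<O> 2 3 2"
proof -
  have "d_left_inv (d0_inv (\<alpha> x)) $ I = \<alpha> x $ I" for x I
    using 0[of I x] by (cases "I = {1, 3}") (auto simp: d_left_inv_d0_inv_nth)
  then have \<alpha>_eq: "dd 0 (dd0_inv \<alpha>) = \<alpha>" by (simp add: dd_eq dd0_inv_def fun_eq_iff covector_eq_iff)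
  have "dd0_inv \<alpha> \<in> \<O> 3 1"
    using \<O> \<alpha> Omega_dd0_inv[of \<alpha> 3 2] Omega_c_dd0_inv[of \<alpha> 3 2] by auto
  moreover have "0 \<in> \<O> p k" for p k using \<O> Omega_zero Omega_c_zero by blast
  moreover have "{1..<2} = {1::nat}" by auto
  ultimately show ?thesis
    unfolding boundaries_def using \<alpha> \<alpha>_eq
    by (intro CollectI conjI exI[of _ "\<lambda>j. if j = 0 then dd0_inv \<alpha> else 0"]) (auto simp: sum_lt_2)
qed

text \<open>In weight 4, degree 2 the form theta_14 is killed by d_0 and theta_24 is not, so the
  condition of being a cycle is a pointwise one.\<close>

lemma cycles_2_4_2_mem:
  assumes \<O>: "\<O> = Omega \<or> \<O> = Omega_c" and \<alpha>: "\<alpha> \<in> \<O> 4 2" and 0: "\<And>x J. \<not> J \<noteq> {2, 4} \<Longrightarrow> \<alpha> x $ J = 0"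
  shows "\<alpha> \<in> cycles \<O> 2 4 2"
proof -
  have \<alpha>': "\<alpha> \<in> Omega 4 2" using \<alpha> \<O> Omega_c_Omega by blast
  have "\<alpha> x $ {3} = 0" "\<alpha> x $ {4} = 0" "\<alpha> x $ {3, 4} = 0" for x
    by (auto intro!: Omega_nth_eq_0[OF \<alpha>'] simp: weight_def)
  then have "dd 0 \<alpha> = 0" using 0[of "{2, 4}"] by (simp add: dd_eq d_left_inv_eq fun_eq_iff)
  then show ?thesis using \<alpha> cycles_2[OF \<O>, of 4 2] by simp
qed

lemma Compl_neq: "I \<noteq> {1, 3} \<Longrightarrow> - I \<noteq> {2, 4}" for I :: "4 set"
  using Compl_index_set(10) by (metis double_complement)

text \<open>The test cycles have no theta_24 component and so cannot see theta_13, its complement.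
  The undetected component is exactly what the boundaries of order 2 provide; all the rest vanishes
  by the Hodge argument.\<close>

lemma left_nondegenerate_3_2: "left_nondegenerate 3 2 3 2"
  unfolding left_nondegenerate_def
proof (intro ballI impI)
  fix \<alpha> assume \<alpha>: "\<alpha> \<in> cycles Omega 3 3 2" and 0: "\<forall>\<eta>\<in>cycles Omega_c 2 (7 - 3) (4 - 2). form_pairing \<alpha> \<eta> = 0"
  have \<alpha>O: "\<alpha> \<in> Omega 3 2" using \<alpha> by (simp add: cycles_def)
  have "\<alpha> x $ I = 0" if "I \<noteq> {1, 3}" for x I
    using 0 cycles_2_4_2_mem[of Omega_c] Compl_neq[OF that]
    by (intro pairing_nondegenerate_left[OF \<alpha>O, of "\<lambda>J. J \<noteq> {2, 4}"]) auto
  then show "\<alpha> \<in> boundaries Omega 2 3 2" using \<alpha>O by (intro boundaries_2_mem) auto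
qed

lemma right_nondegenerate_2_3: "right_nondegenerate 2 3 4 2"
  unfolding right_nondegenerate_def
proof (intro ballI impI)
  fix \<eta> assume \<eta>: "\<eta> \<in> cycles Omega_c 3 (7 - 4) (4 - 2)" and 0: "\<forall>\<alpha>\<in>cycles Omega 2 4 2. form_pairing \<alpha> \<eta> = 0"
  have \<eta>O: "\<eta> \<in> Omega_c 3 2" using \<eta> by (simp add: cycles_def)
  have "\<eta> x $ I = 0" if "I \<noteq> {1, 3}" for x I
    using 0 cycles_2_4_2_mem[of Omega] Compl_neq[OF that]
    by (intro pairing_nondegenerate_right[OF \<eta>O, of "\<lambda>J. J \<noteq> {2, 4}"]) auto
  then show "\<eta> \<in> boundaries Omega_c 2 (7 - 4) (4 - 2)" using \<eta>O boundaries_2_mem[of Omega_c \<eta>] by auto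
qed

section \<open>The pairings between weights 6 and 1\<close>

definition single :: "4 set \<Rightarrow> (engel \<Rightarrow> real) \<Rightarrow> form" where
  "single I f = (\<lambda>x. f x *\<^sub>R axis I 1)"

lemma smooth_single: "smooth f \<Longrightarrow> smooth (single I f)"
  unfolding single_def by (intro smooth_scaleR smooth_const)

lemma single_Omega:
  assumes "smooth f" "int (\<Sum>i\<in>I. weight i) = p" "int (card I) = k"
  shows "single I f \<in> Omega p k"
  using assms smooth_single[OF assms(1)] by (auto simp: Omega_def single_def axis_def)

lemma single_Omega_c:
  assumes "smooth f" "bounded {x. f x \<noteq> 0}" "int (\<Sum>i\<in>I. weight i) = p" "int (card I) = k"
  shows "single I f \<in> Omega_c p k"
proof -
  have "bounded {x. single I f x \<noteq> 0}"
    by (rule bounded_subset[OF assms(2)]) (auto simp: single_def)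
  then show ?thesis using single_Omega assms by (simp add: Omega_c_iff)
qed

lemma left_inv_deriv_single:
  assumes "smooth f"
  shows "\<X> i (single I f) = single I (\<X> i f)"
  unfolding single_def
  by (rule left_inv_deriv_linear[OF bounded_linear_scaleR_left[of "axis I 1 :: covector"] assms])

lemma dd_single:
  assumes "smooth f"
  shows "dd 0 (single I f) = (\<lambda>x. f x *\<^sub>R d_left_inv (axis I 1))"
    "dd 1 (single I f) = (\<lambda>x. \<X> 1 f x *\<^sub>R (theta 1 \<and>\<and> axis I 1) + \<X> 2 f x *\<^sub>R (theta 2 \<and>\<and> axis I 1))"
    "dd 2 (single I f) = (\<lambda>x. \<X> 3 f x *\<^sub>R (theta 3 \<and>\<and> axis I 1))"
  unfolding dd_eq left_inv_deriv_single[OF assms]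
  by (simp_all only: single_def d_left_inv_scaleR wedge.scaleR_right)

lemma theta_wedge_axis_values:
  "theta 1 \<and>\<and> axis {1, 4} 1 = 0" "theta 2 \<and>\<and> axis {1, 4} 1 = - axis {1, 2, 4} 1"
  "theta 1 \<and>\<and> axis {3, 4} 1 = axis {1, 3, 4} 1" "theta 2 \<and>\<and> axis {3, 4} 1 = axis {2, 3, 4} 1"
  "theta 3 \<and>\<and> axis {1, 4} 1 = - axis {1, 3, 4} 1"
  "theta 1 \<and>\<and> axis {1} 1 = 0" "theta 2 \<and>\<and> axis {1} 1 = - axis {1, 2} 1"
  "theta 3 \<and>\<and> axis {1} 1 = - axis {1, 3} 1" 
  "theta 1 \<and>\<and> axis {3} 1 = axis {1, 3} 1" "theta 2 \<and>\<and> axis {3} 1 = axis {2, 3} 1"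
proof -
  have [simp]: "({2, 1, 4} :: 4 set) = {1, 2, 4}" "({3, 1, 4} :: 4 set) = {1, 3, 4}"
    "({2, 1} :: 4 set) = {1, 2}" "({3, 1} :: 4 set) = {1, 3}"
    "({1, 4, 2} :: 4 set) = {1, 2, 4}" "({3, 4, 1} :: 4 set) = {1, 3, 4}"
    "({3, 4, 2} :: 4 set) = {2, 3, 4}" "({1, 4, 3} :: 4 set) = {1, 3, 4}" "({3, 2} :: 4 set) = {2, 3}"
    by auto
  show "theta 1 \<and>\<and> axis {1, 4} 1 = 0" "theta 2 \<and>\<and> axis {1, 4} 1 = - axis {1, 2, 4} 1"
    "theta 1 \<and>\<and> axis {3, 4} 1 = axis {1, 3, 4} 1" "theta 2 \<and>\<and> axis {3, 4} 1 = axis {2, 3, 4} 1"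
    "theta 3 \<and>\<and> axis {1, 4} 1 = - axis {1, 3, 4} 1"
    "theta 1 \<and>\<and> axis {1} 1 = 0" "theta 2 \<and>\<and> axis {1} 1 = - axis {1, 2} 1"
    "theta 3 \<and>\<and> axis {1} 1 = - axis {1, 3} 1"
    "theta 1 \<and>\<and> axis {3} 1 = axis {1, 3} 1" "theta 2 \<and>\<and> axis {3} 1 = axis {2, 3} 1"
    by (simp_all add: theta_def axis_wedge_axis shuffle_sign_def pos_def)
qed

lemma d_left_inv_axis_values:
  "d_left_inv (axis {1, 4} 1) = 0" "d_left_inv (axis {3, 4} 1) = - axis {1, 2, 4} 1"
  "d_left_inv (axis {1} 1) = 0" "d_left_inv (axis {3} 1) = - axis {1, 2} 1" "d_left_inv (axis {4} 1) = - axis {1, 3} 1"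
  by (simp_all add: d_left_inv_eq axis_def set_eq_iff forall_4)

text \<open>Try c_4 = u theta_14, c_5 = f theta_34 and c_6 = 0. In weight 5 the condition d_0 c_5 +
  d_1 c_4 = 0 forces f = - X_2 u, and then d_1 c_5 + d_2 c_4 has coefficients - (X_1 X_2 u + X_3 u)
  at theta_134 and - X_2 X_2 u at theta_234. The two equations for \<open>u\<close> come from
  here.\<close>

lemma boundaries_3_mem:
  assumes \<O>: "\<O> = Omega \<or> (\<O> = Omega_c \<and> bounded {x. u x \<noteq> 0})" and \<alpha>: "\<alpha> \<in> \<O> 6 3"
    and u: "smooth u" "\<X> 2 (\<X> 2 u) = (\<lambda>x. - (\<alpha> x $ {2, 3, 4}))"
    and u': "\<And>x. \<X> 1 (\<X> 2 u) x + \<X> 3 u x = - (\<alpha> x $ {1, 3, 4})"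
  shows "\<alpha> \<in> boundaries \<O> 3 6 3"
proof -
  note s = smooth_left_inv_deriv[OF u(1)]
  let ?f = "\<lambda>x. - \<X> 2 u x"
  have sf: "smooth ?f" by (rule smooth_minus[OF s])
  define c where "c j = (if j = 1 then single {3, 4} ?f else if j = 2 then single {1, 4} u else 0)" for j :: nat
  have "single {3, 4} ?f \<in> \<O> 5 2 \<and> single {1, 4} u \<in> \<O> 4 2 \<and> 0 \<in> \<O> 6 2"
    using \<O>
  proof (elim disjE conjE)
    assume "\<O> = Omega"
    then show ?thesis
      using single_Omega[OF sf] single_Omega[OF u(1)] Omega_zero by (simp add: weight_def)
  next
    assume "\<O> = Omega_c" and b: "bounded {x. u x \<noteq> 0}"
    moreover have "bounded {x. ?f x \<noteq> 0}" using bounded_left_inv_deriv[OF b, of 2] by simp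
    ultimately show ?thesis
      using single_Omega_c[OF sf] single_Omega_c[OF u(1) b] Omega_c_zero by (simp add: weight_def)
  qed
  then have c_mem: "single {3, 4} ?f \<in> \<O> 5 2" "single {1, 4} u \<in> \<O> 4 2" "0 \<in> \<O> 6 2" by simp_all
  have \<alpha>': "\<alpha> \<in> Omega 6 3" using \<alpha> \<O> Omega_c_Omega by blast
  have Xf: "\<X> i ?f = (\<lambda>x. - \<X> i (\<X> 2 u) x)" for i by (rule left_inv_deriv_minus[OF s])
  have \<alpha>_eq: "\<alpha> x = \<alpha> x $ {1, 3, 4} *\<^sub>R axis {1, 3, 4} 1 + \<alpha> x $ {2, 3, 4} *\<^sub>R axis {2, 3, 4} 1" for x
  proof -
    have "({1, 3, 4} :: 4 set) \<noteq> {2, 3, 4}"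
      by (simp only: set_eq_iff forall_4 insert_iff empty_iff idx4_distinct simp_thms)
    moreover have "\<forall>I. int (\<Sum>i\<in>I. weight i) = 6 \<and> int (card I) = 3 \<longrightarrow> I = {1, 3, 4} \<or> I = {2, 3, 4}"
      unfolding all_index_set by (simp add: weight_def)
    then have "\<alpha> x $ I = 0" if "\<not> (I = {1, 3, 4} \<or> I = {2, 3, 4})" for I
      using that by (intro Omega_nth_eq_0[OF \<alpha>']) blast
    ultimately show ?thesis by (auto simp: covector_eq_iff axis_def)
  qed
  have top: "\<alpha> = dd 1 (single {3, 4} ?f) + dd 2 (single {1, 4} u)"
  proof (rule ext)
    fix x
    have a: "\<alpha> x $ {1, 3, 4} = - \<X> 1 (\<X> 2 u) x - \<X> 3 u x" using u'[of x] by linarith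
    have b: "\<alpha> x $ {2, 3, 4} = - \<X> 2 (\<X> 2 u) x" unfolding u(2) by simp
    show "\<alpha> x = (dd 1 (single {3, 4} ?f) + dd 2 (single {1, 4} u)) x"
      unfolding dd_single[OF sf] dd_single[OF u(1)] theta_wedge_axis_values Xf plus_fun_apply
      by (subst \<alpha>_eq) (simp add: a b algebra_simps)
  qed
  have mid: "dd 0 (single {3, 4} ?f) + dd 1 (single {1, 4} u) = 0"
    unfolding dd_single[OF sf] dd_single[OF u(1)] theta_wedge_axis_values d_left_inv_axis_values
    by (simp add: fun_eq_iff)
  have bot: "dd 0 (single {1, 4} u) = 0"
    unfolding dd_single[OF u(1)] d_left_inv_axis_values by (simp add: fun_eq_iff)
  have sets: "{1..<3} = {1, 2::nat}" "{2..<3} = {2::nat}" "{..<3} = {0, 1, 2::nat}" by auto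
  show ?thesis
    unfolding boundaries_def
  proof (intro CollectI conjI exI[of _ c] allI impI ballI \<alpha>)
    fix j :: nat assume "j < 3"
    then have "j = 0 \<or> j = 1 \<or> j = 2" by auto
    then show "c j \<in> \<O> (6 - int j) (3 - 1)" using c_mem by (auto simp: c_def)
  next
    show "\<alpha> = (\<Sum>j<3. dd j (c j))" unfolding sets using top by (simp add: c_def)
  next
    fix i :: nat assume "i \<in> {1..<3}"
    then have "i = 1 \<or> i = 2" by auto
    then show "0 = (\<Sum>j\<in>{i..<3}. dd (j - i) (c j))"
    proof (elim disjE)
      assume i: "i = 1"
      show ?thesis unfolding i sets using mid by (simp add: c_def)
    next
      assume i: "i = 2"
      show ?thesis unfolding i sets using bot by (simp add: c_def)
    qed
  qed
qed

context graded_forms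
begin

text \<open>It is the lowest component of the exact form d h, which is closed in all
  weights.\<close>

lemma dd_1_mem_cycles:
  assumes h: "h \<in> \<O> 0 0" "dd 0 h = 0" and m: "m \<ge> 1"
  shows "dd 1 h \<in> cycles \<O> m 1 1"
proof -
  define w where "w q = (if q = 0 then h else 0)" for q :: int
  have w: "cycle_lift 1 0 0 w"
    using h zero_mem by (auto simp: cycle_lift_def w_def total_diff_def)
  moreover have "total_diff w 1 = dd 1 h" by (simp add: total_diff_def w_def)
  ultimately show ?thesis
    using total_diff_cycle_lift[OF w, of m] cycles_iff_lift[OF m] by force
qed

end

lemma dd_1_top:
  assumes "smooth \<alpha>"
  shows "dd 1 \<alpha> x $ UNIV = \<X> 1 (\<lambda>x. \<alpha> x $ {2, 3, 4}) x - \<X> 2 (\<lambda>x. \<alpha> x $ {1, 3, 4}) x"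
proof -
  have "\<X> i (\<lambda>x. \<alpha> x $ J) x = \<X> i \<alpha> x $ J" for i J
    using left_inv_deriv_linear[OF bounded_linear_vec_nth assms, of i J] by (simp add: fun_eq_iff)
  then show ?thesis by (simp add: dd_eq UNIV_4 theta_wedge_index_set)
qed

text \<open>Pairing with d_1 h for test functions \<open>h\<close> gives d_1 \<alpha> = 0, which in
  coefficients is the compatibility condition of the two equations for the potential.\<close>

lemma left_nondegenerate_1_3: "left_nondegenerate 1 3 6 3"
  unfolding left_nondegenerate_def
proof (intro ballI impI)
  fix \<alpha> assume \<alpha>: "\<alpha> \<in> cycles Omega 1 6 3" and 0: "\<forall>\<eta>\<in>cycles Omega_c 3 (7 - 6) (4 - 3). form_pairing \<alpha> \<eta> = 0"
  have \<alpha>O: "\<alpha> \<in> Omega 6 3" using \<alpha> by (simp add: cycles_def)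
  note s = Omega_smooth[OF \<alpha>O]
  have d\<alpha>: "dd 1 \<alpha> \<in> Omega 7 4" using Omega_dd[OF \<alpha>O, of 1] by simp
  have "form_pairing (dd 1 \<alpha>) h = 0" if h: "h \<in> Omega_c (7 - 7) (4 - 4)" for h
  proof -
    have h': "h \<in> Omega_c 0 0" using h by simp
    have "dd 0 h = 0" by (rule dd_0_eq_0[OF Omega_c_Omega[OF h']]) auto
    then have "dd 1 h \<in> cycles Omega_c 3 1 1" by (intro Omega_c.dd_1_mem_cycles h') auto
    then have "form_pairing \<alpha> (dd 1 h) = 0" using 0 by simp
    then show ?thesis
      using stokes[OF \<alpha>O Omega_smooth[OF Omega_c_Omega[OF h']], of 1] Omega_c_bounded[OF h'] by simp
  qed
  then have "dd 1 \<alpha> x $ UNIV = 0" for x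
    by (intro pairing_nondegenerate_left[OF d\<alpha>, of "\<lambda>J. True"]) auto
  then have "\<X> 1 (\<lambda>x. \<alpha> x $ {2, 3, 4}) = \<X> 2 (\<lambda>x. \<alpha> x $ {1, 3, 4})"
    using dd_1_top[OF s] by (simp add: fun_eq_iff)
  then obtain u where "smooth u" "\<X> 2 (\<X> 2 u) = (\<lambda>x. - (\<alpha> x $ {2, 3, 4}))"
    "\<And>x. \<X> 1 (\<X> 2 u) x + \<X> 3 u x = - (\<alpha> x $ {1, 3, 4})"
    using smooth_potential_exists[OF smooth_nth[OF s] smooth_nth[OF s]] by blast
  then show "\<alpha> \<in> boundaries Omega 3 6 3" using \<alpha>O by (intro boundaries_3_mem) auto
qed

text \<open>The auxiliary forms are f theta_3 with f = X_2 p, forced by d_1, and g theta_4 with g =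
  X_3 p + X_1 X_2 p. What d_0 cannot absorb is the coefficient X_2 X_2 p of theta_23.\<close>

lemma cycle_single:
  assumes p: "smooth p" "\<X> 2 (\<X> 2 p) = (\<lambda>x. 0)"
  shows "single {1} p \<in> cycles Omega 3 1 1"
proof -
  let ?f = "\<X> 2 p" let ?g = "\<lambda>x. \<X> 3 p x + \<X> 1 (\<X> 2 p) x"
  have sf: "smooth ?f" and sg: "smooth ?g"
    by (intro smooth_add smooth_left_inv_deriv p)+
  define z where "z j = (if j = 1 then single {3} ?f else single {4} ?g)" for j :: nat
  have mem: "single {1} p \<in> Omega 1 1" "single {3} ?f \<in> Omega 2 1" "single {4} ?g \<in> Omega 3 1"
    by (rule single_Omega[OF p(1)] single_Omega[OF sf] single_Omega[OF sg]; simp add: weight_def)+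
  have "dd 0 (single {1} p) = 0"
    unfolding dd_single[OF p(1)] d_left_inv_axis_values by (simp add: fun_eq_iff)
  moreover have "dd 1 (single {1} p) = dd 0 (single {3} ?f)"
    unfolding dd_single[OF p(1)] dd_single[OF sf] theta_wedge_axis_values d_left_inv_axis_values by simp
  moreover have "dd 2 (single {1} p) = dd 0 (single {4} ?g) + dd 1 (single {3} ?f)"
    unfolding dd_single[OF p(1)] dd_single[OF sf] dd_single[OF sg] theta_wedge_axis_values d_left_inv_axis_values p(2)
    by (simp add: fun_eq_iff algebra_simps)
  ultimately have "cycle_aux Omega 3 1 1 (single {1} p) z"
    unfolding cycle_aux_3 using mem by (simp add: z_def)
  with \<open>dd 0 (single {1} p) = 0\<close> mem show ?thesis by (auto simp: cycles_def)
qed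

text \<open>Exact forms again give compatibility. The cycles p theta_1 turn orthogonality into the
  vanishing of the integrals of \<open>p\<close> against the coefficient of theta_234, which is the
  hypothesis needed for a compactly supported potential.\<close>

lemma right_nondegenerate_3_1: "right_nondegenerate 3 1 1 1"
  unfolding right_nondegenerate_def
proof (intro ballI impI)
  fix \<eta> assume \<eta>: "\<eta> \<in> cycles Omega_c 1 (7 - 1) (4 - 1)" and 0: "\<forall>\<alpha>\<in>cycles Omega 3 1 1. form_pairing \<alpha> \<eta> = 0"
  have \<eta>O: "\<eta> \<in> Omega_c 6 3" using \<eta> by (simp add: cycles_def)
  note s = Omega_smooth[OF Omega_c_Omega[OF \<eta>O]] and bd = Omega_c_bounded[OF \<eta>O]
  have d\<eta>: "dd 1 \<eta> \<in> Omega_c 7 4" using Omega_c_dd[OF \<eta>O, of 1] by simp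
  have "form_pairing h (dd 1 \<eta>) = 0" if h: "h \<in> Omega (7 - 7) (4 - 4)" for h
  proof -
    have h': "h \<in> Omega 0 0" using h by simp
    have "dd 0 h = 0" by (rule dd_0_eq_0[OF h']) auto
    then have "dd 1 h \<in> cycles Omega 3 1 1" by (intro Omega.dd_1_mem_cycles h') auto
    then have "form_pairing (dd 1 h) \<eta> = 0" using 0 by simp
    then show ?thesis using stokes[OF h' s, of 1] bd by simp
  qed
  then have "dd 1 \<eta> x $ UNIV = 0" for x
    by (intro pairing_nondegenerate_right[OF d\<eta>, of "\<lambda>J. True"]) auto
  then have ab: "\<X> 1 (\<lambda>x. \<eta> x $ {2, 3, 4}) = \<X> 2 (\<lambda>x. \<eta> x $ {1, 3, 4})"
    using dd_1_top[OF s] by (simp add: fun_eq_iff)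
  have b: "bounded {x. \<eta> x $ J \<noteq> 0}" for J
    by (rule bounded_subset[OF bd]) auto
  have orth: "(LINT x|lborel. \<eta> x $ {2, 3, 4} * p x) = 0"
    if "smooth p" "\<X> 2 (\<X> 2 p) = (\<lambda>x. 0)" for p
  proof -
    have "form_pairing (single {1} p) \<eta> = 0" using 0 cycle_single[OF that] by blast
    moreover have "(single {1} p x \<and>\<and> \<eta> x) $ UNIV = \<eta> x $ {2, 3, 4} * p x" for x
      unfolding single_def theta_def[symmetric] wedge.scaleR_left
      by (simp add: UNIV_4 theta_wedge_index_set)
    ultimately show ?thesis by (simp add: form_pairing_def form_integral_def)
  qed
  obtain u where "smooth u" "bounded {x. u x \<noteq> 0}" "\<X> 2 (\<X> 2 u) = (\<lambda>x. - (\<eta> x $ {2, 3, 4}))"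
    "\<And>x. \<X> 1 (\<X> 2 u) x + \<X> 3 u x = - (\<eta> x $ {1, 3, 4})"
    using compact_potential_exists[OF smooth_nth[OF s] b smooth_nth[OF s] b ab orth] by blast
  then show "\<eta> \<in> boundaries Omega_c 3 (7 - 1) (4 - 1)"
    using \<eta>O boundaries_3_mem[of Omega_c u \<eta>] by simp
qed

section \<open>The two spectral complexes\<close>

text \<open>Twelve of the sixteen assertions fall under the vacuous case. The four others are the
  two with theta_24 excluded and the two between weights 6 and 1.\<close>

lemma admissible_nondegenerate:
  assumes "(p, k, r, l) \<in> admissible"
  shows "r \<ge> 1" "l \<ge> 1" "left_nondegenerate r l p k" "right_nondegenerate r l p k"
proof -
  note full = cycles_full[of Omega_c] cycles_full[of Omega]
  have L: "left_nondegenerate 1 1 0 0" "left_nondegenerate 2 1 1 1" "left_nondegenerate 1 1 7 4"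
    "left_nondegenerate 1 2 6 3" "left_nondegenerate 3 1 1 1" "left_nondegenerate 2 3 4 2"
    by (rule left_nondegenerate_full; simp add: full)+
  have R: "right_nondegenerate 1 1 0 0" "right_nondegenerate 2 1 1 1" "right_nondegenerate 1 1 7 4"
    "right_nondegenerate 1 2 6 3" "right_nondegenerate 3 2 3 2" "right_nondegenerate 1 3 6 3"
    by (rule right_nondegenerate_full; simp add: full)+
  have "r \<ge> 1 \<and> l \<ge> 1 \<and> left_nondegenerate r l p k \<and> right_nondegenerate r l p k"
    using assms L R left_nondegenerate_3_2 right_nondegenerate_2_3 left_nondegenerate_1_3 right_nondegenerate_3_1
    unfolding admissible_def complex1_def complex2_def by (elim UnE) auto
  then show "r \<ge> 1" "l \<ge> 1" "left_nondegenerate r l p k" "right_nondegenerate r l p k" by auto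
qed

text \<open>The last conclusion concerns the test differential that is transposed. Its source
  bidegrees are (6, 3), (4, 2), (1, 1), (0, 0) for \<open>complex1\<close> and (6, 3), (3, 2), (1,
  1), (0, 0) for \<open>complex2\<close>; order 3 occurs at (1, 1) and (3, 2) only, as
  \<open>continuous_diff\<close> requires.\<close>

lemma complex_step:
  assumes "ts \<in> {complex1, complex2}" "i < 4"
  obtains p k r l r' where "ts ! i = (p, k, r, l)" "ts ! Suc i = (p + int r, k + 1, r', r)"
    "continuous_diff r (7 - p - int r) (4 - k - 1)"
proof -
  have "i = 0 \<or> i = 1 \<or> i = 2 \<or> i = 3" using assms(2) by auto
  then have "\<exists>p k r l r'. ts ! i = (p, k, r, l) \<and> ts ! Suc i = (p + int r, k + 1, r', r) \<and>
      continuous_diff r (7 - p - int r) (4 - k - 1)"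
    using assms(1)
    by (elim disjE insertE emptyE) (simp_all add: complex1_def complex2_def continuous_diff)
  with that show ?thesis by blast
qed

lemma complex_mem_admissible:
  assumes "ts \<in> {complex1, complex2}" "i \<le> 4"
  shows "ts ! i \<in> admissible"
proof -
  have "i < length ts" using assms by (auto simp: complex1_def complex2_def)
  then show ?thesis using nth_mem[of i ts] assms(1) by (auto simp: admissible_def)
qed

lemma spectral_complex_embedding:
  assumes ts: "ts \<in> {complex1, complex2}"
  shows "complex_embedding 4 (E_term ts) (E_diff ts) (C_term ts) (C_diff ts) (psi_term ts)"
  unfolding complex_embedding_def is_complex_def
proof (intro conjI allI impI ballI)
  fix i :: nat assume i: "i < 4"
  obtain p k r l r' where st: "ts ! i = (p, k, r, l)" "ts ! Suc i = (p + int r, k + 1, r', r)"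
    "continuous_diff r (7 - p - int r) (4 - k - 1)" by (rule complex_step[OF ts i])
  have pos: "r \<ge> 1" "l \<ge> 1" "r' \<ge> 1"
    using admissible_nondegenerate(1,2) complex_mem_admissible[OF ts, of i]
      complex_mem_admissible[OF ts, of "Suc i"] i st by auto
  show "lin_map (E_term ts i) (E_term ts (Suc i)) (E_diff ts i)"
    using Omega.spectral_diff_lin_map[OF pos(1,3), of p k l]
    by (simp add: E_term_def E_diff_def st E_space_def)
  show "lin_map (C_term ts i) (C_term ts (Suc i)) (C_diff ts i)"
    using current_boundary_lin_map[OF pos(1,2) st(3), of r']
    by (simp add: C_term_def C_diff_def st)
  show "psi_term ts (Suc i) (E_diff ts i x) = C_diff ts i (psi_term ts i x)" if "x \<in> vcar (E_term ts i)" for x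
    using psi_spectral_diff[OF pos(1,3,2), of x p k] that
    by (simp add: psi_term_def E_diff_def C_diff_def E_term_def st)
next
  fix i :: nat assume i: "Suc i < 4"
  then have i': "i < 4" by simp
  obtain p k r l r' where st: "ts ! i = (p, k, r, l)" "ts ! Suc i = (p + int r, k + 1, r', r)"
    by (rule complex_step[OF ts i'])
  obtain p2 k2 r2 l2 r3 where st2: "ts ! Suc i = (p2, k2, r2, l2)" "ts ! Suc (Suc i) = (p2 + int r2, k2 + 1, r3, r2)"
    by (rule complex_step[OF ts i])
  have pos: "r \<ge> 1" "l \<ge> 1" "r' \<ge> 1"
    using admissible_nondegenerate(1,2) complex_mem_admissible[OF ts, of i]
      complex_mem_admissible[OF ts, of "Suc i"] i st by auto
  have eq: "p2 = p + int r" "k2 = k + 1" "r2 = r'" using st st2 by auto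
  show "E_diff ts (Suc i) (E_diff ts i x) = vzero (E_term ts (Suc (Suc i)))" if "x \<in> vcar (E_term ts i)" for x
    using Omega.spectral_diff_spectral_diff[OF pos(1,3), of x p k l] that
    by (simp add: E_diff_def E_term_def st st2(2) eq E_space_def) (simp add: quotient_rspace_def)
  show "C_diff ts (Suc i) (C_diff ts i x) = vzero (C_term ts (Suc (Suc i)))" if "x \<in> vcar (C_term ts i)" for x
    using current_boundary_current_boundary[OF pos, of x p k r3] that
    by (simp add: C_diff_def C_term_def st st2(2) eq)
next
  fix i :: nat assume i: "i \<le> 4"
  obtain p k r l where t: "ts ! i = (p, k, r, l)" by (metis prod_cases4)
  then have "(p, k, r, l) \<in> admissible" using complex_mem_admissible[OF ts i] by simp
  note a = admissible_nondegenerate[OF this]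
  show "lin_map (E_term ts i) (C_term ts i) (psi_term ts i)"
    using psi_lin_map[OF a(1,2)] by (simp add: E_term_def C_term_def psi_term_def t)
  show "inj_on (psi_term ts i) (vcar (E_term ts i))"
    using psi_inj_on[OF a(1,2,3)] by (simp add: E_term_def psi_term_def t)
qed

theorem theorem1:
  shows "(\<forall>(p, k, r, l) \<in> admissible.
           pairing_well_defined r l p k \<and> pairing_nondegenerate r l p k \<and>
           lin_map (E_space r l p k) (C_space r l p k) (psi r l p k) \<and>
           inj_on (psi r l p k) (vcar (E_space r l p k)))
    \<and> (\<forall>ts \<in> {complex1, complex2}. \<forall>p k r l m.
           consecutive ts (p - int l, k - 1, l, m) (p, k, r, l) \<longrightarrow>
           (\<forall>A \<in> vcar (E_space l m (p - int l) (k - 1)).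
              psi r l p k (spectral_diff Omega l (p - int l) (k - 1) A) =
              current_boundary r l (p - int l) (k - 1) (psi l m (p - int l) (k - 1) A)))
    \<and> (\<forall>ts \<in> {complex1, complex2}.
           complex_embedding 4 (E_term ts) (E_diff ts) (C_term ts) (C_diff ts) (psi_term ts))"
proof (intro conjI ballI allI impI)
  fix t assume "t \<in> admissible"
  then show "case t of (p, k, r, l) \<Rightarrow>
      pairing_well_defined r l p k \<and> pairing_nondegenerate r l p k \<and>
      lin_map (E_space r l p k) (C_space r l p k) (psi r l p k) \<and>
      inj_on (psi r l p k) (vcar (E_space r l p k))"
  proof (cases t)
    case (fields p k r l)
    then have "(p, k, r, l) \<in> admissible" using \<open>t \<in> admissible\<close> by simp
    note a = admissible_nondegenerate[OF this]
    show ?thesis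
      using pairing_well_defined[OF a(1,2)] pairing_nondegenerateI[OF a] psi_lin_map[OF a(1,2)]
        psi_inj_on[OF a(1,2,3)] by (simp add: fields)
  qed
next
  fix ts p k r l m A
  assume ts: "ts \<in> {complex1, complex2}" and c: "consecutive ts (p - int l, k - 1, l, m) (p, k, r, l)"
    and A: "A \<in> vcar (E_space l m (p - int l) (k - 1))"
  obtain i where "Suc i < length ts" "ts ! i = (p - int l, k - 1, l, m)" "ts ! Suc i = (p, k, r, l)"
    using c by (auto simp: consecutive_def)
  moreover have "length ts = 5" using ts by (auto simp: complex1_def complex2_def)
  ultimately have "(p - int l, k - 1, l, m) \<in> admissible" "(p, k, r, l) \<in> admissible"
    using complex_mem_admissible[OF ts, of i] complex_mem_admissible[OF ts, of "Suc i"] by auto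
  then have "l \<ge> 1" "r \<ge> 1" "m \<ge> 1" using admissible_nondegenerate(1,2) by blast+
  from psi_spectral_diff[OF this A]
  show "psi r l p k (spectral_diff Omega l (p - int l) (k - 1) A) =
      current_boundary r l (p - int l) (k - 1) (psi l m (p - int l) (k - 1) A)" by simp
qed (rule spectral_complex_embedding)

end
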